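(* Let $\tfrac12<\sigma<1$, $0<\delta<\sigma-\tfrac12$ and $A>0$. Let $P_1$ be the set of real $x\ge2$ with $\pi(x)>\operatorname{li}(x)$. (i) If $\xi=0$, $\mathcal{B}=\mathcal{B}(\xi,\sigma,\delta,A)$ is a multiset constructed as described in the context, $\zeta(\rho)=0$ for all $\rho\in\mathcal{B}$ (with multiplicities), and $\zeta(s)$ has no other zeros in the region $\{s:\operatorname{Re}(s)\ge\sigma-\delta,\ \operatorname{Im}(s)\ge0\}$, then $\lim_{X\to\infty}\operatorname{meas}(P_1\cap[2,X])/X=0$. (ii) If $\xi=\pi$, $\mathcal{B}=\mathcal{B}(\xi,\sigma,\delta,A)$ is a multiset constructed as described in the context, $\zeta(\rho)=0$ for all $\rho\in\mathcal{B}$ (with multiplicities), and $\zeta(s)$ has no other zeros in the region $\{s:\operatorname{Re}(s)\ge\sigma-\delta,\ \operatorname{Im}(s)\ge0\}$, then $\lim_{X\to\infty}\operatorname{meas}(P_1\cap[2,X])/X=1$.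
   Context: $\pi(x)$ is the number of primes $p\le x$, $\operatorname{li}(x)$ the logarithmic integral, $\zeta$ the Riemann zeta function, and $\operatorname{meas}$ Lebesgue measure. Construction of $\mathcal{B}(\xi,\sigma,\delta,A)$ for $\xi\in[0,2\pi)$: for each integer $j\ge1$ choose real numbers $\gamma_j,\delta_j,\theta_j$ with $\exp(j^8)\le\gamma_j\le 2\exp(j^8)$, $|\delta_j-j^{-8}|\le j^{-9}$, and $|\theta_j-(\xi-\pi/2)j^{-16}|\le j^{-17}$. Choose $j_0$ so large that for all $j\ge j_0$ one has $\gamma_j>A$ and $\delta_j\le\delta$. Then $\mathcal{B}$ is the multiset union, over integers $j\ge j_0$ and $1\le k\le j^3$, of $m(k,j)=k(j^3+1-k)$ copies of $\rho_{j,k}=\sigma-\delta_j+i(k\gamma_j+\theta_j)$. *)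

theory Defs
  imports "HOL-Complex_Analysis.Complex_Analysis"
begin

text \<open>
  The Riemann zeta function as the analytic continuation of its Dirichlet series to the plane
  without 1. The value at the pole is fixed to be 0 only so that the function is unique; this
  value is never treated as a zero below.
\<close>

definition zeta :: "complex \<Rightarrow> complex" where
  "zeta = (THE f. f holomorphic_on (UNIV - {1}) \<and>
                  (\<forall>s. Re s > 1 \<longrightarrow> (\<lambda>n. 1 / of_nat (Suc n) powr s) sums f s) \<and>
                  f 1 = 0)"

definition zeta_zero_mult :: "complex \<Rightarrow> nat" where
  "zeta_zero_mult s = (if s \<noteq> 1 \<and> zeta s = 0 then nat (zorder zeta s) else 0)"

definition prime_pi :: "real \<Rightarrow> nat" where
  "prime_pi x = card {p::nat. prime p \<and> real p \<le> x}"

text \<open>The Cauchy principal value of the integral of \<open>1 / ln t\<close> over \<open>[0, x]\<close>, for \<open>x > 1\<close>.\<close>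

definition li :: "real \<Rightarrow> real" where
  "li x = Lim (at_right 0)
     (\<lambda>\<epsilon>. integral {0..1 - \<epsilon>} (\<lambda>t. 1 / ln t) + integral {1 + \<epsilon>..x} (\<lambda>t. 1 / ln t))"

definition P1 :: "real set" where
  "P1 = {x. x \<ge> 2 \<and> real (prime_pi x) > li x}"

definition rho :: "real \<Rightarrow> (nat \<Rightarrow> real) \<Rightarrow> (nat \<Rightarrow> real) \<Rightarrow> (nat \<Rightarrow> real) \<Rightarrow> nat \<Rightarrow> nat \<Rightarrow> complex" where
  "rho \<sigma> \<gamma> d \<theta> j k = Complex (\<sigma> - d j) (real k * \<gamma> j + \<theta> j)"

text \<open>
  The multisets in question are infinite, so they are represented by their multiplicity
  functions: a multiset union becomes a sum of multiplicities. The index set of the sum below is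
  finite for all admissible parameters (see \<open>finite_rho_fibre\<close>).
\<close>

definition B_mult ::
  "real \<Rightarrow> (nat \<Rightarrow> real) \<Rightarrow> (nat \<Rightarrow> real) \<Rightarrow> (nat \<Rightarrow> real) \<Rightarrow> nat \<Rightarrow> complex \<Rightarrow> nat" where
  "B_mult \<sigma> \<gamma> d \<theta> j0 s =
     (\<Sum>(j, k) \<in> {(j, k). j \<ge> j0 \<and> 1 \<le> k \<and> k \<le> j ^ 3 \<and> rho \<sigma> \<gamma> d \<theta> j k = s}.
        k * (j ^ 3 + 1 - k))"

definition admissible_params ::
  "real \<Rightarrow> (nat \<Rightarrow> real) \<Rightarrow> (nat \<Rightarrow> real) \<Rightarrow> (nat \<Rightarrow> real) \<Rightarrow> bool" where
  "admissible_params \<xi> \<gamma> d \<theta> \<longleftrightarrow> (\<forall>j\<ge>1.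
     exp (real j ^ 8) \<le> \<gamma> j \<and> \<gamma> j \<le> 2 * exp (real j ^ 8) \<and>
     \<bar>d j - 1 / real j ^ 8\<bar> \<le> 1 / real j ^ 9 \<and>
     \<bar>\<theta> j - (\<xi> - pi / 2) / real j ^ 16\<bar> \<le> 1 / real j ^ 17)"

definition is_B :: "real \<Rightarrow> real \<Rightarrow> real \<Rightarrow> real \<Rightarrow> (complex \<Rightarrow> nat) \<Rightarrow> bool" where
  "is_B \<xi> \<sigma> \<delta> A B \<longleftrightarrow> (\<exists>\<gamma> d \<theta> j0.
     admissible_params \<xi> \<gamma> d \<theta> \<and>
     j0 \<ge> 1 \<and> (\<forall>j\<ge>j0. \<gamma> j > A \<and> d j \<le> \<delta>) \<and>
     B = B_mult \<sigma> \<gamma> d \<theta> j0)"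

lemma finite_rho_fibre:
  assumes "admissible_params \<xi> \<gamma> d \<theta>" and "j0 \<ge> 1"
  shows "finite {(j, k). j \<ge> j0 \<and> 1 \<le> k \<and> k \<le> j ^ 3 \<and> rho \<sigma> \<gamma> d \<theta> j k = s}"
proof -
  define N where "N = nat \<lceil>\<bar>Im s\<bar> + \<bar>\<xi> - pi / 2\<bar> + 1\<rceil>"
  have "j \<le> N" if j: "j \<ge> j0" and k: "1 \<le> k" and eq: "rho \<sigma> \<gamma> d \<theta> j k = s" for j k
  proof -
    have j1: "real j \<ge> 1" using j assms(2) by simp
    have g: "exp (real j ^ 8) \<le> \<gamma> j"
      and t: "\<bar>\<theta> j - (\<xi> - pi / 2) / real j ^ 16\<bar> \<le> 1 / real j ^ 17"
      using assms j by (auto simp: admissible_params_def)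
    have "real j \<le> real j ^ 8" using power_increasing[of 1 8 "real j"] j1 by simp
    also have "\<dots> \<le> exp (real j ^ 8)" using exp_ge_add_one_self[of "real j ^ 8"] by linarith
    finally have jg: "real j \<le> \<gamma> j" using g by linarith
    have "1 * \<gamma> j \<le> real k * \<gamma> j"
      using k jg j1 by (intro mult_right_mono) auto
    moreover have "real k * \<gamma> j + \<theta> j = Im s" using eq by (auto simp: rho_def)
    moreover have "\<bar>(\<xi> - pi / 2) / real j ^ 16\<bar> \<le> \<bar>\<xi> - pi / 2\<bar>"
    proof -
      have "1 \<le> real j ^ 16" using j1 by (rule one_le_power)
      then have "\<bar>\<xi> - pi / 2\<bar> * 1 \<le> \<bar>\<xi> - pi / 2\<bar> * real j ^ 16" by (intro mult_left_mono) auto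
      then show ?thesis using \<open>1 \<le> real j ^ 16\<close>
        by (simp add: abs_divide divide_le_eq)
    qed
    moreover have "1 / real j ^ 17 \<le> 1" using one_le_power[OF j1, of 17] by (simp add: divide_le_eq)
    ultimately have "real j \<le> \<bar>Im s\<bar> + \<bar>\<xi> - pi / 2\<bar> + 1" using jg t by linarith
    then show ?thesis unfolding N_def by linarith
  qed
  then have "{(j, k). j \<ge> j0 \<and> 1 \<le> k \<and> k \<le> j ^ 3 \<and> rho \<sigma> \<gamma> d \<theta> j k = s}
               \<subseteq> {..N} \<times> {..N ^ 3}"
    by (auto intro: order_trans power_mono)
  then show ?thesis by (rule finite_subset) auto
qed

end

theory Submission
  imports Defs "HOL-Number_Theory.Number_Theory" "HOL-Probability.Probability" "HOL-Real_Asymp.Real_Asymp"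
begin

text \<open>
  If \<open>c\<close> is slightly smaller than \<open>\<sigma>\<close>, then \<open>\<psi>(x) - x\<close> differs from the sum of \<open>- x\<^sup>\<rho> / \<rho>\<close> over the zeros with
  real part above \<open>c\<close> by a function \<open>E\<close> with \<open>\<integral> E(x)\<^sup>2 x\<^sup>-\<^sup>2\<^sup>c\<^sup>-\<^sup>1 dx < \<infinity>\<close>: the Laplace transform of \<open>E(exp v)\<close>
  continues to the line \<open>Re s = c\<close> and is square integrable there, because the zeros in \<open>\<B>\<close> are sparse. Hence
  \<open>|E(x)| \<le> x\<^sup>c\<^sup>'\<close> off a set of density 0 for each \<open>c' > c\<close>, and the race is decided by \<open>\<B>\<close>.

  For \<open>u = ln x\<close> the zeros \<open>\<rho>\<^sub>j\<^sub>,\<^sub>k\<close> with fixed \<open>j\<close> contribute \<open>V\<^sub>j(u)\<close> times a sum over \<open>k\<close> with weights \<open>j\<^sup>3 + 1 - k\<close>,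
  that is, a Fejer kernel at \<open>\<gamma>\<^sub>j u\<close> minus \<open>j\<^sup>3 + 1\<close>, with a small phase error coming from \<open>\<theta>\<^sub>j\<close>. Only the indices \<open>j\<close> with
  \<open>|j - Y| = O(sqrt Y)\<close>, where \<open>u\<close> is about \<open>Y^16\<close>, matter. The Fejer kernel is \<open>O(1)\<close> unless \<open>\<gamma>\<^sub>j u\<close> is close to a
  multiple of \<open>2\<pi>\<close>, which happens for few \<open>x\<close>, so that almost always every relevant block has the sign given by \<open>\<xi>\<close>.

  The construction allows \<open>\<delta>\<^sub>1 = 0\<close>, in which case a zero would lie on the line \<open>Re s = \<sigma>\<close>. This is excluded
  because \<open>\<zeta>\<close> has no zeros with \<open>1/2 < Re s < 1\<close> and \<open>0.14 \<le> Im s \<le> 8.02\<close>, by Euler-Maclaurin summation.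
\<close>

section \<open>Continuation of the zeta function\<close>

text \<open>Density only asks for control in mean square, and for sparse zeros this is available on
  every line \<open>Re s = c\<close> that keeps a positive distance from them. Such lines exist
  because the real parts \<sigma> - d j are strictly monotone for j \<ge> 2; \<open>c\<close> is put
  between two consecutive ones. The multiplicity k (K + 1 - k), K = j^3, carries a factor k that
  cancels the k of \<rho> \<approx> i k \<gamma>; the rest is the Fejer weight. The logarithm of V j
  is about \<sigma> u - (u / j^8 + j^8), which is largest at j = u^(1/16). The obstacle is the
  phase. For relevant j it is of order Y^(-1/2), but it multiplies the imaginary part of the kernel,
  of size K / q with q = |exp(i \<gamma> u) - 1|, so q should be much larger than Y^(-1/2). About
  Y^(1/2) indices are relevant, and a union bound over them only affords thresholds much smaller
  than Y^(-1/2). Hence two thresholds, with y = Y^(1/16): q \<ge> y^-12 for every relevant j, which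
  preserves the bias, and q \<ge> y^-6 for all but a share y^-5 of the total weight, by Markov's
  inequality.\<close>

lemma holomorphic_on_suminf:
  fixes f :: "nat \<Rightarrow> complex \<Rightarrow> complex"
  assumes S: "open S" and f: "\<And>n. f n holomorphic_on S"
    and M: "\<And>x. x \<in> S \<Longrightarrow> \<exists>d>0. \<exists>M. summable M \<and> (\<forall>n. \<forall>y\<in>ball x d. norm (f n y) \<le> M n)"
  shows "(\<lambda>x. \<Sum>n. f n x) holomorphic_on S"
proof (rule holomorphic_uniform_sequence[OF S])
  fix n
  show "(\<lambda>x. \<Sum>i<n. f i x) holomorphic_on S"
    by (intro holomorphic_intros f)
next
  fix x assume x: "x \<in> S"
  obtain d M where d: "d > 0" "summable M" "\<And>n y. y \<in> ball x d \<Longrightarrow> norm (f n y) \<le> M n"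
    using M[OF x] by blast
  obtain d' where d': "d' > 0" "cball x d' \<subseteq> S"
    using S x open_contains_cball by blast
  define e where "e = min d' (d / 2)"
  have e: "e > 0" "cball x e \<subseteq> S" "cball x e \<subseteq> ball x d"
    using d d' by (auto simp: e_def)
  have "uniform_limit (cball x e) (\<lambda>n x. \<Sum>i<n. f i x) (\<lambda>x. \<Sum>n. f n x) sequentially"
    using e d by (intro Weierstrass_m_test[of _ _ M]) auto
  thus "\<exists>d>0. cball x d \<subseteq> S \<and> uniform_limit (cball x d) (\<lambda>n x. \<Sum>i<n. f i x) (\<lambda>x. \<Sum>n. f n x) sequentially"
    using e by blast
qed

text \<open>The right-hand side is the modulus of the binomial coefficient of - b. The majorant of a
  binomial series is thus again a binomial series, and its convergence at 1/2 is that of the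
  expansion of (1 - 1/2) powr (- b).\<close>

lemma gbinomial_norm_le:
  fixes z :: complex
  assumes "norm z \<le> b"
  shows "norm (z gchoose k) \<le> pochhammer b k / fact k"
proof -
  have "norm (z gchoose k) = (\<Prod>i=0..<k. norm (z - of_nat i)) / fact k"
    by (simp add: gbinomial_prod_rev norm_divide prod_norm)
  also have "... \<le> (\<Prod>i=0..<k. b + of_nat i) / fact k"
  proof (intro divide_right_mono prod_mono)
    fix i assume "i \<in> {0..<k}"
    show "0 \<le> norm (z - of_nat i) \<and> norm (z - of_nat i) \<le> b + of_nat i"
      using norm_triangle_ineq4[of z "of_nat i"] assms by auto
  qed auto
  also have "... = pochhammer b k / fact k"
    by (simp add: pochhammer_prod)
  finally show ?thesis .
qed

lemma summable_pochhammer_half: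
  fixes b :: real
  shows "summable (\<lambda>k. pochhammer b k / fact k * (1/2) ^ k)"
proof -
  have "(\<lambda>k. ((-b) gchoose k) * (-1/2) ^ k) sums (1 + (-1/2)) powr (-b)"
    by (rule gen_binomial_real) auto
  moreover have "((-b) gchoose k) * (-1/2) ^ k = pochhammer b k / fact k * (1/2) ^ k" for k
  proof -
    have "((-b) gchoose k) * (-1/2) ^ k = pochhammer b k / fact k * ((-1) ^ k * (-1/2) ^ k)"
      by (simp add: gbinomial_pochhammer)
    also have "(-1) ^ k * (-1/2) ^ k = ((1/2) ^ k :: real)"
      by (simp add: power_mult_distrib[symmetric])
    finally show ?thesis .
  qed
  ultimately show ?thesis by (auto simp: sums_iff)
qed

lemma pochhammer_ge_0: "(b::real) \<ge> 0 \<Longrightarrow> pochhammer b k \<ge> 0"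
  by (auto simp: pochhammer_prod intro!: prod_nonneg)

text \<open>With N = n + 2 this is the remainder of the binomial expansion of (N + 1) powr (1 - s)
  in powers of 1 / N after the term k = m + 1. Summed over n, the term k = 0 telescopes and the term
  k = 1 is (1 - s) times the Dirichlet series, so the identity can be solved for the latter.
  Starting at N = 2 keeps 1 / N \<le> 1 / 2, inside the circle of convergence.\<close>

definition ztail_term :: "nat \<Rightarrow> nat \<Rightarrow> complex \<Rightarrow> complex" where
  "ztail_term m n s = of_nat (n + 3) powr (1 - s) -
     (\<Sum>k\<le>m+1. ((1 - s) gchoose k) * of_nat (n + 2) powr (1 - s - of_nat k))"

text \<open>The first omitted term has k = m + 2, hence size N powr (1 - Re s - (m + 2)). The
  further factors 1 / N are replaced by 1 / 2, and 2 ^ (m + 2) restores the full power of 1 / 2 in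
  the majorant.\<close>

lemma ztail_term_bound:
  fixes s :: complex
  assumes "norm (1 - s) \<le> b"
  shows "norm (ztail_term m n s) \<le>
    2 ^ (m + 2) * (\<Sum>k. pochhammer b k / fact k * (1/2) ^ k) * real (n + 2) powr (- Re s - real m - 1)"
proof -
  define N where "N = real (n + 2)"
  have N: "N \<ge> 2" by (simp add: N_def)
  define p where "p = (\<lambda>k. pochhammer b k / fact k)"
  have b0: "b \<ge> 0" using assms norm_ge_zero order_trans by blast
  have p0: "p k \<ge> 0" for k using b0 by (auto simp: p_def intro!: divide_nonneg_nonneg pochhammer_ge_0)
  define a where "a = (\<lambda>k. ((1 - s) gchoose k) * of_real (1 / N) ^ k)"
  have sums: "a sums (1 + of_real (1/N)) powr (1 - s)"
    unfolding a_def using N by (intro gen_binomial_complex) (simp add: norm_divide)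
  have e1: "of_nat (n + 3) powr (1 - s) = of_real N powr (1 - s) * (1 + of_real (1/N)) powr (1 - s)"
  proof -
    have "of_nat (n + 3) = (of_real N * of_real (1 + 1/N) :: complex)"
    proof -
      have "real (n + 3) = N * (1 + 1 / N)" using N by (simp add: N_def field_simps)
      hence "of_real (real (n + 3)) = (of_real (N * (1 + 1/N)) :: complex)" by (rule arg_cong)
      thus ?thesis by (simp only: of_real_mult of_real_of_nat_eq)
    qed
    also have "... powr (1 - s) = of_real N powr (1 - s) * of_real (1 + 1/N) powr (1 - s)"
      using N by (intro powr_times_real) auto
    finally show ?thesis by simp
  qed
  have e2: "of_nat (n + 2) powr (1 - s - of_nat k) = of_real N powr (1 - s) * of_real (1 / N) ^ k" for k
  proof -
    have "of_nat (n + 2) = (of_real N :: complex)" by (simp add: N_def)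
    moreover have "(of_real N :: complex) \<noteq> 0" using N by simp
    ultimately show ?thesis
      by (simp add: powr_diff powr_nat' power_one_over divide_simps)
  qed
  have "ztail_term m n s = of_real N powr (1 - s) * ((1 + of_real (1/N)) powr (1 - s) - (\<Sum>k\<le>m+1. a k))"
    unfolding ztail_term_def e1 e2 a_def by (simp add: algebra_simps sum_distrib_left)
  also have "(1 + of_real (1/N)) powr (1 - s) - (\<Sum>k\<le>m+1. a k) = (\<Sum>k. a (k + (m + 2)))"
  proof -
    have "(\<Sum>k. a (k + (m + 2))) = suminf a - (\<Sum>k<m+2. a k)"
      using sums by (intro suminf_minus_initial_segment) (auto simp: sums_iff)
    moreover have "{..<m+2} = {..m+1}" by auto
    moreover have "suminf a = (1 + of_real (1/N)) powr (1 - s)" using sums by (rule sums_unique[symmetric])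
    ultimately show ?thesis by (simp only:)
  qed
  finally have eq: "ztail_term m n s = of_real N powr (1 - s) * (\<Sum>k. a (k + (m + 2)))" .
  have S: "summable (\<lambda>k. p k * (1/2)^k)" unfolding p_def by (rule summable_pochhammer_half)
  have S': "summable (\<lambda>k. p (k + (m+2)) * (1/2)^(k + (m+2)))"
    using summable_ignore_initial_segment[OF S, of "m+2"] .
  have bd: "norm (a (k + (m + 2))) \<le> 2^(m+2) * N powr (- real m - 2) * (p (k + (m+2)) * (1/2)^(k + (m+2)))" for k
  proof -
    have "norm (a (k + (m + 2))) \<le> p (k + (m + 2)) * (1 / N) ^ (k + (m + 2))"
    proof -
      have "norm (a i) \<le> p i * (1 / N) ^ i" for i
        unfolding a_def p_def norm_mult norm_power using N gbinomial_norm_le[OF assms]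
        by (intro mult_mono) (auto simp: p0[unfolded p_def] norm_divide)
      thus ?thesis .
    qed
    also have "... \<le> p (k + (m + 2)) * ((1/2)^k * N powr (- real m - 2))"
    proof (intro mult_left_mono p0)
      have "- real m - 2 = - real (m + 2)" by simp
      hence "N powr (- real m - 2) = N powr (- real (m + 2))" by (simp only:)
      also have "... = (1 / N) ^ (m + 2)" using N by (simp only: powr_minus_divide powr_realpow power_one_over)
      finally have "(1 / N) ^ (k + (m + 2)) = (1 / N) ^ k * N powr (- real m - 2)" by (simp add: power_add)
      also have "... \<le> (1/2)^k * N powr (- real m - 2)"
        using N by (intro mult_right_mono power_mono) (auto simp: field_simps)
      finally show "(1 / N) ^ (k + (m + 2)) \<le> (1/2)^k * N powr (- real m - 2)" .
    qed
    also have "... = 2^(m+2) * N powr (- real m - 2) * (p (k + (m+2)) * (1/2)^(k + (m+2)))"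
      by (simp add: power_add power_one_over field_simps)
    finally show ?thesis .
  qed
  have "norm (\<Sum>k. a (k + (m + 2))) \<le> (\<Sum>k. 2^(m+2) * N powr (- real m - 2) * (p (k + (m+2)) * (1/2)^(k + (m+2))))"
    by (rule norm_suminf_le) (use bd S' in \<open>auto intro!: summable_mult\<close>)
  also have "... = 2^(m+2) * N powr (- real m - 2) * (\<Sum>k. p (k + (m+2)) * (1/2)^(k + (m+2)))"
    by (rule suminf_mult) (rule S')
  also have "... \<le> 2^(m+2) * N powr (- real m - 2) * (\<Sum>k. p k * (1/2)^k)"
  proof (intro mult_left_mono)
    have "(\<Sum>k. p k * (1/2)^k) = (\<Sum>k. p (k + (m+2)) * (1/2)^(k + (m+2))) + (\<Sum>k<m+2. p k * (1/2)^k)"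
      by (rule suminf_split_initial_segment[OF S])
    moreover have "(\<Sum>k<m+2. p k * (1/2)^k) \<ge> 0" using p0 by (intro sum_nonneg) auto
    ultimately show "(\<Sum>k. p (k + (m+2)) * (1/2)^(k + (m+2))) \<le> (\<Sum>k. p k * (1/2)^k)" by linarith
  qed auto
  finally have "norm (\<Sum>k. a (k + (m + 2))) \<le> 2^(m+2) * N powr (- real m - 2) * (\<Sum>k. p k * (1/2)^k)" .
  hence "norm (ztail_term m n s) \<le> N powr (1 - Re s) * (2^(m+2) * N powr (- real m - 2) * (\<Sum>k. p k * (1/2)^k))"
    unfolding eq norm_mult using N by (auto intro!: mult_mono simp: norm_powr_real_powr)
  also have "... = 2^(m+2) * (\<Sum>k. p k * (1/2)^k) * (N powr (1 - Re s) * N powr (- real m - 2))"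
    by (simp add: mult_ac)
  also have "N powr (1 - Re s) * N powr (- real m - 2) = N powr (- Re s - real m - 1)"
    by (simp add: powr_add[symmetric])
  finally show ?thesis unfolding p_def N_def .
qed

lemma summable_shift_powr:
  fixes a :: real
  assumes "a < -1"
  shows "summable (\<lambda>n. real (n + m) powr a)"
proof -
  have "summable (\<lambda>n. real n powr a)" using assms summable_real_powr_iff by blast
  thus ?thesis by (rule summable_ignore_initial_segment)
qed

lemma holomorphic_ztail_term: "ztail_term m n holomorphic_on UNIV"
  unfolding ztail_term_def gbinomial_prod_rev
  by (intro holomorphic_intros) auto

text \<open>The exponent - Re s - m - 1 is below - 1 exactly on this half-plane. Half the distance
  to its boundary, \<open>d\<close>, makes the bound uniform on a ball.\<close>

lemma ztail_holomorphic: "(\<lambda>s. \<Sum>n. ztail_term m n s) holomorphic_on {s. Re s > - real m}"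
proof (rule holomorphic_on_suminf)
  show "open {s. Re s > - real m}" by (rule open_halfspace_Re_gt)
  show "ztail_term m n holomorphic_on {s. Re s > - real m}" for n
    using holomorphic_ztail_term by (rule holomorphic_on_subset) auto
next
  fix x assume x: "x \<in> {s. Re s > - real m}"
  define d where "d = (Re x + real m) / 2"
  have d: "d > 0" using x by (auto simp: d_def)
  define b where "b = norm (1 - x) + d"
  define C where "C = 2 ^ (m + 2) * (\<Sum>k. pochhammer b k / fact k * (1/2) ^ k)"
  define M where "M = (\<lambda>n. C * real (n + 2) powr (- (Re x - d) - real m - 1))"
  have b0: "b \<ge> 0" using d by (auto simp: b_def)
  have C: "C \<ge> 0" unfolding C_def
    by (intro mult_nonneg_nonneg suminf_nonneg summable_pochhammer_half) (auto intro!: divide_nonneg_nonneg pochhammer_ge_0 b0)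
  have "summable M" unfolding M_def d_def using x
    by (intro summable_mult summable_shift_powr) (auto simp: field_simps)
  moreover have "norm (ztail_term m n y) \<le> M n" if "y \<in> ball x d" for n y
  proof -
    have "norm (1 - y) \<le> norm (1 - x) + norm (x - y)" using norm_triangle_ineq[of "1 - x" "x - y"] by simp
    hence b: "norm (1 - y) \<le> b" using that by (auto simp: b_def dist_norm)
    have "\<bar>Re (x - y)\<bar> < d" using that abs_Re_le_cmod[of "x - y"] by (auto simp: dist_norm)
    hence "Re y \<ge> Re x - d" by auto
    hence "real (n + 2) powr (- Re y - real m - 1) \<le> real (n + 2) powr (- (Re x - d) - real m - 1)"
      by (intro powr_mono) auto
    thus ?thesis using ztail_term_bound[OF b, of m n] C unfolding M_def C_def
      by (meson mult_left_mono order_trans)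
  qed
  ultimately show "\<exists>d>0. \<exists>M. summable M \<and> (\<forall>n. \<forall>y\<in>ball x d. norm (ztail_term m n y) \<le> M n)"
    using d by blast
qed

lemma dirichlet_series_summable:
  assumes "Re s > 1"
  shows "summable (\<lambda>n. 1 / of_nat (n + Suc m) powr s)" "summable (\<lambda>n. norm (1 / of_nat (n + Suc m) powr s :: complex))"
proof -
  have "norm (1 / of_nat (n + Suc m) powr s :: complex) = real (n + Suc m) powr (- Re s)" for n
    using norm_powr_real_powr[of "of_real (real (n + Suc m))" s]
    by (simp add: norm_divide powr_minus_divide del: of_nat_Suc)
  thus *: "summable (\<lambda>n. norm (1 / of_nat (n + Suc m) powr s :: complex))"
    using summable_shift_powr[of "- Re s" "Suc m"] assms by simp
  show "summable (\<lambda>n. 1 / of_nat (n + Suc m) powr s)"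
    by (rule summable_norm_cancel[OF *])
qed

definition zeta2 :: "complex \<Rightarrow> complex" where
  "zeta2 s = (\<Sum>n. 1 / of_nat (n + 2) powr s)"

lemma zeta2_sums: "Re s > 1 \<Longrightarrow> (\<lambda>n. 1 / of_nat (n + 2) powr s) sums zeta2 s"
  using dirichlet_series_summable(1)[of s 1] unfolding zeta2_def by (simp add: summable_sums numeral_2_eq_2)

lemma tendsto_powr_complex_0:
  assumes "Re s > 0"
  shows "(\<lambda>n. of_nat (n + m) powr (-s) :: complex) \<longlonglongrightarrow> 0"
proof (rule tendsto_norm_zero_cancel)
  have *: "(\<lambda>n. real (n + m) powr (- Re s)) \<longlonglongrightarrow> 0"
    using assms by (intro tendsto_neg_powr filterlim_compose[OF filterlim_real_sequentially] filterlim_add_const_nat_at_top) auto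
  have "norm (of_nat (n + m) powr (-s) :: complex) = real (n + m) powr (- Re s)" if "n \<ge> 1" for n
    using that norm_powr_real_powr[of "of_real (real (n + m))" "-s"] by simp
  hence "eventually (\<lambda>n. real (n + m) powr (- Re s) = norm (of_nat (n + m) powr (-s) :: complex)) sequentially"
    by (intro eventually_mono[OF eventually_ge_at_top[of 1]]) (simp only:)
  from tendsto_cong[OF this] * show "(\<lambda>n. norm (of_nat (n + m) powr (-s) :: complex)) \<longlonglongrightarrow> 0" by simp
qed

lemma ztail_eq:
  assumes s: "Re s > 1"
  shows "(\<Sum>n. ztail_term m n s) = - (2 powr (1 - s)) - (\<Sum>k=1..m+1. ((1 - s) gchoose k) * zeta2 (s + of_nat k - 1))"
proof -
  have tel: "(\<lambda>n. of_nat (Suc n + 2) powr (1 - s) - of_nat (n + 2) powr (1 - s)) sums (0 - of_nat (0 + 2) powr (1 - s))"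
    using tendsto_powr_complex_0[of "s - 1" 2] s by (intro telescope_sums) auto
  have k: "(\<lambda>n. ((1 - s) gchoose k) * of_nat (n + 2) powr (1 - s - of_nat k)) sums (((1 - s) gchoose k) * zeta2 (s + of_nat k - 1))"
    if "k \<ge> 1" for k
  proof -
    have "(\<lambda>n. 1 / of_nat (n + 2) powr (s + of_nat k - 1)) sums zeta2 (s + of_nat k - 1)"
      using that s by (intro zeta2_sums) auto
    moreover have "1 / of_nat (n + 2) powr (s + of_nat k - 1) = (of_nat (n + 2) powr (1 - s - of_nat k) :: complex)" for n
      using powr_minus_divide[of "of_nat (n + 2)" "s + of_nat k - 1"] by (simp add: algebra_simps)
    ultimately show ?thesis by (intro sums_mult) simp
  qed
  have "(\<lambda>n. (of_nat (Suc n + 2) powr (1 - s) - of_nat (n + 2) powr (1 - s)) -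
      (\<Sum>k=1..m+1. ((1 - s) gchoose k) * of_nat (n + 2) powr (1 - s - of_nat k)))
    sums (0 - of_nat (0 + 2) powr (1 - s) - (\<Sum>k=1..m+1. ((1 - s) gchoose k) * zeta2 (s + of_nat k - 1)))"
    by (intro sums_diff tel sums_sum k) auto
  moreover have "(of_nat (Suc n + 2) powr (1 - s) - of_nat (n + 2) powr (1 - s)) -
      (\<Sum>k=1..m+1. ((1 - s) gchoose k) * of_nat (n + 2) powr (1 - s - of_nat k)) = ztail_term m n s" for n
  proof -
    have "{..m+1} = insert 0 {1..m+1}" by auto
    thus ?thesis by (simp add: ztail_term_def numeral_3_eq_3 algebra_simps)
  qed
  ultimately show ?thesis by (simp add: sums_iff)
qed

text \<open>Each step gains one unit: \<open>ztail_eq\<close> is solved for its term k = 1, and the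
  terms k \<ge> 2 involve \<open>zeta2\<close> only at s + k - 1, where a continuation is known
  already. Continuing (s - 1) * zeta2 s instead of zeta2 keeps the pole at 1 out of the
  induction.\<close>

lemma zeta2_continuation:
  "\<exists>g. g holomorphic_on {s. Re s > 1 - real m} \<and> (\<forall>s. Re s > 1 \<longrightarrow> g s = (s - 1) * zeta2 s)"
proof (induction m)
  case 0
  define f where "f = (\<lambda>s. 2 powr (1 - s) + (\<Sum>n. ztail_term 0 n s))"
  have "f holomorphic_on {s. Re s > - real 0}" unfolding f_def
    by (intro holomorphic_intros ztail_holomorphic) auto
  hence "f holomorphic_on {s. Re s > 1 - real 0}" by (rule holomorphic_on_subset) auto
  moreover have "f s = (s - 1) * zeta2 s" if "Re s > 1" for s
    using ztail_eq[OF that, of 0] by (simp add: f_def algebra_simps)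
  ultimately show ?case by blast
next
  case (Suc m)
  then obtain g where g: "g holomorphic_on {s. Re s > 1 - real m}" "\<And>s. Re s > 1 \<Longrightarrow> g s = (s - 1) * zeta2 s"
    by blast
  \<comment> \<open>A division by s + k - 2 has to be avoided. The last factor 1 - s - (k - 1) of
    the binomial coefficient cancels the factor s + k - 2 inside \<open>g (s + k - 1)\<close>, which
    leaves \<open>gchoose (k - 1)\<close> divided by k.\<close>
  define f where "f = (\<lambda>s. 2 powr (1 - s) - (\<Sum>k=2..m+1. ((1 - s) gchoose (k - 1)) / of_nat k * g (s + of_nat k - 1)) + (\<Sum>n. ztail_term m n s))"
  have "f holomorphic_on {s. Re s > - real m}" unfolding f_def
  proof (intro holomorphic_intros ztail_holomorphic)
    show "(\<lambda>s. ((1 - s) gchoose (k - 1))) holomorphic_on {s. - real m < Re s}" for k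
      unfolding gbinomial_prod_rev by (intro holomorphic_intros) auto
    fix k :: nat assume k: "k \<in> {2..m+1}"
    have "(g \<circ> (\<lambda>s. s + of_nat k - 1)) holomorphic_on {s. Re s > - real m}"
      using k by (intro holomorphic_on_compose_gen[OF _ g(1)] holomorphic_intros) auto
    thus "(\<lambda>s. g (s + of_nat k - 1)) holomorphic_on {s. - real m < Re s}" by (simp add: o_def)
  qed auto
  moreover have "f s = (s - 1) * zeta2 s" if s: "Re s > 1" for s
  proof -
    have "((1 - s) gchoose (k - 1)) / of_nat k * g (s + of_nat k - 1) = - ((1 - s) gchoose k) * zeta2 (s + of_nat k - 1)"
      if k: "k \<in> {2..m+1}" for k
    proof -
      obtain i where i: "k = Suc i" using k by (cases k) auto
      have "g (s + of_nat k - 1) = (s + of_nat k - 1 - 1) * zeta2 (s + of_nat k - 1)"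
        using s k by (intro g(2)) auto
      moreover have "((1 - s) gchoose k) = ((1 - s) gchoose (k - 1)) * (1 - s - of_nat i) / of_nat k"
        unfolding i by (simp add: gbinomial_prod_rev field_simps del: of_nat_Suc)
      moreover have "s + of_nat k - 1 - 1 = - (1 - s - of_nat i)" by (simp add: i)
      ultimately show ?thesis by (simp only: times_divide_eq_left times_divide_eq_right minus_divide_left mult_minus_left mult_minus_right mult_ac)
    qed
    hence "(\<Sum>k=2..m+1. ((1 - s) gchoose (k - 1)) / of_nat k * g (s + of_nat k - 1)) =
        - (\<Sum>k=2..m+1. ((1 - s) gchoose k) * zeta2 (s + of_nat k - 1))"
      by (simp add: sum_negf)
    moreover have "(\<Sum>k=1..m+1. ((1 - s) gchoose k) * zeta2 (s + of_nat k - 1)) =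
      (1 - s) * zeta2 s + (\<Sum>k=2..m+1. ((1 - s) gchoose k) * zeta2 (s + of_nat k - 1))"
      by (subst sum.atLeast_Suc_atMost) (auto simp: numeral_2_eq_2)
    ultimately show ?thesis unfolding f_def ztail_eq[OF s] by (simp add: algebra_simps)
  qed
  ultimately show ?case by (intro exI[of _ f]) auto
qed

lemma connected_minus_one: "connected (UNIV - {1::complex})"
  using connected_punctured_universe[of "1::complex"] by (simp add: Compl_eq_Diff_UNIV)

lemma holomorphic_halfplane_unique:
  assumes "f holomorphic_on {s. Re s > a}" "g holomorphic_on {s. Re s > a}" "\<And>s. Re s > 1 \<Longrightarrow> f s = g s" "Re z > a"
  shows "f z = g z"
proof -
  have conn: "connected {s. Re s > a}" by (intro convex_connected convex_halfspace_Re_gt)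
  show ?thesis
    by (rule analytic_continuation_open[where s = "{s. Re s > max a 1}" and s' = "{s. Re s > a}" and f = f and g = g])
       (use assms conn open_halfspace_Re_gt[of a] open_halfspace_Re_gt[of "max a 1"] in \<open>auto intro!: exI[of _ "of_real (max a 1 + 1)"]\<close>)
qed

lemma zeta_exists:
  "\<exists>f. f holomorphic_on (UNIV - {1}) \<and>
      (\<forall>s. Re s > 1 \<longrightarrow> (\<lambda>n. 1 / of_nat (Suc n) powr s) sums f s) \<and> f 1 = (0::complex)"
proof -
  have "\<forall>m. \<exists>g. g holomorphic_on {s. Re s > 1 - real m} \<and> (\<forall>s. Re s > 1 \<longrightarrow> g s = (s - 1) * zeta2 s)"
    using zeta2_continuation by blast
  then obtain g where g: "\<And>m. g m holomorphic_on {s. Re s > 1 - real m}"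
    "\<And>m s. Re s > 1 \<Longrightarrow> g m s = (s - 1) * zeta2 s" by metis
  \<comment> \<open>The index exceeds 1 - Re s, so s lies in the domain of the chosen continuation.
    By uniqueness every other index with this property gives the same value.\<close>
  define G where "G = (\<lambda>s. g (nat \<lceil>2 - Re s\<rceil>) s)"
  have G: "G s = g m s" if "Re s > 1 - real m" for s m
  proof -
    define n where "n = nat \<lceil>2 - Re s\<rceil>"
    define k where "k = min m n"
    have n: "Re s > 1 - real n" unfolding n_def by linarith
    hence k: "Re s > 1 - real k" using that by (auto simp: k_def min_def)
    have "g n s = g k s"
      by (rule holomorphic_halfplane_unique[OF _ g(1)[of k] _ k])
         (auto simp: g(2) k_def intro: holomorphic_on_subset[OF g(1)])
    moreover have "g m s = g k s"
      by (rule holomorphic_halfplane_unique[OF _ g(1)[of k] _ k])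
         (auto simp: g(2) k_def intro: holomorphic_on_subset[OF g(1)])
    ultimately show ?thesis by (simp add: G_def n_def)
  qed
  have "G holomorphic_on UNIV"
    unfolding holomorphic_on_def
  proof safe
    fix x :: complex
    define m where "m = nat \<lceil>2 - Re x\<rceil>"
    have x: "x \<in> {s. Re s > 1 - real m}" unfolding m_def by (simp, linarith)
    have "G holomorphic_on {s. Re s > 1 - real m}"
      by (rule holomorphic_transform[OF g(1)[of m]]) (simp add: G)
    hence "G field_differentiable at x"
      using x open_halfspace_Re_gt by (auto intro: holomorphic_on_imp_differentiable_at)
    thus "G field_differentiable at x within UNIV" by simp
  qed
  define f where "f = (\<lambda>s. if s = 1 then 0 else 1 + G s / (s - 1))"
  have "(\<lambda>s. 1 + G s / (s - 1)) holomorphic_on UNIV - {1}"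
    by (intro holomorphic_intros holomorphic_on_subset[OF \<open>G holomorphic_on UNIV\<close>]) auto
  hence "f holomorphic_on UNIV - {1}"
    by (rule holomorphic_transform) (auto simp: f_def)
  moreover have "(\<lambda>n. 1 / of_nat (Suc n) powr s) sums f s" if s: "Re s > 1" for s
  proof -
    have s1: "s \<noteq> 1" using s by auto
    have "f s = zeta2 s + 1"
      using G[of 0 s] s s1 g(2)[of s 0] by (simp add: f_def)
    moreover have "(\<lambda>n. 1 / of_nat (Suc (Suc n)) powr s) sums zeta2 s"
      using zeta2_sums[OF s] by simp
    ultimately show ?thesis
      by (subst (asm) sums_Suc_iff) simp
  qed
  ultimately show ?thesis by (intro exI[of _ f]) (auto simp: f_def)
qed

text \<open>Uniqueness, which gives \<open>THE\<close> its meaning, is the identity theorem on the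
  punctured plane together with the prescribed value at 1.\<close>

lemma zeta_props:
  "zeta holomorphic_on (UNIV - {1}) \<and>
      (\<forall>s. Re s > 1 \<longrightarrow> (\<lambda>n. 1 / of_nat (Suc n) powr s) sums zeta s) \<and> zeta 1 = 0"
proof -
  have "\<exists>!f. f holomorphic_on (UNIV - {1}) \<and>
      (\<forall>s. Re s > 1 \<longrightarrow> (\<lambda>n. 1 / of_nat (Suc n) powr s) sums f s) \<and> f 1 = (0::complex)"
  proof (rule ex_ex1I[OF zeta_exists])
    fix f g :: "complex \<Rightarrow> complex"
    assume f: "f holomorphic_on (UNIV - {1}) \<and>
      (\<forall>s. Re s > 1 \<longrightarrow> (\<lambda>n. 1 / of_nat (Suc n) powr s) sums f s) \<and> f 1 = 0"
    assume g: "g holomorphic_on (UNIV - {1}) \<and>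
      (\<forall>s. Re s > 1 \<longrightarrow> (\<lambda>n. 1 / of_nat (Suc n) powr s) sums g s) \<and> g 1 = 0"
    show "f = g"
    proof
      fix z
      show "f z = g z"
      proof (cases "z = 1")
        case False
        show ?thesis
          by (rule analytic_continuation_open[where s = "{s. Re s > 1}" and s' = "UNIV - {1}" and f = f and g = g])
             (use f g connected_minus_one False in \<open>auto intro: open_halfspace_Re_gt sums_unique2 intro!: exI[of _ 2]\<close>)
      qed (use f g in auto)
    qed
  qed
  from theI'[OF this] show ?thesis unfolding zeta_def .
qed

lemma zeta_holomorphic: "zeta holomorphic_on (UNIV - {1})"
  and zeta_sums: "Re s > 1 \<Longrightarrow> (\<lambda>n. 1 / of_nat (Suc n) powr s) sums zeta s"
  using zeta_props by auto

lemma zeta_eq_zeta2: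
  assumes "Re s > 1"
  shows "zeta s = 1 + zeta2 s"
proof -
  have "(\<lambda>n. 1 / of_nat (Suc (Suc n)) powr s) sums zeta2 s"
    using zeta2_sums[OF assms] by simp
  hence "(\<lambda>n. 1 / of_nat (Suc n) powr s) sums (zeta2 s + 1)"
    by (subst (asm) sums_Suc_iff) simp
  from sums_unique2[OF this zeta_sums[OF assms]] show ?thesis by (metis add.commute)
qed

text \<open>The case m = 0 is an explicit formula down to Re s > 0. The growth bound and the
  pole-free function \<open>kzeta\<close> are read off from it.\<close>

lemma zeta_formula:
  assumes "Re s > 0" "s \<noteq> 1"
  shows "(s - 1) * (zeta s - 1) = 2 powr (1 - s) + (\<Sum>n. ztail_term 0 n s)"
proof (rule analytic_continuation_open[where s = "{s. Re s > 1}" and s' = "{s. Re s > 0} - {1}" and f = "\<lambda>s. (s - 1) * (zeta s - 1)" and g = "\<lambda>s. 2 powr (1 - s) + (\<Sum>n. ztail_term 0 n s)"])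
  show "connected ({s. Re s > 0} - {1::complex})"
    by (rule connected_open_delete) (auto intro: open_halfspace_Re_gt convex_connected convex_halfspace_Re_gt)
  show "(\<lambda>s. (s - 1) * (zeta s - 1)) holomorphic_on ({s. Re s > 0} - {1})"
    by (intro holomorphic_intros holomorphic_on_subset[OF zeta_holomorphic]) auto
  show "(\<lambda>s. 2 powr (1 - s) + (\<Sum>n. ztail_term 0 n s)) holomorphic_on ({s. Re s > 0} - {1})"
    by (intro holomorphic_intros holomorphic_on_subset[OF ztail_holomorphic[of 0]]) auto
  show "(z - 1) * (zeta z - 1) = 2 powr (1 - z) + (\<Sum>n. ztail_term 0 n z)" if "z \<in> {s. Re s > 1}" for z
    using that ztail_eq[of z 0] by (simp add: zeta_eq_zeta2 algebra_simps)
qed (use assms in \<open>auto intro: open_halfspace_Re_gt intro!: exI[of _ 2] open_Diff\<close>)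

text \<open>The coefficients of the Dirichlet series are real, so the reflected function continues
  the same series.\<close>

lemma zeta_cnj: "zeta (cnj s) = cnj (zeta s)"
proof (cases "s = 1")
  case True
  thus ?thesis using zeta_props by simp
next
  case False
  define f where "f = (\<lambda>s. cnj (zeta (cnj s)))"
  have h: "f holomorphic_on (UNIV - {1})"
  proof -
    have "cnj ` (UNIV - {1}) = UNIV - {1}" by (auto simp: image_cnj_conv_vimage_cnj)
    hence "(cnj \<circ> zeta \<circ> cnj) holomorphic_on (UNIV - {1})"
      using zeta_holomorphic by (intro holomorphic_on_compose_cnj_cnj) (auto intro: open_Diff)
    thus ?thesis by (simp add: f_def o_def)
  qed
  have e: "f z = zeta z" if "Re z > 1" for z
  proof -
    have "(\<lambda>n. cnj (1 / of_nat (Suc n) powr (cnj z))) sums f z"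
      unfolding f_def using zeta_sums[of "cnj z"] that by (subst sums_cnj) auto
    moreover have "cnj (1 / of_nat (Suc n) powr (cnj z)) = 1 / of_nat (Suc n) powr z" for n
      using cnj_powr[of "of_nat (Suc n)" "cnj z"] by (simp add: complex_nonpos_Reals_iff)
    ultimately show ?thesis using zeta_sums[OF that] sums_unique2 by simp
  qed
  have "f s = zeta s"
    by (rule analytic_continuation_open[where s = "{s. Re s > 1}" and s' = "UNIV - {1}" and f = f and g = zeta, OF _ _ _ connected_minus_one _ h zeta_holomorphic e])
       (use False in \<open>auto intro: open_halfspace_Re_gt intro!: exI[of _ 2]\<close>)
  thus ?thesis by (metis complex_cnj_cnj f_def)
qed

section \<open>Polynomial growth for Re s \<ge> 1/2, and a lower bound on Re s = 3\<close>

lemma powr_diff_bound: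
  fixes s :: complex
  assumes n: "n > 0" and x: "n \<le> x" "x \<le> n + 1" and s: "Re s \<ge> -1"
  shows "norm (of_real x powr (-s) - of_real n powr (-s)) \<le> norm s * n powr (- Re s - 1)"
proof -
  have "norm (of_real x powr (-s) - of_real n powr (-s)) \<le> norm s * n powr (- Re s - 1) * norm (x - n)"
  proof (rule differentiable_bound[where S = "{n..n+1}" and f' = "\<lambda>x h. h *\<^sub>R (-s * of_real x powr (-s-1))"])
    fix y assume y: "y \<in> {n..n+1}"
    have "((\<lambda>y. of_real y powr (-s)) has_vector_derivative (-s * of_real y powr (-s-1))) (at y within {n..n+1})"
      using y n by (intro has_vector_derivative_real_field derivative_eq_intros) (auto simp: complex_nonpos_Reals_iff)
    thus "((\<lambda>y. of_real y powr (-s)) has_derivative (\<lambda>h. h *\<^sub>R (-s * of_real y powr (-s-1)))) (at y within {n..n+1})"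
      by (simp add: has_vector_derivative_def)
    show "onorm (\<lambda>h. h *\<^sub>R (- s * complex_of_real y powr (- s - 1))) \<le> cmod s * n powr (- Re s - 1)"
    proof (rule onorm_le)
      fix h :: real
      have "norm (of_real y powr (-s-1)) = y powr (- Re s - 1)"
        using y n by (subst norm_powr_real_powr) auto
      also have "... \<le> n powr (- Re s - 1)" using y n s by (intro powr_mono2') auto
      finally show "norm (h *\<^sub>R (- s * complex_of_real y powr (- s - 1))) \<le> cmod s * n powr (- Re s - 1) * norm h"
        by (auto simp: norm_mult mult_ac intro!: mult_left_mono)
    qed
  qed (use x in auto)
  also have "... \<le> norm s * n powr (- Re s - 1) * 1" using x by (intro mult_left_mono) auto
  finally show ?thesis by simp
qed

text \<open>The constant of \<open>ztail_term_bound\<close> grows exponentially with |1 - s|. Here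
  the remainder is the increment over [N, N + 1] of x powr (1 - s) minus its linear part at N, and
  two mean value inequalities yield the merely quadratic factor |s| |1 - s|.\<close>

lemma ztail_term_0_bound:
  assumes "Re s \<ge> -1"
  shows "norm (ztail_term 0 n s) \<le> norm s * norm (1 - s) * real (n + 2) powr (- Re s - 1)"
proof -
  define N where "N = real (n + 2)"
  have N: "N > 0" by (simp add: N_def)
  define \<phi> where "\<phi> = (\<lambda>x. of_real x powr (1 - s) - (1 - s) * of_real N powr (-s) * of_real x :: complex)"
  have eq: "ztail_term 0 n s = \<phi> (N + 1) - \<phi> N"
  proof -
    have "of_nat (n + 3) = (of_real (N + 1) :: complex)" "of_nat (n + 2) = (of_real N :: complex)" by (simp_all add: N_def)
    note e = this
    show ?thesis unfolding ztail_term_def \<phi>_def e by (simp add: algebra_simps)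
  qed
  have "norm (\<phi> (N + 1) - \<phi> N) \<le> (norm (1 - s) * (norm s * N powr (- Re s - 1))) * norm (N + 1 - N)"
  proof (rule differentiable_bound[where S = "{N..N+1}" and f' = "\<lambda>x h. h *\<^sub>R ((1 - s) * (of_real x powr (-s) - of_real N powr (-s)))"])
    fix y assume y: "y \<in> {N..N+1}"
    have "(\<phi> has_vector_derivative ((1 - s) * (of_real y powr (-s) - of_real N powr (-s)))) (at y within {N..N+1})"
      unfolding \<phi>_def
    proof (rule has_vector_derivative_real_field)
      have "((\<lambda>z. z powr (1 - s) - (1 - s) * of_real N powr (-s) * z) has_field_derivative
        (1 - s) * of_real y powr (1 - s - 1) - (1 - s) * of_real N powr (-s) * 1) (at (of_real y))"
        using y N by (intro DERIV_diff DERIV_cmult DERIV_ident has_field_derivative_powr) (auto simp: complex_nonpos_Reals_iff)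
      thus "((\<lambda>z. z powr (1 - s) - (1 - s) * of_real N powr (-s) * z) has_field_derivative
        (1 - s) * (of_real y powr (-s) - of_real N powr (-s))) (at (of_real y))"
        by (simp add: algebra_simps)
    qed
    thus "(\<phi> has_derivative (\<lambda>h. h *\<^sub>R ((1 - s) * (of_real y powr (-s) - of_real N powr (-s))))) (at y within {N..N+1})"
      by (simp add: has_vector_derivative_def)
    show "onorm (\<lambda>h. h *\<^sub>R ((1 - s) * (of_real y powr (-s) - of_real N powr (-s)))) \<le> norm (1 - s) * (norm s * N powr (- Re s - 1))"
    proof (rule onorm_le)
      fix h :: real
      show "norm (h *\<^sub>R ((1 - s) * (of_real y powr (-s) - of_real N powr (-s)))) \<le> norm (1 - s) * (norm s * N powr (- Re s - 1)) * norm h"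
        using mult_left_mono[OF powr_diff_bound[OF N, of y s], of "\<bar>h\<bar> * norm (1 - s)"] y assms by (auto simp: norm_mult mult_ac)
    qed
  qed auto
  thus ?thesis by (simp add: eq N_def mult_ac)
qed

lemma zeta_growth:
  "\<exists>C>0. \<forall>s. Re s \<ge> 1/2 \<and> s \<noteq> 1 \<longrightarrow> norm ((s - 1) * zeta s) \<le> C * (1 + norm s) ^ 2"
proof -
  define D where "D = (\<Sum>n. real (n + 2) powr (- 3 / 2))"
  have sD: "summable (\<lambda>n. real (n + 2) powr (- 3 / 2))" by (rule summable_shift_powr) auto
  have D: "D \<ge> 0" unfolding D_def by (rule suminf_nonneg[OF sD]) auto
  have "norm ((s - 1) * zeta s) \<le> (D + 4) * (1 + norm s) ^ 2" if s: "Re s \<ge> 1/2" "s \<noteq> 1" for s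
  proof -
    define R where "R = (\<Sum>n. ztail_term 0 n s)"
    have "norm R \<le> (\<Sum>n. norm s * norm (1 - s) * real (n + 2) powr (- 3 / 2))"
      unfolding R_def
    proof (rule norm_suminf_le)
      show "summable (\<lambda>n. norm s * norm (1 - s) * real (n + 2) powr (- 3 / 2))"
        by (intro summable_mult sD)
      fix n
      have "real (n + 2) powr (- Re s - 1) \<le> real (n + 2) powr (- 3 / 2)" using s by (intro powr_mono) auto
      thus "norm (ztail_term 0 n s) \<le> norm s * norm (1 - s) * real (n + 2) powr (- 3 / 2)"
        using ztail_term_0_bound[of s n] s
        by (intro order_trans[OF ztail_term_0_bound mult_left_mono]) auto
    qed
    also have "... = norm s * norm (1 - s) * D" unfolding D_def by (rule suminf_mult[OF sD])
    finally have R: "norm R \<le> norm s * norm (1 - s) * D" .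
    have n1: "norm (1 - s) \<le> 1 + norm s" using norm_triangle_ineq4[of 1 s] by simp
    have p: "norm (2 powr (1 - s) :: complex) \<le> 2"
    proof -
      have "norm (2 powr (1 - s) :: complex) = 2 powr (1 - Re s)" using norm_powr_real_powr[of 2 "1 - s"] by simp
      also have "... \<le> 2 powr 1" using s by (intro powr_mono) auto
      finally show ?thesis by simp
    qed
    have "(s - 1) * zeta s = (s - 1) + 2 powr (1 - s) + R"
      using zeta_formula[of s] s by (simp add: R_def algebra_simps)
    hence "norm ((s - 1) * zeta s) \<le> norm (s - 1) + norm (2 powr (1 - s)) + norm R"
      by (metis norm_triangle_ineq norm_triangle_mono order_refl)
    also have "... \<le> (1 + norm s) + 2 + (1 + norm s) * (1 + norm s) * D"
    proof -
      have "norm s * norm (1 - s) * D \<le> (1 + norm s) * (1 + norm s) * D"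
        using n1 D by (intro mult_right_mono mult_mono) auto
      thus ?thesis using R p n1 by (simp add: norm_minus_commute)
    qed
    also have "... \<le> (D + 4) * (1 + norm s) ^ 2"
      using norm_ge_zero[of s] by (simp add: power2_eq_square algebra_simps)
    finally show ?thesis .
  qed
  thus ?thesis using D by (intro exI[of _ "D + 4"]) auto
qed

text \<open>The first term 1 dominates: n^3 \<ge> 2 (n - 1) n for n \<ge> 2 compares the tail with
  half of a telescoping series. The line Re s = 3 later carries the centres of the discs in
  \<open>zeta_log_deriv_bound\<close> and the inversion integral.\<close>

lemma zeta_3_lower:
  assumes "Re s = 3"
  shows "norm (zeta s) \<ge> 1/4"
proof -
  have le: "norm (1 / of_nat (n + 2) powr s :: complex) \<le> 1/2 * (1 / real (Suc n) - 1 / real (Suc (Suc n)))" for n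
  proof -
    have "norm (1 / of_nat (n + 2) powr s :: complex) = 1 / real (n + 2) powr 3"
      using norm_powr_real_powr[of "of_real (real (n + 2))" s] assms by (simp add: norm_divide)
    also have "real (n + 2) powr 3 = real (n + 2) ^ 3" by (subst powr_numeral) auto
    also have "1 / real (n + 2) ^ 3 \<le> 1 / (2 * (real (Suc n) * real (Suc (Suc n))))"
    proof (intro divide_left_mono)
      have "2 * (real (Suc n) * real (Suc (Suc n))) = (2 * real (Suc n)) * real (n + 2)" by simp
      also have "... \<le> (real (n + 2) * real (n + 2)) * real (n + 2)"
        by (intro mult_right_mono mult_mono) auto
      finally show "2 * (real (Suc n) * real (Suc (Suc n))) \<le> real (n + 2) ^ 3" by (simp add: power3_eq_cube)
    qed (auto intro!: mult_pos_pos)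
    also have "... = 1/2 * (1 / real (Suc n) - 1 / real (Suc (Suc n)))"
      by (simp add: field_simps)
    finally show ?thesis .
  qed
  have "(\<lambda>n. 1 / real (Suc n) - 1 / real (Suc (Suc n))) sums (1 / real (Suc 0) - 0)"
    by (intro telescope_sums') real_asymp
  from sums_mult[OF this, of "1/2"] have t: "(\<lambda>n. 1/2 * (1 / real (Suc n) - 1 / real (Suc (Suc n)))) sums (1/2)" by simp
  have "norm (zeta2 s) \<le> (\<Sum>n. 1/2 * (1 / real (Suc n) - 1 / real (Suc (Suc n))))"
    unfolding zeta2_def by (rule norm_suminf_le[OF le]) (use t in \<open>auto simp: sums_iff\<close>)
  also have "... = 1/2" using t by (simp only: sums_iff)
  finally have "norm (zeta2 s) \<le> 1/2" .
  thus ?thesis using zeta_eq_zeta2[of s] norm_triangle_ineq4[of 1 "- zeta2 s"] assms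
    norm_triangle_ineq2[of 1 "- zeta2 s"] by simp
qed

section \<open>The Dirichlet series of the logarithmic derivative\<close>

lemma ln_powr_summable:
  assumes "a > (1::real)"
  shows "summable (\<lambda>n. ln (real (Suc n)) * real (Suc n) powr (- a))"
proof (rule summable_comparison_test')
  define e where "e = (a - 1) / 2"
  have e: "e > 0" using assms by (simp add: e_def)
  show "summable (\<lambda>n. 1 / e * real (n + 1) powr (- a + e))"
    using assms by (intro summable_mult summable_shift_powr) (auto simp: e_def field_simps)
  fix n :: nat
  have "ln (real (Suc n)) \<le> real (Suc n) powr e / e" using e by (intro ln_powr_bound) auto
  hence "ln (real (Suc n)) * real (Suc n) powr (- a) \<le> real (Suc n) powr e / e * real (Suc n) powr (- a)"
    by (intro mult_right_mono) auto
  also have "... = 1 / e * real (n + 1) powr (- a + e)" by (simp add: powr_add[symmetric])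
  finally show "norm (ln (real (Suc n)) * real (Suc n) powr (- a)) \<le> 1 / e * real (n + 1) powr (- a + e)"
    by simp
qed

lemma norm_Suc_powr: "norm (of_nat (Suc n) powr s :: complex) = real (Suc n) powr Re s"
  using norm_powr_real_powr[of "of_real (real (Suc n))" s] by simp

lemma deriv_zeta_sums:
  assumes "Re s > 1"
  shows "(\<lambda>n. - of_real (ln (real (Suc n))) / of_nat (Suc n) powr s) sums deriv zeta s"
proof -
  have *: "\<exists>g g'. \<forall>x \<in> {s. Re s > 1}. ((\<lambda>n. (of_nat (Suc n) :: complex) powr (-x)) sums g x) \<and>
      ((\<lambda>n. - of_real (ln (real (Suc n))) * (of_nat (Suc n) :: complex) powr (-x)) sums g' x) \<and> (g has_field_derivative g' x) (at x)"
  proof (rule series_and_derivative_comparison_complex)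
    show "open {s. Re s > 1}" by (rule open_halfspace_Re_gt)
    show "((\<lambda>x. (of_nat (Suc n) :: complex) powr (-x)) has_field_derivative - complex_of_real (ln (real (Suc n))) * (of_nat (Suc n) :: complex) powr (-x)) (at x)" for n x
    proof -
      have "Ln (of_nat (Suc n)) = of_real (ln (real (Suc n)))" using Ln_of_real[of "real (Suc n)"] by simp
      hence "((\<lambda>x. exp (- x * Ln (of_nat (Suc n)))) has_field_derivative - complex_of_real (ln (real (Suc n))) * exp (- x * Ln (of_nat (Suc n)))) (at x)"
        by (auto intro!: derivative_eq_intros simp del: of_nat_Suc)
      thus ?thesis by (simp add: powr_def del: of_nat_Suc)
    qed
    fix x assume x: "x \<in> {s. Re s > 1}"
    define d where "d = (Re x - 1) / 2"
    define h where "h = (\<lambda>n. of_real (real (Suc n) powr (- Re x + d)) :: complex)"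
    have "summable h" unfolding h_def summable_of_real_iff using x summable_shift_powr[of "- Re x + d" 1] by (auto simp: d_def field_simps)
    moreover have "range h \<subseteq> \<real>\<^sub>\<ge>\<^sub>0" by (auto simp: h_def)
    moreover have "cmod ((of_nat (Suc n) :: complex) powr (-y)) \<le> cmod (h n)" if "y \<in> ball x d" for n y
    proof -
      have "\<bar>Re (x - y)\<bar> < d" using that abs_Re_le_cmod[of "x - y"] by (auto simp: dist_norm)
      hence "real (Suc n) powr (- Re y) \<le> real (Suc n) powr (- Re x + d)" by (intro powr_mono) auto
      thus ?thesis unfolding norm_Suc_powr h_def by simp
    qed
    ultimately show "\<exists>d h. 0 < d \<and> summable h \<and> range h \<subseteq> \<real>\<^sub>\<ge>\<^sub>0 \<and> (\<forall>\<^sub>F n in sequentially. \<forall>y\<in>ball x d \<inter> {s. 1 < Re s}. cmod ((of_nat (Suc n) :: complex) powr (-y)) \<le> cmod (h n))"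
      using x by (intro exI[of _ d] exI[of _ h]) (auto simp: d_def)
  qed
  then obtain g g' where g: "\<And>x. Re x > 1 \<Longrightarrow> (\<lambda>n. (of_nat (Suc n) :: complex) powr (-x)) sums g x"
    "\<And>x. Re x > 1 \<Longrightarrow> (\<lambda>n. - of_real (ln (real (Suc n))) * (of_nat (Suc n) :: complex) powr (-x)) sums g' x"
    "\<And>x. Re x > 1 \<Longrightarrow> (g has_field_derivative g' x) (at x)" by blast
  have gz: "g x = zeta x" if "Re x > 1" for x
    using sums_unique2[OF g(1)[OF that]] zeta_sums[OF that] by (simp add: powr_minus_divide)
  have "(zeta has_field_derivative g' s) (at s)"
    by (rule has_field_derivative_transform_within_open[OF g(3)[OF assms] open_halfspace_Re_gt[of 1]])
       (use assms gz in auto)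
  hence "deriv zeta s = g' s" by (rule DERIV_imp_deriv)
  thus ?thesis using g(2)[OF assms] by (simp add: powr_minus_divide)
qed

lemma mangoldt_series_norm_summable:
  assumes "Re s > 1"
  shows "summable (\<lambda>n. norm (mangoldt (Suc n) / of_nat (Suc n) powr s :: complex))"
proof (rule summable_comparison_test')
  show "summable (\<lambda>n. ln (real (Suc n)) * real (Suc n) powr (- Re s))" by (rule ln_powr_summable[OF assms])
  fix n :: nat
  have "norm (mangoldt (Suc n) / of_nat (Suc n) powr s :: complex) = mangoldt (Suc n) * real (Suc n) powr (- Re s)"
    unfolding norm_divide norm_Suc_powr by (simp add: powr_minus_divide)
  also have "... \<le> ln (real (Suc n)) * real (Suc n) powr (- Re s)"
    by (intro mult_right_mono mangoldt_le) auto
  finally show "norm (norm (mangoldt (Suc n) / of_nat (Suc n) powr s :: complex)) \<le> ln (real (Suc n)) * real (Suc n) powr (- Re s)" by simp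
qed

text \<open>Dirichlet convolution: the absolutely convergent double series over (a, b) is regrouped
  by n = a b, and the sum of \<open>mangoldt\<close> over the divisors of n is ln n, the coefficient
  in - zeta'.\<close>

lemma zeta_log_deriv:
  assumes s: "Re s > 1"
  shows "zeta s * (\<Sum>n. mangoldt (Suc n) / of_nat (Suc n) powr s) = - deriv zeta s"
proof -
  define A where "A = {n::nat. n \<ge> 1}"
  define p where "p = (\<lambda>n. 1 / of_nat n powr s :: complex)"
  define q where "q = (\<lambda>n. mangoldt n / of_nat n powr s :: complex)"
  define L where "L = (\<Sum>n. q (Suc n))"
  have bij: "bij_betw Suc UNIV A" unfolding A_def
    by (rule bij_betwI[where g = "\<lambda>n. n - 1"]) auto
  have np: "summable (\<lambda>n. norm (p (Suc n)))"
    using dirichlet_series_summable(2)[OF s, of 0] by (simp add: p_def)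
  have nq: "summable (\<lambda>n. norm (q (Suc n)))"
    unfolding q_def by (rule mangoldt_series_norm_summable[OF s])
  have p: "(p has_sum zeta s) A"
    using norm_summable_imp_has_sum[OF np, of "zeta s"] zeta_sums[OF s] has_sum_reindex_bij_betw[OF bij, of p "zeta s"]
    by (simp add: p_def)
  have q: "(q has_sum L) A"
    using norm_summable_imp_has_sum[OF nq, of L] has_sum_reindex_bij_betw[OF bij, of q L] summable_norm_cancel[OF nq]
    by (simp add: L_def summable_sums)
  have ap: "(\<lambda>x. norm (p x)) summable_on A"
    using norm_summable_imp_summable_on[of "\<lambda>n. norm (p (Suc n))"] np summable_on_reindex_bij_betw[OF bij, of "\<lambda>n. norm (p n)"] by simp
  have aq: "(\<lambda>x. norm (q x)) summable_on A"
    using norm_summable_imp_summable_on[of "\<lambda>n. norm (q (Suc n))"] nq summable_on_reindex_bij_betw[OF bij, of "\<lambda>n. norm (q n)"] by simp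
  define f where "f = (\<lambda>(a, b). p a * q b)"
  have "(\<lambda>x. norm (f x)) summable_on A \<times> A"
  proof (rule summable_on_SigmaI)
    show "((\<lambda>y. norm (f (x, y))) has_sum norm (p x) * infsum (\<lambda>y. norm (q y)) A) A" for x
      unfolding f_def prod.case norm_mult by (intro has_sum_cmult_right has_sum_infsum aq)
    show "(\<lambda>x. norm (p x) * infsum (\<lambda>y. norm (q y)) A) summable_on A"
      by (intro summable_on_cmult_left ap)
  qed auto
  hence fs: "f summable_on A \<times> A" by (rule abs_summable_summable)
  have f1: "(f has_sum zeta s * L) (A \<times> A)"
  proof (rule has_sum_SigmaI[OF _ _ fs])
    show "((\<lambda>y. f (x, y)) has_sum p x * L) A" for x
      unfolding f_def prod.case by (intro has_sum_cmult_right q)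
    show "((\<lambda>x. p x * L) has_sum zeta s * L) A" by (intro has_sum_cmult_left p)
  qed
  define g where "g = (\<lambda>(n, d). mangoldt d / of_nat n powr s :: complex)"
  have "(f has_sum zeta s * L) (A \<times> A) \<longleftrightarrow> (g has_sum zeta s * L) (Sigma A (\<lambda>n. {d. d dvd n}))"
  proof (rule has_sum_reindex_bij_witness[where j = "\<lambda>(a, b). (a * b, b)" and i = "\<lambda>(n, d). (n div d, d)"])
    fix x assume "x \<in> A \<times> A"
    then obtain a b where x: "x = (a, b)" "a \<ge> 1" "b \<ge> 1" by (auto simp: A_def)
    show "(case (case x of (a, b) \<Rightarrow> (a * b, b)) of (n, d) \<Rightarrow> (n div d, d)) = x" using x by simp
    show "(case x of (a, b) \<Rightarrow> (a * b, b)) \<in> (SIGMA n:A. {d. d dvd n})" using x by (auto simp: A_def)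
    have "of_nat (a * b) powr s = (of_nat a powr s * of_nat b powr s :: complex)"
      using powr_times_real[of "of_nat a" "of_nat b" s] x by simp
    thus "g (case x of (a, b) \<Rightarrow> (a * b, b)) = f x" using x by (simp add: f_def g_def p_def q_def)
  qed (auto simp: A_def Suc_le_eq dvd_div_eq_0_iff elim!: dvdE intro!: Nat.gr0I)
  with f1 have g1: "(g has_sum zeta s * L) (Sigma A (\<lambda>n. {d. d dvd n}))" by blast
  have "((\<lambda>n. of_real (ln (real n)) / of_nat n powr s) has_sum zeta s * L) A"
  proof (rule has_sum_SigmaD[OF g1])
    fix n assume n: "n \<in> A"
    have "(\<Sum>d | d dvd n. g (n, d)) = (\<Sum>d | d dvd n. mangoldt d) / of_nat n powr s"
      unfolding g_def by (simp add: sum_divide_distrib)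
    also have "... = of_real (ln (real n)) / of_nat n powr s"
      using n by (subst mangoldt_sum) (auto simp: A_def)
    finally show "((\<lambda>d. g (n, d)) has_sum of_real (ln (real n)) / of_nat n powr s) {d. d dvd n}"
      using n by (intro has_sum_finiteI) (auto simp: A_def)
  qed
  hence "((\<lambda>n. of_real (ln (real (Suc n))) / of_nat (Suc n) powr s) has_sum zeta s * L) UNIV"
    using has_sum_reindex_bij_betw[OF bij, of "\<lambda>n. of_real (ln (real n)) / of_nat n powr s" "zeta s * L"] by simp
  hence "(\<lambda>n. of_real (ln (real (Suc n))) / of_nat (Suc n) powr s) sums (zeta s * L)"
    by (rule has_sum_imp_sums)
  moreover have "(\<lambda>n. of_real (ln (real (Suc n))) / of_nat (Suc n) powr s) sums (- deriv zeta s)"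
    using sums_minus[OF deriv_zeta_sums[OF s]] by simp
  ultimately have "zeta s * L = - deriv zeta s" by (rule sums_unique2)
  thus ?thesis by (simp add: L_def q_def)
qed

section \<open>The logarithmic derivative of the zeta function\<close>

text \<open>A zero-free function on a disc has a logarithm, whose real part relative to the centre
  is below ln M. Borel-Caratheodory turns this one-sided bound into a bound for the modulus, and
  Cauchy's inequality turns that into one for the derivative g' / g.\<close>

lemma borel_caratheodory_log_deriv:
  fixes g :: "complex \<Rightarrow> complex"
  assumes r: "0 < r" "r < R" and g: "g holomorphic_on ball z0 R" and nz: "\<And>w. w \<in> ball z0 R \<Longrightarrow> g w \<noteq> 0"
    and M: "\<And>w. w \<in> ball z0 R \<Longrightarrow> norm (g w) < M * norm (g z0)" and w: "dist z0 w \<le> r"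
  shows "norm (deriv g w / g w) \<le> 8 * R / (R - r)^2 * ln M"
proof -
  have R: "R > 0" using r by simp
  obtain L0 where L0: "L0 holomorphic_on ball z0 R" "\<And>z. z \<in> ball z0 R \<Longrightarrow> g z = exp (L0 z)"
    using contractible_imp_holomorphic_log[OF g convex_imp_contractible[OF convex_ball] nz] by metis
  define L where "L = (\<lambda>z. L0 z - L0 z0)"
  have L: "L holomorphic_on ball z0 R" unfolding L_def by (intro holomorphic_intros L0)
  have z0: "z0 \<in> ball z0 R" using R by simp
  have M1: "M > 1" using M[OF z0] nz[OF z0] by auto
  define A where "A = ln M"
  have A: "A > 0" using M1 by (simp add: A_def)
  have ReL: "Re (L z) < A" if "z \<in> ball z0 R" for z
  proof -
    have "exp (Re (L z)) = norm (g z) / norm (g z0)"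
      using that z0 by (simp add: L0 L_def exp_diff norm_divide)
    also have "... < M" using M[OF that] nz[OF z0] by (simp add: divide_simps)
    finally show ?thesis using M1 unfolding A_def by (metis exp_gt_zero exp_less_cancel_iff exp_ln less_trans zero_less_one)
  qed
  \<comment> \<open>The map l / (2 A - l) sends the half-plane Re l < A into the unit disc and fixes
    0, so the Schwarz lemma applies on the rescaled disc.\<close>
  define \<Phi> where "\<Phi> = (\<lambda>x. L (z0 + of_real R * x) / (2 * of_real A - L (z0 + of_real R * x)))"
  have inb: "z0 + of_real R * x \<in> ball z0 R" if "norm x < 1" for x
    using that R by (simp add: dist_norm norm_mult)
  have nz2: "2 * of_real A - L (z0 + of_real R * x) \<noteq> 0" if "norm x < 1" for x
  proof
    assume "2 * of_real A - L (z0 + of_real R * x) = 0"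
    hence "Re (L (z0 + of_real R * x)) = 2 * A" by (metis Re_complex_of_real eq_iff_diff_eq_0 mult_2 of_real_add)
    thus False using ReL[OF inb[OF that]] A by simp
  qed
  have hol: "\<Phi> holomorphic_on ball 0 1"
  proof -
    have "(L \<circ> (\<lambda>x. z0 + of_real R * x)) holomorphic_on ball 0 1"
      by (intro holomorphic_on_compose_gen[OF _ L] holomorphic_intros) (use inb in auto)
    hence "(\<lambda>x. L (z0 + of_real R * x)) holomorphic_on ball 0 1" by (simp add: o_def)
    thus ?thesis unfolding \<Phi>_def by (intro holomorphic_intros) (use nz2 in auto)
  qed
  have lt1: "norm (\<Phi> x) < 1" if "norm x < 1" for x
  proof -
    define l where "l = L (z0 + of_real R * x)"
    have re: "Re l < A" using ReL[OF inb[OF that]] by (simp add: l_def)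
    have "(Re l)^2 < (2 * A - Re l)^2"
    proof -
      have "(2 * A - Re l)^2 - (Re l)^2 = 4 * (A * (A - Re l))" by (simp add: power2_eq_square algebra_simps)
      moreover have "A * (A - Re l) > 0" using A re by simp
      ultimately show ?thesis by linarith
    qed
    hence "norm l < norm (2 * of_real A - l)"
      by (simp add: cmod_def)
    thus ?thesis unfolding \<Phi>_def l_def[symmetric] by (simp add: norm_divide divide_simps)
  qed
  have bound: "norm (L z) \<le> 2 * A * q / (1 - q)" if z: "dist z0 z \<le> q * R" and q: "0 < q" "q < 1" for z q
  proof -
    define x where "x = (z - z0) / of_real R"
    have x: "norm x \<le> q" using z R by (simp add: x_def norm_divide dist_norm norm_minus_commute divide_simps)
    have zx: "z = z0 + of_real R * x" using R by (simp add: x_def)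
    have x1: "norm x < 1" using x q by simp
    have "norm (\<Phi> x) \<le> norm x"
      by (rule Schwarz_Lemma(1)[OF hol _ _ x1]) (auto simp: lt1, simp add: \<Phi>_def L_def)
    hence "norm (\<Phi> x) \<le> q" using x by simp
    hence "norm (L z) \<le> q * norm (2 * of_real A - L z)"
      using nz2[OF x1] unfolding \<Phi>_def zx[symmetric] by (simp add: norm_divide divide_simps)
    also have "... \<le> q * (2 * A + norm (L z))"
      using norm_triangle_ineq4[of "2 * of_real A" "L z"] A q by (intro mult_left_mono) (auto simp: norm_mult)
    finally have "norm (L z) * (1 - q) \<le> 2 * A * q" by (simp add: algebra_simps)
    thus ?thesis using q by (simp add: divide_simps mult.commute)
  qed
  \<comment> \<open>The Cauchy circle around w uses half of the room that is left: its radius is e =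
    (R - r) / 2, and it stays within r + e = q * R of the centre.\<close>
  define q where "q = (r + R) / (2 * R)"
  have q: "0 < q" "q < 1" using r R by (auto simp: q_def field_simps)
  define e where "e = (R - r) / 2"
  have e: "e > 0" using r by (simp add: e_def)
  have sub: "cball w e \<subseteq> ball z0 R"
  proof
    fix x assume "x \<in> cball w e"
    hence "dist z0 x \<le> r + e" using w dist_triangle[of z0 x w] by (simp add: dist_commute)
    thus "x \<in> ball z0 R" using r by (simp add: e_def field_simps)
  qed
  have "norm ((deriv ^^ 1) L w) \<le> fact 1 * (2 * A * q / (1 - q)) / e ^ 1"
  proof (rule Cauchy_inequality)
    show "L holomorphic_on ball w e" using sub L by (meson ball_subset_cball holomorphic_on_subset)
    show "continuous_on (cball w e) L" using sub L by (meson continuous_on_subset holomorphic_on_imp_continuous_on)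
    show "0 < e" by (rule e)
    fix x assume "norm (w - x) = e"
    hence "dist z0 x \<le> r + e" using w dist_triangle[of z0 x w] by (simp add: dist_norm)
    also have "... = q * R" using R by (simp add: q_def e_def field_simps)
    finally show "norm (L x) \<le> 2 * A * q / (1 - q)" using q by (intro bound) auto
  qed
  also have "fact 1 * (2 * A * q / (1 - q)) / e ^ 1 = 4 * (r + R) / (R - r)^2 * A"
  proof -
    have "1 - q = (R - r) / (2 * R)" using R by (simp add: q_def field_simps)
    thus ?thesis using R r by (simp add: q_def e_def power2_eq_square)
  qed
  also have "... \<le> 8 * R / (R - r)^2 * A"
    using r A by (intro mult_right_mono divide_right_mono) auto
  finally have le: "norm (deriv L w) \<le> 8 * R / (R - r)^2 * A" by simp
  have w': "w \<in> ball z0 R" using w r by simp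
  have "(L0 has_field_derivative deriv L0 w) (at w)"
    using L0(1) w' by (meson holomorphic_derivI open_ball)
  hence d1: "(L has_field_derivative deriv L0 w) (at w)" unfolding L_def by (auto intro!: derivative_eq_intros)
  have "((\<lambda>z. exp (L0 z)) has_field_derivative exp (L0 w) * deriv L0 w) (at w)"
    using \<open>(L0 has_field_derivative deriv L0 w) (at w)\<close> by (auto intro!: derivative_eq_intros)
  hence "(g has_field_derivative exp (L0 w) * deriv L0 w) (at w)"
    by (rule has_field_derivative_transform_within_open[OF _ open_ball w']) (simp add: L0)
  hence "deriv g w = g w * deriv L w"
    using d1 L0(2)[OF w'] by (simp add: DERIV_imp_deriv)
  hence "deriv g w / g w = deriv L w" using nz[OF w'] by simp
  thus ?thesis using le by (simp add: A_def)
qed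

lemma holomorphic_factor_zero:
  assumes S: "open S" "connected S" and f: "f holomorphic_on S" and z: "z \<in> S" and nz: "\<exists>w\<in>S. f w \<noteq> (0::complex)"
  obtains h where "h holomorphic_on S" "h z \<noteq> 0" "\<And>w. w \<in> S \<Longrightarrow> f w = (w - z) ^ nat (zorder f z) * h w"
proof -
  define n where "n = nat (zorder f z)"
  obtain r where r: "r > 0" "cball z r \<subseteq> S" "zor_poly f z holomorphic_on cball z r"
     "\<And>w. w \<in> cball z r \<Longrightarrow> f w = zor_poly f z w * (w - z) ^ n \<and> zor_poly f z w \<noteq> 0"
    using zorder_exist_zero[OF f S z nz] unfolding n_def by metis
  define h where "h = (\<lambda>w. if w = z then zor_poly f z z else f w / (w - z) ^ n)"
  have "h holomorphic_on (S - {z}) \<union> ball z r"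
  proof (rule holomorphic_on_Un)
    have "(\<lambda>w. f w / (w - z) ^ n) holomorphic_on S - {z}"
      by (intro holomorphic_intros holomorphic_on_subset[OF f]) auto
    thus "h holomorphic_on S - {z}" by (rule holomorphic_transform) (auto simp: h_def)
    have "zor_poly f z holomorphic_on ball z r" using r(3) ball_subset_cball holomorphic_on_subset by blast
    thus "h holomorphic_on ball z r"
      by (rule holomorphic_transform) (use r(4) in \<open>auto simp: h_def\<close>)
  qed (use S in auto)
  hence "h holomorphic_on S" by (rule holomorphic_on_subset) (use r in auto)
  moreover have "h z \<noteq> 0" using r by (simp add: h_def)
  moreover have "f w = (w - z) ^ n * h w" if "w \<in> S" for w
    using that r(4)[of z] r(1) by (auto simp: h_def)
  ultimately show ?thesis using that by (simp add: n_def)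
qed

definition zeta_zeros :: "real \<Rightarrow> complex set" where
  "zeta_zeros a = {z. z \<noteq> 1 \<and> zeta z = 0 \<and> Re z > a}"

lemma zeta_zero_mult_eq: "z \<in> zeta_zeros a \<Longrightarrow> zeta_zero_mult z = nat (zorder zeta z)"
  by (auto simp: zeta_zeros_def zeta_zero_mult_def)

text \<open>A disc around 3 + i t of radius below 5/2 contains at most one zero, because zeros are
  10 apart. Dividing it out leaves a zero-free function whose growth comes from
  \<open>zeta_growth\<close>. The removed factor contributes m / (s - z), which is O(ln t / \<eta>)
  as m = O(ln t) and s keeps distance \<eta> from z.\<close>

lemma zeta_log_deriv_bound:
  fixes c \<eta> C1 :: real
  assumes c: "c - \<eta> > 1/2" "c < 1" and \<eta>: "0 < \<eta>" "\<eta> \<le> 1"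
    and sep: "\<And>z z'. z \<in> zeta_zeros (c - \<eta>) \<Longrightarrow> z' \<in> zeta_zeros (c - \<eta>) \<Longrightarrow> z \<noteq> z' \<Longrightarrow> dist z z' \<ge> 10"
    and mult: "\<And>z. z \<in> zeta_zeros (c - \<eta>) \<Longrightarrow> real (zeta_zero_mult z) \<le> C1 * ln (norm z)"
  shows "\<exists>C. \<forall>s. c \<le> Re s \<and> Re s \<le> 3 \<and> \<bar>Im s\<bar> \<ge> 20 \<and> (\<forall>z\<in>zeta_zeros (c - \<eta>). dist s z \<ge> \<eta>)
     \<longrightarrow> norm (deriv zeta s / zeta s) \<le> C * ln \<bar>Im s\<bar>"
proof -
  obtain C0 where C0: "C0 > 0" "\<And>s. Re s \<ge> 1/2 \<Longrightarrow> s \<noteq> 1 \<Longrightarrow> norm ((s - 1) * zeta s) \<le> C0 * (1 + norm s) ^ 2"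
    using zeta_growth by blast
  define D where "D = 128 / \<eta>^2 * (\<bar>ln (32 * C0)\<bar> + 2 + 2 * \<bar>C1\<bar> * ln (16 / \<eta>)) + 2 * \<bar>C1\<bar> / \<eta>"
  have "norm (deriv zeta s / zeta s) \<le> D * ln \<bar>Im s\<bar>"
    if s: "c \<le> Re s" "Re s \<le> 3" "\<bar>Im s\<bar> \<ge> 20" "\<And>z. z \<in> zeta_zeros (c - \<eta>) \<Longrightarrow> dist s z \<ge> \<eta>" for s
  proof -
    define t where "t = \<bar>Im s\<bar>"
    have t: "t \<ge> 20" using s by (simp add: t_def)
    define s0 where "s0 = Complex 3 (Im s)"
    define r where "r = 3 - c"
    define R' where "R' = r + \<eta> / 2"
    define R where "R = r + \<eta>"
    have r: "r > 0" "r < R'" "R' < R" "R < 5/2" using c \<eta> by (auto simp: r_def R'_def R_def)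
    have inR: "Re w > c - \<eta>" "w \<noteq> 1" "norm w \<le> 2 * t" "norm (zeta w) \<le> 4 * C0 * t^2" "norm w \<ge> 1" if w: "w \<in> ball s0 R" for w
    proof -
      have d: "norm (s0 - w) < R" using w by (simp add: dist_norm)
      have "\<bar>Re (s0 - w)\<bar> < R" "\<bar>Im (s0 - w)\<bar> < R" using d abs_Re_le_cmod[of "s0 - w"] abs_Im_le_cmod[of "s0 - w"] by linarith+
      hence *: "Re w > 3 - R" "\<bar>Im w\<bar> > t - 3" using r by (auto simp: s0_def t_def)
      show 1: "Re w > c - \<eta>" using * by (simp add: R_def r_def)
      show 2: "w \<noteq> 1" using * t by auto
      show "norm w \<ge> 1" using * t abs_Im_le_cmod[of w] by linarith
      have "norm s0 \<le> 3 + t" using cmod_le[of s0] by (simp add: s0_def t_def)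
      hence nw: "norm w \<le> 3 + t + 3" using d r norm_triangle_ineq3[of s0 w] by linarith
      thus "norm w \<le> 2 * t" using t by simp
      have "1 \<le> norm (w - 1)" using * t abs_Im_le_cmod[of "w - 1"] by simp
      hence "norm (zeta w) \<le> norm (w - 1) * norm (zeta w)"
        using mult_right_mono[of 1 "norm (w - 1)" "norm (zeta w)"] by simp
      also have "... \<le> C0 * (1 + norm w) ^ 2" using C0(2)[of w] 1 2 c by (simp add: norm_mult)
      also have "... \<le> C0 * (2 * t) ^ 2" using nw t C0(1) by (intro mult_left_mono power_mono) auto
      finally show "norm (zeta w) \<le> 4 * C0 * t^2" by (simp add: power_mult_distrib)
    qed
    have s0b: "s0 \<in> ball s0 R" using r by simp
    have zs0: "norm (zeta s0) \<ge> 1/4" by (rule zeta_3_lower) (simp add: s0_def)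
    have hol: "zeta holomorphic_on ball s0 R"
      using zeta_holomorphic by (rule holomorphic_on_subset) (use inR(2)[of 1] in auto)
    \<comment> \<open>If the disc is free of zeros, m = 0 with the dummy point z = s0 fits the same
      pattern.\<close>
    obtain z m h where h: "h holomorphic_on ball s0 R" "\<And>w. w \<in> ball s0 R \<Longrightarrow> zeta w = (w - z) ^ m * h w"
      "\<And>w. w \<in> ball s0 R' \<Longrightarrow> h w \<noteq> 0" "z \<in> ball s0 R'" "m = 0 \<or> dist s z \<ge> \<eta>" "real m \<le> 2 * \<bar>C1\<bar> * ln t"
    proof (cases "\<exists>z\<in>ball s0 R'. zeta z = 0")
      case False
      thus thesis using t r by (intro that[of zeta s0 0]) (use hol in auto)
    next
      case True
      then obtain z where z: "z \<in> ball s0 R'" "zeta z = 0" by blast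
      have zR: "z \<in> ball s0 R" using z r by auto
      have zz: "z \<in> zeta_zeros (c - \<eta>)" using inR[OF zR] z by (auto simp: zeta_zeros_def)
      obtain h where h: "h holomorphic_on ball s0 R" "h z \<noteq> 0" "\<And>w. w \<in> ball s0 R \<Longrightarrow> zeta w = (w - z) ^ nat (zorder zeta z) * h w"
        using holomorphic_factor_zero[OF open_ball connected_ball hol zR] s0b zs0 by (metis norm_zero not_le zero_less_divide_1_iff zero_less_numeral)
      show thesis
      proof (rule that[OF h(1) h(3)])
        show "h w \<noteq> 0" if w: "w \<in> ball s0 R'" for w
        proof
          assume "h w = 0"
          hence wz: "zeta w = 0" "w \<noteq> z" using h w r by auto
          have wR: "w \<in> ball s0 R" using w r by auto
          have "w \<in> zeta_zeros (c - \<eta>)" using inR[OF wR] wz by (auto simp: zeta_zeros_def)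
          hence "dist w z \<ge> 10" using sep zz wz by blast
          moreover have "dist w z \<le> dist s0 w + dist s0 z" by (metis dist_commute dist_triangle)
          ultimately show False using w z r by auto
        qed
        show "z \<in> ball s0 R'" by (rule z)
        show "nat (zorder zeta z) = 0 \<or> \<eta> \<le> dist s z" using s(4)[OF zz] by simp
        have "real (nat (zorder zeta z)) \<le> C1 * ln (norm z)" using mult[OF zz] zeta_zero_mult_eq[OF zz] by simp
        also have "... \<le> \<bar>C1\<bar> * (2 * ln t)"
        proof (intro mult_mono)
          have z0: "norm z \<ge> 1" by (rule inR(5)[OF zR])
          thus "0 \<le> ln (norm z)" by simp
          have "ln (norm z) \<le> ln (2 * t)" using inR(3)[OF zR] z0 by (subst ln_le_cancel_iff) auto
          also have "... \<le> ln (t * t)" using t by (subst ln_le_cancel_iff) auto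
          finally show "ln (norm z) \<le> 2 * ln t" using t by (simp add: ln_mult)
        qed (use t in auto)
        finally show "real (nat (zorder zeta z)) \<le> 2 * \<bar>C1\<bar> * ln t" by simp
      qed auto
    qed
    define B where "B = 4 * C0 * t^2 * (4 / \<eta>) ^ m"
    \<comment> \<open>A bound for |h| relative to |h s0|: |zeta s0| \<ge> 1/4 and |s0 - z| \<le> 4
      give |h s0| 4^m \<ge> 1/4. Since m = O(ln t), ln M is still O(ln t).\<close>
    define M where "M = 32 * C0 * t^2 * (16 / \<eta>) ^ m"
    have Bpos: "B > 0" using C0 t \<eta> by (auto simp: B_def)
    \<comment> \<open>On the circle of radius R2, strictly between R' and R, every point is at least
      \<eta> / 4 away from z. Division by (w - z) ^ m therefore costs at most (4 / \<eta>) ^ m, and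
      the maximum principle carries the bound inside.\<close>
    define R2 where "R2 = (R' + R) / 2"
    have R2: "R' < R2" "R2 < R" "R2 = R' + \<eta> / 4" "R2 > 0" using r by (auto simp: R2_def R'_def R_def field_simps)
    have hB: "norm (h w) \<le> B" if w: "w \<in> ball s0 R'" for w
    proof (rule maximum_modulus_frontier[of h "cball s0 R2"])
      show "h holomorphic_on interior (cball s0 R2)"
        by (rule holomorphic_on_subset[OF h(1)]) (use R2 in auto)
      show "continuous_on (closure (cball s0 R2)) h"
        by (rule continuous_on_subset[OF holomorphic_on_imp_continuous_on[OF h(1)]]) (use R2 in auto)
      show "w \<in> cball s0 R2" using w R2 by auto
      fix x assume "x \<in> frontier (cball s0 R2)"
      hence x: "dist s0 x = R2" using R2 by (simp add: frontier_cball)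
      hence xR: "x \<in> ball s0 R" using R2 by simp
      have "dist s0 x \<le> dist s0 z + dist z x" by (rule dist_triangle)
      hence xz: "norm (x - z) \<ge> \<eta> / 4" using x h(4) R2 by (auto simp: dist_norm norm_minus_commute)
      have "norm (h x) * (\<eta> / 4) ^ m \<le> norm (h x) * norm (x - z) ^ m"
        using xz \<eta> by (intro mult_left_mono power_mono) auto
      also have "... = norm (zeta x)" using h(2)[OF xR] by (simp add: norm_mult norm_power)
      also have "... \<le> 4 * C0 * t^2" by (rule inR(4)[OF xR])
      finally show "norm (h x) \<le> B" using \<eta> unfolding B_def by (simp add: power_divide field_simps)
    qed auto
    have h0: "norm (h s0) * 4 ^ m \<ge> 1/4"
    proof -
      have "norm (zeta s0) = norm (h s0) * norm (s0 - z) ^ m" using h(2)[OF s0b] by (simp add: norm_mult norm_power)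
      also have "... \<le> norm (h s0) * 4 ^ m"
        using h(4) r by (intro mult_left_mono power_mono) (auto simp: dist_norm)
      finally show ?thesis using zs0 by simp
    qed
    have dz: "dist s0 s \<le> r"
    proof -
      have "s0 - s = of_real (3 - Re s)" by (simp add: s0_def complex_eq_iff)
      hence "dist s0 s = \<bar>3 - Re s\<bar>" by (metis dist_norm norm_of_real)
      thus ?thesis using s by (simp add: r_def)
    qed
    have main: "norm (deriv h s / h s) \<le> 8 * R' / (R' - r)^2 * ln M"
    proof (rule borel_caratheodory_log_deriv[of r R' h s0])
      show "h holomorphic_on ball s0 R'" by (rule holomorphic_on_subset[OF h(1)]) (use r in auto)
      fix w assume w: "w \<in> ball s0 R'"
      show "h w \<noteq> 0" by (rule h(3)[OF w])
      have "B < 8 * C0 * t^2 * (4 / \<eta>) ^ m" unfolding B_def using C0 t \<eta> by (intro mult_strict_right_mono) auto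
      also have "... = 32 * C0 * t^2 * (4 / \<eta>) ^ m * (1/4)" by simp
      also have "... \<le> 32 * C0 * t^2 * (4 / \<eta>) ^ m * (norm (h s0) * 4 ^ m)"
        using h0 C0 \<eta> by (intro mult_left_mono) auto
      also have "... = M * norm (h s0)"
      proof -
        have "(16 / \<eta>) ^ m = (4 / \<eta>) ^ m * 4 ^ m" by (simp add: power_mult_distrib[symmetric])
        thus ?thesis by (simp add: M_def)
      qed
      finally show "norm (h w) < M * norm (h s0)" using hB[OF w] by simp
    qed (use r dz in auto)
    have lnt: "ln t \<ge> 1"
    proof -
      have "exp 1 \<le> t" using exp_le t by linarith
      thus ?thesis using t by (subst ln_ge_iff) auto
    qed
    have lnM: "ln M \<le> (\<bar>ln (32 * C0)\<bar> + 2 + 2 * \<bar>C1\<bar> * ln (16 / \<eta>)) * ln t"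
    proof -
      have "ln M = ln (32 * C0) + 2 * ln t + real m * ln (16 / \<eta>)"
        unfolding M_def using C0 t \<eta> by (simp add: ln_mult ln_realpow)
      also have "ln (32 * C0) \<le> \<bar>ln (32 * C0)\<bar> * ln t"
        using mult_left_mono[OF lnt, of "\<bar>ln (32 * C0)\<bar>"] by linarith
      also have "real m * ln (16 / \<eta>) \<le> 2 * \<bar>C1\<bar> * ln t * ln (16 / \<eta>)"
        using h(6) \<eta> by (intro mult_right_mono) (auto simp: ln_ge_zero_iff)
      finally show ?thesis by (simp add: algebra_simps)
    qed
    have "8 * R' / (R' - r)^2 * ln M \<le> 128 / \<eta>^2 * ((\<bar>ln (32 * C0)\<bar> + 2 + 2 * \<bar>C1\<bar> * ln (16 / \<eta>)) * ln t)"
    proof -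
      have e: "(R' - r)^2 = \<eta>^2 / 4" by (simp add: R'_def power_divide)
      have "8 * R' / (R' - r)^2 = 32 * R' / \<eta>^2" unfolding e by simp
      also have "... \<le> 128 / \<eta>^2" using r by (intro divide_right_mono) auto
      finally have a: "8 * R' / (R' - r)^2 \<le> 128 / \<eta>^2" .
      have "0 \<le> ln (16 / \<eta>)" using \<eta> by simp
      hence "8 * R' / (R' - r)^2 * ln M \<le> 8 * R' / (R' - r)^2 * ((\<bar>ln (32 * C0)\<bar> + 2 + 2 * \<bar>C1\<bar> * ln (16 / \<eta>)) * ln t)"
        using lnM r by (intro mult_left_mono) auto
      also have "... \<le> 128 / \<eta>^2 * ((\<bar>ln (32 * C0)\<bar> + 2 + 2 * \<bar>C1\<bar> * ln (16 / \<eta>)) * ln t)"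
        using lnt \<open>0 \<le> ln (16 / \<eta>)\<close> by (intro mult_right_mono a mult_nonneg_nonneg) auto
      finally show ?thesis .
    qed
    with main have b1: "norm (deriv h s / h s) \<le> 128 / \<eta>^2 * (\<bar>ln (32 * C0)\<bar> + 2 + 2 * \<bar>C1\<bar> * ln (16 / \<eta>)) * ln t"
      unfolding mult.assoc[of "128 / \<eta>^2"] by (rule order_trans)
    have sR: "s \<in> ball s0 R'" "s \<in> ball s0 R" using dz r by auto
    have hd: "(h has_field_derivative deriv h s) (at s)" using h(1) sR by (meson holomorphic_derivI open_ball)
    have "((\<lambda>w. (w - z) ^ m * h w) has_field_derivative (of_nat m * (s - z) ^ (m - 1)) * h s + (s - z) ^ m * deriv h s) (at s)"
      by (rule derivative_eq_intros hd refl | simp)+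
    hence "(zeta has_field_derivative (of_nat m * (s - z) ^ (m - 1)) * h s + (s - z) ^ m * deriv h s) (at s)"
      by (rule has_field_derivative_transform_within_open[OF _ open_ball sR(2)]) (simp add: h(2))
    hence dze: "deriv zeta s = (of_nat m * (s - z) ^ (m - 1)) * h s + (s - z) ^ m * deriv h s" by (rule DERIV_imp_deriv)
    have hs: "h s \<noteq> 0" using h(3) sR by simp
    have "deriv zeta s / zeta s = of_nat m / (s - z) + deriv h s / h s"
    proof (cases "m = 0")
      case True
      thus ?thesis using dze h(2)[OF sR(2)] by simp
    next
      case False
      hence sz: "s - z \<noteq> 0" using h(5) \<eta> by auto
      have "(s - z) ^ m = (s - z) * (s - z) ^ (m - 1)" using False by (cases m) auto
      thus ?thesis unfolding dze h(2)[OF sR(2)] using sz hs by (simp add: divide_simps) (simp add: algebra_simps)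
    qed
    hence "norm (deriv zeta s / zeta s) \<le> norm (of_nat m / (s - z)) + norm (deriv h s / h s)"
      by (simp add: norm_triangle_ineq)
    also have "norm (of_nat m / (s - z)) \<le> 2 * \<bar>C1\<bar> / \<eta> * ln t"
    proof (cases "m = 0")
      case False
      hence "norm (s - z) \<ge> \<eta>" using h(5) by (auto simp: dist_norm)
      hence "norm (of_nat m / (s - z)) \<le> real m / \<eta>"
        unfolding norm_divide norm_of_nat using \<eta> by (intro divide_left_mono mult_pos_pos) auto
      also have "... \<le> 2 * \<bar>C1\<bar> * ln t / \<eta>" using h(6) \<eta> by (intro divide_right_mono) auto
      finally show ?thesis by simp
    qed (use lnt \<eta> in auto)
    finally show ?thesis using b1 unfolding D_def t_def by (simp add: algebra_simps)
  qed
  thus ?thesis by blast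
qed

section \<open>Square-integrable continuation of Laplace transforms\<close>

lemma set_integrable_exp_decay:
  fixes a :: real
  assumes "a > 0"
  shows "set_integrable lborel {0<..} (\<lambda>u. exp (- a * u))"
proof -
  have "set_integrable lborel (einterval 0 \<infinity>) (\<lambda>u. exp (- a * u))"
  proof (rule interval_integral_FTC_nonneg(1)[where F = "\<lambda>u. - exp (- a * u) / a" and A = "-1/a" and B = 0])
    show "DERIV (\<lambda>u. - exp (- a * u) / a) x :> exp (- a * x)" for x
      using assms by (auto intro!: derivative_eq_intros simp: field_simps)
    show "isCont (\<lambda>u. exp (- a * u)) x" for x by (intro continuous_intros)
    have "((\<lambda>u. - exp (- a * u) / a) \<longlongrightarrow> - exp (- a * 0) / a) (at_right 0)"
      by (intro tendsto_intros) (use assms in auto)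
    thus "(((\<lambda>u. - exp (- a * u) / a) \<circ> real_of_ereal) \<longlongrightarrow> -1/a) (at_right 0)"
      by (simp add: ereal_tendsto_simps1 zero_ereal_def)
    have "((\<lambda>u. - exp (- a * u) / a) \<longlongrightarrow> 0) at_top" using assms by real_asymp
    thus "(((\<lambda>u. - exp (- a * u) / a) \<circ> real_of_ereal) \<longlongrightarrow> 0) (at_left \<infinity>)"
      by (simp add: ereal_tendsto_simps1)
  qed auto
  moreover have "einterval 0 \<infinity> = {0<..}" by (auto simp: einterval_def zero_ereal_def)
  ultimately show ?thesis by simp
qed

lemma norm_exp_mult_real: "norm (exp (w * of_real u) :: complex) = exp (Re w * u)"
  by (simp add: norm_exp_eq_Re)

lemma laplace_exp:
  fixes w :: complex
  assumes "Re w > 0"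
  shows "set_integrable lborel {0<..} (\<lambda>u. exp (- w * of_real u))"
    and "(LINT u:{0<..}|lborel. exp (- w * of_real u)) = 1 / w"
proof -
  have w0: "w \<noteq> 0" using assms by auto
  have int: "set_integrable lborel {0<..} (\<lambda>u. exp (- w * of_real u))"
    by (rule set_integrable_bound[OF set_integrable_exp_decay[OF assms]])
       (auto simp: norm_exp_mult_real set_borel_measurable_def simp del: mult_minus_left)
  thus "set_integrable lborel {0<..} (\<lambda>u. exp (- w * of_real u))" .
  have e: "einterval 0 \<infinity> = {0<..}" by (auto simp: einterval_def zero_ereal_def)
  have "(LBINT u=0..\<infinity>. exp (- w * of_real u)) = 0 - (-1/w)"
  proof (rule interval_integral_FTC_integrable[where F = "\<lambda>u. - exp (- w * of_real u) / w"])
    show "((\<lambda>u. - exp (- w * of_real u) / w) has_vector_derivative exp (- w * of_real x)) (at x)" for x :: real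
    proof (rule has_vector_derivative_real_field[where f = "\<lambda>z. - exp (- w * z) / w"])
      show "((\<lambda>z. - exp (- w * z) / w) has_field_derivative exp (- w * of_real x)) (at (of_real x))"
        using w0 by (auto intro!: derivative_eq_intros simp: field_simps)
    qed
    show "isCont (\<lambda>u. exp (- w * of_real u)) x" for x by (intro continuous_intros)
    show "set_integrable lborel (einterval 0 \<infinity>) (\<lambda>u. exp (- w * of_real u))" unfolding e by (rule int)
    have "((\<lambda>u. - exp (- w * of_real u) / w) \<longlongrightarrow> - exp (- w * of_real 0) / w) (at_right 0)"
      by (intro tendsto_intros) (use w0 in auto)
    thus "(((\<lambda>u. - exp (- w * of_real u) / w) \<circ> real_of_ereal) \<longlongrightarrow> -1/w) (at_right 0)"
      by (simp add: ereal_tendsto_simps1 zero_ereal_def)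
    have "((\<lambda>u. exp (- Re w * u) / norm w) \<longlongrightarrow> 0) at_top" using assms w0 by real_asymp
    moreover have "norm (- exp (- w * of_real u) / w) = exp (- Re w * u) / norm w" for u
      using norm_exp_mult_real[of "-w" u] by (simp add: norm_divide)
    ultimately have "((\<lambda>u. norm (- exp (- w * of_real u) / w)) \<longlongrightarrow> 0) at_top" by (simp only:)
    hence "((\<lambda>u. - exp (- w * of_real u) / w) \<longlongrightarrow> 0) at_top" by (rule tendsto_norm_zero_cancel)
    thus "(((\<lambda>u. - exp (- w * of_real u) / w) \<circ> real_of_ereal) \<longlongrightarrow> 0) (at_left \<infinity>)"
      by (simp add: ereal_tendsto_simps1)
  qed auto
  thus "(LINT u:{0<..}|lborel. exp (- w * of_real u)) = 1 / w"
    by (simp add: interval_lebesgue_integral_def e)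
qed

section \<open>Gaussian regularisation of the inverse Laplace transform\<close>

lemma gauss_fourier:
  fixes r y :: real
  assumes r: "r > 0"
  shows "integrable lborel (\<lambda>t. exp (of_real (- (r^2 * t^2) / 2) + \<i> * of_real (t * y)))"
    and "(LINT t|lborel. exp (of_real (- (r^2 * t^2) / 2) + \<i> * of_real (t * y))) =
      of_real (sqrt (2 * pi) / r * exp (- (y^2) / (2 * r^2)))"
proof -
  define f where "f = (\<lambda>x. std_normal_density x *\<^sub>R iexp (y / r * x))"
  have fi: "integrable lborel f"
  proof (rule Bochner_Integration.integrable_bound[OF integrable_normal_density[of 1 0]])
    show "AE x in lborel. norm (f x) \<le> norm (std_normal_density x)" by (auto simp: f_def)
  qed (auto simp: f_def)
  have fv: "(LINT x|lborel. f x) = of_real (exp (- ((y / r)^2) / 2))"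
  proof -
    have "char std_normal_distribution (y / r) = (LINT x|lborel. f x)"
      unfolding char_def f_def by (subst integral_density) auto
    thus ?thesis by (simp add: char_std_normal_distribution)
  qed
  have eq: "exp (of_real (- (r^2 * t^2) / 2) + \<i> * of_real (t * y)) = sqrt (2 * pi) *\<^sub>R f (0 + r * t)" for t
  proof -
    have "f (0 + r * t) = (1 / sqrt (2 * pi) * exp (- (r^2 * t^2) / 2)) *\<^sub>R iexp (t * y)"
      using r by (simp add: f_def std_normal_density_def power_mult_distrib mult_ac)
    thus ?thesis unfolding exp_add exp_of_real by (simp add: scaleR_conv_of_real)
  qed
  have fi': "integrable lborel (\<lambda>t. f (0 + r * t))" using r by (intro lborel_integrable_real_affine[OF fi]) auto
  thus "integrable lborel (\<lambda>t. exp (of_real (- (r^2 * t^2) / 2) + \<i> * of_real (t * y)))"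
    unfolding eq by (rule integrable_scaleR_right)
  have "(LINT x|lborel. f x) = \<bar>r\<bar> *\<^sub>R (LINT t|lborel. f (0 + r * t))"
    using r by (intro lborel_integral_real_affine) auto
  hence "(LINT t|lborel. f (0 + r * t)) = (1 / r) *\<^sub>R of_real (exp (- ((y / r)^2) / 2))"
    using r fv by simp
  thus "(LINT t|lborel. exp (of_real (- (r^2 * t^2) / 2) + \<i> * of_real (t * y))) =
      of_real (sqrt (2 * pi) / r * exp (- (y^2) / (2 * r^2)))"
    unfolding eq integral_scaleR_right by (simp add: scaleR_conv_of_real power_divide)
qed

lemma integrable_pair_bound:
  fixes F :: "real \<times> real \<Rightarrow> complex" and p q :: "real \<Rightarrow> real"
  assumes p: "integrable lborel p" and q: "integrable lborel q"
    and F: "F \<in> borel_measurable (lborel \<Otimes>\<^sub>M lborel)" and b: "\<And>x y. norm (F (x, y)) \<le> p x * q y"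
  shows "integrable (lborel \<Otimes>\<^sub>M lborel) F"
proof (rule Bochner_Integration.integrable_bound)
  show "integrable (lborel \<Otimes>\<^sub>M lborel) (\<lambda>(x, y). p x * q y)"
  proof (rule lborel_pair.Fubini_integrable)
    show "(\<lambda>(x, y). p x * q y) \<in> borel_measurable (lborel \<Otimes>\<^sub>M lborel)"
      using p q by (auto dest!: borel_measurable_integrable intro!: borel_measurable_times measurable_compose[OF measurable_fst] measurable_compose[OF measurable_snd] simp: split_beta')
    show "integrable lborel (\<lambda>x. LINT y|lborel. norm (case (x, y) of (x, y) \<Rightarrow> p x * q y))"
      using p by (simp add: abs_mult)
    show "AE x in lborel. integrable lborel (\<lambda>y. case (x, y) of (x, y) \<Rightarrow> p x * q y)"
      using q by simp
  qed
  show "AE x in lborel \<Otimes>\<^sub>M lborel. norm (F x) \<le> norm (case x of (x, y) \<Rightarrow> p x * q y)"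
    using b by (intro always_eventually allI) (auto intro: order_trans[OF b] abs_ge_self)
qed (rule F)

lemma complex_gauss_exponent:
  fixes b t r x :: real
  shows "of_real (r^2 / 2) * (Complex b t)^2 + Complex b t * of_real x =
    of_real (r^2 * b^2 / 2 + b * x) + (of_real (- (r^2 * t^2) / 2) + \<i> * of_real (t * (r^2 * b + x)))"
  by (simp add: complex_eq_iff power2_eq_square field_simps)

lemma norm_complex_gauss:
  fixes b t r x :: real
  shows "norm (exp (of_real (r^2 / 2) * (Complex b t)^2 + Complex b t * of_real x)) =
    exp (r^2 * b^2 / 2 + b * x) * exp (- (r^2 * t^2) / 2)"
  unfolding complex_gauss_exponent norm_exp_eq_Re by (simp add: exp_add[symmetric])

lemma integrable_gauss:
  fixes r :: real
  assumes "r > 0"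
  shows "integrable lborel (\<lambda>t. exp (- (r^2 * t^2) / 2))"
proof -
  have "integrable lborel (\<lambda>t. norm (exp (of_real (- (r^2 * t^2) / 2) + \<i> * of_real (t * 0))))"
    by (rule integrable_norm[OF gauss_fourier(1)[OF assms]])
  thus ?thesis by (simp add: norm_exp_eq_Re)
qed

text \<open>The abscissa b drops out when the square is completed, as Cauchy's theorem
  predicts.\<close>

lemma gauss_line_integral:
  fixes r x b :: real
  assumes "r > 0"
  shows "(LINT t|lborel. exp (of_real (r^2 / 2) * (Complex b t)^2 + Complex b t * of_real x)) =
     of_real (sqrt (2 * pi) / r * exp (- (x^2) / (2 * r^2)))"
proof -
  have "(LINT t|lborel. exp (of_real (r^2 / 2) * (Complex b t)^2 + Complex b t * of_real x)) =
    exp (of_real (r^2 * b^2 / 2 + b * x)) * of_real (sqrt (2 * pi) / r * exp (- ((r^2 * b + x)^2) / (2 * r^2)))"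
    unfolding complex_gauss_exponent exp_add[of "of_real (r^2 * b^2 / 2 + b * x)"]
    using gauss_fourier(2)[OF assms, of "r^2 * b + x"] by (simp only: integral_mult_right_zero)
  also have "... = of_real (sqrt (2 * pi) / r * (exp (r^2 * b^2 / 2 + b * x) * exp (- ((r^2 * b + x)^2) / (2 * r^2))))"
    unfolding exp_of_real of_real_mult by (simp only: mult_ac)
  also have "exp (r^2 * b^2 / 2 + b * x) * exp (- ((r^2 * b + x)^2) / (2 * r^2)) = exp (- (x^2) / (2 * r^2))"
  proof -
    have "r^2 * b^2 / 2 + b * x + - ((r^2 * b + x)^2) / (2 * r^2) = - (x^2) / (2 * r^2)"
      using assms by (simp add: field_simps power2_eq_square)
    thus ?thesis by (simp only: exp_add[symmetric])
  qed
  finally show ?thesis .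
qed

lemma Complex_conv: "Complex b t = of_real b + \<i> * of_real t"
  by (simp add: complex_eq_iff)

text \<open>Multiplying a Laplace transform by exp (r^2 s^2 / 2) convolves the original with the
  normal density of deviation r. The factor makes the inversion integral absolutely convergent, so
  that Fubini applies; the abscissa b > 2 beats the growth exp (2 v) of \<open>e\<close>.\<close>

lemma gauss_smoothing_formula:
  fixes e :: "real \<Rightarrow> real" and g :: "complex \<Rightarrow> complex" and r u b C :: real
  assumes e[measurable]: "e \<in> borel_measurable borel" and e0: "\<And>v. v \<le> 0 \<Longrightarrow> e v = 0"
    and eb: "\<And>v. \<bar>e v\<bar> \<le> C * exp (2 * v)" and r: "r > 0" and b: "b > 2"
    and g: "\<And>t. g (Complex b t) = (LINT v|lborel. of_real (e v) * exp (- (Complex b t) * of_real v))"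
  shows "integrable lborel (\<lambda>t. g (Complex b t) * exp (of_real (r^2 / 2) * (Complex b t)^2 + Complex b t * of_real u))"
    and "(LINT t|lborel. g (Complex b t) * exp (of_real (r^2 / 2) * (Complex b t)^2 + Complex b t * of_real u)) =
      of_real (2 * pi * (LINT v|lborel. e v * normal_density u r v))"
proof -
  have C: "C \<ge> 0" using eb[of 0] by (simp add: order_trans[OF abs_ge_zero])
  have qi: "integrable lborel (\<lambda>v. \<bar>e v\<bar> * exp (- b * v))"
  proof (rule Bochner_Integration.integrable_bound)
    show "integrable lborel (\<lambda>v. C * (indicator {0<..} v *\<^sub>R exp (- (b - 2) * v)))"
      using set_integrable_exp_decay[of "b - 2"] b by (intro integrable_mult_right) (auto simp: set_integrable_def)
    show "AE v in lborel. norm (\<bar>e v\<bar> * exp (- b * v)) \<le> norm (C * (indicator {0<..} v *\<^sub>R exp (- (b - 2) * v)))"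
    proof (intro always_eventually allI)
      fix v
      show "norm (\<bar>e v\<bar> * exp (- b * v)) \<le> norm (C * (indicator {0<..} v *\<^sub>R exp (- (b - 2) * v)))"
      proof (cases "v \<le> 0")
        case False
        have "\<bar>e v\<bar> * exp (- b * v) \<le> C * exp (2 * v) * exp (- b * v)" using eb by (intro mult_right_mono) auto
        also have "... = C * exp (- (b - 2) * v)" by (simp add: exp_add[symmetric] algebra_simps)
        finally show ?thesis using False C by (simp add: abs_mult)
      qed (simp add: e0)
    qed
  qed auto
  have pi': "integrable lborel (\<lambda>t. exp (r^2 * b^2 / 2 + b * u) * exp (- (r^2 * t^2) / 2))"
    by (intro integrable_mult_right integrable_gauss r)
  define F where "F = (\<lambda>t v. of_real (e v) * exp (- (Complex b t) * of_real v) * exp (of_real (r^2 / 2) * (Complex b t)^2 + Complex b t * of_real u))"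
  have Fm: "(\<lambda>(t, v). F t v) \<in> borel_measurable (lborel \<Otimes>\<^sub>M lborel)"
    unfolding F_def Complex_conv by measurable
  have Fi: "integrable (lborel \<Otimes>\<^sub>M lborel) (\<lambda>(t, v). F t v)"
  proof (rule integrable_pair_bound[OF pi' qi Fm])
    fix t v
    show "norm (case (t, v) of (t, v) \<Rightarrow> F t v) \<le> exp (r^2 * b^2 / 2 + b * u) * exp (- (r^2 * t^2) / 2) * (\<bar>e v\<bar> * exp (- b * v))"
      using norm_exp_mult_real[of "- Complex b t" v] unfolding F_def prod.case norm_mult norm_complex_gauss by simp
  qed
  have inner_t: "(LINT v|lborel. F t v) = g (Complex b t) * exp (of_real (r^2 / 2) * (Complex b t)^2 + Complex b t * of_real u)" for t
    unfolding F_def g by (rule integral_mult_left_zero)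
  show "integrable lborel (\<lambda>t. g (Complex b t) * exp (of_real (r^2 / 2) * (Complex b t)^2 + Complex b t * of_real u))"
    using lborel_pair.integrable_fst[OF Fi] by (simp only: inner_t)
  have inner_v: "(LINT t|lborel. F t v) = of_real (2 * pi * (e v * normal_density u r v))" for v
  proof -
    have "F t v = of_real (e v) * exp (of_real (r^2 / 2) * (Complex b t)^2 + Complex b t * of_real (u - v))" for t
      unfolding F_def by (simp add: exp_add[symmetric] exp_diff algebra_simps)
    hence "(LINT t|lborel. F t v) = of_real (e v) * of_real (sqrt (2 * pi) / r * exp (- ((u - v)^2) / (2 * r^2)))"
      by (simp only: integral_mult_right_zero gauss_line_integral[OF r])
    also have "sqrt (2 * pi) / r * exp (- ((u - v)^2) / (2 * r^2)) = 2 * pi * normal_density u r v"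
    proof -
      have "sqrt (2 * pi) / r = 2 * pi / sqrt (2 * pi * r^2)"
        using r by (simp add: real_sqrt_mult field_simps)
      thus ?thesis by (simp add: normal_density_def power2_commute)
    qed
    finally show ?thesis by (simp add: mult_ac)
  qed
  have "(LINT t|lborel. g (Complex b t) * exp (of_real (r^2 / 2) * (Complex b t)^2 + Complex b t * of_real u))
     = (LINT t|lborel. (LINT v|lborel. F t v))" by (simp only: inner_t)
  also have "... = (LINT v|lborel. (LINT t|lborel. F t v))"
    by (rule lborel_pair.Fubini_integral[OF Fi, symmetric])
  also have "... = of_real (2 * pi * (LINT v|lborel. e v * normal_density u r v))"
    unfolding inner_v by (simp del: of_real_mult)
  finally show "(LINT t|lborel. g (Complex b t) * exp (of_real (r^2 / 2) * (Complex b t)^2 + Complex b t * of_real u)) =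
      of_real (2 * pi * (LINT v|lborel. e v * normal_density u r v))" .
qed

text \<open>Dominated convergence after the substitution v = u + r w. The growth exp (2 v) is
  absorbed by the exponential moments of the normal density, uniformly for r \<le> 1.\<close>

lemma gauss_smoothing_limit:
  fixes e :: "real \<Rightarrow> real" and u :: real
  assumes e[measurable]: "e \<in> borel_measurable borel"
    and eb: "\<And>v. \<bar>e v\<bar> \<le> C * exp (2 * v)" and cont: "isCont e u"
  shows "(\<lambda>n. LINT v|lborel. e v * normal_density u (1 / real (Suc n)) v) \<longlonglongrightarrow> e u"
proof -
  have C: "C \<ge> 0" using eb[of 0] by (simp add: order_trans[OF abs_ge_zero])
  have eq: "(LINT v|lborel. e v * normal_density u (1 / real (Suc n)) v) = (LINT w|lborel. e (u + 1 / real (Suc n) * w) * std_normal_density w)" for n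
  proof -
    define r where "r = 1 / real (Suc n)"
    have r: "r > 0" by (simp add: r_def)
    have "(LINT v|lborel. e v * normal_density u r v) = \<bar>r\<bar> *\<^sub>R (LINT w|lborel. e (u + r * w) * normal_density u r (u + r * w))"
      using r by (intro lborel_integral_real_affine) auto
    also have "... = (LINT w|lborel. r * (e (u + r * w) * normal_density u r (u + r * w)))" using r by simp
    also have "... = (LINT w|lborel. e (u + r * w) * std_normal_density w)"
    proof (rule Bochner_Integration.integral_cong[OF refl])
      fix w
      have "r * normal_density u r (u + r * w) = std_normal_density w"
        using r by (simp add: normal_density_def real_sqrt_mult power_mult_distrib)
      thus "r * (e (u + r * w) * normal_density u r (u + r * w)) = e (u + r * w) * std_normal_density w"
        by (metis mult.left_commute)
    qed
    finally show ?thesis unfolding r_def .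
  qed
  define W where "W = (\<lambda>w. C * exp (2 * u) * ((exp (2 * w) + exp (- 2 * w)) * std_normal_density w))"
  have Wi: "integrable lborel W"
  proof -
    have 1: "exp (k * w) * std_normal_density w = exp (k^2 / 2) * normal_density k 1 w" for k w
    proof -
      have "k * w + - (w^2) / 2 = k^2 / 2 + - ((w - k)^2) / 2" by (simp add: power2_eq_square field_simps)
      hence "exp (k * w) * exp (- (w^2) / 2) = exp (k^2 / 2) * exp (- ((w - k)^2) / 2)" by (simp only: exp_add[symmetric])
      thus ?thesis by (simp add: normal_density_def)
    qed
    have "integrable lborel (\<lambda>w. exp (k * w) * std_normal_density w)" for k
      unfolding 1 by (intro integrable_mult_right integrable_normal_density) auto
    from this[of 2] this[of "-2"] show ?thesis unfolding W_def distrib_right by (intro integrable_mult_right Bochner_Integration.integrable_add)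
  qed
  have "(\<lambda>n. LINT w|lborel. e (u + 1 / real (Suc n) * w) * std_normal_density w) \<longlonglongrightarrow> (LINT w|lborel. e u * std_normal_density w)"
  proof (rule integral_dominated_convergence[OF _ _ Wi])
    show "AE w in lborel. (\<lambda>n. e (u + 1 / real (Suc n) * w) * std_normal_density w) \<longlonglongrightarrow> e u * std_normal_density w"
    proof (intro always_eventually allI tendsto_intros)
      fix w
      have "(\<lambda>n. u + 1 / real (Suc n) * w) \<longlonglongrightarrow> u" by real_asymp
      thus "(\<lambda>n. e (u + 1 / real (Suc n) * w)) \<longlonglongrightarrow> e u" by (rule isCont_tendsto_compose[OF cont])
    qed
    fix n
    show "AE w in lborel. norm (e (u + 1 / real (Suc n) * w) * std_normal_density w) \<le> W w"
    proof (intro always_eventually allI)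
      fix w
      define q where "q = 1 / real (Suc n)"
      have q: "0 < q" "q \<le> 1" by (auto simp: q_def)
      have "q * w \<le> \<bar>w\<bar>" using order_trans[OF mult_left_mono[OF abs_ge_self[of w], of q] mult_right_mono[of q 1 "\<bar>w\<bar>"]] q by simp
      hence "exp (2 * (u + q * w)) \<le> exp (2 * u) * exp (2 * \<bar>w\<bar>)" by (simp add: exp_add[symmetric])
      also have "exp (2 * \<bar>w\<bar>) \<le> exp (2 * w) + exp (- 2 * w)" by (cases "w \<ge> 0") auto
      finally have "exp (2 * (u + q * w)) \<le> exp (2 * u) * (exp (2 * w) + exp (- 2 * w))" by simp
      from mult_left_mono[OF this C] have "\<bar>e (u + q * w)\<bar> \<le> C * (exp (2 * u) * (exp (2 * w) + exp (- 2 * w)))"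
        using eb[of "u + q * w"] by linarith
      from mult_right_mono[OF this, of "std_normal_density w"]
      show "norm (e (u + 1 / real (Suc n) * w) * std_normal_density w) \<le> W w"
        unfolding q_def[symmetric] W_def by (simp add: abs_mult mult_ac)
    qed
  qed auto
  moreover have "(LINT w|lborel. e u * std_normal_density w) = e u" by simp
  ultimately show ?thesis unfolding eq by simp
qed

text \<open>The growth of g is controlled only at the heights T n and - T n, so the rectangles are
  cut there. On the horizontal edges a bound linear in T n loses against the Gaussian
  factor.\<close>

lemma contour_shift_gauss:
  fixes g :: "complex \<Rightarrow> complex" and c0 c b u r K :: real and T :: "nat \<Rightarrow> real"
  defines "F \<equiv> \<lambda>s. g s * exp (of_real (r^2 / 2) * s^2 + s * of_real u)"
  assumes g: "g holomorphic_on {s. Re s > c0}" and c: "c0 < c" "0 < c" "c < b" and r: "r > 0"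
    and T: "filterlim T at_top sequentially"
    and K: "\<And>n \<sigma>. c \<le> \<sigma> \<Longrightarrow> \<sigma> \<le> b \<Longrightarrow> norm (g (Complex \<sigma> (T n))) \<le> K * T n \<and> norm (g (Complex \<sigma> (- T n))) \<le> K * T n"
    and ic: "integrable lborel (\<lambda>t. F (Complex c t))" and ib: "integrable lborel (\<lambda>t. F (Complex b t))"
  shows "(LINT t|lborel. F (Complex c t)) = (LINT t|lborel. F (Complex b t))"
proof -
  have F: "F holomorphic_on {s. Re s > c0}" unfolding F_def by (intro holomorphic_intros g)
  have Fc: "continuous_on {s. Re s > c0} F" using F by (rule holomorphic_on_imp_continuous_on)
  define D where "D = exp (r^2 * b^2 / 2 + b * \<bar>u\<bar>)"
  have Fb: "norm (F (Complex \<sigma> \<tau>)) \<le> K * T n * (D * exp (- (r^2 * (T n)^2) / 2))"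
    if "c \<le> \<sigma>" "\<sigma> \<le> b" "\<tau> = T n \<or> \<tau> = - T n" for \<sigma> \<tau> n
  proof -
    have 1: "norm (g (Complex \<sigma> \<tau>)) \<le> K * T n" using K[OF that(1,2)] that(3) by auto
    hence 2: "K * T n \<ge> 0" using norm_ge_zero order_trans by blast
    have "\<sigma> * u \<le> b * \<bar>u\<bar>"
      using that c by (intro order_trans[OF mult_left_mono[OF abs_ge_self[of u], of \<sigma>] mult_right_mono[of \<sigma> b "\<bar>u\<bar>"]]) auto
    moreover have "r^2 * \<sigma>^2 / 2 \<le> r^2 * b^2 / 2" using that c by (intro divide_right_mono mult_left_mono power_mono) auto
    ultimately have "exp (r^2 * \<sigma>^2 / 2 + \<sigma> * u) \<le> D" unfolding D_def by simp
    moreover have "\<tau>^2 = (T n)^2" using that by auto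
    ultimately have "norm (exp (of_real (r^2 / 2) * (Complex \<sigma> \<tau>)^2 + Complex \<sigma> \<tau> * of_real u)) \<le> D * exp (- (r^2 * (T n)^2) / 2)"
      unfolding norm_complex_gauss by (simp add: mult_right_mono)
    with 1 2 show ?thesis unfolding F_def norm_mult by (intro mult_mono) auto
  qed
  define V where "V = (\<lambda>x n. integral {- T n..T n} (\<lambda>t. F (Complex x t)))"
  have rect: "norm (V b n - V c n) \<le> 2 * (K * T n * (D * exp (- (r^2 * (T n)^2) / 2)) * (b - c))" if Tn: "T n > 0" for n
  proof -
    define a1 where "a1 = Complex c (- T n)"
    define a2 where "a2 = Complex b (- T n)"
    define a3 where "a3 = Complex b (T n)"
    define a4 where "a4 = Complex c (T n)"
    note a_defs = a1_def a2_def a3_def a4_def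
    have rp: "rectpath a1 a3 = linepath a1 a2 +++ linepath a2 a3 +++ linepath a3 a4 +++ linepath a4 a1"
      by (simp add: rectpath_def Let_def a_defs)
    have conv: "convex {s. Re s > c0}" by (rule convex_halfspace_Re_gt)
    have in_: "a1 \<in> {s. Re s > c0}" "a2 \<in> {s. Re s > c0}" "a3 \<in> {s. Re s > c0}" "a4 \<in> {s. Re s > c0}"
      using c by (auto simp: a_defs)
    have segs: "closed_segment x y \<subseteq> {s. Re s > c0}" if "x \<in> {s. Re s > c0}" "y \<in> {s. Re s > c0}" for x y
      using that conv by (rule closed_segment_subset)
    have ci: "F contour_integrable_on linepath x y" if "x \<in> {s. Re s > c0}" "y \<in> {s. Re s > c0}" for x y
      by (rule contour_integrable_continuous_linepath) (rule continuous_on_subset[OF Fc segs[OF that]])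
    have "(F has_contour_integral (contour_integral (linepath a1 a2) F + (contour_integral (linepath a2 a3) F +
        (contour_integral (linepath a3 a4) F + contour_integral (linepath a4 a1) F)))) (rectpath a1 a3)"
      unfolding rp by (intro has_contour_integral_join has_contour_integral_integral ci in_) auto
    moreover have "(F has_contour_integral 0) (rectpath a1 a3)"
    proof (rule Cauchy_theorem_convex_simple[OF F conv])
      show "path_image (rectpath a1 a3) \<subseteq> {s. Re s > c0}"
        unfolding rp using segs in_ by (auto simp: path_image_join)
    qed auto
    ultimately have z: "contour_integral (linepath a1 a2) F + (contour_integral (linepath a2 a3) F +
        (contour_integral (linepath a3 a4) F + contour_integral (linepath a4 a1) F)) = 0"
      using has_contour_integral_unique by blast
    have i2: "contour_integral (linepath a2 a3) F = \<i> * V b n"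
      unfolding V_def using Tn by (intro contour_integral_linepath_same_Re) (auto simp: a_defs)
    have "contour_integral (linepath a1 a4) F = \<i> * V c n"
      unfolding V_def using Tn by (intro contour_integral_linepath_same_Re) (auto simp: a_defs)
    moreover have "contour_integral (linepath a1 a4) F = - contour_integral (linepath a4 a1) F"
      by (rule contour_integral_reverse_linepath) (rule continuous_on_subset[OF Fc segs[OF in_(1) in_(4)]])
    ultimately have i4: "contour_integral (linepath a4 a1) F = - (\<i> * V c n)" by (metis minus_minus)
    define B where "B = K * T n * (D * exp (- (r^2 * (T n)^2) / 2))"
    have B0: "B \<ge> 0" using Fb[of c "T n" n] c norm_ge_zero order_trans unfolding B_def by (meson less_imp_le order_refl)
    have seg_im: "c \<le> Re x \<and> Re x \<le> b \<and> Im x = \<tau>" if "x \<in> closed_segment (Complex c \<tau>) (Complex b \<tau>)" for x \<tau>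
    proof -
      obtain q where q: "0 \<le> q" "q \<le> 1" "x = (1 - q) *\<^sub>R Complex c \<tau> + q *\<^sub>R Complex b \<tau>"
        using \<open>x \<in> closed_segment _ _\<close> by (auto simp: in_segment)
      have 1: "Re x = c + q * (b - c)" "Im x = \<tau>" unfolding q(3) by (simp_all add: algebra_simps)
      have 2: "q * (b - c) \<le> b - c" using q c by (intro mult_left_le_one_le) auto
      have 3: "0 \<le> q * (b - c)" using q c by simp
      show ?thesis unfolding 1 using 2 3 by (intro conjI; (rule refl | linarith))
    qed
    have "norm (contour_integral (linepath a1 a2) F) \<le> B * norm (a2 - a1)"
    proof (rule contour_integral_bound_linepath[OF ci[OF in_(1,2)] B0])
      fix x assume "x \<in> closed_segment a1 a2"
      from seg_im[OF this[unfolded a_defs]] have "norm (F (Complex (Re x) (Im x))) \<le> B"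
        unfolding B_def by (intro Fb) auto
      thus "norm (F x) \<le> B" by simp
    qed
    moreover have "norm (contour_integral (linepath a3 a4) F) \<le> B * norm (a4 - a3)"
    proof (rule contour_integral_bound_linepath[OF ci[OF in_(3,4)] B0])
      fix x assume "x \<in> closed_segment a3 a4"
      hence "x \<in> closed_segment (Complex c (T n)) (Complex b (T n))" by (simp add: a_defs closed_segment_commute)
      from seg_im[OF this] have "norm (F (Complex (Re x) (Im x))) \<le> B"
        unfolding B_def by (intro Fb) auto
      thus "norm (F x) \<le> B" by simp
    qed
    moreover have "norm (a2 - a1) = b - c" "norm (a4 - a3) = b - c"
      using c by (simp_all add: a_defs cmod_def)
    moreover have "\<i> * (V b n - V c n) = - contour_integral (linepath a1 a2) F - contour_integral (linepath a3 a4) F"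
      using z unfolding i2 i4 by (simp add: algebra_simps add_eq_0_iff)
    hence "norm (V b n - V c n) = norm (- contour_integral (linepath a1 a2) F - contour_integral (linepath a3 a4) F)"
      by (metis norm_ii norm_mult mult_1)
    moreover have "norm (- contour_integral (linepath a1 a2) F - contour_integral (linepath a3 a4) F)
      \<le> norm (contour_integral (linepath a1 a2) F) + norm (contour_integral (linepath a3 a4) F)"
      by (metis norm_minus_cancel norm_triangle_ineq4)
    ultimately have "norm (V b n - V c n) \<le> 2 * (B * (b - c))" by simp
    thus ?thesis by (simp add: B_def)
  qed
  have "(\<lambda>n. 2 * (K * T n * (D * exp (- (r^2 * (T n)^2) / 2)) * (b - c))) \<longlonglongrightarrow> 0"
  proof -
    have "((\<lambda>x. x * exp (- (r^2 * x^2) / 2)) \<longlongrightarrow> 0) at_top" using r by real_asymp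
    from tendsto_mult_left[OF this, of "2 * K * D * (b - c)"]
    have "((\<lambda>x. 2 * (K * x * (D * exp (- (r^2 * x^2) / 2)) * (b - c))) \<longlongrightarrow> 0) at_top" by (simp only: mult_ac mult_zero_right mult_zero_left)
    thus ?thesis by (rule filterlim_compose[OF _ T])
  qed
  moreover have "eventually (\<lambda>n. norm (V b n - V c n) \<le> 2 * (K * T n * (D * exp (- (r^2 * (T n)^2) / 2)) * (b - c))) sequentially"
    using filterlim_at_top_dense[THEN iffD1, OF T, rule_format, of 0] by eventually_elim (rule rect)
  ultimately have lim0: "(\<lambda>n. V b n - V c n) \<longlonglongrightarrow> 0" by (rule Lim_null_comparison[rotated])
  have lim: "(\<lambda>n. V x n) \<longlonglongrightarrow> (LINT t|lborel. F (Complex x t))" if i: "integrable lborel (\<lambda>t. F (Complex x t))" for x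
  proof -
    have eq: "V x n = (LINT t|lborel. indicator {- T n..T n} t *\<^sub>R F (Complex x t))" for n
    proof -
      have "set_integrable lborel {- T n..T n} (\<lambda>t. F (Complex x t))"
        unfolding set_integrable_def by (rule integrable_mult_indicator[OF _ i]) auto
      thus ?thesis unfolding V_def by (subst set_borel_integral_eq_integral(2)[symmetric]) (auto simp: set_lebesgue_integral_def)
    qed
    have "(\<lambda>n. LINT t|lborel. indicator {- T n..T n} t *\<^sub>R F (Complex x t)) \<longlonglongrightarrow> (LINT t|lborel. F (Complex x t))"
    proof (rule integral_dominated_convergence)
      show "integrable lborel (\<lambda>t. norm (F (Complex x t)))" using i by (rule integrable_norm)
      show m: "(\<lambda>t. F (Complex x t)) \<in> borel_measurable lborel" using i by (rule borel_measurable_integrable)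
      show "(\<lambda>t. indicator {- T n..T n} t *\<^sub>R F (Complex x t)) \<in> borel_measurable lborel" for n
        using m by measurable
      show "AE t in lborel. (\<lambda>n. indicator {- T n..T n} t *\<^sub>R F (Complex x t)) \<longlonglongrightarrow> F (Complex x t)"
      proof (rule always_eventually, rule allI, rule tendsto_eventually)
        fix t
        have "eventually (\<lambda>n. T n > \<bar>t\<bar>) sequentially" using filterlim_at_top_dense[THEN iffD1, OF T] by blast
        moreover have "indicator {- T n..T n} t *\<^sub>R F (Complex x t) = F (Complex x t)" if "T n > \<bar>t\<bar>" for n
        proof -
          have "t \<in> {- T n..T n}" using that by auto
          thus ?thesis by simp
        qed
        ultimately show "eventually (\<lambda>n. indicator {- T n..T n} t *\<^sub>R F (Complex x t) = F (Complex x t)) sequentially"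
          by (rule eventually_mono)
      qed
    qed (auto simp: indicator_def)
    thus ?thesis by (simp only: eq)
  qed
  from tendsto_diff[OF lim[OF ib] lim[OF ic]] lim0 have "(LINT t|lborel. F (Complex b t)) - (LINT t|lborel. F (Complex c t)) = 0"
    by (rule LIMSEQ_unique)
  thus ?thesis by simp
qed

section \<open>The Poisson kernel and a Plancherel inequality\<close>

lemma fourier_exp_abs:
  fixes k s :: real
  assumes k: "k > 0"
  shows "integrable lborel (\<lambda>u. exp (- k * \<bar>u\<bar>))"
    and "(LINT u|lborel. of_real (exp (- k * \<bar>u\<bar>)) * exp (\<i> * of_real (s * u))) = of_real (2 * k / (k^2 + s^2))"
proof -
  define A where "A = (\<lambda>w u. indicator {0<..} u *\<^sub>R exp (- w * of_real u) :: complex)"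
  have Ai: "integrable lborel (A w)" "(LINT u|lborel. A w u) = 1 / w" if "Re w > 0" for w
    using laplace_exp[OF that] by (auto simp: set_integrable_def set_lebesgue_integral_def A_def)
  have Ai': "integrable lborel (\<lambda>u. A w (0 + -1 * u))" "(LINT u|lborel. A w (0 + -1 * u)) = 1 / w" if "Re w > 0" for w
    using lborel_integrable_real_affine[OF Ai(1)[OF that], of "-1" 0] lborel_integral_real_affine[of "-1" "A w" 0] Ai(2)[OF that] by auto
  have ae: "AE u in lborel. of_real (exp (- k * \<bar>u\<bar>)) * exp (\<i> * of_real (s * u)) = A (Complex k (-s)) u + A (Complex k s) (0 + -1 * u)" for s
  proof -
    have "AE u in lborel. u \<noteq> (0::real)" by (rule AE_lborel_singleton)
    thus ?thesis
    proof eventually_elim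
      case (elim u)
      have "of_real (exp (- k * \<bar>u\<bar>)) * exp (\<i> * of_real (s * u)) = exp (of_real (- k * \<bar>u\<bar>) + \<i> * of_real (s * u))"
        unfolding exp_add exp_of_real ..
      also have "of_real (- k * \<bar>u\<bar>) + \<i> * of_real (s * u) = (if u > 0 then - Complex k (-s) * of_real u else - Complex k s * of_real (- u))"
        by (auto simp: complex_eq_iff)
      finally show ?case using elim by (auto simp: A_def)
    qed
  qed
  have i: "integrable lborel (\<lambda>u. A (Complex k (-s)) u + A (Complex k s) (0 + -1 * u))" for s
    using Ai(1)[of "Complex k (-s)"] Ai'(1)[of "Complex k s"] k by (intro Bochner_Integration.integrable_add) auto
  have "integrable lborel (\<lambda>u. of_real (exp (- k * \<bar>u\<bar>)) * exp (\<i> * of_real (0 * u)))"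
    using i[of 0] by (subst integrable_cong_AE[OF _ _ ae]) auto
  hence "integrable lborel (\<lambda>u. norm (of_real (exp (- k * \<bar>u\<bar>)) * exp (\<i> * of_real (0 * u)) :: complex))" by (rule integrable_norm)
  thus "integrable lborel (\<lambda>u. exp (- k * \<bar>u\<bar>))" by simp
  have "(LINT u|lborel. of_real (exp (- k * \<bar>u\<bar>)) * exp (\<i> * of_real (s * u))) = (LINT u|lborel. A (Complex k (-s)) u + A (Complex k s) (0 + -1 * u))"
    using i[of s] by (intro integral_cong_AE ae) auto
  also have "... = 1 / Complex k (-s) + 1 / Complex k s"
    using Ai[of "Complex k (-s)"] Ai'[of "Complex k s"] k by (subst Bochner_Integration.integral_add) auto
  also have "... = of_real (2 * k / (k^2 + s^2))"
  proof -
    have "k^2 + s^2 \<noteq> 0" using k by (metis add_pos_nonneg less_irrefl zero_le_power2 zero_less_power)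
    thus ?thesis using k by (simp add: complex_eq_iff Re_divide Im_divide add_divide_distrib[symmetric] power2_eq_square[of "k^2 + s^2"])
  qed
  finally show "(LINT u|lborel. of_real (exp (- k * \<bar>u\<bar>)) * exp (\<i> * of_real (s * u))) = of_real (2 * k / (k^2 + s^2))" .
qed

lemma nn_integral_poisson:
  fixes k :: real
  assumes k: "k > 0"
  shows "(\<integral>\<^sup>+ s. ennreal (2 * k / (k^2 + (t - s)^2)) \<partial>lborel) = ennreal (2 * pi)"
proof -
  have nz: "k^2 + s^2 > 0" for s :: real using k by (simp add: add_pos_nonneg)
  have e: "einterval (-\<infinity>) \<infinity> = UNIV" by (auto simp: einterval_def)
  have *: "set_integrable lborel (einterval (-\<infinity>) \<infinity>) (\<lambda>s. 2 * k / (k^2 + s^2))"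
    "(LBINT s=-\<infinity>..\<infinity>. 2 * k / (k^2 + s^2)) = pi - (- pi)"
  proof (rule_tac [!] interval_integral_FTC_nonneg[where F = "\<lambda>s. 2 * arctan (s / k)" and A = "-pi" and B = pi])
    show "DERIV (\<lambda>s. 2 * arctan (s / k)) x :> 2 * k / (k^2 + x^2)" for x
      using k nz[of x] by (auto intro!: derivative_eq_intros simp: field_simps power2_eq_square)
    thus "DERIV (\<lambda>s. 2 * arctan (s / k)) x :> 2 * k / (k^2 + x^2)" for x .
    show "isCont (\<lambda>s. 2 * k / (k^2 + s^2)) x" for x using nz[of x] by (intro continuous_intros) auto
    thus "isCont (\<lambda>s. 2 * k / (k^2 + s^2)) x" for x .
    have "((\<lambda>s. 2 * arctan (s / k)) \<longlongrightarrow> - pi) at_bot" using k by real_asymp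
    thus 1: "(((\<lambda>s. 2 * arctan (s / k)) \<circ> real_of_ereal) \<longlongrightarrow> - pi) (at_right (-\<infinity>))"
      by (simp add: ereal_tendsto_simps1)
    thus "(((\<lambda>s. 2 * arctan (s / k)) \<circ> real_of_ereal) \<longlongrightarrow> - pi) (at_right (-\<infinity>))" .
    have "((\<lambda>s. 2 * arctan (s / k)) \<longlongrightarrow> pi) at_top" using k by real_asymp
    thus "(((\<lambda>s. 2 * arctan (s / k)) \<circ> real_of_ereal) \<longlongrightarrow> pi) (at_left \<infinity>)"
      by (simp add: ereal_tendsto_simps1)
    thus "(((\<lambda>s. 2 * arctan (s / k)) \<circ> real_of_ereal) \<longlongrightarrow> pi) (at_left \<infinity>)" .
  qed (use k in \<open>auto intro!: divide_nonneg_nonneg add_nonneg_nonneg\<close>)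
  have "(\<integral>\<^sup>+ s. ennreal (2 * k / (k^2 + s^2)) \<partial>lborel) = ennreal (LINT s|lborel. 2 * k / (k^2 + s^2))"
    using *(1) k by (intro nn_integral_eq_integral) (auto simp: set_integrable_def e intro!: divide_nonneg_nonneg add_nonneg_nonneg)
  also have "(LINT s|lborel. 2 * k / (k^2 + s^2)) = 2 * pi"
    using *(2) by (simp add: interval_lebesgue_integral_def e set_lebesgue_integral_def)
  finally have p: "(\<integral>\<^sup>+ s. ennreal (2 * k / (k^2 + s^2)) \<partial>lborel) = ennreal (2 * pi)" .
  show ?thesis
    using nn_integral_real_affine[of "\<lambda>s. ennreal (2 * k / (k^2 + s^2))" "-1" t] p by simp
qed

text \<open>One half of Plancherel's theorem. The weight exp (- k |u|) makes all integrals
  absolutely convergent; expanding |H|^2 turns it into the Poisson kernel, of mass 2 pi, and |h t|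
  |h t'| \<le> (|h t|^2 + |h t'|^2) / 2 then separates the variables. The bound is uniform in
  k.\<close>

lemma weighted_fourier_L2_bound:
  fixes h :: "real \<Rightarrow> complex" and k :: real
  defines "H \<equiv> \<lambda>u. LINT t|lborel. h t * exp (\<i> * of_real (t * u))"
  assumes h: "integrable lborel h" and h2: "integrable lborel (\<lambda>t. (norm (h t))^2)" and k: "k > 0"
  shows "(\<integral>\<^sup>+ u. ennreal ((norm (H u))^2 * exp (- k * \<bar>u\<bar>)) \<partial>lborel) \<le> ennreal (2 * pi * (LINT t|lborel. (norm (h t))^2))"
proof -
  have hm[measurable]: "h \<in> borel_measurable borel" using borel_measurable_integrable[OF h] by simp
  have [measurable]: "cnj \<in> borel_measurable borel" by (intro borel_measurable_continuous_onI continuous_intros)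
  define W where "W = (\<lambda>u::real. exp (- k * \<bar>u\<bar>))"
  define P where "P = (\<lambda>s::real. 2 * k / (k^2 + s^2))"
  have P0: "P s \<ge> 0" for s using k by (auto simp: P_def intro!: divide_nonneg_nonneg add_nonneg_nonneg)
  have [measurable]: "W \<in> borel_measurable borel" "P \<in> borel_measurable borel" by (auto simp: W_def P_def)
  have Wi: "integrable lborel W" unfolding W_def by (rule fourier_exp_abs(1)[OF k])
  define N where "N = (LINT t|lborel. norm (h t))"
  have HN: "norm (H u) \<le> N" for u
    unfolding H_def N_def using integral_norm_bound[of lborel "\<lambda>t. h t * exp (\<i> * of_real (t * u))"] by (simp add: norm_mult)
  have N0: "N \<ge> 0" using HN[of 0] norm_ge_zero order_trans by blast
  have Hm[measurable]: "H \<in> borel_measurable borel"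
  proof -
    have "(\<lambda>u. LINT t|lborel. h t * exp (\<i> * of_real (t * u))) \<in> borel_measurable lborel"
      by (rule lborel.borel_measurable_lebesgue_integral) measurable
    thus ?thesis by (simp add: H_def)
  qed
  have Hcnj: "cnj (H u) = (LINT t|lborel. cnj (h t) * exp (- (\<i> * of_real (t * u))))" for u
    unfolding H_def by (subst Bochner_Integration.integral_cnj[symmetric]) (simp add: exp_cnj)
  define K where "K = (\<lambda>t. LINT u|lborel. of_real (W u) * cnj (H u) * exp (\<i> * of_real (t * u)))"
  have Keq: "K t = (LINT t'|lborel. cnj (h t') * of_real (P (t - t')))" for t
  proof -
    define F where "F = (\<lambda>u t'. of_real (W u) * exp (\<i> * of_real (t * u)) * (cnj (h t') * exp (- (\<i> * of_real (t' * u)))))"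
    have Fi: "integrable (lborel \<Otimes>\<^sub>M lborel) (\<lambda>(u, t'). F u t')"
    proof (rule integrable_pair_bound[OF Wi integrable_norm[OF h]])
      show "(\<lambda>(u, t'). F u t') \<in> borel_measurable (lborel \<Otimes>\<^sub>M lborel)" unfolding F_def by measurable
      show "norm (case (u, t') of (u, t') \<Rightarrow> F u t') \<le> W u * norm (h t')" for u t'
        by (simp add: F_def norm_mult norm_exp_eq_Re W_def)
    qed
    have "(LINT t'|lborel. F u t') = of_real (W u) * exp (\<i> * of_real (t * u)) * cnj (H u)" for u
      unfolding F_def Hcnj by (rule integral_mult_right_zero)
    hence "K t = (LINT u|lborel. (LINT t'|lborel. F u t'))"
      unfolding K_def by (simp only: mult_ac)
    also have "... = (LINT t'|lborel. (LINT u|lborel. F u t'))"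
      by (rule lborel_pair.Fubini_integral[OF Fi, symmetric])
    also have "(\<lambda>t'. LINT u|lborel. F u t') = (\<lambda>t'. cnj (h t') * of_real (P (t - t')))"
    proof
      fix t'
      have "F u t' = cnj (h t') * (of_real (exp (- k * \<bar>u\<bar>)) * exp (\<i> * of_real ((t - t') * u)))" for u
      proof -
        have "exp (\<i> * of_real (t * u)) * exp (- (\<i> * of_real (t' * u))) = exp (\<i> * of_real ((t - t') * u))"
          unfolding exp_add[symmetric] by (simp add: algebra_simps)
        thus ?thesis unfolding F_def W_def by (metis mult.assoc mult.left_commute)
      qed
      thus "(LINT u|lborel. F u t') = cnj (h t') * of_real (P (t - t'))"
        by (simp only: integral_mult_right_zero fourier_exp_abs(2)[OF k] P_def)
    qed
    finally show ?thesis .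
  qed
  define F where "F = (\<lambda>u t. of_real (W u) * cnj (H u) * (h t * exp (\<i> * of_real (t * u))))"
  have Fi: "integrable (lborel \<Otimes>\<^sub>M lborel) (\<lambda>(u, t). F u t)"
  proof (rule integrable_pair_bound)
    show "integrable lborel (\<lambda>u. N * W u)" by (intro integrable_mult_right Wi)
    show "integrable lborel (\<lambda>t. norm (h t))" by (rule integrable_norm[OF h])
    show "(\<lambda>(u, t). F u t) \<in> borel_measurable (lborel \<Otimes>\<^sub>M lborel)" unfolding F_def by measurable
    fix u t
    have "norm (F u t) = W u * norm (H u) * norm (h t)" by (simp add: F_def norm_mult norm_exp_eq_Re W_def)
    also have "... \<le> W u * N * norm (h t)" using HN by (intro mult_right_mono mult_left_mono) (auto simp: W_def)
    finally show "norm (case (u, t) of (u, t) \<Rightarrow> F u t) \<le> N * W u * norm (h t)" by (simp add: mult_ac)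
  qed
  have in_u: "(LINT t|lborel. F u t) = of_real ((norm (H u))^2 * W u)" for u
  proof -
    have "(LINT t|lborel. F u t) = of_real (W u) * cnj (H u) * H u"
      unfolding F_def H_def by (rule integral_mult_right_zero)
    also have "... = of_real ((norm (H u))^2 * W u)" using complex_norm_square[of "H u"] by (simp add: mult_ac)
    finally show ?thesis .
  qed
  have in_t: "(LINT u|lborel. F u t) = h t * K t" for t
  proof -
    have "F u t = h t * (of_real (W u) * cnj (H u) * exp (\<i> * of_real (t * u)))" for u by (simp add: F_def mult_ac)
    thus ?thesis unfolding K_def by (simp only: integral_mult_right_zero)
  qed
  have hK: "integrable lborel (\<lambda>t. h t * K t)" using lborel_pair.integrable_snd[OF Fi] by (simp only: in_t)
  have iX: "integrable lborel (\<lambda>u. (norm (H u))^2 * W u)"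
    using integrable_Re[OF lborel_pair.integrable_fst[OF Fi]] by (simp only: in_u Re_complex_of_real)
  define X where "X = (LINT u|lborel. (norm (H u))^2 * W u)"
  have "(\<integral>\<^sup>+ u. ennreal ((norm (H u))^2 * W u) \<partial>lborel) = ennreal X"
    unfolding X_def by (rule nn_integral_eq_integral[OF iX]) (auto simp: W_def)
  also have "of_real X = (LINT t|lborel. h t * K t)"
    using lborel_pair.Fubini_integral[OF Fi] by (simp only: in_u in_t X_def integral_complex_of_real)
  hence "ennreal X \<le> ennreal (norm (LINT t|lborel. h t * K t))"
    by (metis abs_ge_self ennreal_leI norm_of_real)
  also have "... \<le> (\<integral>\<^sup>+ t. ennreal (norm (h t * K t)) \<partial>lborel)"
    by (rule integral_norm_bound_ennreal[OF hK])
  also have "... \<le> (\<integral>\<^sup>+ t. (\<integral>\<^sup>+ t'. ennreal ((norm (h t))^2 / 2 * P (t - t')) + ennreal ((norm (h t'))^2 / 2 * P (t - t')) \<partial>lborel) \<partial>lborel)"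
  proof (rule nn_integral_mono)
    fix t
    have iK: "ennreal (norm (K t)) \<le> (\<integral>\<^sup>+ t'. ennreal (norm (h t') * P (t - t')) \<partial>lborel)"
    proof -
      have "ennreal (norm (K t)) \<le> (\<integral>\<^sup>+ t'. ennreal (norm (cnj (h t') * of_real (P (t - t')))) \<partial>lborel)"
        unfolding Keq
      proof (rule integral_norm_bound_ennreal)
        have "P s \<le> 2 / k" for s
        proof -
          have "P s \<le> 2 * k / k^2" unfolding P_def using k by (intro divide_left_mono mult_pos_pos add_pos_nonneg) auto
          thus ?thesis using k by (simp add: power2_eq_square)
        qed
        hence "norm (cnj (h t') * of_real (P (t - t'))) \<le> norm (2 / k * norm (h t'))" for t'
          using P0[of "t - t'"] k mult_right_mono[of "P (t - t')" "2 / k" "norm (h t')"] by (simp add: norm_mult abs_mult mult.commute)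
        thus "integrable lborel (\<lambda>t'. cnj (h t') * of_real (P (t - t')))"
          by (intro Bochner_Integration.integrable_bound[OF integrable_mult_right[OF integrable_norm[OF h], of "2 / k"]] always_eventually allI) auto
      qed
      thus ?thesis using P0 by (simp add: norm_mult)
    qed
    have "ennreal (norm (h t * K t)) = ennreal (norm (h t)) * ennreal (norm (K t))" by (simp add: norm_mult ennreal_mult)
    also have "... \<le> ennreal (norm (h t)) * (\<integral>\<^sup>+ t'. ennreal (norm (h t') * P (t - t')) \<partial>lborel)"
      by (intro mult_left_mono iK) auto
    also have "... = (\<integral>\<^sup>+ t'. ennreal (norm (h t)) * ennreal (norm (h t') * P (t - t')) \<partial>lborel)"
      by (rule nn_integral_cmult[symmetric]) measurable
    also have "... \<le> (\<integral>\<^sup>+ t'. ennreal ((norm (h t))^2 / 2 * P (t - t')) + ennreal ((norm (h t'))^2 / 2 * P (t - t')) \<partial>lborel)"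
    proof (rule nn_integral_mono)
      fix t'
      have "norm (h t) * norm (h t') \<le> (norm (h t))^2 / 2 + (norm (h t'))^2 / 2"
        using sum_squares_bound[of "norm (h t)" "norm (h t')"] by simp
      hence "norm (h t) * norm (h t') * P (t - t') \<le> ((norm (h t))^2 / 2 + (norm (h t'))^2 / 2) * P (t - t')"
        by (intro mult_right_mono P0)
      hence "ennreal (norm (h t) * (norm (h t') * P (t - t'))) \<le> ennreal ((norm (h t))^2 / 2 * P (t - t') + (norm (h t'))^2 / 2 * P (t - t'))"
        by (intro ennreal_leI) (simp only: distrib_right mult.assoc)
      thus "ennreal (norm (h t)) * ennreal (norm (h t') * P (t - t')) \<le> ennreal ((norm (h t))^2 / 2 * P (t - t')) + ennreal ((norm (h t'))^2 / 2 * P (t - t'))"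
        using P0 by (subst (asm) ennreal_mult', simp, subst (asm) ennreal_plus) auto
    qed
    finally show "ennreal (norm (h t * K t)) \<le> (\<integral>\<^sup>+ t'. ennreal ((norm (h t))^2 / 2 * P (t - t')) + ennreal ((norm (h t'))^2 / 2 * P (t - t')) \<partial>lborel)" .
  qed
  also have "... = (\<integral>\<^sup>+ t. (\<integral>\<^sup>+ t'. ennreal ((norm (h t))^2 / 2 * P (t - t')) \<partial>lborel) \<partial>lborel) + (\<integral>\<^sup>+ t. (\<integral>\<^sup>+ t'. ennreal ((norm (h t'))^2 / 2 * P (t - t')) \<partial>lborel) \<partial>lborel)"
    by (subst nn_integral_add[symmetric]) (auto intro!: nn_integral_cong nn_integral_add)
  also have "(\<integral>\<^sup>+ t. (\<integral>\<^sup>+ t'. ennreal ((norm (h t'))^2 / 2 * P (t - t')) \<partial>lborel) \<partial>lborel) = (\<integral>\<^sup>+ t. (\<integral>\<^sup>+ t'. ennreal ((norm (h t))^2 / 2 * P (t' - t)) \<partial>lborel) \<partial>lborel)"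
    by (rule lborel_pair.Fubini') measurable
  also have "(\<lambda>t t'. ennreal ((norm (h t))^2 / 2 * P (t' - t))) = (\<lambda>t t'. ennreal ((norm (h t))^2 / 2 * P (t - t')))"
    by (simp add: P_def power2_commute)
  also have "(\<integral>\<^sup>+ t. (\<integral>\<^sup>+ t'. ennreal ((norm (h t))^2 / 2 * P (t - t')) \<partial>lborel) \<partial>lborel) = (\<integral>\<^sup>+ t. ennreal ((norm (h t))^2 / 2) * ennreal (2 * pi) \<partial>lborel)"
  proof (rule nn_integral_cong)
    fix t
    have "(\<integral>\<^sup>+ t'. ennreal ((norm (h t))^2 / 2 * P (t - t')) \<partial>lborel) = ennreal ((norm (h t))^2 / 2) * (\<integral>\<^sup>+ t'. ennreal (P (t - t')) \<partial>lborel)"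
    proof -
      have "ennreal ((norm (h t))^2 / 2 * P (t - t')) = ennreal ((norm (h t))^2 / 2) * ennreal (P (t - t'))" for t'
        by (rule ennreal_mult) (auto simp: P0)
      thus ?thesis by (simp only:) (rule nn_integral_cmult, measurable)
    qed
    also have "(\<integral>\<^sup>+ t'. ennreal (P (t - t')) \<partial>lborel) = ennreal (2 * pi)" unfolding P_def by (rule nn_integral_poisson[OF k])
    finally show "(\<integral>\<^sup>+ t'. ennreal ((norm (h t))^2 / 2 * P (t - t')) \<partial>lborel) = ennreal ((norm (h t))^2 / 2) * ennreal (2 * pi)" .
  qed
  also have "(\<integral>\<^sup>+ t. ennreal ((norm (h t))^2 / 2) * ennreal (2 * pi) \<partial>lborel) = ennreal (pi * (LINT t|lborel. (norm (h t))^2))"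
  proof -
    have "(\<integral>\<^sup>+ t. ennreal ((norm (h t))^2 / 2) * ennreal (2 * pi) \<partial>lborel) = (\<integral>\<^sup>+ t. ennreal (pi * (norm (h t))^2) \<partial>lborel)"
      by (intro nn_integral_cong) (simp add: ennreal_mult''[symmetric] mult_ac)
    also have "... = ennreal (LINT t|lborel. pi * (norm (h t))^2)"
      by (intro nn_integral_eq_integral integrable_mult_right h2) auto
    finally show ?thesis by simp
  qed
  also have "ennreal (pi * (LINT t|lborel. (norm (h t))^2)) + ennreal (pi * (LINT t|lborel. (norm (h t))^2)) = ennreal (2 * pi * (LINT t|lborel. (norm (h t))^2))"
    by (subst ennreal_plus[symmetric]) (auto simp: algebra_simps)
  finally show ?thesis unfolding W_def by (simp add: mult_ac)
qed

text \<open>For each r the smoothed function is, after moving the contour to Re s = c, exp (c u)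
  times a Fourier integral of g along that line. Its weighted square integral is bounded
  independently of r, and Fatou's lemma removes the smoothing.\<close>

lemma laplace_L2_continuation:
  fixes e :: "real \<Rightarrow> real" and g :: "complex \<Rightarrow> complex" and c0 c b K C :: real and T :: "nat \<Rightarrow> real"
  assumes e[measurable]: "e \<in> borel_measurable borel" and e0: "\<And>v. v \<le> 0 \<Longrightarrow> e v = 0"
    and eb: "\<And>v. \<bar>e v\<bar> \<le> C * exp (2 * v)" and cont: "AE v in lborel. isCont e v"
    and b: "b > 2" and c: "c0 < c" "0 < c" "c < b"
    and g: "\<And>t. g (Complex b t) = (LINT v|lborel. of_real (e v) * exp (- (Complex b t) * of_real v))"
    and hol: "g holomorphic_on {s. Re s > c0}"
    and T: "filterlim T at_top sequentially"
    and K: "\<And>n \<sigma>. c \<le> \<sigma> \<Longrightarrow> \<sigma> \<le> b \<Longrightarrow> norm (g (Complex \<sigma> (T n))) \<le> K * T n \<and> norm (g (Complex \<sigma> (- T n))) \<le> K * T n"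
    and L2: "integrable lborel (\<lambda>t. (norm (g (Complex c t)))^2)"
  shows "(\<integral>\<^sup>+ v. ennreal ((e v)^2 * exp (- 2 * c * v)) \<partial>lborel) \<le>
     ennreal (exp (c^2) / (2 * pi) * (LINT t|lborel. (norm (g (Complex c t)))^2))"
proof -
  define G2 where "G2 = (LINT t|lborel. (norm (g (Complex c t)))^2)"
  define q where "q = (\<lambda>n u. LINT v|lborel. e v * normal_density u (1 / real (Suc n)) v)"
  have qm[measurable]: "q n \<in> borel_measurable borel" for n
  proof -
    have "(\<lambda>u. LINT v|lborel. e v * normal_density u (1 / real (Suc n)) v) \<in> borel_measurable lborel"
      unfolding normal_density_def by (rule lborel.borel_measurable_lebesgue_integral) measurable
    thus ?thesis by (simp add: q_def)
  qed
  have gm[measurable]: "(\<lambda>t. g (Complex c t)) \<in> borel_measurable borel"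
  proof (rule borel_measurable_continuous_onI)
    show "continuous_on UNIV (\<lambda>t. g (Complex c t))" unfolding Complex_conv
      by (rule continuous_on_compose2[OF holomorphic_on_imp_continuous_on[OF hol]]) (use c in \<open>auto intro!: continuous_intros\<close>)
  qed
  \<comment> \<open>The same r serves as deviation of the smoothing and as parameter k of the weight
    exp (- k |u|); both disappear together in the limit.\<close>
  have bound: "(\<integral>\<^sup>+ u. ennreal ((q n u)^2 * exp (- 2 * c * u) * exp (- (1 / real (Suc n)) * \<bar>u\<bar>)) \<partial>lborel) \<le> ennreal (exp (c^2) / (2 * pi) * G2)" for n
  proof -
    define r where "r = 1 / real (Suc n)"
    have r: "r > 0" "r \<le> 1" by (auto simp: r_def)
    define h where "h = (\<lambda>t. g (Complex c t) * exp (of_real (r^2 / 2) * (Complex c t)^2))"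
    have hm[measurable]: "h \<in> borel_measurable borel" unfolding h_def by (measurable, simp only: Complex_conv, measurable)
    have nh: "norm (h t) = norm (g (Complex c t)) * (exp (r^2 * c^2 / 2) * exp (- (r^2 * t^2) / 2))" for t
      unfolding h_def norm_mult using norm_complex_gauss[of r c t 0] by simp
    \<comment> \<open>Squared, this is the origin of the factor exp (c^2) in the bound: r \<le> 1
      makes it uniform.\<close>
    have e1: "exp (r^2 * c^2 / 2) \<le> exp (c^2 / 2)"
      using r mult_right_mono[of "r^2" 1 "c^2"] by (simp add: power_le_one)
    \<comment> \<open>On the line g is only square integrable. So is the Gaussian factor, which
      makes their product h integrable.\<close>
    have hi: "integrable lborel h"
    proof (rule Bochner_Integration.integrable_bound)
      have gi: "integrable lborel (\<lambda>t. (exp (- (r^2 * t^2) / 2))^2)"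
      proof (rule Bochner_Integration.integrable_bound[OF integrable_gauss[OF r(1)]])
        have "(exp (- (r^2 * t^2) / 2))^2 \<le> exp (- (r^2 * t^2) / 2)" for t :: real
          by (simp add: power2_eq_square mult_le_one)
        thus "AE t in lborel. norm ((exp (- (r^2 * t^2) / 2))^2) \<le> norm (exp (- (r^2 * t^2) / 2))" by simp
      qed auto
      show "integrable lborel (\<lambda>t. exp (r^2 * c^2 / 2) * ((norm (g (Complex c t)))^2 + (exp (- (r^2 * t^2) / 2))^2))"
        by (intro integrable_mult_right Bochner_Integration.integrable_add L2 gi)
      have hb: "norm (h t) \<le> exp (r^2 * c^2 / 2) * ((norm (g (Complex c t)))^2 + (exp (- (r^2 * t^2) / 2))^2)" for t
      proof -
        define A where "A = norm (g (Complex c t))"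
        define B where "B = exp (- (r^2 * t^2) / 2)"
        have "2 * A * B \<le> A^2 + B^2" by (rule sum_squares_bound)
        moreover have "A * B \<ge> 0" by (simp add: A_def B_def)
        ultimately have "A * B \<le> A^2 + B^2" by simp
        hence "exp (r^2 * c^2 / 2) * (A * B) \<le> exp (r^2 * c^2 / 2) * (A^2 + B^2)" by (intro mult_left_mono) auto
        thus ?thesis unfolding nh A_def B_def by (simp only: mult_ac)
      qed
      show "AE t in lborel. norm (h t) \<le> norm (exp (r^2 * c^2 / 2) * ((norm (g (Complex c t)))^2 + (exp (- (r^2 * t^2) / 2))^2))"
        unfolding real_norm_def by (intro always_eventually allI order_trans[OF hb abs_ge_self])
    qed auto
    have hle: "(norm (h t))^2 \<le> exp (c^2) * (norm (g (Complex c t)))^2" for t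
    proof -
      have "exp (r^2 * c^2 / 2) * exp (- (r^2 * t^2) / 2) \<le> exp (c^2 / 2) * 1"
        using e1 by (intro mult_mono) auto
      hence "norm (h t) \<le> norm (g (Complex c t)) * (exp (c^2 / 2) * 1)" unfolding nh by (intro mult_left_mono) auto
      hence "(norm (h t))^2 \<le> (norm (g (Complex c t)) * (exp (c^2 / 2) * 1))^2" by (intro power_mono) auto
      also have "... = exp (c^2) * (norm (g (Complex c t)))^2" by (simp add: power_mult_distrib exp_double[symmetric] mult.commute)
      finally show ?thesis .
    qed
    have h2: "integrable lborel (\<lambda>t. (norm (h t))^2)"
      by (rule Bochner_Integration.integrable_bound[OF integrable_mult_right[OF L2, of "exp (c^2)"]]) (use hle in auto)
    define H where "H = (\<lambda>u. LINT t|lborel. h t * exp (\<i> * of_real (t * u)))"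
    have qH: "2 * pi * \<bar>q n u\<bar> = exp (c * u) * norm (H u)" for u
    proof -
      define F where "F = (\<lambda>s. g s * exp (of_real (r^2 / 2) * s^2 + s * of_real u))"
      have Fc: "F (Complex c t) = exp (of_real (c * u)) * (h t * exp (\<i> * of_real (t * u)))" for t
        unfolding F_def h_def Complex_conv by (simp add: exp_add algebra_simps)
      have ib: "integrable lborel (\<lambda>t. F (Complex b t))"
        "(LINT t|lborel. F (Complex b t)) = of_real (2 * pi * (LINT v|lborel. e v * normal_density u r v))"
        unfolding F_def by (rule gauss_smoothing_formula[OF e e0 eb r(1) b g]; assumption)+
      have hei: "integrable lborel (\<lambda>t. h t * exp (\<i> * of_real (t * u)))"
        by (rule Bochner_Integration.integrable_bound[OF hi]) (auto simp: norm_mult norm_exp_eq_Re)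
      hence ic: "integrable lborel (\<lambda>t. F (Complex c t))" unfolding Fc by (rule integrable_mult_right)
      have "(LINT t|lborel. F (Complex c t)) = (LINT t|lborel. F (Complex b t))"
        unfolding F_def by (rule contour_shift_gauss[OF hol c r(1) T K ic[unfolded F_def] ib(1)[unfolded F_def]])
      hence "exp (of_real (c * u)) * H u = of_real (2 * pi * q n u)"
        unfolding Fc ib(2) H_def q_def r_def by (simp only: integral_mult_right_zero)
      hence "norm (exp (of_real (c * u)) * H u) = norm (of_real (2 * pi * q n u) :: complex)" by (simp only:)
      thus ?thesis by (simp add: norm_mult norm_exp_eq_Re abs_mult)
    qed
    have "(q n u)^2 * exp (- 2 * c * u) = 1 / (2 * pi)^2 * (norm (H u))^2" for u
    proof -
      have "\<bar>q n u\<bar> = exp (c * u) * norm (H u) / (2 * pi)" using qH[of u] by (simp add: field_simps)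
      hence "(q n u)^2 = (exp (c * u) * norm (H u) / (2 * pi))^2" by (metis power2_abs)
      also have "... = exp (2 * c * u) * (norm (H u))^2 / (2 * pi)^2"
        by (simp add: power_divide power_mult_distrib exp_double[symmetric] mult.assoc)
      finally show ?thesis by (simp add: exp_minus field_simps)
    qed
    hence "(\<integral>\<^sup>+ u. ennreal ((q n u)^2 * exp (- 2 * c * u) * exp (- r * \<bar>u\<bar>)) \<partial>lborel) =
       (\<integral>\<^sup>+ u. ennreal (1 / (2 * pi)^2) * ennreal ((norm (H u))^2 * exp (- r * \<bar>u\<bar>)) \<partial>lborel)"
      by (intro nn_integral_cong) (simp add: ennreal_mult'[symmetric] mult_ac)
    also have "... = ennreal (1 / (2 * pi)^2) * (\<integral>\<^sup>+ u. ennreal ((norm (H u))^2 * exp (- r * \<bar>u\<bar>)) \<partial>lborel)"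
    proof (rule nn_integral_cmult)
      have "H \<in> borel_measurable lborel" unfolding H_def
        by (rule lborel.borel_measurable_lebesgue_integral) measurable
      thus "(\<lambda>u. ennreal ((norm (H u))^2 * exp (- r * \<bar>u\<bar>))) \<in> borel_measurable lborel" by measurable
    qed
    also have "... \<le> ennreal (1 / (2 * pi)^2) * ennreal (2 * pi * (LINT t|lborel. (norm (h t))^2))"
      unfolding H_def by (intro mult_left_mono weighted_fourier_L2_bound hi h2 r(1)) auto
    also have "... = ennreal (1 / (2 * pi) * (LINT t|lborel. (norm (h t))^2))"
      by (subst ennreal_mult'[symmetric]) (auto simp: power2_eq_square)
    also have "... \<le> ennreal (1 / (2 * pi) * (exp (c^2) * G2))"
    proof (intro ennreal_leI mult_left_mono)
      have "(LINT t|lborel. (norm (h t))^2) \<le> (LINT t|lborel. exp (c^2) * (norm (g (Complex c t)))^2)"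
        by (intro integral_mono h2 integrable_mult_right L2 hle)
      thus "(LINT t|lborel. (norm (h t))^2) \<le> exp (c^2) * G2" by (simp add: G2_def)
    qed auto
    finally show ?thesis unfolding r_def by simp
  qed
  have lim: "AE u in lborel. ennreal ((e u)^2 * exp (- 2 * c * u)) = liminf (\<lambda>n. ennreal ((q n u)^2 * exp (- 2 * c * u) * exp (- (1 / real (Suc n)) * \<bar>u\<bar>)))"
    using cont
  proof eventually_elim
    case (elim u)
    have "(\<lambda>n. q n u) \<longlonglongrightarrow> e u" unfolding q_def by (rule gauss_smoothing_limit[OF e eb elim])
    moreover have "(\<lambda>n. exp (- (1 / real (Suc n)) * \<bar>u\<bar>)) \<longlonglongrightarrow> 1" by real_asymp
    ultimately have "(\<lambda>n. (q n u)^2 * exp (- 2 * c * u) * exp (- (1 / real (Suc n)) * \<bar>u\<bar>)) \<longlonglongrightarrow> (e u)^2 * exp (- 2 * c * u) * 1"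
      by (intro tendsto_intros)
    hence "(\<lambda>n. ennreal ((q n u)^2 * exp (- 2 * c * u) * exp (- (1 / real (Suc n)) * \<bar>u\<bar>))) \<longlonglongrightarrow> ennreal ((e u)^2 * exp (- 2 * c * u))"
      by (intro tendsto_ennrealI) simp
    thus ?case by (rule lim_imp_Liminf[OF sequentially_bot, symmetric])
  qed
  have "(\<integral>\<^sup>+ v. ennreal ((e v)^2 * exp (- 2 * c * v)) \<partial>lborel) =
    (\<integral>\<^sup>+ u. liminf (\<lambda>n. ennreal ((q n u)^2 * exp (- 2 * c * u) * exp (- (1 / real (Suc n)) * \<bar>u\<bar>))) \<partial>lborel)"
    using lim by (rule nn_integral_cong_AE)
  also have "... \<le> liminf (\<lambda>n. \<integral>\<^sup>+ u. ennreal ((q n u)^2 * exp (- 2 * c * u) * exp (- (1 / real (Suc n)) * \<bar>u\<bar>)) \<partial>lborel)"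
    by (rule nn_integral_liminf) measurable
  also have "... \<le> ennreal (exp (c^2) / (2 * pi) * G2)"
    by (rule Liminf_le) (use bound in auto)
  finally show ?thesis by (simp add: G2_def)
qed

section \<open>Mean square of the remainder in the explicit formula\<close>

text \<open>The function (s - 1) zeta(s) on Re s > 0 with the pole removed. It is given by the
  formula rather than by the product because \<open>zeta\<close> has a dummy value at 1, where
  \<open>kzeta\<close> is 1.\<close>

definition kzeta :: "complex \<Rightarrow> complex" where
  "kzeta s = (s - 1) + 2 powr (1 - s) + (\<Sum>n. ztail_term 0 n s)"

lemma kzeta_holomorphic: "kzeta holomorphic_on {s. Re s > 0}"
  unfolding kzeta_def using ztail_holomorphic[of 0] by (intro holomorphic_intros) auto

lemma kzeta_eq: "Re s > 0 \<Longrightarrow> s \<noteq> 1 \<Longrightarrow> kzeta s = (s - 1) * zeta s"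
  using zeta_formula[of s] by (simp add: kzeta_def algebra_simps)

lemma kzeta_1: "kzeta 1 = 1"
proof -
  have "ztail_term 0 n 1 = 0" for n
  proof -
    have "(of_nat (n + 3) :: complex) \<noteq> 0" "(of_nat (n + 2) :: complex) \<noteq> 0" by (metis of_nat_eq_0_iff add_is_0 zero_neq_numeral)+
    thus ?thesis by (simp add: ztail_term_def)
  qed
  thus ?thesis by (simp add: kzeta_def)
qed

lemma kzeta_log_deriv:
  assumes "Re s > 0" "s \<noteq> 1" "zeta s \<noteq> 0"
  shows "deriv kzeta s / kzeta s = deriv zeta s / zeta s + 1 / (s - 1)"
proof -
  have "(zeta has_field_derivative deriv zeta s) (at s)"
    using zeta_holomorphic assms by (intro holomorphic_derivI[of _ "UNIV - {1}"]) (auto intro: open_Diff)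
  hence "((\<lambda>s. (s - 1) * zeta s) has_field_derivative 1 * zeta s + deriv zeta s * (s - 1)) (at s)"
    by (auto intro!: derivative_eq_intros)
  hence "(kzeta has_field_derivative 1 * zeta s + deriv zeta s * (s - 1)) (at s)"
    by (rule has_field_derivative_transform_within_open[where S = "{s. Re s > 0} - {1}"])
       (use assms in \<open>auto simp: kzeta_eq intro: open_Diff open_halfspace_Re_gt\<close>)
  hence "deriv kzeta s = zeta s + deriv zeta s * (s - 1)" by (simp add: DERIV_imp_deriv)
  thus ?thesis using assms by (simp add: kzeta_eq field_simps)
qed

text \<open>Taking the limit at every point removes all isolated removable singularities at once,
  possibly infinitely many, together with the artificial values of \<open>f\<close> there.\<close>

lemma holomorphic_Lim_extension:
  fixes f :: "complex \<Rightarrow> complex"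
  assumes "open S" and loc: "\<And>z. z \<in> S \<Longrightarrow> \<exists>r>0. \<exists>h. h holomorphic_on ball z r \<and> (\<forall>w\<in>ball z r - {z}. f w = h w)"
  shows "(\<lambda>z. Lim (at z) f) holomorphic_on S"
    and "\<And>z r h. z \<in> S \<Longrightarrow> r > 0 \<Longrightarrow> h holomorphic_on ball z r \<Longrightarrow> (\<And>w. w \<in> ball z r - {z} \<Longrightarrow> f w = h w) \<Longrightarrow> Lim (at z) f = h z"
proof -
  have Lim_eq: "Lim (at w) f = h w" if "w \<in> ball z r" "h holomorphic_on ball z r" "\<And>x. x \<in> ball z r - {z} \<Longrightarrow> f x = h x" for z r h w
  proof -
    have "(h \<longlongrightarrow> h w) (at w)"
      using that(1,2) by (meson continuous_on_eq_continuous_at holomorphic_on_imp_continuous_on isCont_def open_ball)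
    moreover have "eventually (\<lambda>x. h x = f x) (at w)"
    proof -
      have "eventually (\<lambda>x. x \<in> ball z r - ({z} - {w})) (at w)"
        using that(1) by (intro eventually_at_in_open') (auto intro: open_Diff finite_imp_closed)
      moreover have "eventually (\<lambda>x. x \<noteq> w) (at w)" by (simp add: eventually_at_filter)
      ultimately show ?thesis by eventually_elim (use that(3) in auto)
    qed
    ultimately have "(f \<longlongrightarrow> h w) (at w)" by (rule Lim_transform_eventually)
    thus ?thesis by (intro tendsto_Lim) auto
  qed
  show "Lim (at z) f = h z" if "z \<in> S" "r > 0" "h holomorphic_on ball z r" "\<And>w. w \<in> ball z r - {z} \<Longrightarrow> f w = h w" for z r h
    using that by (intro Lim_eq[of z z r h]) auto
  show "(\<lambda>z. Lim (at z) f) holomorphic_on S"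
    unfolding holomorphic_on_def
  proof
    fix z assume z: "z \<in> S"
    obtain r h where rh: "r > 0" "h holomorphic_on ball z r" "\<And>w. w \<in> ball z r - {z} \<Longrightarrow> f w = h w"
      using loc[OF z] by blast
    have "(\<lambda>z. Lim (at z) f) holomorphic_on ball z r"
      by (rule holomorphic_transform[OF rh(2)]) (use Lim_eq[OF _ rh(2,3)] in auto)
    thus "(\<lambda>z. Lim (at z) f) field_differentiable at z within S"
      using rh(1) by (meson centre_in_ball field_differentiable_at_within holomorphic_on_imp_differentiable_at open_ball)
  qed
qed

text \<open>The Laplace transform of the sum of m exp (z v) / z over the zeros z of multiplicity
  m.\<close>

definition zsum :: "(nat \<Rightarrow> complex) \<Rightarrow> complex \<Rightarrow> complex" where
  "zsum z s = (\<Sum>n. of_nat (zeta_zero_mult (z n)) / (z n * (s - z n)))"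

text \<open>For Re s > 1 the first two terms equal - zeta'(s) / (s zeta(s)) - 1 / (s - 1), the
  transform of psi (exp v) - exp v. In terms of \<open>kzeta\<close> the pole at 1 is visibly
  absent, and \<open>zsum\<close> is there to cancel the poles at the zeros.\<close>

definition lfun :: "(nat \<Rightarrow> complex) \<Rightarrow> complex \<Rightarrow> complex" where
  "lfun z s = - deriv kzeta s / (kzeta s * s) - 1 / s + zsum z s"

text \<open>What the explicit formula uses about the zeros: a zero-free strip of width 2 \<eta>
  around Re s = c, sparsity of the zeros to its right, and absolute convergence of the sum over
  them. The multiplicity bound makes the logarithmic derivative O(ln t) away from zeros.\<close>

locale zeta_zero_config =
  fixes c \<eta> C1 :: real and z :: "nat \<Rightarrow> complex"
  assumes c: "c - \<eta> > 1/2" "c < 1" and \<eta>: "0 < \<eta>" "\<eta> \<le> 1"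
    and sep: "\<And>w w'. w \<in> zeta_zeros (c - \<eta>) \<Longrightarrow> w' \<in> zeta_zeros (c - \<eta>) \<Longrightarrow> w \<noteq> w' \<Longrightarrow> dist w w' \<ge> 10"
    and mult: "\<And>w. w \<in> zeta_zeros (c - \<eta>) \<Longrightarrow> real (zeta_zero_mult w) \<le> C1 * ln (norm w)"
    and gap: "\<And>w. w \<in> zeta_zeros (c - \<eta>) \<Longrightarrow> Re w \<ge> c + \<eta> \<and> Re w < 1"
    and inj: "inj z" and range: "range z = zeta_zeros (c - \<eta>)"
    and summ: "summable (\<lambda>n. real (zeta_zero_mult (z n)) / norm (z n))"
begin

lemma z_in: "z n \<in> zeta_zeros (c - \<eta>)" using range by auto

lemma z_props: "Re (z n) \<ge> c + \<eta>" "Re (z n) < 1" "z n \<noteq> 0" "z n \<noteq> 1" "zeta (z n) = 0" "norm (z n) > 0"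
proof -
  show 1: "Re (z n) \<ge> c + \<eta>" "Re (z n) < 1" using gap[OF z_in] by auto
  show "z n \<noteq> 0" using 1 c \<eta> by auto
  thus "norm (z n) > 0" by simp
  show "z n \<noteq> 1" "zeta (z n) = 0" using z_in[of n] by (auto simp: zeta_zeros_def)
qed

lemma zsum_holomorphic_part:
  assumes r: "r > 0" and far: "\<And>n. n \<in> A \<Longrightarrow> dist w (z n) \<ge> 2 * r"
  shows "(\<lambda>s. \<Sum>n. if n \<in> A then of_nat (zeta_zero_mult (z n)) / (z n * (s - z n)) else 0) holomorphic_on ball w r"
    and "\<And>s. s \<in> ball w r \<Longrightarrow> summable (\<lambda>n. if n \<in> A then of_nat (zeta_zero_mult (z n)) / (z n * (s - z n)) else 0)"
proof -
  have far': "dist s (z n) \<ge> r" if "n \<in> A" "s \<in> ball w r" for n s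
    using far[OF that(1)] that(2) dist_triangle[of w "z n" s] by auto
  have bd: "norm (if n \<in> A then of_nat (zeta_zero_mult (z n)) / (z n * (s - z n)) else 0) \<le> 1 / r * (real (zeta_zero_mult (z n)) / norm (z n))"
    if "s \<in> ball w r" for n s
  proof (cases "n \<in> A")
    case True
    have "real (zeta_zero_mult (z n)) / (norm (z n) * norm (s - z n)) \<le> real (zeta_zero_mult (z n)) / (norm (z n) * r)"
      using far'[OF True that] r z_props(6)[of n] by (intro divide_left_mono mult_left_mono mult_pos_pos) (auto simp: dist_norm)
    thus ?thesis using True by (simp add: norm_divide norm_mult mult.commute)
  qed (use r in auto)
  show "summable (\<lambda>n. if n \<in> A then of_nat (zeta_zero_mult (z n)) / (z n * (s - z n)) else 0)" if "s \<in> ball w r" for s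
    by (rule summable_comparison_test'[OF summable_mult[OF summ]]) (rule bd[OF that])
  show "(\<lambda>s. \<Sum>n. if n \<in> A then of_nat (zeta_zero_mult (z n)) / (z n * (s - z n)) else 0) holomorphic_on ball w r"
  proof (rule holomorphic_on_suminf)
    fix n
    show "(\<lambda>s. if n \<in> A then of_nat (zeta_zero_mult (z n)) / (z n * (s - z n)) else 0) holomorphic_on ball w r"
    proof (cases "n \<in> A")
      case True
      have "s \<noteq> z n" if "s \<in> ball w r" for s using far'[OF True that] r by auto
      thus ?thesis using True z_props(3)[of n] by (auto intro!: holomorphic_intros)
    qed auto
  next
    fix x assume x: "x \<in> ball w r"
    obtain d where d: "d > 0" "ball x d \<subseteq> ball w r" using x by (meson open_ball open_contains_ball)
    show "\<exists>d>0. \<exists>M. summable M \<and> (\<forall>n. \<forall>y\<in>ball x d. norm (if n \<in> A then of_nat (zeta_zero_mult (z n)) / (z n * (y - z n)) else 0) \<le> M n)"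
      using d bd summable_mult[OF summ, of "1/r"] by (intro exI[of _ d] exI[of _ "\<lambda>n. 1 / r * (real (zeta_zero_mult (z n)) / norm (z n))"]) blast
  qed auto
qed

text \<open>Separation makes the zeros discrete: apart from w itself, at most one zero lies within
  distance 2 of w.\<close>

lemma zero_free_radius:
  "\<exists>r>0. r \<le> 1 \<and> (\<forall>n. z n \<noteq> w \<longrightarrow> dist w (z n) \<ge> 2 * r)"
proof (cases "\<exists>n. z n \<noteq> w \<and> dist w (z n) < 2")
  case False
  thus ?thesis by (intro exI[of _ 1]) (auto simp: not_less)
next
  case True
  then obtain k where k: "z k \<noteq> w" "dist w (z k) < 2" by blast
  have "dist w (z n) \<ge> 2 * (dist w (z k) / 2)" if "z n \<noteq> w" for n
  proof (cases "z n = z k")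
    case False
    have "dist (z n) (z k) \<ge> 10" by (rule sep[OF z_in z_in False])
    thus ?thesis using k(2) dist_triangle[of "z n" "z k" w] by (simp add: dist_commute)
  qed auto
  thus ?thesis using k by (intro exI[of _ "dist w (z k) / 2"]) auto
qed

text \<open>One factorization for zeros and for all other points, with m = 0 at the latter. The
  point 1 is treated apart: \<open>zeta\<close> is not holomorphic there, so the cofactor is patched
  with \<open>kzeta\<close>.\<close>

lemma kzeta_factor:
  assumes w: "Re w > c - \<eta>"
  obtains r h m where "r > 0" "h holomorphic_on ball w r" "\<And>s. s \<in> ball w r \<Longrightarrow> h s \<noteq> 0"
    "\<And>s. s \<in> ball w r \<Longrightarrow> kzeta s = (s - w) ^ m * h s" "ball w r \<subseteq> {s. Re s > c - \<eta>}"
    "w \<in> zeta_zeros (c - \<eta>) \<Longrightarrow> m = zeta_zero_mult w" "w \<notin> zeta_zeros (c - \<eta>) \<Longrightarrow> m = 0"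
proof -
  define S where "S = {s. Re s > c - \<eta>}"
  have S: "open S" unfolding S_def by (rule open_halfspace_Re_gt)
  have wS: "w \<in> S" using w by (simp add: S_def)
  have S0: "S \<subseteq> {s. Re s > 0}" using c by (auto simp: S_def)
  obtain h m where h: "h holomorphic_on S" "h w \<noteq> 0" "\<And>s. s \<in> S \<Longrightarrow> s \<noteq> 1 \<or> w = 1 \<Longrightarrow> kzeta s = (s - w) ^ m * h s"
    "w \<in> zeta_zeros (c - \<eta>) \<Longrightarrow> m = zeta_zero_mult w" "w \<notin> zeta_zeros (c - \<eta>) \<Longrightarrow> m = 0"
  proof (cases "w \<in> zeta_zeros (c - \<eta>)")
    case False
    hence "kzeta w \<noteq> 0" using kzeta_1 kzeta_eq[of w] wS S0 by (cases "w = 1") (auto simp: zeta_zeros_def S_def)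
    thus thesis using False kzeta_holomorphic S0 by (intro that[of kzeta 0]) (auto intro: holomorphic_on_subset)
  next
    case True
    have w1: "w \<noteq> 1" using True by (auto simp: zeta_zeros_def)
    define S' where "S' = S - {1}"
    have "connected S" unfolding S_def by (intro convex_connected convex_halfspace_Re_gt)
    hence S': "open S'" "connected S'" "w \<in> S'" unfolding S'_def
      using S wS w1 connected_open_delete[OF S] by (auto intro!: open_Diff)
    have hol: "zeta holomorphic_on S'" by (rule holomorphic_on_subset[OF zeta_holomorphic]) (auto simp: S'_def)
    have "zeta 3 \<noteq> 0" using zeta_3_lower[of 3] by auto
    moreover have "3 \<in> S'" using c \<eta> by (auto simp: S'_def S_def)
    ultimately obtain h0 where h0: "h0 holomorphic_on S'" "h0 w \<noteq> 0" "\<And>s. s \<in> S' \<Longrightarrow> zeta s = (s - w) ^ nat (zorder zeta w) * h0 s"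
      using holomorphic_factor_zero[OF S'(1,2) hol S'(3)] by blast
    define m where "m = nat (zorder zeta w)"
    have mz: "m = zeta_zero_mult w" using zeta_zero_mult_eq[OF True] by (simp add: m_def)
    have k_eq: "kzeta s = (s - w) ^ m * ((s - 1) * h0 s)" if "s \<in> S'" for s
      using h0(3)[OF that] that S0 kzeta_eq[of s] by (auto simp: S'_def m_def)
    define h where "h = (\<lambda>s. if s = 1 then kzeta 1 / (1 - w) ^ m else (s - 1) * h0 s)"
    have "h holomorphic_on S"
    proof -
      have "h holomorphic_on (S' \<union> (S - {w}))"
      proof (rule holomorphic_on_Un)
        have "(\<lambda>s. (s - 1) * h0 s) holomorphic_on S'" by (intro holomorphic_intros h0)
        thus "h holomorphic_on S'" by (rule holomorphic_transform) (auto simp: h_def S'_def)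
        have "(\<lambda>s. kzeta s / (s - w) ^ m) holomorphic_on S - {w}"
          by (intro holomorphic_intros holomorphic_on_subset[OF kzeta_holomorphic]) (use S0 in auto)
        thus "h holomorphic_on S - {w}"
          by (rule holomorphic_transform) (use k_eq in \<open>auto simp: h_def S'_def\<close>)
      qed (use S' S in \<open>auto intro: open_Diff\<close>)
      thus ?thesis by (rule holomorphic_on_subset) (use w1 in \<open>auto simp: S'_def\<close>)
    qed
    thus thesis using True w1 mz h0(2) k_eq by (intro that[of h m]) (auto simp: h_def S'_def)
  qed
  have "continuous (at w) h" using h(1) S wS by (meson continuous_on_eq_continuous_at holomorphic_on_imp_continuous_on)
  then obtain e where e: "e > 0" "\<And>s. dist w s < e \<Longrightarrow> h s \<noteq> 0"
    using continuous_at_avoid[of w h 0] h(2) by blast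
  obtain d where d: "d > 0" "ball w d \<subseteq> S" using S wS by (meson open_contains_ball)
  define q where "q = (if w = 1 then 1 else dist w 1)"
  have q: "q > 0" by (auto simp: q_def)
  define r where "r = min (min e d) q"
  have "r > 0" using e d q by (auto simp: r_def)
  moreover have sub: "ball w r \<subseteq> S" using d by (auto simp: r_def)
  moreover have "h s \<noteq> 0" if "s \<in> ball w r" for s using that e by (auto simp: r_def)
  moreover have "kzeta s = (s - w) ^ m * h s" if "s \<in> ball w r" for s
  proof -
    have "s \<noteq> 1 \<or> w = 1" using that by (auto simp: r_def q_def split: if_splits)
    thus ?thesis using h(3) sub that by auto
  qed
  ultimately show thesis using h(1,4,5) holomorphic_on_subset[OF h(1) sub]
    by (intro that[of r h m]) (auto simp: S_def)
qed

text \<open>At a zero w of multiplicity m the logarithmic derivative contributes - m / ((s - w) s)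
  and the sum over the zeros m / (w (s - w)). Their sum is m / (w s), which is regular at w.\<close>

lemma lfun_local:
  assumes w: "Re w > c - \<eta>"
  shows "\<exists>r>0. \<exists>H. H holomorphic_on ball w r \<and> (\<forall>s\<in>ball w r - {w}. lfun z s = H s) \<and> (w \<notin> zeta_zeros (c - \<eta>) \<longrightarrow> lfun z w = H w)"
proof -
  obtain r1 h m where h: "r1 > 0" "h holomorphic_on ball w r1" "\<And>s. s \<in> ball w r1 \<Longrightarrow> h s \<noteq> 0"
    "\<And>s. s \<in> ball w r1 \<Longrightarrow> kzeta s = (s - w) ^ m * h s" "ball w r1 \<subseteq> {s. Re s > c - \<eta>}"
    "w \<in> zeta_zeros (c - \<eta>) \<Longrightarrow> m = zeta_zero_mult w" "w \<notin> zeta_zeros (c - \<eta>) \<Longrightarrow> m = 0"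
    using kzeta_factor[OF w] by metis
  obtain r2 where r2: "r2 > 0" "r2 \<le> 1" "\<And>n. z n \<noteq> w \<Longrightarrow> dist w (z n) \<ge> 2 * r2"
    using zero_free_radius by blast
  define r where "r = min r1 r2"
  have r: "r > 0" using h r2 by (auto simp: r_def)
  have s0: "s \<noteq> 0" if "s \<in> ball w r" for s
  proof -
    have "s \<in> ball w r1" using that by (simp add: r_def)
    hence "Re s > c - \<eta>" using h(5) by blast
    thus ?thesis using c by auto
  qed
  have w0: "w \<noteq> 0" using s0[of w] r by auto
  have hr: "h holomorphic_on ball w r" by (rule holomorphic_on_subset[OF h(2)]) (auto simp: r_def)
  define A where "A = {n. z n \<noteq> w}"
  define R where "R = (\<lambda>s. \<Sum>n. if n \<in> A then of_nat (zeta_zero_mult (z n)) / (z n * (s - z n)) else 0)"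
  have far: "dist w (z n) \<ge> 2 * r" if "n \<in> A" for n using r2(3)[of n] that by (auto simp: A_def r_def)
  have R: "R holomorphic_on ball w r" "\<And>s. s \<in> ball w r \<Longrightarrow> summable (\<lambda>n. if n \<in> A then of_nat (zeta_zero_mult (z n)) / (z n * (s - z n)) else 0)"
    unfolding R_def using zsum_holomorphic_part[OF r far] by auto
  have zs: "zsum z s = R s + of_nat m / (w * (s - w))" if s: "s \<in> ball w r" for s
  proof (cases "w \<in> zeta_zeros (c - \<eta>)")
    case True
    then obtain k where k: "z k = w" using range by (metis rangeE)
    have Ak: "n \<in> A \<longleftrightarrow> n \<noteq> k" for n using k inj by (auto simp: A_def dest: injD)
    define a where "a = (\<lambda>n. of_nat (zeta_zero_mult (z n)) / (z n * (s - z n)))"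
    have "(\<lambda>n. if n = k then a n else 0) sums a k" by (rule sums_single)
    moreover have "(\<lambda>n. if n \<in> A then a n else 0) sums R s" using R(2)[OF s] unfolding R_def a_def by (rule summable_sums)
    ultimately have "(\<lambda>n. (if n \<in> A then a n else 0) + (if n = k then a n else 0)) sums (R s + a k)" by (intro sums_add)
    moreover have "(if n \<in> A then a n else 0) + (if n = k then a n else 0) = a n" for n by (simp add: Ak)
    ultimately have "zsum z s = R s + a k" unfolding zsum_def a_def by (simp add: sums_iff)
    thus ?thesis using h(6)[OF True] k by (simp add: a_def)
  next
    case False
    hence "n \<in> A" for n using z_in[of n] by (auto simp: A_def)
    thus ?thesis using h(7)[OF False] by (simp add: zsum_def R_def)
  qed
  define H where "H = (\<lambda>s. of_nat m / (w * s) - deriv h s / (h s * s) - 1 / s + R s)"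
  have "H holomorphic_on ball w r" unfolding H_def
    using w0 s0 h(3) by (intro holomorphic_intros holomorphic_deriv hr R) (auto simp: r_def)
  moreover have "lfun z s = H s" if s: "s \<in> ball w r" "s \<noteq> w \<or> m = 0" for s
  proof -
    have hd: "(h has_field_derivative deriv h s) (at s)" using hr s(1) by (meson holomorphic_derivI open_ball)
    have "((\<lambda>s. (s - w) ^ m * h s) has_field_derivative (of_nat m * (s - w) ^ (m - 1)) * h s + (s - w) ^ m * deriv h s) (at s)"
      by (rule derivative_eq_intros hd refl | simp)+
    hence "(kzeta has_field_derivative (of_nat m * (s - w) ^ (m - 1)) * h s + (s - w) ^ m * deriv h s) (at s)"
      by (rule has_field_derivative_transform_within_open[OF _ open_ball s(1)]) (use h(4) in \<open>auto simp: r_def\<close>)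
    hence dk: "deriv kzeta s = (of_nat m * (s - w) ^ (m - 1)) * h s + (s - w) ^ m * deriv h s" by (rule DERIV_imp_deriv)
    have k: "kzeta s = (s - w) ^ m * h s" "h s \<noteq> 0" using h(3,4) s by (auto simp: r_def)
    show ?thesis
    proof (cases "m = 0")
      case True
      thus ?thesis using dk k by (simp add: lfun_def H_def zs[OF s(1)])
    next
      case False
      hence sw: "s - w \<noteq> 0" using s by auto
      have "(s - w) ^ m = (s - w) * (s - w) ^ (m - 1)" using False by (cases m) auto
      hence "deriv kzeta s / (kzeta s * s) = of_nat m / ((s - w) * s) + deriv h s / (h s * s)"
        unfolding dk k(1) using sw k(2) s0[OF s(1)] by (simp add: divide_simps) (simp add: algebra_simps)
      hence "lfun z s = (of_nat m / (w * (s - w)) - of_nat m / ((s - w) * s)) - deriv h s / (h s * s) - 1 / s + R s"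
        by (simp add: lfun_def zs[OF s(1)] algebra_simps)
      also have "of_nat m / (w * (s - w)) - of_nat m / ((s - w) * s) = of_nat m / (w * s)"
        using sw w0 s0[OF s(1)] by (simp add: divide_simps) (simp add: algebra_simps)
      finally show ?thesis by (simp add: H_def)
    qed
  qed
  ultimately show ?thesis using r h(7) by (intro exI[of _ r] conjI exI[of _ H]) auto
qed

text \<open>This is \<open>lfun\<close> with its removable singularities filled in; at a zero the
  value of \<open>lfun\<close> itself is an artefact of division by 0.\<close>

definition gfun :: "complex \<Rightarrow> complex" where
  "gfun s = Lim (at s) (lfun z)"

lemma gfun_holomorphic: "gfun holomorphic_on {s. Re s > c - \<eta>}"
  unfolding gfun_def[abs_def]
  by (rule holomorphic_Lim_extension(1)[OF open_halfspace_Re_gt]) (use lfun_local in blast)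

lemma gfun_eq:
  assumes "Re w > c - \<eta>" "w \<notin> zeta_zeros (c - \<eta>)"
  shows "gfun w = lfun z w"
proof -
  obtain r H where H: "r > 0" "H holomorphic_on ball w r" "\<And>s. s \<in> ball w r - {w} \<Longrightarrow> lfun z s = H s" "lfun z w = H w"
    using lfun_local[OF assms(1)] assms(2) by blast
  have "gfun w = H w" unfolding gfun_def
    by (rule holomorphic_Lim_extension(2)[OF open_halfspace_Re_gt _ _ H(1,2,3)]) (use lfun_local assms in blast)+
  thus ?thesis using H by simp
qed

end

section \<open>Chebyshev's function psi and its Laplace transform\<close>

definition psi :: "real \<Rightarrow> real" where
  "psi x = (\<Sum>n | 0 < n \<and> real n \<le> x. mangoldt n)"

lemma finite_le_real: "finite {n::nat. 0 < n \<and> real n \<le> x}"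
  by (rule finite_subset[of _ "{..nat \<lfloor>x\<rfloor>}"]) (auto simp: le_nat_floor)

lemma psi_nonneg: "psi x \<ge> 0"
  unfolding psi_def by (intro sum_nonneg mangoldt_nonneg)

lemma psi_mono: "x \<le> y \<Longrightarrow> psi x \<le> psi y"
  unfolding psi_def by (intro sum_mono2 finite_le_real) (auto intro: mangoldt_nonneg)

lemma psi_le:
  assumes "x \<ge> 1"
  shows "psi x \<le> x * ln x"
proof -
  have "psi x \<le> (\<Sum>n | 0 < n \<and> real n \<le> x. ln x)"
    unfolding psi_def
  proof (rule sum_mono)
    fix n assume n: "n \<in> {n. 0 < n \<and> real n \<le> x}"
    hence "mangoldt n \<le> ln (real n)" by (intro mangoldt_le) auto
    also have "... \<le> ln x" using n by (subst ln_le_cancel_iff) auto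
    finally show "mangoldt n \<le> ln x" .
  qed
  also have "... = real (card {n::nat. 0 < n \<and> real n \<le> x}) * ln x" by simp
  also have "... \<le> x * ln x"
  proof (intro mult_right_mono)
    have "{n::nat. 0 < n \<and> real n \<le> x} \<subseteq> {1..nat \<lfloor>x\<rfloor>}" by (auto simp: le_nat_floor)
    hence "card {n::nat. 0 < n \<and> real n \<le> x} \<le> nat \<lfloor>x\<rfloor>" using card_mono[of "{1..nat \<lfloor>x\<rfloor>}"] by force
    thus "real (card {n::nat. 0 < n \<and> real n \<le> x}) \<le> x" using assms by linarith
  qed (use assms in auto)
  finally show ?thesis .
qed

lemma laplace_exp_shift:
  fixes w :: complex and a :: real
  assumes "Re w > 0"
  shows "integrable lborel (\<lambda>u. indicator {a<..} u *\<^sub>R exp (- w * of_real u))"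
    and "(LINT u|lborel. indicator {a<..} u *\<^sub>R exp (- w * of_real u)) = exp (- w * of_real a) / w"
    and "(LINT u|lborel. norm (indicator {a<..} u *\<^sub>R exp (- w * of_real u))) = exp (- Re w * a) / Re w"
proof -
  have *: "integrable lborel (\<lambda>u. indicator {a<..} u *\<^sub>R exp (- w * of_real u)) \<and>
     (LINT u|lborel. indicator {a<..} u *\<^sub>R exp (- w * of_real u)) = exp (- w * of_real a) / w" if "Re w > 0" for w
  proof -
    define F where "F = (\<lambda>u. indicator {a<..} u *\<^sub>R exp (- w * of_real u) :: complex)"
    have eq: "F (a + 1 * x) = exp (- w * of_real a) * (indicator {0<..} x *\<^sub>R exp (- w * of_real x))" for x
      by (auto simp: F_def indicator_def exp_add[symmetric] algebra_simps)
    have i: "integrable lborel (\<lambda>x. indicator {0<..} x *\<^sub>R exp (- w * of_real x))"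
      using laplace_exp(1)[OF that] by (simp add: set_integrable_def)
    hence "integrable lborel (\<lambda>x. F (a + 1 * x))" unfolding eq by (rule integrable_mult_right)
    hence 1: "integrable lborel F" using lborel_integrable_real_affine_iff[of 1 F a] by simp
    have "(LINT u|lborel. F u) = \<bar>1\<bar> *\<^sub>R (LINT x|lborel. F (a + 1 * x))" by (rule lborel_integral_real_affine) simp
    also have "... = exp (- w * of_real a) * (1 / w)"
      using laplace_exp(2)[OF that] unfolding eq set_lebesgue_integral_def by (simp only: integral_mult_right_zero abs_one scaleR_one)
    finally show ?thesis using 1 by (simp add: F_def)
  qed
  show "integrable lborel (\<lambda>u. indicator {a<..} u *\<^sub>R exp (- w * of_real u))"
    "(LINT u|lborel. indicator {a<..} u *\<^sub>R exp (- w * of_real u)) = exp (- w * of_real a) / w"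
    using *[OF assms] by auto
  have "norm (indicator {a<..} u *\<^sub>R exp (- w * of_real u)) = Re (indicator {a<..} u *\<^sub>R exp (- of_real (Re w) * of_real u))" for u
    using norm_exp_mult_real[of "-w" u] Re_exp[of "- of_real (Re w) * of_real u"] by (auto simp: indicator_def)
  hence "(LINT u|lborel. norm (indicator {a<..} u *\<^sub>R exp (- w * of_real u))) =
     (LINT u|lborel. Re (indicator {a<..} u *\<^sub>R exp (- of_real (Re w) * of_real u)))" by (simp only:)
  also have "... = Re (exp (- of_real (Re w) * of_real a) / of_real (Re w))"
    using *[of "of_real (Re w)"] assms by (subst integral_Re) auto
  also have "... = exp (- Re w * a) / Re w"
  proof -
    have "exp (- of_real (Re w) * of_real a) / of_real (Re w) = complex_of_real (exp (- Re w * a) / Re w)"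
      by (simp add: exp_of_real[symmetric])
    thus ?thesis by (metis Re_complex_of_real)
  qed
  finally show "(LINT u|lborel. norm (indicator {a<..} u *\<^sub>R exp (- w * of_real u))) = exp (- Re w * a) / Re w" .
qed

lemma AE_not_ln_nat: "AE v in lborel. \<forall>n::nat. v \<noteq> ln (real n)"
proof -
  have "AE v in lborel. v \<noteq> ln (real n)" for n by (rule AE_lborel_singleton)
  thus ?thesis by (simp add: AE_all_countable)
qed

text \<open>psi (exp v) as a superposition of steps, ready for termwise integration. The open
  half-line v > ln n differs from the condition n \<le> exp v only at v = ln n, and these points
  form a null set.\<close>

lemma psi_exp_eq_suminf:
  assumes v: "\<forall>n::nat. v \<noteq> ln (real n)"
  shows "(\<lambda>n. mangoldt (Suc n) * indicator {ln (real (Suc n))<..} v) sums (indicator {0<..} v * psi (exp v) :: real)"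
proof -
  define A where "A = {n. real (Suc n) \<le> exp v}"
  have fin: "finite A" by (rule finite_subset[of _ "{..nat \<lfloor>exp v\<rfloor>}"]) (auto simp: A_def le_nat_floor)
  have iff: "real (Suc n) \<le> exp v \<longleftrightarrow> ln (real (Suc n)) < v" for n
  proof -
    have "real (Suc n) \<le> exp v \<longleftrightarrow> ln (real (Suc n)) \<le> v" by (subst ln_le_cancel_iff[of "real (Suc n)" "exp v", symmetric]) auto
    thus ?thesis using v[rule_format, of "Suc n"] by (auto simp del: of_nat_Suc)
  qed
  have "(\<lambda>n. mangoldt (Suc n) * indicator {ln (real (Suc n))<..} v) sums (\<Sum>n\<in>A. mangoldt (Suc n) * indicator {ln (real (Suc n))<..} v :: real)"
    by (rule sums_finite[OF fin]) (auto simp: A_def iff indicator_def simp del: of_nat_Suc)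
  also have "(\<Sum>n\<in>A. mangoldt (Suc n) * indicator {ln (real (Suc n))<..} v :: real) = (\<Sum>n\<in>A. mangoldt (Suc n))"
    by (rule sum.cong) (auto simp: A_def iff simp del: of_nat_Suc)
  also have "... = psi (exp v)"
    unfolding psi_def A_def by (rule sum.reindex_bij_witness[of _ "\<lambda>n. n - 1" Suc]) auto
  also have "psi (exp v) = indicator {0<..} v * psi (exp v)"
  proof (cases "v > 0")
    case False
    hence "exp v < 1" using v[rule_format, of 1] by auto
    hence "{n::nat. 0 < n \<and> real n \<le> exp v} = {}"
    proof -
      have "\<not> (0 < n \<and> real n \<le> exp v)" for n :: nat
      proof
        assume "0 < n \<and> real n \<le> exp v"
        hence "1 \<le> real n" "real n \<le> exp v" by auto
        thus False using \<open>exp v < 1\<close> by linarith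
      qed
      thus ?thesis by blast
    qed
    thus ?thesis by (simp only: psi_def sum.empty mult_zero_right)
  qed auto
  finally show ?thesis .
qed

lemma laplace_psi:
  assumes s: "Re s > 1" and nz: "zeta s \<noteq> 0"
  shows "integrable lborel (\<lambda>v. of_real (indicator {0<..} v * psi (exp v)) * exp (- s * of_real v))"
    and "(LINT v|lborel. of_real (indicator {0<..} v * psi (exp v)) * exp (- s * of_real v)) = - deriv zeta s / (zeta s * s)"
proof -
  define f where "f = (\<lambda>n v. of_real (mangoldt (Suc n)) * (indicator {ln (real (Suc n))<..} v *\<^sub>R exp (- s * of_real v)) :: complex)"
  have s0: "Re s > 0" "s \<noteq> 0" using s by auto
  have fi: "integrable lborel (f n)" for n unfolding f_def by (intro integrable_mult_right laplace_exp_shift(1) s0)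
  have exp_ln: "exp (- s * of_real (ln (real (Suc n)))) = 1 / of_nat (Suc n) powr s" for n
  proof -
    have "Ln (of_nat (Suc n)) = of_real (ln (real (Suc n)))" using Ln_of_real[of "real (Suc n)"] by simp
    thus ?thesis by (simp add: powr_def exp_minus divide_inverse del: of_nat_Suc)
  qed
  have fv: "(LINT v|lborel. f n v) = mangoldt (Suc n) / of_nat (Suc n) powr s / s" for n
    unfolding f_def integral_mult_right_zero laplace_exp_shift(2)[OF s0(1)] exp_ln by (simp del: of_nat_Suc)
  have fn: "(LINT v|lborel. norm (f n v)) = norm (mangoldt (Suc n) / of_nat (Suc n) powr s :: complex) / Re s" for n
  proof -
    have "(LINT v|lborel. norm (f n v)) = mangoldt (Suc n) * (exp (- Re s * ln (real (Suc n))) / Re s)"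
      unfolding f_def norm_mult by (subst integral_mult_right_zero) (simp only: laplace_exp_shift(3)[OF s0(1)] norm_of_real abs_mangoldt)
    also have "exp (- Re s * ln (real (Suc n))) = 1 / real (Suc n) powr Re s" by (simp add: powr_def exp_minus divide_inverse del: of_nat_Suc)
    finally show ?thesis unfolding norm_divide norm_Suc_powr by simp
  qed
  have AEs: "AE v in lborel. (\<lambda>n. f n v) sums (of_real (indicator {0<..} v * psi (exp v)) * exp (- s * of_real v)) \<and> summable (\<lambda>n. norm (f n v))"
    using AE_not_ln_nat
  proof eventually_elim
    case (elim v)
    note S = psi_exp_eq_suminf[OF elim]
    have f_eq: "f n v = of_real (mangoldt (Suc n) * indicator {ln (real (Suc n))<..} v) * exp (- s * of_real v)" for n
      by (simp add: f_def indicator_def)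
    have "(\<lambda>n. f n v) sums (of_real (indicator {0<..} v * psi (exp v)) * exp (- s * of_real v))"
      unfolding f_eq by (intro sums_mult2 sums_of_real S)
    moreover have "summable (\<lambda>n. norm (f n v))"
    proof -
      have "norm (f n v) = mangoldt (Suc n) * indicator {ln (real (Suc n))<..} v * norm (exp (- s * of_real v))" for n
        unfolding f_eq norm_mult norm_of_real by (simp add: abs_mult mangoldt_nonneg)
      thus ?thesis using summable_mult2[OF sums_summable[OF S]] by simp
    qed
    ultimately show ?case by blast
  qed
  have sm: "summable (\<lambda>n. LINT v|lborel. norm (f n v))"
    unfolding fn by (intro summable_divide mangoldt_series_norm_summable s)
  have AE2: "AE v in lborel. summable (\<lambda>n. norm (f n v))" using AEs by auto
  have AE3: "AE v in lborel. (\<Sum>n. f n v) = of_real (indicator {0<..} v * psi (exp v)) * exp (- s * of_real v)"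
    using AEs by eventually_elim (auto simp: sums_iff)
  have psim: "(\<lambda>v. psi (exp v)) \<in> borel_measurable borel"
    by (rule borel_measurable_mono) (auto intro!: monoI psi_mono)
  have m: "(\<lambda>v. of_real (indicator {0<..} v * psi (exp v)) * exp (- s * of_real v)) \<in> borel_measurable lborel"
    using psim by measurable
  have si: "integrable lborel (\<lambda>v. \<Sum>n. f n v)" by (rule integrable_suminf[OF fi AE2 sm])
  thus "integrable lborel (\<lambda>v. of_real (indicator {0<..} v * psi (exp v)) * exp (- s * of_real v))"
    using integrable_cong_AE[OF _ m AE3] by (auto dest: borel_measurable_integrable)
  have "(LINT v|lborel. of_real (indicator {0<..} v * psi (exp v)) * exp (- s * of_real v)) = (LINT v|lborel. (\<Sum>n. f n v))"
    by (rule integral_cong_AE[OF m borel_measurable_integrable[OF si]]) (use AE3 in auto)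
  also have "... = (\<Sum>n. LINT v|lborel. f n v)" by (rule integral_suminf[OF fi AE2 sm])
  also have "... = (\<Sum>n. mangoldt (Suc n) / of_nat (Suc n) powr s) / s"
    unfolding fv by (rule suminf_divide[OF summable_norm_cancel[OF mangoldt_series_norm_summable[OF s]]])
  finally have L: "(LINT v|lborel. of_real (indicator {0<..} v * psi (exp v)) * exp (- s * of_real v)) = (\<Sum>n. mangoldt (Suc n) / of_nat (Suc n) powr s) / s" .
  show "(LINT v|lborel. of_real (indicator {0<..} v * psi (exp v)) * exp (- s * of_real v)) = - deriv zeta s / (zeta s * s)"
    unfolding L zeta_log_deriv[OF s, symmetric] using nz by simp
qed

text \<open>With A and S the sums of a n and of a n * b n, the inequality is the expansion of the
  nonnegative sum of a n (A b n - S)^2, divided by A. If A = 0, all a n vanish.\<close>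

lemma suminf_Cauchy_Schwarz:
  fixes a b :: "nat \<Rightarrow> real"
  assumes a: "summable a" "\<And>n. a n \<ge> 0" and ab: "summable (\<lambda>n. a n * b n)" and ab2: "summable (\<lambda>n. a n * (b n)^2)"
  shows "(\<Sum>n. a n * b n)^2 \<le> suminf a * (\<Sum>n. a n * (b n)^2)"
proof -
  define A where "A = suminf a"
  define S where "S = (\<Sum>n. a n * b n)"
  define Q where "Q = (\<Sum>n. a n * (b n)^2)"
  have A0: "A \<ge> 0" unfolding A_def by (rule suminf_nonneg[OF a])
  have sm: "(\<lambda>n. a n * (A * b n - S)^2) sums (A^2 * Q - 2 * A * S * S + S^2 * A)"
  proof -
    have "(\<lambda>n. A^2 * (a n * (b n)^2) - 2 * A * S * (a n * b n) + S^2 * a n) sums (A^2 * Q - 2 * A * S * S + S^2 * A)"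
      unfolding A_def S_def Q_def by (intro sums_add sums_diff sums_mult summable_sums a ab ab2)
    moreover have "A^2 * (a n * (b n)^2) - 2 * A * S * (a n * b n) + S^2 * a n = a n * (A * b n - S)^2" for n
      by (simp add: power2_eq_square algebra_simps)
    ultimately show ?thesis by simp
  qed
  have "0 \<le> A^2 * Q - 2 * A * S * S + S^2 * A"
    using sums_le[OF _ sums_zero sm] a(2) by auto
  hence "A * (A * Q - S^2) \<ge> 0" by (simp add: power2_eq_square algebra_simps)
  hence "A = 0 \<or> A * Q \<ge> S^2" using A0 by (auto simp: zero_le_mult_iff)
  moreover have "S^2 \<le> A * Q" if "A = 0"
  proof -
    have "a n = 0" for n using suminf_eq_zero_iff[OF a] that by (auto simp: A_def)
    thus ?thesis using that by (simp add: S_def)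
  qed
  ultimately show ?thesis unfolding A_def S_def Q_def by blast
qed

lemma integrable_one_plus_abs_powr:
  "integrable lborel (\<lambda>t::real. (1 + \<bar>t\<bar>) powr (-3/2))"
proof -
  define f where "f = (\<lambda>t::real. indicator {0<..} t * (1 + t) powr (-3/2))"
  have "set_integrable lborel (einterval 0 \<infinity>) (\<lambda>t. (1 + t) powr (-3/2))"
  proof (rule interval_integral_FTC_nonneg(1)[where F = "\<lambda>t. -2 * (1 + t) powr (-1/2)" and A = "-2" and B = 0])
    fix x :: real assume "0 < ereal x"
    hence x: "x > 0" by (simp add: zero_ereal_def)
    show "DERIV (\<lambda>t. -2 * (1 + t) powr (-1/2)) x :> (1 + x) powr (-3/2)"
      using x by (auto intro!: derivative_eq_intros)
    show "isCont (\<lambda>t. (1 + t) powr (-3/2)) x" using x by (intro continuous_intros) auto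
  next
    have "((\<lambda>t. -2 * (1 + t) powr (-1/2)) \<longlongrightarrow> -2 * (1 + 0) powr (-1/2)) (at_right (0::real))"
      by (intro tendsto_intros) auto
    thus "(((\<lambda>t. -2 * (1 + t) powr (-1/2)) \<circ> real_of_ereal) \<longlongrightarrow> -2) (at_right 0)"
      by (simp add: ereal_tendsto_simps1 zero_ereal_def)
    have "((\<lambda>t. -2 * (1 + t) powr (-1/2)) \<longlongrightarrow> (0::real)) at_top" by real_asymp
    thus "(((\<lambda>t. -2 * (1 + t) powr (-1/2)) \<circ> real_of_ereal) \<longlongrightarrow> 0) (at_left \<infinity>)"
      by (simp add: ereal_tendsto_simps1)
  qed auto
  moreover have "einterval 0 \<infinity> = {0<..}" by (auto simp: einterval_def zero_ereal_def)
  ultimately have f: "integrable lborel f" by (simp add: set_integrable_def f_def)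
  hence f': "integrable lborel (\<lambda>t. f (0 + -1 * t))" by (intro lborel_integrable_real_affine) auto
  have "integrable lborel (\<lambda>t. f t + f (0 + -1 * t))" by (intro Bochner_Integration.integrable_add f f')
  moreover have "AE t in lborel. (1 + \<bar>t\<bar>) powr (-3/2) = f t + f (0 + -1 * t)"
    using AE_lborel_singleton[of 0] by eventually_elim (auto simp: f_def indicator_def)
  ultimately show ?thesis
    using integrable_cong_AE[of "\<lambda>t. (1 + \<bar>t\<bar>) powr (-3/2)" lborel "\<lambda>t. f t + f (0 + -1 * t)"] by (auto dest: borel_measurable_integrable)
qed

section \<open>Square integrability on the line Re s = c\<close>

context zeta_zero_config
begin

abbreviation \<mu> :: "nat \<Rightarrow> real" where "\<mu> n \<equiv> real (zeta_zero_mult (z n)) / norm (z n)"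

lemma cnj_zero: "w \<in> zeta_zeros a \<Longrightarrow> cnj w \<in> zeta_zeros a"
  by (auto simp: zeta_zeros_def zeta_cnj)

lemma zsum_term_norm: "norm (of_nat (zeta_zero_mult (z n)) / (z n * (s - z n))) = \<mu> n * (1 / norm (s - z n))"
  by (simp add: norm_divide norm_mult)

lemma line_dist: "norm (Complex c t - z n) \<ge> \<eta>"
  using z_props(1)[of n] abs_Re_le_cmod[of "Complex c t - z n"] by simp

lemma zsum_line_summable:
  "summable (\<lambda>n. \<mu> n * (1 / norm (Complex c t - z n)))" "summable (\<lambda>n. \<mu> n * (1 / norm (Complex c t - z n))^2)"
proof -
  have b: "1 / norm (Complex c t - z n) \<le> 1 / \<eta>" for n using line_dist[of t n] \<eta> by (intro divide_left_mono mult_pos_pos) auto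
  show "summable (\<lambda>n. \<mu> n * (1 / norm (Complex c t - z n)))"
  proof (rule summable_comparison_test'[OF summable_mult2[OF summ, of "1/\<eta>"]])
    fix n
    have "\<mu> n * (1 / norm (Complex c t - z n)) \<le> \<mu> n * (1 / \<eta>)" by (intro mult_left_mono b) auto
    thus "norm (\<mu> n * (1 / norm (Complex c t - z n))) \<le> \<mu> n * (1 / \<eta>)" by simp
  qed
  show "summable (\<lambda>n. \<mu> n * (1 / norm (Complex c t - z n))^2)"
  proof (rule summable_comparison_test'[OF summable_mult2[OF summ, of "(1/\<eta>)^2"]])
    fix n
    have "\<mu> n * (1 / norm (Complex c t - z n))^2 \<le> \<mu> n * (1 / \<eta>)^2" by (intro mult_left_mono power_mono b) auto
    thus "norm (\<mu> n * (1 / norm (Complex c t - z n))^2) \<le> \<mu> n * (1 / \<eta>)^2" by simp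
  qed
qed

text \<open>Cauchy-Schwarz with the summable weights \<open>\<mu>\<close>, so that on integrating
  along the line every zero contributes a multiple of a Poisson kernel.\<close>

lemma zsum_line_bound:
  "(norm (zsum z (Complex c t)))^2 \<le> suminf \<mu> * (\<Sum>n. \<mu> n * (1 / norm (Complex c t - z n))^2)"
proof -
  have "norm (zsum z (Complex c t)) \<le> (\<Sum>n. \<mu> n * (1 / norm (Complex c t - z n)))"
    unfolding zsum_def by (rule norm_suminf_le) (simp_all only: zsum_term_norm order_refl zsum_line_summable)
  hence "(norm (zsum z (Complex c t)))^2 \<le> (\<Sum>n. \<mu> n * (1 / norm (Complex c t - z n)))^2" by (intro power_mono) auto
  also have "... \<le> suminf \<mu> * (\<Sum>n. \<mu> n * (1 / norm (Complex c t - z n))^2)"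
    by (rule suminf_Cauchy_Schwarz[OF summ _ zsum_line_summable]) auto
  finally show ?thesis .
qed

lemma line_not_zero: "Complex c t \<notin> zeta_zeros (c - \<eta>)"
  using gap[of "Complex c t"] \<eta> by auto

lemma gfun_line_continuous: "continuous_on UNIV (\<lambda>t. gfun (Complex c t))"
  unfolding Complex_conv
  by (rule continuous_on_compose2[OF holomorphic_on_imp_continuous_on[OF gfun_holomorphic]])
     (use \<eta> in \<open>auto intro!: continuous_intros\<close>)

lemma kzeta_line_continuous: "continuous_on UNIV (\<lambda>t. - deriv kzeta (Complex c t) / (kzeta (Complex c t) * Complex c t) - 1 / Complex c t)"
proof -
  have hol: "deriv kzeta holomorphic_on {s. Re s > 0}" by (intro holomorphic_deriv kzeta_holomorphic open_halfspace_Re_gt)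
  have c0: "c > 0" using c \<eta> by simp
  have nz: "kzeta (Complex c t) \<noteq> 0" for t
    using line_not_zero[of t] c c0 \<eta> kzeta_1 kzeta_eq[of "Complex c t"] by (cases "Complex c t = 1") (auto simp: zeta_zeros_def)
  have cC: "continuous_on UNIV (Complex c)" unfolding Complex_conv[abs_def] by (intro continuous_intros)
  have 1: "continuous_on UNIV (\<lambda>t. deriv kzeta (Complex c t))"
    by (rule continuous_on_compose2[OF holomorphic_on_imp_continuous_on[OF hol] cC]) (use c0 in auto)
  have 2: "continuous_on UNIV (\<lambda>t. kzeta (Complex c t))"
    by (rule continuous_on_compose2[OF holomorphic_on_imp_continuous_on[OF kzeta_holomorphic] cC]) (use c0 in auto)
  have "Complex c t \<noteq> 0" for t using c0 by (auto simp: complex_eq_iff)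
  thus ?thesis using nz by (intro continuous_intros 1 2 cC) auto
qed

lemma log_deriv_kzeta_bound:
  "\<exists>C. C \<ge> 0 \<and> (\<forall>s. c \<le> Re s \<and> Re s \<le> 3 \<and> \<bar>Im s\<bar> \<ge> 20 \<and> (\<forall>w\<in>zeta_zeros (c - \<eta>). dist s w \<ge> \<eta>)
     \<longrightarrow> norm (- deriv kzeta s / (kzeta s * s) - 1 / s) \<le> C * ln \<bar>Im s\<bar> / \<bar>Im s\<bar>)"
proof -
  obtain C where C: "\<And>s. c \<le> Re s \<Longrightarrow> Re s \<le> 3 \<Longrightarrow> \<bar>Im s\<bar> \<ge> 20 \<Longrightarrow> (\<forall>w\<in>zeta_zeros (c - \<eta>). dist s w \<ge> \<eta>)
     \<Longrightarrow> norm (deriv zeta s / zeta s) \<le> C * ln \<bar>Im s\<bar>"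
    using zeta_log_deriv_bound[OF c \<eta> sep mult] by blast
  have "norm (- deriv kzeta s / (kzeta s * s) - 1 / s) \<le> (\<bar>C\<bar> + 2) * ln \<bar>Im s\<bar> / \<bar>Im s\<bar>"
    if s: "c \<le> Re s" "Re s \<le> 3" "\<bar>Im s\<bar> \<ge> 20" "\<forall>w\<in>zeta_zeros (c - \<eta>). dist s w \<ge> \<eta>" for s
  proof -
    define t where "t = \<bar>Im s\<bar>"
    have t: "t \<ge> 20" using s by (simp add: t_def)
    have s1: "Re s > 0" "s \<noteq> 1" using s c \<eta> by auto
    have "s \<notin> zeta_zeros (c - \<eta>)" using s(4) \<eta> by auto
    hence nz: "zeta s \<noteq> 0" using s1 s c \<eta> by (auto simp: zeta_zeros_def)
    have nt: "norm s \<ge> t" "norm (s - 1) \<ge> t" using abs_Im_le_cmod[of s] abs_Im_le_cmod[of "s - 1"] by (auto simp: t_def)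
    have lnt: "ln t \<ge> 1"
    proof -
      have "exp 1 \<le> t" using exp_le t by linarith
      thus ?thesis using t by (subst ln_ge_iff) auto
    qed
    have "- deriv kzeta s / (kzeta s * s) - 1 / s = - ((deriv zeta s / zeta s + 1 / (s - 1)) + 1) / s"
    proof -
      have a: "- A / s - 1 / s = - (A + 1) / s" for A by (simp add: diff_divide_distrib)
      have "- deriv kzeta s / (kzeta s * s) = - (deriv kzeta s / kzeta s) / s" by simp
      thus ?thesis unfolding kzeta_log_deriv[OF s1 nz] by (simp only: a)
    qed
    hence "norm (- deriv kzeta s / (kzeta s * s) - 1 / s) = norm ((deriv zeta s / zeta s + 1 / (s - 1)) + 1) / norm s"
      by (simp only: norm_divide norm_minus_cancel)
    also have "... \<le> (\<bar>C\<bar> + 2) * ln t / t"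
    proof (rule frac_le)
      have "norm ((deriv zeta s / zeta s + 1 / (s - 1)) + 1) \<le> norm (deriv zeta s / zeta s) + norm (1 / (s - 1)) + 1"
        by (metis norm_one norm_triangle_ineq norm_triangle_mono order_refl)
      also have "norm (deriv zeta s / zeta s) \<le> \<bar>C\<bar> * ln t"
        using order_trans[OF C[OF s] mult_right_mono[OF abs_ge_self[of C]]] lnt by (simp add: t_def)
      also have "norm (1 / (s - 1)) \<le> 1" using nt t by (auto simp: norm_divide divide_le_eq)
      finally show "norm ((deriv zeta s / zeta s + 1 / (s - 1)) + 1) \<le> (\<bar>C\<bar> + 2) * ln t" using lnt by (simp add: algebra_simps)
    qed (use nt t lnt in auto)
    finally show ?thesis by (simp add: t_def)
  qed
  thus ?thesis by (intro exI[of _ "\<bar>C\<bar> + 2"]) auto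
qed

text \<open>The logarithmic derivative divided by s decays like ln t / t, which is square
  integrable. The sum over the zeros is instead integrated zero by zero.\<close>

lemma gfun_line_L2: "integrable lborel (\<lambda>t. (norm (gfun (Complex c t)))^2)"
proof -
  define g1 where "g1 = (\<lambda>t. - deriv kzeta (Complex c t) / (kzeta (Complex c t) * Complex c t) - 1 / Complex c t)"
  define g2 where "g2 = (\<lambda>t. zsum z (Complex c t))"
  have geq: "gfun (Complex c t) = g1 t + g2 t" for t
    using gfun_eq[of "Complex c t"] line_not_zero \<eta> by (simp add: lfun_def g1_def g2_def)
  have g1c: "continuous_on UNIV g1" unfolding g1_def by (rule kzeta_line_continuous)
  have g2c: "continuous_on UNIV g2"
  proof -
    have "g2 = (\<lambda>t. gfun (Complex c t) - g1 t)" using geq by auto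
    thus ?thesis using gfun_line_continuous g1c by (auto intro: continuous_intros)
  qed
  have [measurable]: "g1 \<in> borel_measurable borel" "g2 \<in> borel_measurable borel"
    using g1c g2c by (auto intro: borel_measurable_continuous_onI)
  obtain C where C: "C \<ge> 0" "\<And>s. c \<le> Re s \<Longrightarrow> Re s \<le> 3 \<Longrightarrow> \<bar>Im s\<bar> \<ge> 20 \<Longrightarrow> (\<forall>w\<in>zeta_zeros (c - \<eta>). dist s w \<ge> \<eta>)
     \<Longrightarrow> norm (- deriv kzeta s / (kzeta s * s) - 1 / s) \<le> C * ln \<bar>Im s\<bar> / \<bar>Im s\<bar>"
    using log_deriv_kzeta_bound by blast
  have "compact (g1 ` {-20..20})" by (intro compact_continuous_image continuous_on_subset[OF g1c]) auto
  from compact_imp_bounded[OF this] obtain B where B: "\<And>t. t \<in> {-20..20} \<Longrightarrow> norm (g1 t) \<le> B"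
    unfolding bounded_iff by blast
  have B0: "B \<ge> 0" using order_trans[OF norm_ge_zero B[of 0]] by simp
  \<comment> \<open>For |t| \<le> 20 the continuous g1 is at most B, and 1 + |t| \<le> 21 is below
    63. Beyond that, ln t \<le> 4 t^(1/4) and the passage from |t| to 1 + |t|, which costs a factor
    2, lead to 8 C.\<close>
  define D where "D = 63 * B + 8 * C"
  have D0: "D \<ge> 0" using B0 C by (simp add: D_def)
  have g1b: "norm (g1 t) \<le> D * (1 + \<bar>t\<bar>) powr (-3/4)" for t
  proof (cases "\<bar>t\<bar> \<le> 20")
    case True
    have "norm (g1 t) \<le> B" by (rule B) (use True in auto)
    also have "B \<le> B * (63 * (1 + \<bar>t\<bar>) powr (-3/4))"
    proof -
      have "(1 + \<bar>t\<bar>) powr (3/4) \<le> (1 + \<bar>t\<bar>) powr 1" by (intro powr_mono) auto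
      also have "... \<le> 63" using True by simp
      finally have "1 \<le> 63 * (1 + \<bar>t\<bar>) powr (-3/4)" by (simp add: powr_minus field_simps)
      thus ?thesis using mult_left_mono[of 1 _ B] B0 by simp
    qed
    also have "... \<le> D * (1 + \<bar>t\<bar>) powr (-3/4)" using C(1) by (simp add: D_def algebra_simps)
    finally show ?thesis .
  next
    case False
    hence t: "\<bar>t\<bar> \<ge> 20" by simp
    have "norm (g1 t) \<le> C * ln \<bar>t\<bar> / \<bar>t\<bar>"
    proof -
      have f: "\<forall>w\<in>zeta_zeros (c - \<eta>). dist (Complex c t) w \<ge> \<eta>"
        unfolding range[symmetric] using line_dist by (auto simp: dist_norm)
      show ?thesis unfolding g1_def using C(2)[OF _ _ _ f] t c by simp
    qed
    also have "ln \<bar>t\<bar> \<le> \<bar>t\<bar> powr (1/4) / (1/4)" using t by (intro ln_powr_bound) auto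
    hence "C * ln \<bar>t\<bar> / \<bar>t\<bar> \<le> C * (\<bar>t\<bar> powr (1/4) / (1/4)) / \<bar>t\<bar>"
      using C t by (intro divide_right_mono mult_left_mono) auto
    also have "... = 4 * C * \<bar>t\<bar> powr (-3/4)"
    proof -
      have "\<bar>t\<bar> powr (1/4) / \<bar>t\<bar> powr 1 = \<bar>t\<bar> powr (1/4 - 1)" by (rule powr_diff[symmetric])
      hence "\<bar>t\<bar> powr (1/4) / \<bar>t\<bar> = \<bar>t\<bar> powr (-3/4)" using t by simp
      moreover have "C * (\<bar>t\<bar> powr (1/4) / (1/4)) / \<bar>t\<bar> = 4 * C * (\<bar>t\<bar> powr (1/4) / \<bar>t\<bar>)" by simp
      ultimately show ?thesis by (simp only:)
    qed
    also have "\<bar>t\<bar> powr (-3/4) \<le> 2 * (1 + \<bar>t\<bar>) powr (-3/4)"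
    proof -
      have "(1 + \<bar>t\<bar>) powr (3/4) \<le> (2 * \<bar>t\<bar>) powr (3/4)" using t by (intro powr_mono2) auto
      also have "... = 2 powr (3/4) * \<bar>t\<bar> powr (3/4)" by (rule powr_mult)
      also have "(2::real) powr (3/4) \<le> 2 powr 1" by (intro powr_mono) auto
      finally have "(1 + \<bar>t\<bar>) powr (3/4) \<le> 2 * \<bar>t\<bar> powr (3/4)" by (simp add: mult_right_mono)
      thus ?thesis using t by (simp add: powr_minus_divide field_simps)
    qed
    hence "4 * C * \<bar>t\<bar> powr (-3/4) \<le> 4 * C * (2 * (1 + \<bar>t\<bar>) powr (-3/4))" using C by (intro mult_left_mono) auto
    also have "... \<le> D * (1 + \<bar>t\<bar>) powr (-3/4)" using B0 by (simp add: D_def algebra_simps)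
    finally show ?thesis .
  qed
  have i1: "integrable lborel (\<lambda>t. (norm (g1 t))^2)"
  proof (rule Bochner_Integration.integrable_bound[OF integrable_mult_right[OF integrable_one_plus_abs_powr, of "D^2"]])
    have "(norm (g1 t))^2 \<le> D^2 * (1 + \<bar>t\<bar>) powr (-3/2)" for t
    proof -
      have "(norm (g1 t))^2 \<le> (D * (1 + \<bar>t\<bar>) powr (-3/4))^2" using g1b by (intro power_mono) auto
      also have "... = D^2 * (1 + \<bar>t\<bar>) powr (-3/2)" by (simp add: power_mult_distrib power2_eq_square powr_add[symmetric])
      finally show ?thesis .
    qed
    thus "AE t in lborel. norm ((norm (g1 t))^2) \<le> norm (D^2 * (1 + \<bar>t\<bar>) powr (-3/2))" by simp
  qed auto
  have i2: "integrable lborel (\<lambda>t. (norm (g2 t))^2)"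
  proof (rule integrableI_bounded)
    define A where "A = suminf \<mu>"
    have A0: "A \<ge> 0" unfolding A_def by (rule suminf_nonneg[OF summ]) auto
    \<comment> \<open>The integral of 1 / |c + i t - z|^2 over the line is pi / (Re z - c), and the
      zero-free strip gives Re z - c \<ge> \<eta>.\<close>
    have Q: "(\<integral>\<^sup>+ t. ennreal ((1 / norm (Complex c t - z n))^2) \<partial>lborel) \<le> ennreal (pi / \<eta>)" for n
    proof -
      define k where "k = Re (z n) - c"
      have k: "k \<ge> \<eta>" "k > 0" using z_props(1)[of n] \<eta> by (auto simp: k_def)
      have "(1 / norm (Complex c t - z n))^2 = 1 / (2 * k) * (2 * k / (k^2 + (Im (z n) - t)^2))" for t
        using k by (simp add: cmod_power2 power_divide k_def power2_commute)
      hence "(\<integral>\<^sup>+ t. ennreal ((1 / norm (Complex c t - z n))^2) \<partial>lborel) = (\<integral>\<^sup>+ t. ennreal (1 / (2 * k)) * ennreal (2 * k / (k^2 + (Im (z n) - t)^2)) \<partial>lborel)"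
        using k by (simp only: ennreal_mult' zero_le_divide_1_iff mult_nonneg_nonneg less_imp_le)
      also have "... = ennreal (1 / (2 * k)) * (\<integral>\<^sup>+ t. ennreal (2 * k / (k^2 + (Im (z n) - t)^2)) \<partial>lborel)"
        by (rule nn_integral_cmult) measurable
      also have "... = ennreal (1 / (2 * k)) * ennreal (2 * pi)" by (simp only: nn_integral_poisson[OF k(2)])
      also have "... = ennreal (pi / k)" using k by (subst ennreal_mult'[symmetric]) auto
      also have "... \<le> ennreal (pi / \<eta>)" using k \<eta> by (intro ennreal_leI divide_left_mono mult_pos_pos) auto
      finally show ?thesis .
    qed
    have "(\<integral>\<^sup>+ t. ennreal (norm ((norm (g2 t))^2)) \<partial>lborel) \<le> (\<integral>\<^sup>+ t. ennreal A * (\<Sum>n. ennreal (\<mu> n * (1 / norm (Complex c t - z n))^2)) \<partial>lborel)"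
    proof (rule nn_integral_mono)
      fix t
      have "ennreal (norm ((norm (g2 t))^2)) \<le> ennreal (A * (\<Sum>n. \<mu> n * (1 / norm (Complex c t - z n))^2))"
        using zsum_line_bound[of t] by (intro ennreal_leI) (simp add: A_def g2_def)
      also have "... = ennreal A * (\<Sum>n. ennreal (\<mu> n * (1 / norm (Complex c t - z n))^2))"
        using A0 zsum_line_summable(2)[of t] by (subst ennreal_mult') (auto simp: suminf_ennreal2)
      finally show "ennreal (norm ((norm (g2 t))^2)) \<le> ennreal A * (\<Sum>n. ennreal (\<mu> n * (1 / norm (Complex c t - z n))^2))" .
    qed
    also have "... = ennreal A * (\<integral>\<^sup>+ t. (\<Sum>n. ennreal (\<mu> n * (1 / norm (Complex c t - z n))^2)) \<partial>lborel)"
      unfolding Complex_conv by (rule nn_integral_cmult) measurable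
    also have "(\<integral>\<^sup>+ t. (\<Sum>n. ennreal (\<mu> n * (1 / norm (Complex c t - z n))^2)) \<partial>lborel) = (\<Sum>n. \<integral>\<^sup>+ t. ennreal (\<mu> n * (1 / norm (Complex c t - z n))^2) \<partial>lborel)"
      unfolding Complex_conv by (rule nn_integral_suminf) measurable
    also have "... \<le> (\<Sum>n. ennreal (\<mu> n * (pi / \<eta>)))"
    proof (rule suminf_le)
      fix n
      have "(\<integral>\<^sup>+ t. ennreal (\<mu> n * (1 / norm (Complex c t - z n))^2) \<partial>lborel) = ennreal (\<mu> n) * (\<integral>\<^sup>+ t. ennreal ((1 / norm (Complex c t - z n))^2) \<partial>lborel)"
        unfolding Complex_conv by (subst nn_integral_cmult[symmetric]) (measurable, simp only: ennreal_mult' divide_nonneg_nonneg of_nat_0_le_iff norm_ge_zero)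
      also have "... \<le> ennreal (\<mu> n) * ennreal (pi / \<eta>)" by (intro mult_left_mono Q) auto
      also have "... = ennreal (\<mu> n * (pi / \<eta>))" by (rule ennreal_mult'[symmetric]) auto
      finally show "(\<integral>\<^sup>+ t. ennreal (\<mu> n * (1 / norm (Complex c t - z n))^2) \<partial>lborel) \<le> ennreal (\<mu> n * (pi / \<eta>))" .
    qed auto
    also have "(\<Sum>n. ennreal (\<mu> n * (pi / \<eta>))) = ennreal (\<Sum>n. \<mu> n * (pi / \<eta>))"
      using \<eta> by (intro suminf_ennreal2 summable_mult2 summ) auto
    finally have "(\<integral>\<^sup>+ t. ennreal (norm ((norm (g2 t))^2)) \<partial>lborel) \<le> ennreal A * ennreal (\<Sum>n. \<mu> n * (pi / \<eta>))"
      by (meson mult_left_mono order_trans zero_le)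
    also have "... < \<infinity>" by (simp add: ennreal_mult_less_top)
    finally show "(\<integral>\<^sup>+ t. ennreal (norm ((norm (g2 t))^2)) \<partial>lborel) < \<infinity>" .
  qed auto
  show ?thesis
  proof (rule Bochner_Integration.integrable_bound[OF integrable_mult_right[OF Bochner_Integration.integrable_add[OF i1 i2], of 2]])
    have "(norm (g1 t + g2 t))^2 \<le> 2 * ((norm (g1 t))^2 + (norm (g2 t))^2)" for t
    proof -
      have "(norm (g1 t + g2 t))^2 \<le> (norm (g1 t) + norm (g2 t))^2" by (intro power_mono norm_triangle_ineq) auto
      also have "... \<le> 2 * ((norm (g1 t))^2 + (norm (g2 t))^2)"
        using sum_squares_bound[of "norm (g1 t)" "norm (g2 t)"] by (simp add: power2_sum)
      finally show ?thesis .
    qed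
    thus "AE t in lborel. norm ((norm (gfun (Complex c t)))^2) \<le> norm (2 * ((norm (g1 t))^2 + (norm (g2 t))^2))"
      unfolding geq by (intro always_eventually allI) (simp add: abs_mult)
  qed (auto simp: geq)
qed

end

lemma cnj_eq_one_iff: "cnj w = 1 \<longleftrightarrow> w = 1"
  by (metis complex_cnj_cnj complex_cnj_one)

text \<open>The factorization of \<open>zeta\<close> at w is reflected into one at the conjugate
  point, with the same exponent.\<close>

lemma zeta_zero_mult_cnj: "zeta_zero_mult (cnj w) = zeta_zero_mult w"
proof (cases "w \<noteq> 1 \<and> zeta w = 0")
  case False
  thus ?thesis by (auto simp: zeta_zero_mult_def zeta_cnj cnj_eq_one_iff)
next
  case True
  have op: "open (UNIV - {1::complex})" by (intro open_Diff) auto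
  have "zeta 3 \<noteq> 0" using zeta_3_lower[of 3] by auto
  hence nz: "\<exists>x\<in>UNIV - {1}. zeta x \<noteq> 0" by (intro bexI[of _ 3]) auto
  have wS: "w \<in> UNIV - {1}" using True by auto
  have pos: "zorder zeta w > 0" using zorder_exist_zero[OF zeta_holomorphic op connected_minus_one wS nz] True by auto
  obtain h where h: "h holomorphic_on UNIV - {1}" "h w \<noteq> 0" "\<And>s. s \<in> UNIV - {1} \<Longrightarrow> zeta s = (s - w) ^ nat (zorder zeta w) * h s"
    using holomorphic_factor_zero[OF op connected_minus_one zeta_holomorphic wS nz] by metis
  define g where "g = (\<lambda>s. cnj (h (cnj s)))"
  have "zorder zeta (cnj w) = zorder zeta w"
  proof (rule zorder_eqI[OF op])
    show "cnj w \<in> UNIV - {1}" using True by (auto simp: cnj_eq_one_iff)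
    have "cnj ` (UNIV - {1}) = UNIV - {1}" by (auto simp: image_cnj_conv_vimage_cnj)
    hence "(cnj \<circ> h \<circ> cnj) holomorphic_on (UNIV - {1})"
      using h(1) op by (intro holomorphic_on_compose_cnj_cnj) auto
    thus "g holomorphic_on UNIV - {1}" by (simp add: g_def o_def)
    show "g (cnj w) \<noteq> 0" using h(2) by (simp add: g_def)
    fix s assume s: "s \<in> UNIV - {1}" "s \<noteq> cnj w"
    have "cnj s \<in> UNIV - {1}" using s by (auto simp: cnj_eq_one_iff)
    from h(3)[OF this] have "zeta s = cnj ((cnj s - w) ^ nat (zorder zeta w) * h (cnj s))"
      by (metis complex_cnj_cnj zeta_cnj)
    hence "zeta s = g s * (s - cnj w) ^ nat (zorder zeta w)" by (simp add: g_def)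
    thus "zeta s = g s * (s - cnj w) powi zorder zeta w" using pos by (simp add: power_int_def)
  qed
  thus ?thesis using True by (auto simp: zeta_zero_mult_def zeta_cnj cnj_eq_one_iff)
qed

lemma psi_cong_floor:
  assumes "\<lfloor>x\<rfloor> = \<lfloor>y\<rfloor>"
  shows "psi x = psi y"
proof -
  have "real n \<le> x \<longleftrightarrow> real n \<le> y" for n
    using assms le_floor_iff[of "int n" x] le_floor_iff[of "int n" y] by simp
  thus ?thesis by (simp add: psi_def)
qed

lemma isCont_psi_exp:
  assumes v: "\<forall>n::nat. v \<noteq> ln (real n)"
  shows "isCont (\<lambda>v. psi (exp v)) v"
proof -
  define k where "k = \<lfloor>exp v\<rfloor>"
  have k0: "k \<ge> 0" by (simp add: k_def)
  have "real_of_int k \<noteq> exp v"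
  proof
    assume "real_of_int k = exp v"
    hence "real (nat k) = exp v" using k0 by simp
    thus False using v[rule_format, of "nat k"] by simp
  qed
  hence k: "real_of_int k < exp v" "exp v < real_of_int k + 1" unfolding k_def by linarith+
  have "(exp \<longlongrightarrow> exp v) (at v)" by (intro tendsto_intros)
  hence "eventually (\<lambda>y. exp y > real_of_int k) (at v)" "eventually (\<lambda>y. exp y < real_of_int k + 1) (at v)"
    using order_tendstoD k by blast+
  hence "eventually (\<lambda>y. psi (exp v) = psi (exp y)) (at v)"
  proof eventually_elim
    case (elim y)
    hence "\<lfloor>exp y\<rfloor> = k" by linarith
    thus ?case by (intro psi_cong_floor) (simp add: k_def)
  qed
  thus ?thesis unfolding isCont_def by (rule Lim_transform_eventually[OF tendsto_const])
qed

section \<open>The remainder in the explicit formula and its mean square\<close>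

context zeta_zero_config
begin

definition Sc :: "real \<Rightarrow> complex" where
  "Sc v = (\<Sum>n. of_nat (zeta_zero_mult (z n)) * exp (z n * of_real v) / z n)"

lemma Sc_term_bound: "norm (of_nat (zeta_zero_mult (z n)) * exp (z n * of_real v) / z n) \<le> \<mu> n * exp \<bar>v\<bar>"
proof -
  have "Re (z n) * v \<le> \<bar>v\<bar>"
  proof -
    have "Re (z n) * v \<le> Re (z n) * \<bar>v\<bar>" using z_props(1)[of n] c \<eta> by (intro mult_left_mono) auto
    also have "... \<le> \<bar>v\<bar>" using z_props(1,2)[of n] c \<eta> by (intro mult_left_le_one_le) auto
    finally show ?thesis .
  qed
  hence "norm (exp (z n * of_real v)) \<le> exp \<bar>v\<bar>" by (simp add: norm_exp_eq_Re)
  hence "\<mu> n * norm (exp (z n * of_real v)) \<le> \<mu> n * exp \<bar>v\<bar>" by (intro mult_left_mono) auto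
  thus ?thesis by (simp add: norm_divide norm_mult)
qed

lemma Sc_norm_summable: "summable (\<lambda>n. norm (of_nat (zeta_zero_mult (z n)) * exp (z n * of_real v) / z n))"
  by (rule summable_comparison_test'[OF summable_mult2[OF summ, of "exp \<bar>v\<bar>"]]) (use Sc_term_bound in auto)

lemma Sc_bound: "norm (Sc v) \<le> suminf \<mu> * exp \<bar>v\<bar>"
proof -
  have "norm (Sc v) \<le> (\<Sum>n. \<mu> n * exp \<bar>v\<bar>)" unfolding Sc_def
    by (rule norm_suminf_le[OF Sc_term_bound summable_mult2[OF summ]])
  also have "... = suminf \<mu> * exp \<bar>v\<bar>" by (rule suminf_mult2[symmetric, OF summ])
  finally show ?thesis .
qed

lemma Sc_has_sum: "((\<lambda>w. of_nat (zeta_zero_mult w) * exp (w * of_real v) / w) has_sum Sc v) (zeta_zeros (c - \<eta>))"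
proof -
  have "((\<lambda>n. of_nat (zeta_zero_mult (z n)) * exp (z n * of_real v) / z n) has_sum Sc v) UNIV"
    unfolding Sc_def by (intro norm_summable_imp_has_sum Sc_norm_summable summable_sums summable_norm_cancel[OF Sc_norm_summable])
  thus ?thesis unfolding range[symmetric] has_sum_reindex[OF inj] by (simp add: o_def)
qed

text \<open>The zeros come in conjugate pairs of equal multiplicity, and the unordered sum may be
  re-indexed by \<open>cnj\<close>. The enumeration \<open>z\<close> itself respects no such
  symmetry, hence the detour through \<open>has_sum\<close>.\<close>

lemma Sc_real: "of_real (Re (Sc v)) = Sc v"
proof -
  define F where "F = (\<lambda>w. of_nat (zeta_zero_mult w) * exp (w * of_real v) / w)"
  define Z where "Z = zeta_zeros (c - \<eta>)"
  have F: "(F has_sum Sc v) Z" unfolding F_def Z_def by (rule Sc_has_sum)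
  have "((\<lambda>w. cnj (F w)) has_sum cnj (Sc v)) Z" using F by simp
  also have "(\<lambda>w. cnj (F w)) = F \<circ> cnj" by (auto simp: F_def zeta_zero_mult_cnj exp_cnj)
  finally have "(F has_sum cnj (Sc v)) (cnj ` Z)" by (subst has_sum_reindex) (auto intro: inj_onI simp: o_def)
  moreover have "cnj ` Z = Z"
    unfolding Z_def using cnj_zero[of _ "c - \<eta>"] by (auto simp: image_iff) (metis complex_cnj_cnj)
  ultimately have "cnj (Sc v) = Sc v" using F has_sum_unique by metis
  hence "Im (Sc v) = 0" by (simp add: complex_eq_iff)
  thus ?thesis by (simp add: complex_eq_iff)
qed

lemma Sc_isCont: "isCont Sc v"
proof -
  define V where "V = \<bar>v\<bar> + 1"
  have "uniform_limit {-V..V} (\<lambda>N v. \<Sum>n<N. of_nat (zeta_zero_mult (z n)) * exp (z n * of_real v) / z n) (\<lambda>v. \<Sum>n. of_nat (zeta_zero_mult (z n)) * exp (z n * of_real v) / z n) sequentially"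
  proof (rule Weierstrass_m_test[OF _ summable_mult2[OF summ, of "exp V"]])
    fix n x assume "x \<in> {-V..V}"
    hence "\<mu> n * exp \<bar>x\<bar> \<le> \<mu> n * exp V" by (intro mult_left_mono) auto
    thus "norm (of_nat (zeta_zero_mult (z n)) * exp (z n * of_real x) / z n) \<le> \<mu> n * exp V"
      using Sc_term_bound[of n x] by linarith
  qed
  hence "continuous_on {-V..V} Sc" unfolding Sc_def[abs_def]
    by (rule uniform_limit_theorem[rotated]) (use z_props(3) in \<open>auto intro!: always_eventually continuous_intros\<close>)
  thus ?thesis by (rule continuous_on_interior) (auto simp: V_def interior_atLeastAtMost_real)
qed

text \<open>The remainder of the explicit formula at x = exp v. It is cut off at v \<le> 0 so that
  its Laplace integral is one-sided.\<close>

definition ez :: "real \<Rightarrow> real" where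
  "ez v = (if v \<le> 0 then 0 else psi (exp v) - exp v + Re (Sc v))"

lemma ez_measurable: "ez \<in> borel_measurable borel"
proof -
  have [measurable]: "(\<lambda>v. psi (exp v)) \<in> borel_measurable borel"
    by (rule borel_measurable_mono) (auto intro!: monoI psi_mono)
  have [measurable]: "Sc \<in> borel_measurable borel"
    by (rule borel_measurable_continuous_onI) (use Sc_isCont in \<open>simp add: continuous_on_eq_continuous_at\<close>)
  show ?thesis unfolding ez_def by measurable
qed

lemma ez_bound: "\<bar>ez v\<bar> \<le> (2 + suminf \<mu>) * exp (2 * v)"
proof (cases "v \<le> 0")
  case True
  have "suminf \<mu> \<ge> 0" by (rule suminf_nonneg[OF summ]) auto
  thus ?thesis using True by (simp add: ez_def)
next
  case False
  have "v \<le> exp v" using exp_ge_add_one_self[of v] by linarith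
  have e2: "exp (2 * v) = exp v * exp v" by (simp add: exp_add[symmetric])
  have e3: "exp v \<le> exp (2 * v)" using False by simp
  have "psi (exp v) \<le> exp v * v" using psi_le[of "exp v"] False by simp
  also have "... \<le> exp (2 * v)" using \<open>v \<le> exp v\<close> unfolding e2 by (intro mult_left_mono) auto
  finally have "psi (exp v) \<le> exp (2 * v)" .
  moreover have "\<bar>Re (Sc v)\<bar> \<le> suminf \<mu> * exp (2 * v)"
  proof -
    have "\<bar>Re (Sc v)\<bar> \<le> norm (Sc v)" by (rule abs_Re_le_cmod)
    also have "... \<le> suminf \<mu> * exp v" using Sc_bound[of v] False by simp
    also have "... \<le> suminf \<mu> * exp (2 * v)" by (intro mult_left_mono e3 suminf_nonneg[OF summ]) auto
    finally show ?thesis .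
  qed
  moreover have "ez v = psi (exp v) - exp v + Re (Sc v)" using False by (simp add: ez_def)
  ultimately show ?thesis using psi_nonneg[of "exp v"] e3 exp_gt_zero[of v] unfolding distrib_right by linarith
qed

lemma ez_isCont: "AE v in lborel. isCont ez v"
  using AE_not_ln_nat
proof eventually_elim
  case (elim v)
  hence "v \<noteq> 0" using elim[rule_format, of 1] by simp
  show ?case
  proof (cases "v < 0")
    case True
    have "eventually (\<lambda>y. 0 = ez y) (nhds v)"
      by (rule eventually_mono[OF eventually_nhds_in_open[of "{..<0}"]]) (use True in \<open>auto simp: ez_def\<close>)
    thus ?thesis using isCont_cong[of "\<lambda>_. 0" ez v] by simp
  next
    case False
    hence v: "v > 0" using \<open>v \<noteq> 0\<close> by simp
    have "eventually (\<lambda>y. psi (exp y) - exp y + Re (Sc y) = ez y) (nhds v)"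
      by (rule eventually_mono[OF eventually_nhds_in_open[of "{0<..}"]]) (use v in \<open>auto simp: ez_def\<close>)
    moreover have "isCont (\<lambda>y. psi (exp y) - exp y + Re (Sc y)) v"
      by (intro continuous_intros isCont_psi_exp elim bounded_linear.isCont[OF bounded_linear_Re Sc_isCont])
    ultimately show ?thesis by (simp only: isCont_cong)
  qed
qed

text \<open>An abscissa above 2 is required by \<open>laplace_L2_continuation\<close>; at 3,
  \<open>zeta_3_lower\<close> also supplies that \<open>zeta\<close> does not vanish.\<close>

lemma ez_laplace: "gfun (Complex 3 t) = (LINT v|lborel. of_real (ez v) * exp (- Complex 3 t * of_real v))"
proof -
  define s where "s = Complex 3 t"
  have s: "Re s = 3" "s \<noteq> 0" "s \<noteq> 1" by (auto simp: s_def complex_eq_iff)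
  have nz: "zeta s \<noteq> 0" using zeta_3_lower[OF s(1)] by auto
  define f where "f = (\<lambda>n v. of_nat (zeta_zero_mult (z n)) / z n * (indicator {0<..} v *\<^sub>R exp (- (s - z n) * of_real v)))"
  have Re_pos: "Re (s - z n) > 0" for n using z_props(2)[of n] s by simp
  have fi: "integrable lborel (f n)" for n unfolding f_def by (intro integrable_mult_right laplace_exp_shift(1) Re_pos)
  have fv: "(LINT v|lborel. f n v) = of_nat (zeta_zero_mult (z n)) / (z n * (s - z n))" for n
    unfolding f_def integral_mult_right_zero laplace_exp_shift(2)[OF Re_pos] by simp
  have fn: "(LINT v|lborel. norm (f n v)) \<le> \<mu> n" for n
  proof -
    have "(LINT v|lborel. norm (f n v)) = norm (of_nat (zeta_zero_mult (z n)) / z n) * (exp (- Re (s - z n) * 0) / Re (s - z n))"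
      unfolding f_def norm_mult by (subst integral_mult_right_zero) (simp only: laplace_exp_shift(3)[OF Re_pos])
    also have "... = \<mu> n / Re (s - z n)" by (simp add: norm_divide)
    also have "... \<le> \<mu> n / 1" using z_props(2)[of n] s by (intro divide_left_mono) auto
    finally show ?thesis by simp
  qed
  have sm: "summable (\<lambda>n. LINT v|lborel. norm (f n v))"
    by (rule summable_comparison_test'[OF summ]) (use fn in auto)
  have f_eq: "f n v = of_nat (zeta_zero_mult (z n)) * exp (z n * of_real v) / z n * (indicator {0<..} v *\<^sub>R exp (- s * of_real v))" for n v
  proof -
    have "exp (- (s - z n) * of_real v) = exp (z n * of_real v) * exp (- s * of_real v)"
      by (simp add: exp_add[symmetric] algebra_simps)
    thus ?thesis by (simp add: f_def)
  qed
  have AE2: "AE v in lborel. summable (\<lambda>n. norm (f n v))"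
    unfolding f_eq norm_mult[of "_ / _"] by (intro always_eventually allI summable_mult2 Sc_norm_summable)
  have fsum: "(\<Sum>n. f n v) = Sc v * (indicator {0<..} v *\<^sub>R exp (- s * of_real v))" for v
    unfolding f_eq Sc_def by (rule suminf_mult2[symmetric, OF summable_norm_cancel[OF Sc_norm_summable]])
  have I3: "integrable lborel (\<lambda>v. Sc v * (indicator {0<..} v *\<^sub>R exp (- s * of_real v)))"
    "(LINT v|lborel. Sc v * (indicator {0<..} v *\<^sub>R exp (- s * of_real v))) = zsum z s"
    using integrable_suminf[OF fi AE2 sm] integral_suminf[OF fi AE2 sm] unfolding fsum fv zsum_def by auto
  have Re1: "Re (s - 1) > 0" using s by simp
  have I2: "integrable lborel (\<lambda>v. indicator {0<..} v *\<^sub>R exp (- (s - 1) * of_real v))"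
    "(LINT v|lborel. indicator {0<..} v *\<^sub>R exp (- (s - 1) * of_real v)) = 1 / (s - 1)"
    using laplace_exp_shift(1,2)[OF Re1, of 0] by auto
  have I1: "integrable lborel (\<lambda>v. of_real (indicator {0<..} v * psi (exp v)) * exp (- s * of_real v))"
    "(LINT v|lborel. of_real (indicator {0<..} v * psi (exp v)) * exp (- s * of_real v)) = - deriv zeta s / (zeta s * s)"
    using laplace_psi[of s] s nz by auto
  have "of_real (ez v) * exp (- s * of_real v) = of_real (indicator {0<..} v * psi (exp v)) * exp (- s * of_real v)
     - indicator {0<..} v *\<^sub>R exp (- (s - 1) * of_real v) + Sc v * (indicator {0<..} v *\<^sub>R exp (- s * of_real v))" for v
  proof (cases "v \<le> 0")
    case False
    have A: "of_real (ez v) = of_real (psi (exp v)) - exp (of_real v) + Sc v"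
      using False Sc_real[of v] by (simp add: ez_def exp_of_real)
    have B: "exp (- (s - 1) * of_real v) = exp (of_real v) * exp (- s * of_real v)"
      by (simp add: exp_add[symmetric] algebra_simps)
    show ?thesis unfolding A B using False by (simp add: distrib_right left_diff_distrib)
  qed (simp add: ez_def)
  hence "(LINT v|lborel. of_real (ez v) * exp (- s * of_real v)) = - deriv zeta s / (zeta s * s) - 1 / (s - 1) + zsum z s"
    by (simp only: Bochner_Integration.integral_add[OF Bochner_Integration.integrable_diff[OF I1(1) I2(1)] I3(1)]
       Bochner_Integration.integral_diff[OF I1(1) I2(1)] I1(2) I2(2) I3(2))
  moreover have "gfun s = lfun z s"
    using s c \<eta> nz by (intro gfun_eq) (auto simp: zeta_zeros_def)
  moreover have "lfun z s = - deriv zeta s / (zeta s * s) - 1 / (s - 1) + zsum z s"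
  proof -
    have "- deriv kzeta s / (kzeta s * s) = - (deriv kzeta s / kzeta s) / s" by simp
    also have "deriv kzeta s / kzeta s = deriv zeta s / zeta s + 1 / (s - 1)" using s nz by (intro kzeta_log_deriv) auto
    finally have k: "- deriv kzeta s / (kzeta s * s) = - (deriv zeta s / zeta s + 1 / (s - 1)) / s" .
    have "1 / (s - 1) / s + 1 / s = 1 / (s - 1)" using s by (simp add: field_simps)
    moreover have "- (D + q) / s - 1 / s = - D / s - (q / s + 1 / s)" for D q by (simp add: add_divide_distrib diff_divide_distrib)
    ultimately have "- (deriv zeta s / zeta s + 1 / (s - 1)) / s - 1 / s = - (deriv zeta s / zeta s) / s - 1 / (s - 1)" by (simp only:)
    thus ?thesis unfolding lfun_def k by simp
  qed
  ultimately show ?thesis by (simp add: s_def)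
qed

text \<open>If a zero lies within 2 of the height 20 + n, then none lies within 2 of 25 + n: the
  same zero cannot be close to both, and two different ones would differ by less than 9 in height
  and by less than 1 in real part, against the separation 10.\<close>

lemma zero_free_heights:
  "\<exists>T. filterlim T at_top sequentially \<and> (\<forall>n. T n \<ge> 20 \<and> (\<forall>w\<in>zeta_zeros (c - \<eta>). \<bar>Im w - T n\<bar> \<ge> 2))"
proof -
  define bad where "bad = (\<lambda>x. \<exists>w\<in>zeta_zeros (c - \<eta>). \<bar>Im w - x\<bar> < 2)"
  define T where "T = (\<lambda>n. if bad (20 + real n) then 25 + real n else 20 + real n)"
  have "\<not> bad (T n)" for n
  proof (cases "bad (20 + real n)")
    case True
    then obtain w where w: "w \<in> zeta_zeros (c - \<eta>)" "\<bar>Im w - (20 + real n)\<bar> < 2" by (auto simp: bad_def)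
    show ?thesis
    proof
      assume "bad (T n)"
      then obtain w' where w': "w' \<in> zeta_zeros (c - \<eta>)" "\<bar>Im w' - (25 + real n)\<bar> < 2"
        using True by (auto simp: bad_def T_def)
      have "w \<noteq> w'" using w(2) w'(2) by auto
      hence "dist w w' \<ge> 10" using sep w w' by blast
      moreover have "\<bar>Re (w - w')\<bar> < 1" "\<bar>Im (w - w')\<bar> < 9" using gap[OF w(1)] gap[OF w'(1)] c \<eta> w(2) w'(2) by auto
      ultimately show False using cmod_le[of "w - w'"] by (simp add: dist_norm)
    qed
  qed (simp add: T_def)
  hence "\<forall>n. T n \<ge> 20 \<and> (\<forall>w\<in>zeta_zeros (c - \<eta>). \<bar>Im w - T n\<bar> \<ge> 2)" by (auto simp: bad_def T_def not_less)
  moreover have "filterlim T at_top sequentially"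
  proof (rule filterlim_at_top_mono)
    show "filterlim (\<lambda>n. 20 + real n) at_top sequentially" by real_asymp
  qed (auto simp: T_def)
  ultimately show ?thesis by blast
qed

theorem ez_L2: "\<exists>M. (\<integral>\<^sup>+ v. ennreal ((ez v)^2 * exp (- 2 * c * v)) \<partial>lborel) \<le> ennreal M"
proof -
  obtain T where T: "filterlim T at_top sequentially" "\<And>n. T n \<ge> 20"
    "\<And>n w. w \<in> zeta_zeros (c - \<eta>) \<Longrightarrow> \<bar>Im w - T n\<bar> \<ge> 2" using zero_free_heights by blast
  obtain C where C: "C \<ge> 0" "\<And>s. c \<le> Re s \<Longrightarrow> Re s \<le> 3 \<Longrightarrow> \<bar>Im s\<bar> \<ge> 20 \<Longrightarrow> (\<forall>w\<in>zeta_zeros (c - \<eta>). dist s w \<ge> \<eta>)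
     \<Longrightarrow> norm (- deriv kzeta s / (kzeta s * s) - 1 / s) \<le> C * ln \<bar>Im s\<bar> / \<bar>Im s\<bar>"
    using log_deriv_kzeta_bound by blast
  define A where "A = suminf \<mu>"
  have A0: "A \<ge> 0" unfolding A_def by (rule suminf_nonneg[OF summ]) auto
  have gb: "norm (gfun (Complex x y)) \<le> (C + A) * T n" if x: "c \<le> x" "x \<le> 3" and y: "y = T n \<or> y = - T n" for x y n
  proof -
    define s where "s = Complex x y"
    have far: "dist s w \<ge> 2" if w: "w \<in> zeta_zeros (c - \<eta>)" for w
    proof -
      have "\<bar>Im w - y\<bar> \<ge> 2"
        using y T(3)[OF w, of n] T(3)[OF cnj_zero[OF w], of n] by auto
      thus ?thesis using abs_Im_le_cmod[of "s - w"] by (simp add: s_def dist_norm)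
    qed
    have ns: "s \<notin> zeta_zeros (c - \<eta>)" using far[of s] by auto
    have Ims: "\<bar>Im s\<bar> = T n" using y T(2)[of n] by (auto simp: s_def)
    have g: "gfun s = (- deriv kzeta s / (kzeta s * s) - 1 / s) + zsum z s"
      using gfun_eq[of s] ns x \<eta> by (simp add: s_def lfun_def)
    have "norm (- deriv kzeta s / (kzeta s * s) - 1 / s) \<le> C * ln (T n) / T n"
    proof -
      have f: "\<forall>w\<in>zeta_zeros (c - \<eta>). dist s w \<ge> \<eta>" using far \<eta> by force
      show ?thesis using C(2)[OF _ _ _ f] x Ims T(2)[of n] by (simp add: s_def)
    qed
    also have "... \<le> C"
      using C(1) T(2)[of n] ln_bound[of "T n"] mult_left_mono[of "ln (T n)" "T n" C] by (simp add: divide_simps mult.commute)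
    finally have 1: "norm (- deriv kzeta s / (kzeta s * s) - 1 / s) \<le> C" .
    have "norm (zsum z s) \<le> suminf \<mu>"
      unfolding zsum_def
    proof (rule norm_suminf_le[OF _ summ])
      fix n
      have "1 / norm (s - z n) \<le> 1" using far[OF z_in[of n]] by (simp add: dist_norm divide_le_eq)
      hence "\<mu> n * (1 / norm (s - z n)) \<le> \<mu> n * 1" by (intro mult_left_mono) auto
      thus "norm (of_nat (zeta_zero_mult (z n)) / (z n * (s - z n))) \<le> \<mu> n" unfolding zsum_term_norm by simp
    qed
    hence "norm (gfun s) \<le> C + A" unfolding g A_def by (rule norm_triangle_le[OF add_mono[OF 1]])
    also have "... \<le> (C + A) * T n" using C(1) A0 T(2)[of n] mult_left_mono[of 1 "T n" "C + A"] by simp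
    finally show ?thesis by (simp add: s_def)
  qed
  have "(\<integral>\<^sup>+ v. ennreal ((ez v)^2 * exp (- 2 * c * v)) \<partial>lborel) \<le>
     ennreal (exp (c^2) / (2 * pi) * (LINT t|lborel. (norm (gfun (Complex c t)))^2))"
  proof (rule laplace_L2_continuation[OF ez_measurable _ ez_bound ez_isCont])
    show "ez v = 0" if "v \<le> 0" for v using that by (simp add: ez_def)
    show "(3::real) > 2" "c - \<eta> < c" "0 < c" "c < 3" using c \<eta> by auto
    show "gfun (Complex 3 t) = (LINT v|lborel. of_real (ez v) * exp (- Complex 3 t * of_real v))" for t by (rule ez_laplace)
    show "gfun holomorphic_on {s. Re s > c - \<eta>}" by (rule gfun_holomorphic)
    show "filterlim T at_top sequentially" by (rule T)
    show "integrable lborel (\<lambda>t. (norm (gfun (Complex c t)))^2)" by (rule gfun_line_L2)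
    show "norm (gfun (Complex x (T n))) \<le> (C + A) * T n \<and> norm (gfun (Complex x (- T n))) \<le> (C + A) * T n"
      if "c \<le> x" "x \<le> 3" for n x using gb[OF that] by blast
  qed
  thus ?thesis by blast
qed

end

section \<open>Passage to the prime counting function\<close>

text \<open>The integrand of \<open>li\<close> without its pole at 1. It is continuous on the closed
  half-line: 1/2 is the limit at 1, and at 0 the convention 1 / ln 0 = 0 produces the value 1, which
  is the right-hand limit.\<close>

definition Fli :: "real \<Rightarrow> real" where
  "Fli t = (if t = 1 then 1/2 else 1 / ln t - 1 / (t - 1))"

lemma Fli_continuous: "continuous_on {0..} Fli"
  unfolding continuous_on_eq_continuous_within
proof
  fix x :: real assume x: "x \<in> {0..}"
  consider "x = 0" | "x = 1" | "x > 0" "x \<noteq> 1" using x by force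
  thus "continuous (at x within {0..}) Fli"
  proof cases
    case 1
    have "((\<lambda>t. 1 / ln t - 1 / (t - 1)) \<longlongrightarrow> 1) (at_right (0::real))" by real_asymp
    moreover have "eventually (\<lambda>t. 1 / ln t - 1 / (t - 1) = Fli t) (at_right (0::real))"
      using eventually_at_right_real[of 0 1] by (auto simp: Fli_def elim!: eventually_mono)
    ultimately have "(Fli \<longlongrightarrow> 1) (at_right 0)" by (rule Lim_transform_eventually)
    moreover have "at (0::real) within {0..} = at_right 0"
      unfolding at_within_def by (intro arg_cong[of _ _ "\<lambda>S. inf (nhds 0) (principal S)"]) auto
    ultimately show ?thesis using 1 by (simp add: continuous_within Fli_def)
  next
    case 2
    have "((\<lambda>t. 1 / ln t - 1 / (t - 1)) \<longlongrightarrow> 1/2) (at (1::real))" by real_asymp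
    moreover have "eventually (\<lambda>t. 1 / ln t - 1 / (t - 1) = Fli t) (at (1::real))"
      by (auto simp: eventually_at_filter Fli_def)
    ultimately have "(Fli \<longlongrightarrow> 1/2) (at 1)" by (rule Lim_transform_eventually)
    hence "(Fli \<longlongrightarrow> 1/2) (at 1 within {0..})" by (rule tendsto_within_subset) simp
    thus ?thesis using 2 by (simp add: continuous_within Fli_def)
  next
    case 3
    have "isCont (\<lambda>t. 1 / ln t - 1 / (t - 1)) x" using 3 by (intro continuous_intros) auto
    moreover have "eventually (\<lambda>t. 1 / ln t - 1 / (t - 1) = Fli t) (nhds x)"
      by (rule eventually_mono[OF eventually_nhds_in_open[of "- {1}"]]) (use 3 in \<open>auto simp: Fli_def\<close>)
    ultimately have "isCont Fli x" by (simp only: isCont_cong)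
    thus ?thesis by (rule continuous_at_imp_continuous_at_within)
  qed
qed

lemma Fli_integrable: "0 \<le> a \<Longrightarrow> Fli integrable_on {a..b}"
  by (rule integrable_continuous_real, rule continuous_on_subset[OF Fli_continuous]) auto

text \<open>With r the excised radius, 1 / (t - 1) integrates to ln r on the left of 1 and to ln (x
  - 1) - ln r on the right. The principal value cancels ln r.\<close>

lemma li_eq:
  assumes x: "x \<ge> 2"
  shows "li x = integral {0..x} Fli + ln (x - 1)"
proof -
  define A where "A = (\<lambda>r. integral {0..1 - r} (\<lambda>t. 1 / ln t) + integral {1 + r..x} (\<lambda>t. 1 / ln t))"
  have eq: "A r = integral {0..1 - r} Fli + integral {1 + r..x} Fli + ln (x - 1)" if e: "r \<in> {0<..<1}" for r
  proof -
    have i1: "((\<lambda>t. 1 / (t - 1)) has_integral (ln \<bar>1 - r - 1\<bar> - ln \<bar>0 - 1\<bar>)) {0..1 - r}"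
    proof (rule fundamental_theorem_of_calculus)
      fix t assume t: "t \<in> {0..1 - r}"
      have "((\<lambda>t. ln (1 - t)) has_real_derivative 1 / (t - 1)) (at t within {0..1 - r})"
        using t e by (auto intro!: derivative_eq_intros simp: divide_simps)
      hence "((\<lambda>t. ln \<bar>t - 1\<bar>) has_real_derivative 1 / (t - 1)) (at t within {0..1 - r})"
        by (rule has_field_derivative_transform_within[of _ _ _ _ 1]) (use t e in auto)
      thus "((\<lambda>t. ln \<bar>t - 1\<bar>) has_vector_derivative 1 / (t - 1)) (at t within {0..1 - r})"
        by (simp add: has_real_derivative_iff_has_vector_derivative)
    qed (use e in auto)
    have i2: "((\<lambda>t. 1 / (t - 1)) has_integral (ln (x - 1) - ln (1 + r - 1))) {1 + r..x}"
      using x e by (intro fundamental_theorem_of_calculus)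
        (auto intro!: derivative_eq_intros simp: has_real_derivative_iff_has_vector_derivative[symmetric])
    have f1: "(Fli has_integral integral {0..1 - r} Fli) {0..1 - r}" by (intro integrable_integral Fli_integrable) auto
    have f2: "(Fli has_integral integral {1 + r..x} Fli) {1 + r..x}" using e by (intro integrable_integral Fli_integrable) auto
    have "((\<lambda>t. 1 / ln t) has_integral (integral {0..1 - r} Fli + (ln \<bar>1 - r - 1\<bar> - ln \<bar>0 - 1\<bar>))) {0..1 - r}"
      by (rule has_integral_eq[OF _ has_integral_add[OF f1 i1]]) (use e in \<open>auto simp: Fli_def\<close>)
    moreover have "((\<lambda>t. 1 / ln t) has_integral (integral {1 + r..x} Fli + (ln (x - 1) - ln (1 + r - 1)))) {1 + r..x}"
      by (rule has_integral_eq[OF _ has_integral_add[OF f2 i2]]) (use e in \<open>auto simp: Fli_def\<close>)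
    ultimately show ?thesis using e unfolding A_def by (simp add: integral_unique)
  qed
  have lim: "((\<lambda>r. integral {0..1 - r} Fli + integral {1 + r..x} Fli + ln (x - 1)) \<longlongrightarrow> integral {0..x} Fli + ln (x - 1)) (at_right 0)"
  proof -
    have c: "continuous_on {0..x} (\<lambda>y. integral {0..y} Fli)"
      by (rule indefinite_integral_continuous_1) (rule Fli_integrable, simp)
    have c1: "isCont (\<lambda>y. integral {0..y} Fli) 1" using c by (rule continuous_on_interior) (use x in \<open>auto simp: interior_atLeastAtMost_real\<close>)
    have t1: "((\<lambda>r. 1 - r) \<longlongrightarrow> (1::real)) (at_right 0)" "((\<lambda>r. 1 + r) \<longlongrightarrow> (1::real)) (at_right 0)"
      by (auto intro!: tendsto_eq_intros)
    have l1: "((\<lambda>r. integral {0..1 - r} Fli) \<longlongrightarrow> integral {0..1} Fli) (at_right 0)"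
      by (rule isCont_tendsto_compose[OF c1 t1(1)])
    have l2: "((\<lambda>r. integral {0..1 + r} Fli) \<longlongrightarrow> integral {0..1} Fli) (at_right 0)"
      by (rule isCont_tendsto_compose[OF c1 t1(2)])
    have "((\<lambda>r. integral {0..1 - r} Fli + (integral {0..x} Fli - integral {0..1 + r} Fli) + ln (x - 1)) \<longlongrightarrow> integral {0..1} Fli + (integral {0..x} Fli - integral {0..1} Fli) + ln (x - 1)) (at_right 0)"
      by (intro tendsto_intros l1 l2)
    moreover have "eventually (\<lambda>r. integral {0..1 - r} Fli + (integral {0..x} Fli - integral {0..1 + r} Fli) + ln (x - 1) = integral {0..1 - r} Fli + integral {1 + r..x} Fli + ln (x - 1)) (at_right 0)"
    proof (rule eventually_mono[OF eventually_at_right_real[of 0 1]])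
      fix r :: real assume e: "r \<in> {0<..<1}"
      have "integral {0..1 + r} Fli + integral {1 + r..x} Fli = integral {0..x} Fli"
        using e x by (intro Henstock_Kurzweil_Integration.integral_combine Fli_integrable) auto
      thus "integral {0..1 - r} Fli + (integral {0..x} Fli - integral {0..1 + r} Fli) + ln (x - 1) = integral {0..1 - r} Fli + integral {1 + r..x} Fli + ln (x - 1)" by linarith
    qed auto
    ultimately show ?thesis using Lim_transform_eventually by fastforce
  qed
  have "eventually (\<lambda>r. integral {0..1 - r} Fli + integral {1 + r..x} Fli + ln (x - 1) = A r) (at_right 0)"
    by (rule eventually_mono[OF eventually_at_right_real[of 0 1]]) (use eq in auto)
  from Lim_transform_eventually[OF lim this] have "(A \<longlongrightarrow> integral {0..x} Fli + ln (x - 1)) (at_right 0)" .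
  hence "Lim (at_right 0) A = integral {0..x} Fli + ln (x - 1)" by (intro tendsto_Lim) auto
  thus ?thesis by (simp add: li_def A_def)
qed

lemma li_has_derivative:
  assumes "x \<ge> 2" and b: "x \<le> b"
  shows "(li has_real_derivative 1 / ln x) (at x within {2..b})"
proof -
  have "((\<lambda>y. integral {0..y} Fli) has_real_derivative Fli x) (at x within {0..max x b})"
    using assms by (intro integral_has_real_derivative continuous_on_subset[OF Fli_continuous]) auto
  hence "((\<lambda>y. integral {0..y} Fli) has_real_derivative Fli x) (at x within {2..b})"
    by (rule DERIV_subset) auto
  moreover have "((\<lambda>y. ln (y - 1)) has_real_derivative 1 / (x - 1)) (at x within {2..b})"
    using assms by (auto intro!: derivative_eq_intros)
  ultimately have "((\<lambda>y. integral {0..y} Fli + ln (y - 1)) has_real_derivative Fli x + 1 / (x - 1)) (at x within {2..b})"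
    by (rule DERIV_add)
  moreover have "Fli x + 1 / (x - 1) = 1 / ln x" using assms by (simp add: Fli_def)
  ultimately have d: "((\<lambda>y. integral {0..y} Fli + ln (y - 1)) has_real_derivative 1 / ln x) (at x within {2..b})" by simp
  show ?thesis
    by (rule has_field_derivative_transform_within[OF d zero_less_one]) (use assms b in \<open>auto simp: li_eq\<close>)
qed

section \<open>Partial summation in the variable v = ln x\<close>

lemma ln2_pos: "ln (2::real) > 0" "ln (2::real) \<ge> 1/2"
proof -
  show "ln (2::real) > 0" by simp
  show "ln (2::real) \<ge> 1/2" using ln2_ge_two_thirds by linarith
qed

text \<open>The derivative of li (exp v) - exp v / v is exp v / v^2; this is the smooth counterpart
  of \<open>PiS_integral\<close>, with exp v in the place of psi (exp v).\<close>

lemma li_exp_integral: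
  assumes u: "u \<ge> ln 2"
  shows "((\<lambda>v. exp v / v^2) has_integral (li (exp u) - exp u / u - (li 2 - 2 / ln 2))) {ln 2..u}"
proof -
  have "((\<lambda>v. exp v / v^2) has_integral ((li (exp u) - exp u / u) - (li (exp (ln 2)) - exp (ln 2) / ln 2))) {ln 2..u}"
  proof (rule fundamental_theorem_of_calculus[OF u])
    fix v assume v: "v \<in> {ln 2..u}"
    have v0: "v > 0" using v ln2_pos by auto
    have ev: "exp v \<ge> 2" using v by (metis atLeastAtMost_iff exp_le_cancel_iff exp_ln zero_less_numeral)
    have sub: "exp ` {ln 2..u} \<subseteq> {2..exp u}" by (auto simp: ln_le_cancel_iff) (metis exp_le_cancel_iff exp_ln zero_less_numeral)
    have "((\<lambda>v. li (exp v)) has_real_derivative 1 / ln (exp v) * exp v) (at v within {ln 2..u})"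
      by (rule DERIV_image_chain[where f = li and g = exp, unfolded o_def])
         (use li_has_derivative[OF ev, of "exp u"] sub v in \<open>auto intro: DERIV_subset DERIV_at_within_shift derivative_eq_intros\<close>)
    moreover have "((\<lambda>v. exp v / v) has_real_derivative exp v / v - exp v / v^2) (at v within {ln 2..u})"
      using v0 by (auto intro!: derivative_eq_intros simp: field_simps power2_eq_square)
    ultimately have "((\<lambda>v. li (exp v) - exp v / v) has_real_derivative 1 / ln (exp v) * exp v - (exp v / v - exp v / v^2)) (at v within {ln 2..u})"
      by (rule DERIV_diff)
    thus "((\<lambda>v. li (exp v) - exp v / v) has_vector_derivative exp v / v^2) (at v within {ln 2..u})"
      by (simp add: has_real_derivative_iff_has_vector_derivative)
  qed
  thus ?thesis by simp
qed

text \<open>Riemann's count of prime powers, in which p^k has weight 1 / k. The term n = 1 is 0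
  because \<open>mangoldt 1\<close> is.\<close>

definition PiS :: "real \<Rightarrow> real" where
  "PiS x = (\<Sum>n | 0 < n \<and> real n \<le> x. mangoldt n / ln (real n))"

text \<open>In psi (exp v) the summand \<open>mangoldt n\<close> is present from v = ln n on, and
  the integral of 1 / v^2 over [ln n, u] is 1 / ln n - 1 / u.\<close>

lemma PiS_integral:
  assumes u: "u \<ge> ln 2"
  shows "((\<lambda>v. psi (exp v) / v^2) has_integral (PiS (exp u) - psi (exp u) / u)) {ln 2..u}"
proof -
  define N where "N = {n::nat. 2 \<le> n \<and> real n \<le> exp u}"
  have finN: "finite N" unfolding N_def by (rule finite_subset[OF _ finite_le_real[of "exp u"]]) auto
  have psum: "(\<Sum>n | 0 < n \<and> real n \<le> y. f n) = (\<Sum>n\<in>N. if real n \<le> y then f n else 0)"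
    if f1: "f 1 = 0" and y: "y \<le> exp u" for f :: "nat \<Rightarrow> real" and y
  proof -
    have "(\<Sum>n | 0 < n \<and> real n \<le> y. f n) = (\<Sum>n\<in>{n\<in>N. real n \<le> y}. f n)"
    proof (rule sum.mono_neutral_right)
      show "finite {n. 0 < n \<and> real n \<le> y}" by (rule finite_le_real)
      show "{n \<in> N. real n \<le> y} \<subseteq> {n. 0 < n \<and> real n \<le> y}" by (auto simp: N_def)
      show "\<forall>i\<in>{n. 0 < n \<and> real n \<le> y} - {n \<in> N. real n \<le> y}. f i = 0"
      proof
        fix i assume i: "i \<in> {n. 0 < n \<and> real n \<le> y} - {n \<in> N. real n \<le> y}"
        hence "i = 1" using y by (auto simp: N_def)
        thus "f i = 0" using f1 by simp
      qed
    qed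
    also have "... = (\<Sum>n\<in>N. if real n \<le> y then f n else 0)" by (rule sum.inter_filter[OF finN])
    finally show ?thesis .
  qed
  have u0: "u > 0" using u ln2_pos by linarith
  have "((\<lambda>v. \<Sum>n\<in>N. if v \<in> {ln (real n)..u} then mangoldt n / v^2 else 0) has_integral (\<Sum>n\<in>N. mangoldt n * (1 / ln (real n) - 1 / u))) {ln 2..u}"
  proof (rule has_integral_sum[OF finN])
    fix n assume n: "n \<in> N"
    hence n2: "real n \<ge> 2" "real n \<le> exp u" by (auto simp: N_def)
    have ln2: "ln 2 \<le> ln (real n)" "ln (real n) \<le> u" "ln (real n) > 0"
      using n2 ln_le_cancel_iff[of "real n" "exp u"] by auto
    have "((\<lambda>v. mangoldt n / v^2) has_integral ((- mangoldt n / u) - (- mangoldt n / ln (real n)))) {ln (real n)..u}"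
    proof (rule fundamental_theorem_of_calculus[OF ln2(2)])
      fix v assume v: "v \<in> {ln (real n)..u}"
      hence "v > 0" using ln2 by auto
      hence "((\<lambda>v. - mangoldt n / v) has_real_derivative mangoldt n / v^2) (at v within {ln (real n)..u})"
        by (auto intro!: derivative_eq_intros simp: field_simps power2_eq_square)
      thus "((\<lambda>v. - mangoldt n / v) has_vector_derivative mangoldt n / v^2) (at v within {ln (real n)..u})"
        by (simp add: has_real_derivative_iff_has_vector_derivative)
    qed
    hence "((\<lambda>v. mangoldt n / v^2) has_integral (mangoldt n * (1 / ln (real n) - 1 / u))) {ln (real n)..u}"
      by (simp add: algebra_simps)
    thus "((\<lambda>v. if v \<in> {ln (real n)..u} then mangoldt n / v^2 else 0) has_integral (mangoldt n * (1 / ln (real n) - 1 / u))) {ln 2..u}"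
      by (subst has_integral_restrict) (use ln2 in auto)
  qed
  moreover have "(\<Sum>n\<in>N. if v \<in> {ln (real n)..u} then mangoldt n / v^2 else 0) = psi (exp v) / v^2" if v: "v \<in> {ln 2..u}" for v
  proof -
    have "psi (exp v) / v^2 = (\<Sum>n\<in>N. if real n \<le> exp v then mangoldt n else 0) / v^2"
      unfolding psi_def using v by (subst psum) auto
    also have "... = (\<Sum>n\<in>N. if v \<in> {ln (real n)..u} then mangoldt n / v^2 else 0)"
      unfolding sum_divide_distrib
    proof (rule sum.cong[OF refl])
      fix n assume n: "n \<in> N"
      have "real n \<le> exp v \<longleftrightarrow> ln (real n) \<le> v" using n ln_le_cancel_iff[of "real n" "exp v"] by (auto simp: N_def)
      thus "(if real n \<le> exp v then mangoldt n else 0) / v^2 = (if v \<in> {ln (real n)..u} then mangoldt n / v^2 else 0)"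
        using v by auto
    qed
    finally show ?thesis by simp
  qed
  ultimately have "((\<lambda>v. psi (exp v) / v^2) has_integral (\<Sum>n\<in>N. mangoldt n * (1 / ln (real n) - 1 / u))) {ln 2..u}"
    by (rule has_integral_eq[rotated])
  moreover have "(\<Sum>n\<in>N. mangoldt n * (1 / ln (real n) - 1 / u)) = PiS (exp u) - psi (exp u) / u"
  proof -
    have "PiS (exp u) = (\<Sum>n\<in>N. mangoldt n / ln (real n))"
      unfolding PiS_def by (subst psum) (auto simp: N_def intro!: sum.cong)
    moreover have "psi (exp u) = (\<Sum>n\<in>N. mangoldt n)"
      unfolding psi_def by (subst psum) (auto simp: N_def intro!: sum.cong)
    ultimately show ?thesis by (simp add: right_diff_distrib sum_subtractf sum_divide_distrib)
  qed
  ultimately show ?thesis by simp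
qed

lemma PiS_minus_li:
  assumes u: "u \<ge> ln 2"
  shows "((\<lambda>v. (psi (exp v) - exp v) / v^2) has_integral
    (PiS (exp u) - li (exp u) - (psi (exp u) - exp u) / u + (li 2 - 2 / ln 2))) {ln 2..u}"
proof -
  have "((\<lambda>v. psi (exp v) / v^2 - exp v / v^2) has_integral
    (PiS (exp u) - psi (exp u) / u - (li (exp u) - exp u / u - (li 2 - 2 / ln 2)))) {ln 2..u}"
    by (rule has_integral_diff[OF PiS_integral[OF u] li_exp_integral[OF u]])
  thus ?thesis by (simp add: diff_divide_distrib algebra_simps)
qed

text \<open>The summands beyond the primes are at most 1 each and belong to p^k with k \<ge> 2, so
  that p \<le> sqrt x and k \<le> log 2 x.\<close>

lemma PiS_prime_pi:
  assumes x: "x \<ge> 2"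
  shows "real (prime_pi x) \<le> PiS x" "PiS x \<le> real (prime_pi x) + sqrt x * log 2 x"
proof -
  define A where "A = {n::nat. 0 < n \<and> real n \<le> x}"
  define P where "P = {p::nat. prime p \<and> real p \<le> x}"
  define Q where "Q = {n\<in>A. primepow n \<and> \<not> prime n}"
  have finA: "finite A" unfolding A_def by (rule finite_le_real)
  have PA: "P \<subseteq> A" by (auto simp: P_def A_def prime_gt_0_nat)
  have finP: "finite P" using PA finA finite_subset by blast
  have finQ: "finite Q" using finA by (simp add: Q_def)
  have t0: "mangoldt n / ln (real n) \<ge> 0" if "n \<in> A" for n
    using that by (intro divide_nonneg_nonneg mangoldt_nonneg) (auto simp: A_def)
  have tP: "mangoldt n / ln (real n) = (1::real)" if "n \<in> P" for n
  proof -
    have "n \<ge> 2" using that by (auto simp: P_def prime_ge_2_nat)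
    hence "ln (real n) > 0" by simp
    thus ?thesis using that by (simp add: P_def)
  qed
  have "PiS x = (\<Sum>n\<in>P. mangoldt n / ln (real n)) + (\<Sum>n\<in>A - P. mangoldt n / ln (real n))"
    unfolding PiS_def A_def[symmetric] using sum.subset_diff[OF PA finA, of "\<lambda>n. mangoldt n / ln (real n) :: real"] by simp
  also have "(\<Sum>n\<in>P. mangoldt n / ln (real n)) = real (prime_pi x)" by (simp add: tP prime_pi_def P_def[symmetric])
  finally have eq: "PiS x = real (prime_pi x) + (\<Sum>n\<in>A - P. mangoldt n / ln (real n))" .
  have "(\<Sum>n\<in>A - P. mangoldt n / ln (real n)) \<ge> (0::real)" by (intro sum_nonneg t0) auto
  thus "real (prime_pi x) \<le> PiS x" using eq by simp
  have "(\<Sum>n\<in>A - P. mangoldt n / ln (real n)) = (\<Sum>n\<in>Q. mangoldt n / ln (real n) :: real)"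
    using finA by (intro sum.mono_neutral_right) (auto simp: Q_def P_def A_def mangoldt_def)
  also have "... \<le> (\<Sum>n\<in>Q. 1)"
  proof (rule sum_mono)
    fix n assume n: "n \<in> Q"
    hence n0: "n > 0" "n > 1" using primepow_gt_Suc_0[of n] by (auto simp: Q_def A_def)
    thus "mangoldt n / ln (real n) \<le> (1::real)" using mangoldt_le[of n] by (simp add: divide_le_eq)
  qed
  also have "... = real (card Q)" by simp
  also have "real (card Q) \<le> sqrt x * log 2 x"
  proof -
    define I where "I = {1..nat \<lfloor>sqrt x\<rfloor>} \<times> {1..nat \<lfloor>log 2 x\<rfloor>}"
    have "Q \<subseteq> (\<lambda>(p, k). p ^ k) ` I"
    proof
      fix n assume n: "n \<in> Q"
      then obtain p k where pk: "prime p" "k > 0" "n = p ^ k" by (auto simp: Q_def primepow_def)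
      have k2: "k \<ge> 2" using n pk by (cases "k = 1") (auto simp: Q_def)
      have nx: "real p ^ k \<le> x" using n pk by (simp add: Q_def A_def)
      have p2: "real p \<ge> 2" using prime_ge_2_nat[OF pk(1)] by simp
      have "real p ^ 2 \<le> real p ^ k" using p2 k2 by (intro power_increasing) auto
      hence "real p \<le> sqrt x" using nx by (intro real_le_rsqrt) simp
      hence 1: "p \<in> {1..nat \<lfloor>sqrt x\<rfloor>}" using p2 by (auto simp: le_nat_floor)
      have "2 ^ k \<le> real p ^ k" using p2 by (intro power_mono) auto
      hence "2 powr real k \<le> x" using nx by (simp add: powr_realpow)
      hence "real k \<le> log 2 x" using x by (subst le_log_iff) auto
      hence "k \<in> {1..nat \<lfloor>log 2 x\<rfloor>}" using pk by (auto simp: le_nat_floor)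
      hence "(p, k) \<in> I" using 1 by (simp add: I_def)
      thus "n \<in> (\<lambda>(p, k). p ^ k) ` I" by (rule rev_image_eqI) (simp add: pk)
    qed
    moreover have "finite I" by (simp add: I_def)
    ultimately have "card Q \<le> card I" by (intro surj_card_le)
    also have "card I = nat \<lfloor>sqrt x\<rfloor> * nat \<lfloor>log 2 x\<rfloor>" by (simp add: I_def)
    finally have "real (card Q) \<le> real (nat \<lfloor>sqrt x\<rfloor>) * real (nat \<lfloor>log 2 x\<rfloor>)" by (simp flip: of_nat_mult)
    also have "... \<le> sqrt x * log 2 x"
      using x by (intro mult_mono of_nat_floor) auto
    finally show ?thesis .
  qed
  finally show "PiS x \<le> real (prime_pi x) + sqrt x * log 2 x" using eq by simp
qed

section \<open>Comparison of pi(x) and li(x) through the zeros\<close>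

context zeta_zero_config
begin

text \<open>A majorant for the sum over the zeros after one integration, which gains another factor
  1 / |z|.\<close>

definition Qz :: "real \<Rightarrow> real" where
  "Qz u = (\<Sum>n. \<mu> n / norm (z n) * exp (Re (z n) * u))"

lemma z_norm_ge: "norm (z n) \<ge> 1/2"
  using z_props(1)[of n] complex_Re_le_cmod[of "z n"] c \<eta> by linarith

lemma Qz_term_le: "\<mu> n / norm (z n) \<le> 2 * \<mu> n"
proof -
  have "x / y \<le> 2 * x" if "y \<ge> 1/2" "x \<ge> 0" for x y :: real
  proof -
    have "x / y \<le> x / (1/2)" using that by (intro divide_left_mono) auto
    thus ?thesis by simp
  qed
  note * = this
  show ?thesis by (rule *[OF z_norm_ge]) auto
qed

lemma Qz_summable: "summable (\<lambda>n. \<mu> n / norm (z n) * exp (Re (z n) * u))"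
proof (rule summable_comparison_test'[OF summable_mult2[OF summable_mult[OF summ, of 2], of "exp \<bar>u\<bar>"]])
  fix n
  have "Re (z n) * u \<le> \<bar>u\<bar>"
  proof -
    have "Re (z n) * u \<le> Re (z n) * \<bar>u\<bar>" using z_props(1)[of n] c \<eta> by (intro mult_left_mono) auto
    also have "... \<le> \<bar>u\<bar>" using z_props(1,2)[of n] c \<eta> by (intro mult_left_le_one_le) auto
    finally show ?thesis .
  qed
  hence "\<mu> n / norm (z n) * exp (Re (z n) * u) \<le> 2 * \<mu> n * exp \<bar>u\<bar>"
    by (intro mult_mono Qz_term_le) auto
  thus "norm (\<mu> n / norm (z n) * exp (Re (z n) * u)) \<le> 2 * \<mu> n * exp \<bar>u\<bar>" by simp
qed

lemma Qz_mono: "u \<le> v \<Longrightarrow> Qz u \<le> Qz v"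
  unfolding Qz_def
  by (intro suminf_le Qz_summable mult_left_mono) (use z_props(1) c \<eta> in \<open>auto intro!: mult_left_mono order_trans[OF _ z_props(1)]\<close>)

lemma Qz_nonneg: "Qz u \<ge> 0"
  unfolding Qz_def by (intro suminf_nonneg Qz_summable) auto

text \<open>The termwise antiderivative P of Re Sc is at most \<open>Qz u\<close> on the interval.
  Integration by parts against 1 / v^2 leaves three terms, each at most Qz u / (ln 2)^2 \<le> 4 Qz
  u.\<close>

lemma Sc_integral_bound:
  assumes u: "u \<ge> ln 2"
  shows "\<bar>integral {ln 2..u} (\<lambda>v. Re (Sc v) / v^2)\<bar> \<le> 12 * Qz u"
proof -
  define a where "a = ln (2::real)"
  have a: "a \<ge> 1/2" "a > 0" using ln2_pos by (auto simp: a_def)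
  have au: "a \<le> u" using u by (simp add: a_def)
  define m where "m = (\<lambda>n. real (zeta_zero_mult (z n)))"
  define f where "f = (\<lambda>n v. Re (of_real (m n) * exp (z n * of_real v) / (z n)^2))"
  define f' where "f' = (\<lambda>n v. Re (of_real (m n) * exp (z n * of_real v) / z n))"
  have f'b: "\<bar>f' n v\<bar> \<le> \<mu> n * exp \<bar>v\<bar>" for n v
    unfolding f'_def m_def of_real_of_nat_eq by (rule order_trans[OF abs_Re_le_cmod Sc_term_bound])
  have fb: "\<bar>f n v\<bar> \<le> \<mu> n / norm (z n) * exp (Re (z n) * v)" for n v
  proof -
    have "\<bar>f n v\<bar> \<le> norm (of_real (m n) * exp (z n * of_real v) / (z n)^2)" unfolding f_def by (rule abs_Re_le_cmod)
    also have "... = \<mu> n / norm (z n) * exp (Re (z n) * v)"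
      by (simp add: norm_divide norm_mult norm_power norm_exp_eq_Re m_def power2_eq_square)
    finally show ?thesis .
  qed
  have "\<exists>g. \<forall>x\<in>{a..u}. (\<lambda>n. f n x) sums g x \<and> (g has_field_derivative Re (Sc x)) (at x within {a..u})"
  proof (rule has_field_derivative_series)
    show "convex {a..u}" by simp
    show "a \<in> {a..u}" using au by simp
    show "summable (\<lambda>n. f n a)"
      by (rule summable_comparison_test'[OF Qz_summable[of a]]) (use fb in auto)
    show "(f n has_field_derivative f' n x) (at x within {a..u})" if "x \<in> {a..u}" for n x
    proof -
      have "((\<lambda>v. of_real (m n) * exp (z n * of_real v) / (z n)^2) has_vector_derivative of_real (m n) * exp (z n * of_real x) / z n) (at x within {a..u})"
      proof (rule has_vector_derivative_real_field[where f = "\<lambda>w. of_real (m n) * exp (z n * w) / (z n)^2"])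
        show "((\<lambda>w. of_real (m n) * exp (z n * w) / (z n)^2) has_field_derivative of_real (m n) * exp (z n * of_real x) / z n) (at (of_real x))"
          using z_props(3)[of n] by (auto intro!: derivative_eq_intros simp: field_simps power2_eq_square)
      qed
      hence "((\<lambda>v. Re (of_real (m n) * exp (z n * of_real v) / (z n)^2)) has_vector_derivative Re (of_real (m n) * exp (z n * of_real x) / z n)) (at x within {a..u})"
        by (rule bounded_linear.has_vector_derivative[OF bounded_linear_Re])
      thus ?thesis unfolding f_def f'_def by (simp add: has_real_derivative_iff_has_vector_derivative)
    qed
    have Scf: "Re (Sc x) = (\<Sum>n. f' n x)" for x
      unfolding Sc_def f'_def m_def of_real_of_nat_eq by (rule Re_suminf[OF summable_norm_cancel[OF Sc_norm_summable]])
    show "uniform_limit {a..u} (\<lambda>n x. \<Sum>i<n. f' i x) (\<lambda>x. Re (Sc x)) sequentially"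
      unfolding Scf
    proof (rule Weierstrass_m_test[OF _ summable_mult2[OF summ, of "exp u"]])
      fix n x assume x: "x \<in> {a..u}"
      have "\<mu> n * exp \<bar>x\<bar> \<le> \<mu> n * exp u" using x a by (intro mult_left_mono) auto
      thus "norm (f' n x) \<le> \<mu> n * exp u" using f'b[of n x] by simp
    qed
  qed
  then obtain P where P: "\<And>x. x \<in> {a..u} \<Longrightarrow> (\<lambda>n. f n x) sums P x"
    "\<And>x. x \<in> {a..u} \<Longrightarrow> (P has_real_derivative Re (Sc x)) (at x within {a..u})" by blast
  have PQ: "\<bar>P x\<bar> \<le> Qz u" if x: "x \<in> {a..u}" for x
  proof -
    have "norm (\<Sum>n. f n x) \<le> Qz x" unfolding Qz_def by (rule norm_suminf_le[OF _ Qz_summable]) (use fb in auto)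
    hence "\<bar>P x\<bar> \<le> Qz x" using P(1)[OF x] by (simp add: sums_iff)
    also have "... \<le> Qz u" using x by (intro Qz_mono) auto
    finally show ?thesis .
  qed
  have Pc: "continuous_on {a..u} P" using P(2) DERIV_continuous continuous_on_eq_continuous_within by blast
  have i1: "((\<lambda>v. Re (Sc v) / v^2 - 2 * P v / v ^ 3) has_integral (P u / u^2 - P a / a^2)) {a..u}"
  proof (rule fundamental_theorem_of_calculus[OF au])
    fix v assume v: "v \<in> {a..u}"
    hence v0: "v > 0" using a by auto
    have "((\<lambda>v. P v / v^2) has_real_derivative (Re (Sc v) * v^2 - P v * (2 * v)) / (v^2 * v^2)) (at v within {a..u})"
      using v0 by (intro DERIV_divide P(2)[OF v]) (auto intro!: derivative_eq_intros)
    also have "(Re (Sc v) * v^2 - P v * (2 * v)) / (v^2 * v^2) = Re (Sc v) / v^2 - 2 * P v / v ^ 3"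
      using v0 by (simp add: field_simps power2_eq_square power3_eq_cube)
    finally show "((\<lambda>v. P v / v^2) has_vector_derivative Re (Sc v) / v^2 - 2 * P v / v ^ 3) (at v within {a..u})"
      by (simp add: has_real_derivative_iff_has_vector_derivative)
  qed
  have i2: "(\<lambda>v. 2 * P v / v ^ 3) integrable_on {a..u}"
    using a by (intro integrable_continuous_real continuous_intros Pc) auto
  have i3: "((\<lambda>v. 2 * Qz u / v ^ 3) has_integral (Qz u / a^2 - Qz u / u^2)) {a..u}"
  proof -
    have "((\<lambda>v. 2 * Qz u / v ^ 3) has_integral (- Qz u / u^2 - (- Qz u / a^2))) {a..u}"
    proof (rule fundamental_theorem_of_calculus[OF au])
      fix v assume v: "v \<in> {a..u}"
      hence v0: "v > 0" using a by auto
      have "((\<lambda>v. - Qz u / v^2) has_real_derivative 2 * Qz u / v ^ 3) (at v within {a..u})"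
        using v0 by (auto intro!: derivative_eq_intros simp: field_simps power2_eq_square power3_eq_cube)
      thus "((\<lambda>v. - Qz u / v^2) has_vector_derivative 2 * Qz u / v ^ 3) (at v within {a..u})"
        by (simp add: has_real_derivative_iff_has_vector_derivative)
    qed
    thus ?thesis by simp
  qed
  have "\<bar>integral {a..u} (\<lambda>v. 2 * P v / v ^ 3)\<bar> \<le> integral {a..u} (\<lambda>v. 2 * Qz u / v ^ 3)"
    unfolding real_norm_def[symmetric]
  proof (rule integral_norm_bound_integral[OF i2])
    show "(\<lambda>v. 2 * Qz u / v ^ 3) integrable_on {a..u}" using i3 by blast
    fix v assume v: "v \<in> {a..u}"
    thus "norm (2 * P v / v ^ 3) \<le> 2 * Qz u / v ^ 3" using PQ[OF v] a by (auto simp: abs_mult intro!: divide_right_mono)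
  qed
  also have "... = Qz u / a^2 - Qz u / u^2" using i3 by (rule integral_unique)
  also have "... \<le> Qz u / a^2" using Qz_nonneg[of u] by simp
  finally have b2: "\<bar>integral {a..u} (\<lambda>v. 2 * P v / v ^ 3)\<bar> \<le> Qz u / a^2" .
  have "((\<lambda>v. (Re (Sc v) / v^2 - 2 * P v / v ^ 3) + 2 * P v / v ^ 3) has_integral ((P u / u^2 - P a / a^2) + integral {a..u} (\<lambda>v. 2 * P v / v ^ 3))) {a..u}"
    by (intro has_integral_add i1 integrable_integral i2)
  hence "integral {a..u} (\<lambda>v. Re (Sc v) / v^2) = (P u / u^2 - P a / a^2) + integral {a..u} (\<lambda>v. 2 * P v / v ^ 3)"
    by (simp add: integral_unique)
  moreover have "\<bar>P u / u^2\<bar> \<le> Qz u / a^2"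
    unfolding abs_divide using PQ[of u] au a Qz_nonneg[of u] by (intro frac_le) (auto intro!: power_mono)
  moreover have "\<bar>P a / a^2\<bar> \<le> Qz u / a^2"
    unfolding abs_divide using PQ[of a] au a Qz_nonneg[of u] by (intro frac_le) auto
  ultimately have "\<bar>integral {a..u} (\<lambda>v. Re (Sc v) / v^2)\<bar> \<le> 3 * (Qz u / a^2)" using b2 by linarith
  also have "Qz u / a^2 \<le> Qz u / (1/2)^2" using a Qz_nonneg[of u] by (intro divide_left_mono power_mono) auto
  finally show ?thesis unfolding a_def by (simp add: power2_eq_square)
qed

text \<open>The product inequality 2 A B \<le> A^2 + B^2 with the balance L = exp (c u) passes from
  mean square to mean: both the weighted square of \<open>ez\<close>, multiplied by L, and exp (2 c
  v) / L integrate to O(L).\<close>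

lemma ez_integral_bound:
  "\<exists>C. C \<ge> 0 \<and> (\<forall>u\<ge>ln 2. (\<lambda>v. ez v / v^2) integrable_on {ln 2..u} \<longrightarrow> \<bar>integral {ln 2..u} (\<lambda>v. ez v / v^2)\<bar> \<le> C * exp (c * u))"
proof -
  obtain M0 where M0: "(\<integral>\<^sup>+ v. ennreal ((ez v)^2 * exp (- 2 * c * v)) \<partial>lborel) \<le> ennreal M0" using ez_L2 by blast
  define M where "M = max 0 M0"
  have M: "(\<integral>\<^sup>+ v. ennreal ((ez v)^2 * exp (- 2 * c * v)) \<partial>lborel) \<le> ennreal M" "M \<ge> 0"
    using M0 by (auto simp: M_def intro: order_trans ennreal_leI)
  note [measurable] = ez_measurable
  have c0: "c > 1/2" using c \<eta> by simp
  have Mi: "integrable lborel (\<lambda>v. (ez v)^2 * exp (- 2 * c * v))"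
    by (rule integrableI_bounded) (use M(1) in \<open>auto simp: le_less_trans[OF _ ennreal_less_top]\<close>)
  have Mv: "(LINT v|lborel. (ez v)^2 * exp (- 2 * c * v)) \<le> M"
    using M nn_integral_eq_integral[OF Mi] by (auto simp: ennreal_le_iff2)
  have "\<bar>integral {ln 2..u} (\<lambda>v. ez v / v^2)\<bar> \<le> (2 * M + 2) * exp (c * u)"
    if u: "u \<ge> ln 2" for u
  proof -
    define a where "a = ln (2::real)"
    have a: "a \<ge> 1/2" "a > 0" "a \<le> u" using ln2_pos u by (auto simp: a_def)
    define L where "L = exp (c * u)"
    have L: "L > 0" by (simp add: L_def)
    define w where "w = (\<lambda>v. 2 * (L * ((ez v)^2 * exp (- 2 * c * v))) + 2 * (exp (2 * c * v) / L))"
    have pw: "\<bar>ez v / v^2\<bar> \<le> w v" if v: "v \<in> {a..u}" for v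
    proof -
      define A where "A = \<bar>ez v\<bar> * exp (- c * v)"
      define B where "B = exp (c * v) / L"
      have "\<bar>ez v\<bar> = L * (A * B)" using L by (simp add: A_def B_def exp_minus)
      also have "A * B \<le> (A^2 + B^2) / 2" using sum_squares_bound[of A B] by simp
      hence "L * (A * B) \<le> L * ((A^2 + B^2) / 2)" using L by (intro mult_left_mono) auto
      also have "... = (L * ((ez v)^2 * exp (- 2 * c * v)) + exp (2 * c * v) / L) / 2"
      proof -
        have "A^2 = (ez v)^2 * exp (- 2 * c * v)" by (simp add: A_def power_mult_distrib exp_double[symmetric])
        moreover have "L * B^2 = exp (2 * c * v) / L" using L by (simp add: B_def power_divide power2_eq_square exp_add[symmetric])
        ultimately show ?thesis by (simp add: distrib_left)
      qed
      finally have e: "\<bar>ez v\<bar> \<le> w v / 4" by (simp add: w_def)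
      have "(1/2)^2 \<le> v^2" using v a by (intro power_mono) auto
      hence "\<bar>ez v\<bar> / v^2 \<le> (w v / 4) / (1/2)^2" using e by (intro frac_le) auto
      thus ?thesis by (simp add: abs_divide power2_eq_square)
    qed
    have exp_hi: "((\<lambda>v. exp (2 * c * v)) has_integral (exp (2 * c * u) / (2 * c) - exp (2 * c * a) / (2 * c))) {a..u}"
      using c0 a by (intro fundamental_theorem_of_calculus)
        (auto intro!: derivative_eq_intros simp: has_real_derivative_iff_has_vector_derivative[symmetric])
    have si: "set_integrable lborel {a..u} (\<lambda>v. (ez v)^2 * exp (- 2 * c * v))"
      unfolding set_integrable_def by (rule integrable_mult_indicator[OF _ Mi]) auto
    have hi: "(\<lambda>v. (ez v)^2 * exp (- 2 * c * v)) integrable_on {a..u}"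
      "integral {a..u} (\<lambda>v. (ez v)^2 * exp (- 2 * c * v)) \<le> M"
    proof -
      show "(\<lambda>v. (ez v)^2 * exp (- 2 * c * v)) integrable_on {a..u}" by (rule set_borel_integral_eq_integral(1)[OF si])
      have "integral {a..u} (\<lambda>v. (ez v)^2 * exp (- 2 * c * v)) = (LINT v|lborel. indicator {a..u} v *\<^sub>R ((ez v)^2 * exp (- 2 * c * v)))"
        using set_borel_integral_eq_integral(2)[OF si] by (simp add: set_lebesgue_integral_def)
      also have "... \<le> (LINT v|lborel. (ez v)^2 * exp (- 2 * c * v))"
        by (intro integral_mono Mi integrable_mult_indicator) (auto simp: indicator_def)
      finally show "integral {a..u} (\<lambda>v. (ez v)^2 * exp (- 2 * c * v)) \<le> M" using Mv by linarith
    qed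
    have wi: "(w has_integral (2 * (L * integral {a..u} (\<lambda>v. (ez v)^2 * exp (- 2 * c * v))) + 2 * ((exp (2 * c * u) / (2 * c) - exp (2 * c * a) / (2 * c)) / L))) {a..u}"
      unfolding w_def by (intro has_integral_add has_integral_mult_right has_integral_divide exp_hi integrable_integral hi)
    have "\<bar>integral {a..u} (\<lambda>v. ez v / v^2)\<bar> \<le> integral {a..u} w"
    proof (cases "(\<lambda>v. ez v / v^2) integrable_on {a..u}")
      case True
      show ?thesis unfolding real_norm_def[symmetric]
        by (rule integral_norm_bound_integral[OF True]) (use wi pw in auto)
    next
      \<comment> \<open>The integral of a non-integrable function is 0 by convention.\<close>
      case False
      have "0 \<le> integral {a..u} w" using wi L by (intro integral_nonneg) (auto simp: w_def)
      thus ?thesis using False by (simp add: not_integrable_integral)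
    qed
    also have "... = 2 * (L * integral {a..u} (\<lambda>v. (ez v)^2 * exp (- 2 * c * v))) + 2 * ((exp (2 * c * u) / (2 * c) - exp (2 * c * a) / (2 * c)) / L)"
      by (rule integral_unique[OF wi])
    also have "... \<le> 2 * (L * M) + 2 * L"
    proof -
      have "exp (2 * c * u) / (2 * c) - exp (2 * c * a) / (2 * c) \<le> exp (2 * c * u) / (2 * c)" using c0 by simp
      also have "... \<le> exp (2 * c * u) / 1" using c0 by (intro divide_left_mono) auto
      also have "... = L * L" by (simp add: L_def exp_add[symmetric])
      finally have "(exp (2 * c * u) / (2 * c) - exp (2 * c * a) / (2 * c)) / L \<le> L * L / L" using L by (intro divide_right_mono) auto
      moreover have "L * integral {a..u} (\<lambda>v. (ez v)^2 * exp (- 2 * c * v)) \<le> L * M" using hi L by (intro mult_left_mono) auto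
      moreover have "L * L / L = L" using L by simp
      ultimately show ?thesis by linarith
    qed
    also have "... = (2 * M + 2) * exp (c * u)" by (simp add: L_def algebra_simps)
    finally show ?thesis by (simp add: a_def)
  qed
  thus ?thesis using M(2) by (intro exI[of _ "2 * M + 2"]) auto
qed

text \<open>Multiplied by u = ln x, the boundary term (psi x - x) / u of partial summation is
  exactly ez u - Re (Sc u). The rest is smaller: \<open>ez\<close> integrates to O(exp (c u)), the
  zeros to O(Qz u), and the proper prime powers are below sqrt x * log 2 x.\<close>

theorem prime_pi_approx:
  "\<exists>C. C \<ge> 0 \<and> (\<forall>u\<ge>ln 2. \<bar>u * (real (prime_pi (exp u)) - li (exp u)) + Re (Sc u)\<bar> \<le> \<bar>ez u\<bar> + u * (C * (1 + u) * exp (c * u) + 12 * Qz u))"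
proof -
  obtain C where C: "C \<ge> 0" "\<And>u. u \<ge> ln 2 \<Longrightarrow> (\<lambda>v. ez v / v^2) integrable_on {ln 2..u} \<Longrightarrow> \<bar>integral {ln 2..u} (\<lambda>v. ez v / v^2)\<bar> \<le> C * exp (c * u)"
    using ez_integral_bound by blast
  define D where "D = C + 2 + \<bar>li 2 - 2 / ln 2\<bar>"
  have c0: "c > 1/2" using c \<eta> by simp
  have "\<bar>u * (real (prime_pi (exp u)) - li (exp u)) + Re (Sc u)\<bar> \<le> \<bar>ez u\<bar> + u * (D * (1 + u) * exp (c * u) + 12 * Qz u)"
    if u: "u \<ge> ln 2" for u
  proof -
    have u0: "u > 0" using u ln2_pos by linarith
    define x where "x = exp u"
    have x2: "x \<ge> 2" using u unfolding x_def by (metis exp_le_cancel_iff exp_ln zero_less_numeral)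
    define r where "r = li 2 - 2 / ln 2"
    have hi: "((\<lambda>v. (psi (exp v) - exp v) / v^2) has_integral (PiS x - li x - (psi x - x) / u + r)) {ln 2..u}"
      unfolding x_def r_def by (rule PiS_minus_li[OF u])
    have Sci: "(\<lambda>v. Re (Sc v) / v^2) integrable_on {ln 2..u}"
    proof (rule integrable_continuous_real)
      have "continuous_on {ln 2..u} Sc" using Sc_isCont by (simp add: continuous_at_imp_continuous_on)
      thus "continuous_on {ln 2..u} (\<lambda>v. Re (Sc v) / v^2)" using ln2_pos by (intro continuous_intros) auto
    qed
    have ez_eq: "ez v / v^2 = (psi (exp v) - exp v) / v^2 + Re (Sc v) / v^2" if "v \<in> {ln 2..u}" for v
    proof -
      have "v > 0" using that ln2_pos by auto
      thus ?thesis by (simp add: ez_def add_divide_distrib)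
    qed
    have "((\<lambda>v. (psi (exp v) - exp v) / v^2 + Re (Sc v) / v^2) has_integral
      (PiS x - li x - (psi x - x) / u + r + integral {ln 2..u} (\<lambda>v. Re (Sc v) / v^2))) {ln 2..u}"
      by (intro has_integral_add hi integrable_integral Sci)
    hence ezi: "((\<lambda>v. ez v / v^2) has_integral
      (PiS x - li x - (psi x - x) / u + r + integral {ln 2..u} (\<lambda>v. Re (Sc v) / v^2))) {ln 2..u}"
      by (rule has_integral_eq[rotated]) (use ez_eq in auto)
    have b1: "\<bar>PiS x - li x - (psi x - x) / u + r + integral {ln 2..u} (\<lambda>v. Re (Sc v) / v^2)\<bar> \<le> C * exp (c * u)"
      using C(2)[OF u] ezi by (auto simp: integral_unique)
    have b2: "\<bar>integral {ln 2..u} (\<lambda>v. Re (Sc v) / v^2)\<bar> \<le> 12 * Qz u" by (rule Sc_integral_bound[OF u])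
    have b3: "\<bar>PiS x - real (prime_pi x)\<bar> \<le> 2 * u * exp (c * u)"
    proof -
      have "log 2 x = u / ln 2" by (simp add: log_def x_def)
      also have "u / ln 2 \<le> u / (1/2)" using ln2_pos u0 by (intro divide_left_mono) auto
      finally have l: "log 2 x \<le> 2 * u" by simp
      have "sqrt x = exp (u / 2)" unfolding x_def by (rule real_sqrt_unique) (auto simp: exp_double[symmetric])
      also have "exp (u / 2) \<le> exp (c * u)" using c0 u0 by simp
      finally have q: "sqrt x \<le> exp (c * u)" .
      have "\<bar>PiS x - real (prime_pi x)\<bar> \<le> sqrt x * log 2 x" using PiS_prime_pi[OF x2] by linarith
      also have "... \<le> exp (c * u) * (2 * u)" using q l x2 by (intro mult_mono) auto
      finally show ?thesis by (simp add: mult.commute)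
    qed
    have e1: "exp (c * u) \<ge> 1" using c0 u0 by simp
    have psi: "psi x - x = ez u - Re (Sc u)" using u0 by (simp add: ez_def x_def)
    define J where "J = PiS x - li x - (psi x - x) / u"
    have J: "\<bar>J\<bar> \<le> C * exp (c * u) + \<bar>r\<bar> + 12 * Qz u" using b1 b2 unfolding J_def by linarith
    have key: "u * (real (prime_pi x) - li x) + Re (Sc u) = ez u + u * (J - (PiS x - real (prime_pi x)))"
    proof -
      have "u * ((psi x - x) / u) = psi x - x" using u0 by simp
      thus ?thesis using psi unfolding J_def by (simp add: right_diff_distrib distrib_left)
    qed
    have "\<bar>J - (PiS x - real (prime_pi x))\<bar> \<le> D * (1 + u) * exp (c * u) + 12 * Qz u"
    proof -
      have "\<bar>r\<bar> \<le> \<bar>r\<bar> * exp (c * u)" using e1 mult_left_mono[of 1 "exp (c * u)" "\<bar>r\<bar>"] by simp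
      hence "\<bar>J - (PiS x - real (prime_pi x))\<bar> \<le> (C + \<bar>r\<bar> + 2 * u) * exp (c * u) + 12 * Qz u"
        using J b3 unfolding distrib_right by linarith
      also have "(C + \<bar>r\<bar> + 2 * u) * exp (c * u) \<le> D * (1 + u) * exp (c * u)"
        using C(1) u0 by (intro mult_right_mono) (auto simp: D_def r_def algebra_simps)
      finally show ?thesis by simp
    qed
    hence "\<bar>u * (J - (PiS x - real (prime_pi x)))\<bar> \<le> u * (D * (1 + u) * exp (c * u) + 12 * Qz u)"
      using u0 by (simp add: abs_mult)
    thus ?thesis unfolding x_def[symmetric] key by linarith
  qed
  thus ?thesis using C(1) by (intro exI[of _ D]) (auto simp: D_def)
qed

end

section \<open>Density estimates\<close>

lemma sin_ge_half:
  assumes "0 \<le> x" "x \<le> pi / 2"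
  shows "sin x \<ge> x / 2"
proof -
  have pi: "pi / 2 < 1.6" using pi_approx by simp
  show ?thesis
  proof (cases "x \<le> pi / 3")
    case True
    have "0 - 0 / 2 \<le> sin x - x / 2"
    proof (rule deriv_nonneg_imp_mono[of 0 x "\<lambda>t. sin t - t / 2" "\<lambda>t. cos t - 1/2", simplified sin_zero])
      fix t assume t: "t \<in> {0..x}"
      show "((\<lambda>t. sin t - t / 2) has_real_derivative cos t - 1/2) (at t)" by (auto intro!: derivative_eq_intros)
      have "cos t \<ge> cos (pi / 3)" using t True assms by (intro cos_monotone_0_pi_le) auto
      thus "cos t - 1/2 \<ge> 0" by (simp add: cos_60)
    qed (use assms in auto)
    thus ?thesis by simp
  next
    case False
    have "sin (pi / 3) \<le> sin x" using False assms by (intro sin_monotone_2pi_le) auto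
    moreover have "sin (pi / 3) = sqrt 3 / 2" by (rule sin_60)
    moreover have "sqrt 3 \<ge> 1.6" by (rule real_le_rsqrt) (simp add: power2_eq_square)
    ultimately show ?thesis using pi assms by linarith
  qed
qed

lemma norm_cis_minus_1: "norm (cis t - 1) = 2 * \<bar>sin (t / 2)\<bar>"
proof -
  have "(norm (cis t - 1))^2 = (2 * sin (t / 2))^2"
  proof -
    have "(norm (cis t - 1))^2 = (cos t - 1)^2 + (sin t)^2" by (simp add: cmod_power2)
    also have "... = 2 - 2 * cos t" using sin_cos_squared_add[of t] by (simp add: power2_eq_square algebra_simps)
    also have "cos t = 1 - 2 * (sin (t / 2))^2" using cos_double_sin[of "t / 2"] by simp
    finally show ?thesis by (simp add: power_mult_distrib)
  qed
  hence "sqrt ((norm (cis t - 1))^2) = sqrt ((2 * sin (t / 2))^2)" by (rule arg_cong)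
  hence "norm (cis t - 1) = \<bar>2 * sin (t / 2)\<bar>" by (simp only: real_sqrt_abs abs_norm_cancel)
  thus ?thesis by (simp add: abs_mult)
qed

text \<open>With y the half angle reduced modulo pi to [- pi / 2, pi / 2], the chord 2 |sin y| is at
  least |y|.\<close>

lemma near_multiple_of_2pi:
  assumes "norm (cis t - 1) < \<tau>"
  shows "\<exists>n::int. \<bar>t - 2 * pi * of_int n\<bar> \<le> 2 * \<tau>"
proof -
  define n where "n = round (t / (2 * pi))"
  define y where "y = t / 2 - pi * of_int n"
  have "\<bar>of_int n - t / (2 * pi)\<bar> \<le> 1/2" unfolding n_def by (rule of_int_round_abs_le)
  hence "pi * \<bar>of_int n - t / (2 * pi)\<bar> \<le> pi * (1/2)" by (intro mult_left_mono) auto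
  moreover have "pi * \<bar>of_int n - t / (2 * pi)\<bar> = \<bar>y\<bar>"
  proof -
    have "pi * \<bar>of_int n - t / (2 * pi)\<bar> = \<bar>pi * (of_int n - t / (2 * pi))\<bar>" by (simp add: abs_mult)
    also have "pi * (of_int n - t / (2 * pi)) = - y" by (simp add: y_def field_simps)
    finally show ?thesis by simp
  qed
  ultimately have y: "\<bar>y\<bar> \<le> pi / 2" by simp
  have "\<bar>sin (t / 2)\<bar> = \<bar>sin y\<bar>"
  proof -
    have "sin (t / 2) = sin y * cos (pi * of_int n) + cos y * sin (pi * of_int n)"
      using sin_add[of y "pi * of_int n"] by (simp add: y_def)
    moreover have "sin (pi * of_int n) = 0" by (simp add: sin_zero_iff_int2)
    moreover have "\<bar>cos (pi * of_int n)\<bar> = 1"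
      using sin_cos_squared_add[of "pi * of_int n"] \<open>sin (pi * of_int n) = 0\<close> by (simp add: power2_eq_1_iff)
    ultimately show ?thesis by (simp add: abs_mult)
  qed
  also have "\<bar>sin y\<bar> \<ge> \<bar>y\<bar> / 2"
    using sin_ge_half[of "\<bar>y\<bar>"] y by (cases "y \<ge> 0") auto
  finally have "\<bar>y\<bar> / 2 \<le> \<bar>sin (t / 2)\<bar>" .
  hence "\<bar>y\<bar> \<le> \<tau>" using assms unfolding norm_cis_minus_1 by linarith
  thus ?thesis by (intro exI[of _ n]) (auto simp: y_def abs_le_iff)
qed

lemma Icc_fmeasurable: "{a..b::real} \<in> fmeasurable lborel"
  by (rule fmeasurableI) (auto simp: emeasure_lborel_Icc_eq)

text \<open>In the variable ln x the set is covered by intervals of length 4 \<tau> / \<gamma>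
  around the points 2 pi n / \<gamma>. Back in x each piece has length at most 8 X \<tau> /
  \<gamma>, and at most \<gamma> + 3 \<le> 4 \<gamma> of them matter. For \<tau> > 1 the bound is
  trivial.\<close>

lemma measure_near_multiples:
  fixes X \<gamma> \<tau> :: real
  assumes X: "X > 0" and \<gamma>: "\<gamma> \<ge> 1" and \<tau>: "\<tau> > 0"
  defines "S \<equiv> {x \<in> {X..2 * X}. norm (cis (\<gamma> * ln x) - 1) < \<tau>}"
  shows "S \<in> sets lborel" "measure lborel S \<le> 32 * \<tau> * X"
proof -
  have [measurable]: "(\<lambda>x. cis (\<gamma> * ln x)) \<in> borel_measurable borel"
    unfolding cis_conv_exp by measurable
  show Sm: "S \<in> sets lborel" unfolding S_def by measurable
  define a where "a = (\<lambda>n::int. max X (exp (2 * pi * of_int n / \<gamma> - 2 * \<tau> / \<gamma>)))"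
  define b where "b = (\<lambda>n::int. min (2 * X) (exp (2 * pi * of_int n / \<gamma> + 2 * \<tau> / \<gamma>)))"
  define n0 where "n0 = \<lfloor>\<gamma> * ln X / (2 * pi)\<rfloor>"
  define n1 where "n1 = \<lceil>\<gamma> * ln (2 * X) / (2 * pi)\<rceil>"
  have S_sub: "S \<subseteq> (\<Union>n\<in>{n0..n1}. {a n..b n})" if \<tau>1: "\<tau> \<le> 1"
  proof
    fix x assume "x \<in> S"
    hence x: "X \<le> x" "x \<le> 2 * X" "norm (cis (\<gamma> * ln x) - 1) < \<tau>" by (auto simp: S_def)
    hence x0: "x > 0" using X by linarith
    obtain n :: int where n: "\<bar>\<gamma> * ln x - 2 * pi * of_int n\<bar> \<le> 2 * \<tau>" using near_multiple_of_2pi[OF x(3)] by blast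
    have lo: "ln x \<ge> 2 * pi * of_int n / \<gamma> - 2 * \<tau> / \<gamma>" and hi: "ln x \<le> 2 * pi * of_int n / \<gamma> + 2 * \<tau> / \<gamma>"
      using n \<gamma> unfolding diff_divide_distrib[symmetric] add_divide_distrib[symmetric]
      by (auto simp: divide_le_eq le_divide_eq mult.commute abs_le_iff)
    have "x \<ge> exp (2 * pi * of_int n / \<gamma> - 2 * \<tau> / \<gamma>)" "x \<le> exp (2 * pi * of_int n / \<gamma> + 2 * \<tau> / \<gamma>)"
      using lo hi x0 by (metis exp_le_cancel_iff exp_ln)+
    hence "x \<in> {a n..b n}" using x by (auto simp: a_def b_def)
    moreover have "n \<in> {n0..n1}"
    proof -
      have "\<gamma> * ln X \<le> \<gamma> * ln x" using x X \<gamma> by (intro mult_left_mono) auto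
      moreover have "\<gamma> * ln x \<le> \<gamma> * ln (2 * X)" using x x0 X \<gamma> by (intro mult_left_mono) auto
      moreover have pi2: "2 < pi" using pi_gt3 by linarith
      ultimately have "\<gamma> * ln X - 2 * pi < 2 * pi * of_int n" "2 * pi * of_int n < \<gamma> * ln (2 * X) + 2 * pi"
        using n \<tau>1 by (auto simp: abs_le_iff)
      hence "\<gamma> * ln X / (2 * pi) - 1 < of_int n" "of_int n < \<gamma> * ln (2 * X) / (2 * pi) + 1"
        by (simp_all add: field_simps)
      hence "of_int n0 - 1 < (of_int n :: real)" "(of_int n :: real) < of_int n1 + 1"
        unfolding n0_def n1_def by linarith+
      thus ?thesis by auto
    qed
    ultimately show "x \<in> (\<Union>n\<in>{n0..n1}. {a n..b n})" by blast
  qed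
  have len: "measure lborel {a n..b n} \<le> 8 * X * \<tau> / \<gamma>" for n
  proof (cases "a n \<le> b n")
    case True
    have a0: "a n > 0" "b n > 0" "b n \<le> 2 * X" using X by (auto simp: a_def b_def)
    \<comment> \<open>The length b - a = b (1 - a / b) is at most b times the logarithmic length ln
      b - ln a, with b \<le> 2 X.\<close>
    have "ln (a n / b n) \<le> a n / b n - 1" using a0 by (intro ln_le_minus_one) auto
    hence "1 - a n / b n \<le> ln (b n) - ln (a n)" using a0 by (simp add: ln_div)
    also have "... \<le> (2 * pi * of_int n / \<gamma> + 2 * \<tau> / \<gamma>) - (2 * pi * of_int n / \<gamma> - 2 * \<tau> / \<gamma>)"
    proof (intro diff_mono)
      have "ln (b n) \<le> ln (exp (2 * pi * of_int n / \<gamma> + 2 * \<tau> / \<gamma>))" using a0 by (subst ln_le_cancel_iff) (auto simp: b_def)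
      thus "ln (b n) \<le> 2 * pi * of_int n / \<gamma> + 2 * \<tau> / \<gamma>" by simp
      have "ln (exp (2 * pi * of_int n / \<gamma> - 2 * \<tau> / \<gamma>)) \<le> ln (a n)" using a0 by (subst ln_le_cancel_iff) (auto simp: a_def)
      thus "2 * pi * of_int n / \<gamma> - 2 * \<tau> / \<gamma> \<le> ln (a n)" by simp
    qed
    finally have "1 - a n / b n \<le> 4 * \<tau> / \<gamma>" by simp
    hence "b n * (1 - a n / b n) \<le> (2 * X) * (4 * \<tau> / \<gamma>)" using a0 True by (intro mult_mono) (auto simp: divide_le_eq)
    moreover have "b n * (1 - a n / b n) = b n - a n" using a0 by (simp add: right_diff_distrib)
    ultimately show ?thesis using True by (simp add: mult_ac)
  qed (use X \<gamma> \<tau> in auto)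
  show "measure lborel S \<le> 32 * \<tau> * X"
  proof (cases "\<tau> \<le> 1")
    case True
    have "measure lborel S \<le> measure lborel (\<Union>n\<in>{n0..n1}. {a n..b n})"
    proof (rule measure_mono_fmeasurable[OF S_sub[OF True] Sm])
      show "(\<Union>n\<in>{n0..n1}. {a n..b n}) \<in> fmeasurable lborel" by (intro fmeasurable.finite_UN Icc_fmeasurable) auto
    qed
    also have "... \<le> (\<Sum>n\<in>{n0..n1}. measure lborel {a n..b n})" by (rule measure_UNION_le) auto
    also have "... \<le> (\<Sum>n\<in>{n0..n1}. 8 * X * \<tau> / \<gamma>)" by (intro sum_mono len)
    also have "... = real (card {n0..n1}) * (8 * X * \<tau> / \<gamma>)" by simp
    also have "real (card {n0..n1}) \<le> 4 * \<gamma>"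
    proof -
      have l2: "\<gamma> * ln (2 * X) = \<gamma> * ln X + \<gamma> * ln 2" using X by (simp add: ln_mult algebra_simps)
      have "\<gamma> * ln 2 \<le> \<gamma> * 1" using \<gamma> ln_2_less_1 by (intro mult_left_mono) auto
      hence "\<gamma> * ln 2 / (2 * pi) \<le> \<gamma> / (2 * pi)" by (intro divide_right_mono) auto
      also have "... \<le> \<gamma> / 1" using \<gamma> pi_gt3 by (intro divide_left_mono) auto
      finally have "\<gamma> * ln (2 * X) / (2 * pi) \<le> \<gamma> * ln X / (2 * pi) + \<gamma>" unfolding l2 add_divide_distrib by simp
      hence "of_int n1 - of_int n0 \<le> \<gamma> + (2::real)" unfolding n0_def n1_def by linarith
      hence "of_int (n1 - n0 + 1) \<le> \<gamma> + (3::real)" by simp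
      moreover have "real (card {n0..n1}) \<le> max 0 (of_int (n1 - n0 + 1))" by simp
      ultimately show ?thesis using \<gamma> by linarith
    qed
    hence "real (card {n0..n1}) * (8 * X * \<tau> / \<gamma>) \<le> 4 * \<gamma> * (8 * X * \<tau> / \<gamma>)"
      using X \<tau> \<gamma> by (intro mult_right_mono) auto
    also have "... = 32 * \<tau> * X" using \<gamma> by simp
    finally show ?thesis .
  next
    case False
    have "measure lborel S \<le> measure lborel {X..2 * X}"
      by (rule measure_mono_fmeasurable[OF _ _ Icc_fmeasurable]) (use Sm in \<open>auto simp: S_def\<close>)
    also have "... = X" using X by simp
    also have "... \<le> 32 * \<tau> * X" using False X by simp
    finally show ?thesis .
  qed
qed

text \<open>Markov's inequality for a weighted count of memberships. Finiteness is stated separately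
  because \<open>measure\<close> is 0 on sets of infinite measure.\<close>

lemma markov_weighted_indicators:
  fixes a :: "'i \<Rightarrow> real" and S :: "'i \<Rightarrow> real set"
  assumes fin: "finite R" and a: "\<And>j. j \<in> R \<Longrightarrow> a j \<ge> 0" and S: "\<And>j. j \<in> R \<Longrightarrow> S j \<in> fmeasurable lborel"
    and m: "\<And>j. j \<in> R \<Longrightarrow> measure lborel (S j) \<le> m" and l: "l > 0"
  shows "{x. l \<le> (\<Sum>j\<in>R. a j * indicator (S j) x)} \<in> fmeasurable lborel"
    "measure lborel {x. l \<le> (\<Sum>j\<in>R. a j * indicator (S j) x)} \<le> m * (\<Sum>j\<in>R. a j) / l"
proof -
  define f where "f = (\<lambda>x. \<Sum>j\<in>R. a j * indicator (S j) x :: real)"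
  have Ss: "S j \<in> sets borel" if "j \<in> R" for j using S[OF that] by (auto simp: fmeasurable_def)
  have fi: "integrable lborel f" unfolding f_def using S
    by (intro Bochner_Integration.integrable_sum integrable_mult_right) (auto simp: fmeasurable_def)
  have f0: "f x \<ge> 0" for x unfolding f_def using a by (intro sum_nonneg) auto
  have "(LINT x|lborel. f x) = (\<Sum>j\<in>R. a j * measure lborel (S j))"
    unfolding f_def using S by (subst Bochner_Integration.integral_sum) (auto simp: fmeasurable_def)
  also have "... \<le> (\<Sum>j\<in>R. a j * m)" using a m by (intro sum_mono mult_left_mono) auto
  finally have If: "(LINT x|lborel. f x) \<le> m * (\<Sum>j\<in>R. a j)" by (simp add: sum_distrib_left mult.commute)
  have fm: "{x. l \<le> f x} \<in> sets lborel" using borel_measurable_integrable[OF fi] by measurable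
  have "emeasure lborel {x \<in> space lborel. l \<le> f x} \<le> ennreal (1 / l * (LINT x|lborel. f x))"
    by (rule integral_Markov_inequality[OF fi _ l]) (simp add: f0)
  hence em: "emeasure lborel {x. l \<le> f x} \<le> ennreal (1 / l * (LINT x|lborel. f x))" by simp
  also have "... \<le> ennreal (m * (\<Sum>j\<in>R. a j) / l)" using If l by (intro ennreal_leI) (simp add: divide_right_mono)
  finally have em2: "emeasure lborel {x. l \<le> f x} \<le> ennreal (m * (\<Sum>j\<in>R. a j) / l)" .
  thus "{x. l \<le> (\<Sum>j\<in>R. a j * indicator (S j) x)} \<in> fmeasurable lborel"
    using fm unfolding f_def by (intro fmeasurableI) (auto intro: le_less_trans)
  have "0 \<le> (LINT x|lborel. f x)" by (intro integral_nonneg_AE) (simp add: f0)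
  hence "m * (\<Sum>j\<in>R. a j) / l \<ge> 0" using If l by auto
  thus "measure lborel {x. l \<le> (\<Sum>j\<in>R. a j * indicator (S j) x)} \<le> m * (\<Sum>j\<in>R. a j) / l"
    using em2 unfolding f_def measure_def by (intro enn2real_leI)
qed

text \<open>X is halved until it falls below 2 X0. The dyadic pieces contribute at most (e / 2) (X /
  2 + X / 4 + ...), and the bottom piece at most 2 X0.\<close>

lemma density_zero_from_dyadic:
  fixes B :: "real set"
  assumes B: "B \<in> sets lebesgue"
    and dy: "\<And>\<eta>. \<eta> > 0 \<Longrightarrow> \<exists>X0. \<forall>X\<ge>X0. measure lebesgue (B \<inter> {X..2 * X}) \<le> \<eta> * X"
  shows "((\<lambda>X. measure lebesgue (B \<inter> {2..X}) / X) \<longlongrightarrow> 0) at_top"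
proof (rule tendstoI)
  fix e :: real assume e: "e > 0"
  obtain X0' where X0': "\<And>X. X \<ge> X0' \<Longrightarrow> measure lebesgue (B \<inter> {X..2 * X}) \<le> e / 2 * X" using dy[of "e / 2"] e by auto
  define X0 where "X0 = max X0' 2"
  have fm: "B \<inter> {a..b} \<in> fmeasurable lebesgue" for a b
    using fmeasurable_Int_fmeasurable[OF lmeasurable_interval(1)[of a b] B] by (simp add: Int_commute cbox_interval)
  have bound: "measure lebesgue (B \<inter> {2..X}) \<le> e / 2 * X + 2 * X0" if "X \<le> 2 ^ n * X0" "X \<ge> 2" for X n
    using that
  proof (induction n arbitrary: X)
    case 0
    have "measure lebesgue (B \<inter> {2..X}) \<le> measure lebesgue {2..X}"
      using fm[of 2 X] by (intro measure_mono_fmeasurable[OF _ _ lmeasurable_interval(1)]) (auto simp: fmeasurable_def)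
    thus ?case using 0 e by (simp add: X0_def) (smt (verit) divide_nonneg_pos mult_nonneg_nonneg)
  next
    case (Suc n)
    show ?case
    proof (cases "X \<le> 2 * X0")
      case True
      have "measure lebesgue (B \<inter> {2..X}) \<le> measure lebesgue {2..X}"
        using fm[of 2 X] by (intro measure_mono_fmeasurable[OF _ _ lmeasurable_interval(1)]) (auto simp: fmeasurable_def)
      also have "... \<le> 2 * X0" using Suc.prems True by simp
      also have "... \<le> e / 2 * X + 2 * X0" using e Suc.prems by simp
      finally show ?thesis .
    next
      case False
      have "measure lebesgue (B \<inter> {2..X}) \<le> measure lebesgue ((B \<inter> {2..X / 2}) \<union> (B \<inter> {X / 2..2 * (X / 2)}))"
        using fm[of 2 X] fm[of 2 "X / 2"] fm[of "X / 2" "2 * (X / 2)"]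
        by (intro measure_mono_fmeasurable fmeasurable.Un) (auto simp: fmeasurable_def)
      also have "... \<le> measure lebesgue (B \<inter> {2..X / 2}) + measure lebesgue (B \<inter> {X / 2..2 * (X / 2)})"
        using fm[of 2 "X / 2"] fm[of "X / 2" "2 * (X / 2)"] by (intro measure_Un_le) (auto simp: fmeasurable_def)
      also have "measure lebesgue (B \<inter> {2..X / 2}) \<le> e / 2 * (X / 2) + 2 * X0"
        using Suc.prems False by (intro Suc.IH) (auto simp: X0_def)
      also have "measure lebesgue (B \<inter> {X / 2..2 * (X / 2)}) \<le> e / 2 * (X / 2)"
        using False by (intro X0') (auto simp: X0_def)
      finally show ?thesis by (simp add: mult.commute)
    qed
  qed
  have "eventually (\<lambda>X. X > 4 * X0 / e \<and> X \<ge> 2) at_top"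
    by (intro eventually_conj eventually_gt_at_top eventually_ge_at_top)
  thus "eventually (\<lambda>X. dist (measure lebesgue (B \<inter> {2..X}) / X) 0 < e) at_top"
  proof eventually_elim
    case (elim X)
    obtain n where "X / X0 < 2 ^ n" using real_arch_pow[of 2 "X / X0"] by auto
    hence "X \<le> 2 ^ n * X0" by (simp add: X0_def divide_less_eq less_imp_le)
    hence "measure lebesgue (B \<inter> {2..X}) \<le> e / 2 * X + 2 * X0" using bound elim by blast
    also have "2 * X0 < e / 2 * X" using elim e by (simp add: divide_less_eq field_simps)
    finally have "measure lebesgue (B \<inter> {2..X}) < e * X" by (simp add: mult.commute)
    thus ?case using elim by (simp add: divide_less_eq)
  qed
qed

section \<open>Blocks of zeros and Fejer kernels\<close>

text \<open>Half of a Fejer kernel without its constant term: K + 1 + 2 Re (fejD K t) is K + 1 times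
  the Fejer kernel, by \<open>dirS_norm_sq\<close>.\<close>

definition fejD :: "nat \<Rightarrow> real \<Rightarrow> complex" where
  "fejD K t = (\<Sum>k=1..K. of_real (real K + 1 - real k) * cis (real k * t))"

definition dirS :: "nat \<Rightarrow> real \<Rightarrow> complex" where
  "dirS K t = (\<Sum>k\<le>K. cis (real k * t))"

lemma fejD_Suc: "fejD (Suc K) t = fejD K t + (dirS (Suc K) t - 1)"
proof -
  have "fejD (Suc K) t = (\<Sum>k=1..K. of_real (real (Suc K) + 1 - real k) * cis (real k * t)) + cis (real (Suc K) * t)"
    unfolding fejD_def by simp
  also have "(\<Sum>k=1..K. of_real (real (Suc K) + 1 - real k) * cis (real k * t)) = fejD K t + (\<Sum>k=1..K. cis (real k * t))"
    unfolding fejD_def sum.distrib[symmetric] by (intro sum.cong) (auto simp: algebra_simps)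
  also have "dirS (Suc K) t - 1 = (\<Sum>k=1..Suc K. cis (real k * t))"
  proof -
    have "{..Suc K} = insert 0 {1..Suc K}" by auto
    thus ?thesis by (simp add: dirS_def)
  qed
  ultimately show ?thesis by (simp add: add_ac)
qed

text \<open>Adding w = cis ((K + 1) t) changes the square by 1 + 2 Re (dirS K t * cnj w).
  Multiplication by cnj w reverses the frequencies, so this real part is that of dirS (K + 1) t - 1,
  the increment in \<open>fejD_Suc\<close>.\<close>

lemma dirS_norm_sq: "(norm (dirS K t))^2 = real K + 1 + 2 * Re (fejD K t)"
proof (induction K)
  case 0
  thus ?case by (simp add: dirS_def fejD_def)
next
  case (Suc K)
  define w where "w = cis (real (Suc K) * t)"
  have S: "dirS (Suc K) t = dirS K t + w" by (simp add: dirS_def w_def)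
  have nw: "norm w = 1" by (simp add: w_def)
  have "Re (dirS K t * cnj w) = Re (dirS (Suc K) t - 1)"
  proof -
    have "dirS K t * cnj w = (\<Sum>k\<le>K. cis (real k * t - real (Suc K) * t))"
      unfolding dirS_def w_def sum_distrib_right cis_cnj cis_mult by simp
    hence "Re (dirS K t * cnj w) = (\<Sum>k\<le>K. cos (real k * t - real (Suc K) * t))" by simp
    also have "... = (\<Sum>k\<le>K. cos (real (Suc K - k) * t))"
    proof (rule sum.cong[OF refl])
      fix k assume "k \<in> {..K}"
      hence "real (Suc K - k) = real (Suc K) - real k" by (simp add: of_nat_diff)
      hence "real k * t - real (Suc K) * t = - (real (Suc K - k) * t)" by (simp add: algebra_simps)
      thus "cos (real k * t - real (Suc K) * t) = cos (real (Suc K - k) * t)" by (simp only: cos_minus)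
    qed
    also have "... = (\<Sum>k=1..Suc K. cos (real k * t))"
      by (rule sum.reindex_bij_witness[of _ "\<lambda>k. Suc K - k" "\<lambda>k. Suc K - k"]) auto
    also have "... = Re (dirS (Suc K) t - 1)"
    proof -
      have "{..Suc K} = insert 0 {1..Suc K}" by auto
      thus ?thesis by (simp add: dirS_def)
    qed
    finally show ?thesis .
  qed
  moreover have "(norm (dirS K t + w))^2 = (norm (dirS K t))^2 + 1 + 2 * Re (dirS K t * cnj w)"
  proof -
    have "(Re w)^2 + (Im w)^2 = 1" using nw cmod_power2[of w] by simp
    thus ?thesis unfolding cmod_power2 by (simp add: power2_eq_square algebra_simps)
  qed
  ultimately show ?case unfolding S[symmetric] fejD_Suc using Suc.IH by simp
qed

lemma dirS_bound:
  assumes q: "norm (cis t - 1) > 0"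
  shows "norm (dirS K t) \<le> 2 / norm (cis t - 1)"
proof -
  have "(cis t - 1) * dirS K t = cis (real (Suc K) * t) - 1"
  proof (induction K)
    case (Suc K)
    have "(cis t - 1) * dirS (Suc K) t = (cis (real (Suc K) * t) - 1) + (cis t - 1) * cis (real (Suc K) * t)"
      using Suc.IH by (simp add: dirS_def algebra_simps)
    also have "(cis t - 1) * cis (real (Suc K) * t) = cis (real (Suc (Suc K)) * t) - cis (real (Suc K) * t)"
      by (simp add: left_diff_distrib cis_mult algebra_simps)
    finally show ?case by simp
  qed (simp add: dirS_def)
  hence "norm (cis t - 1) * norm (dirS K t) = norm (cis (real (Suc K) * t) - 1)" by (metis norm_mult)
  also have "... \<le> 2" using norm_triangle_ineq4[of "cis (real (Suc K) * t)" 1] by simp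
  finally show ?thesis using q by (simp add: field_simps)
qed

text \<open>The negative term K + 1 is the bias that decides the race; the kernel itself stays
  bounded at a fixed distance from the multiples of 2 pi.\<close>

lemma fejD_Re_le:
  assumes q: "norm (cis t - 1) > 0"
  shows "2 * Re (fejD K t) \<le> - (real K + 1) + 4 / (norm (cis t - 1))^2"
proof -
  have "(norm (dirS K t))^2 \<le> (2 / norm (cis t - 1))^2" by (intro power_mono dirS_bound q) auto
  thus ?thesis unfolding dirS_norm_sq by (simp add: power_divide)
qed

lemma fejD_norm_le:
  assumes q: "norm (cis t - 1) > 0"
  shows "norm (fejD K t) \<le> 2 * real K / norm (cis t - 1)"
proof (induction K)
  case (Suc K)
  have "dirS (Suc K) t - 1 = cis t * dirS K t"
  proof -
    have "dirS (Suc K) t = 1 + (\<Sum>k\<le>K. cis (real (Suc k) * t))"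
      unfolding dirS_def by (subst sum.atMost_Suc_shift) simp
    thus ?thesis by (simp add: dirS_def sum_distrib_left cis_mult algebra_simps)
  qed
  hence "norm (dirS (Suc K) t - 1) \<le> 2 / norm (cis t - 1)" using dirS_bound[OF q, of K] by (simp add: norm_mult)
  hence "norm (fejD (Suc K) t) \<le> 2 * real K / norm (cis t - 1) + 2 / norm (cis t - 1)"
    unfolding fejD_Suc by (intro norm_triangle_le add_mono Suc.IH)
  also have "... = 2 * real (Suc K) / norm (cis t - 1)" by (simp add: add_divide_distrib algebra_simps)
  finally show ?case .
qed (simp add: fejD_def)

lemma fejD_trivial: "norm (fejD K t) \<le> real K ^ 2"
proof -
  have "norm (fejD K t) \<le> (\<Sum>k=1..K. real K)"
    unfolding fejD_def by (rule sum_norm_le) (auto simp: norm_mult simp del: of_real_add of_real_diff)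
  thus ?thesis by (simp add: power2_eq_square)
qed

text \<open>A phase error mixes in the imaginary part of \<open>fejD\<close>, for which
  \<open>fejD_norm_le\<close> gives only 2 K / |cis t - 1|. What has to be small is therefore \<phi>
  divided by |cis t - 1|, and not \<phi> alone.\<close>

lemma fejer_phase_bound:
  assumes \<phi>: "\<bar>\<phi>\<bar> \<le> 1" and q: "norm (cis t - 1) > 0" and K: "8 / (norm (cis t - 1))^2 \<le> real K"
  shows "2 * Re (cis \<phi> * fejD K t) \<le> - real K / 4 + 4 * \<bar>\<phi>\<bar> * real K / norm (cis t - 1)"
proof -
  define D where "D = fejD K t"
  have "2 * Re D \<le> - real K / 2"
    using fejD_Re_le[OF q, of K] K unfolding D_def by (simp add: field_simps)
  moreover have cphi: "cos \<phi> \<ge> 1/2"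
  proof -
    have "cos (pi / 3) \<le> cos \<bar>\<phi>\<bar>" using \<phi> pi_gt3 by (intro cos_monotone_0_pi_le) auto
    thus ?thesis by (simp add: cos_60)
  qed
  ultimately have 1: "cos \<phi> * (2 * Re D) \<le> - real K / 4"
  proof -
    have "cos \<phi> * (2 * Re D) \<le> cos \<phi> * (- real K / 2)"
      using cphi \<open>2 * Re D \<le> - real K / 2\<close> by (intro mult_left_mono) auto
    also have "... \<le> 1/2 * (- real K / 2)"
      using cphi by (intro mult_right_mono_neg) auto
    finally show ?thesis by simp
  qed
  have "\<bar>sin \<phi> * Im D\<bar> \<le> \<bar>\<phi>\<bar> * (2 * real K / norm (cis t - 1))"
    unfolding abs_mult using fejD_norm_le[OF q, of K] abs_Im_le_cmod[of D] abs_sin_le_one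
    by (intro mult_mono abs_sin_x_le_abs_x) (auto simp: D_def)
  hence 2: "- 2 * (sin \<phi> * Im D) \<le> 4 * \<bar>\<phi>\<bar> * real K / norm (cis t - 1)" by (simp add: abs_le_iff)
  have "2 * Re (cis \<phi> * D) = cos \<phi> * (2 * Re D) - 2 * (sin \<phi> * Im D)" by (simp add: algebra_simps)
  thus ?thesis using 1 2 unfolding D_def by linarith
qed

text \<open>In the denominator \<open>\<rho> k\<close> is replaced by i k \<gamma>: its factor k
  cancels against the multiplicity and its factor i turns Re into Im. As \<open>\<beta>\<close> and
  \<open>\<theta>\<close> are bounded by 1 and 3, the reciprocals differ by at most 8 / (k
  \<gamma>)^2, which makes each of the K errors at most 16 K / \<gamma>^2 times exp (\<beta>
  u).\<close>

lemma zero_block_approx: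
  fixes \<gamma> \<beta> \<theta> u :: real and K :: nat
  defines "\<rho> \<equiv> \<lambda>k. Complex \<beta> (real k * \<gamma> + \<theta>)"
  assumes \<gamma>: "\<gamma> \<ge> 10" and \<theta>: "\<bar>\<theta>\<bar> \<le> 3" and \<beta>: "0 < \<beta>" "\<beta> < 1"
  shows "\<bar>(\<Sum>k=1..K. 2 * Re (of_nat (k * (K + 1 - k)) * exp (\<rho> k * of_real u) / \<rho> k)) -
     2 * (exp (\<beta> * u) / \<gamma>) * Im (cis (\<theta> * u) * fejD K (\<gamma> * u))\<bar> \<le> 16 * (exp (\<beta> * u) / \<gamma>) * (real K ^ 2 / \<gamma>)"
proof -
  have term_eq: "\<bar>2 * Re (of_nat (k * (K + 1 - k)) * exp (\<rho> k * of_real u) / \<rho> k) -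
     2 * (exp (\<beta> * u) / \<gamma>) * Im (cis (\<theta> * u) * (of_real (real K + 1 - real k) * cis (real k * (\<gamma> * u))))\<bar> \<le> 16 * exp (\<beta> * u) / \<gamma>^2 * real K"
    if k: "k \<in> {1..K}" for k
  proof -
    define a where "a = real K + 1 - real k"
    have a: "0 \<le> a" "a \<le> real K" using k by (auto simp: a_def)
    define e where "e = exp (\<rho> k * of_real u)"
    have e_eq: "e = of_real (exp (\<beta> * u)) * (cis (\<theta> * u) * cis (real k * (\<gamma> * u)))"
    proof -
      have "\<rho> k * of_real u = of_real (\<beta> * u) + \<i> * of_real (\<theta> * u + real k * (\<gamma> * u))"
        by (simp add: \<rho>_def complex_eq_iff algebra_simps)
      thus ?thesis by (simp only: e_def exp_add exp_of_real cis_mult) (simp only: cis_conv_exp)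
    qed
    have ne: "norm e = exp (\<beta> * u)" unfolding e_eq by (simp add: norm_mult)
    have kg: "real k * \<gamma> \<ge> 10" using k \<gamma> mult_mono[of 1 "real k" 10 \<gamma>] by simp
    have rho_ge: "norm (\<rho> k) \<ge> real k * \<gamma> / 2"
      using abs_Im_le_cmod[of "\<rho> k"] \<theta> kg by (simp add: \<rho>_def abs_le_iff)
    have rho0: "\<rho> k \<noteq> 0" using rho_ge kg by auto
    have mk: "of_nat (k * (K + 1 - k)) = (of_real (real k * a) :: complex)"
      using k by (simp add: a_def of_nat_diff)
    define c where "c = \<i> * of_real (real k * \<gamma>)"
    have c0: "c \<noteq> 0" "norm c = real k * \<gamma>" using k kg \<gamma> by (auto simp: c_def norm_mult)
    have main: "2 * (exp (\<beta> * u) / \<gamma>) * Im (cis (\<theta> * u) * (of_real a * cis (real k * (\<gamma> * u)))) = 2 * Re (of_real (real k * a) * e / c)"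
    proof -
      define W where "W = cis (\<theta> * u) * cis (real k * (\<gamma> * u))"
      have "of_real (real k * a) * e / c = of_real (exp (\<beta> * u) / \<gamma> * a) * W / \<i>"
        using k \<gamma> unfolding e_eq c_def W_def[symmetric] by (simp add: field_simps)
      also have "W / \<i> = - \<i> * W" by simp
      hence "of_real (exp (\<beta> * u) / \<gamma> * a) * W / \<i> = of_real (exp (\<beta> * u) / \<gamma> * a) * (- \<i> * W)" by (simp only: times_divide_eq_right[symmetric])
      finally have r1: "Re (of_real (real k * a) * e / c) = exp (\<beta> * u) / \<gamma> * a * Im W" by simp
      have "cis (\<theta> * u) * (of_real a * cis (real k * (\<gamma> * u))) = of_real a * W" by (simp add: W_def)
      hence r2: "Im (cis (\<theta> * u) * (of_real a * cis (real k * (\<gamma> * u)))) = a * Im W" by (simp only:) simp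
      show ?thesis unfolding r1 r2 by simp
    qed
    have "\<bar>2 * Re (of_real (real k * a) * e / \<rho> k) - 2 * Re (of_real (real k * a) * e / c)\<bar>
      = 2 * \<bar>Re (of_real (real k * a) * e / \<rho> k - of_real (real k * a) * e / c)\<bar>" unfolding minus_complex.simps by (simp only: right_diff_distrib[symmetric] abs_mult abs_numeral)
    also have "... \<le> 2 * norm (of_real (real k * a) * e / \<rho> k - of_real (real k * a) * e / c)"
      by (intro mult_left_mono abs_Re_le_cmod) auto
    also have "of_real (real k * a) * e / \<rho> k - of_real (real k * a) * e / c = of_real (real k * a) * e * ((c - \<rho> k) / (\<rho> k * c))"
      using rho0 c0 by (simp add: field_simps)
    also have "norm ... = real k * a * exp (\<beta> * u) * (norm (c - \<rho> k) / (norm (\<rho> k) * (real k * \<gamma>)))"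
      using a ne c0 by (simp add: norm_mult norm_divide)
    also have "... \<le> real k * a * exp (\<beta> * u) * (4 / ((real k * \<gamma> / 2) * (real k * \<gamma>)))"
    proof (intro mult_left_mono frac_le)
      have "c - \<rho> k = - Complex \<beta> \<theta>" by (simp add: c_def \<rho>_def complex_eq_iff)
      hence "norm (c - \<rho> k) = norm (Complex \<beta> \<theta>)" by (simp only: norm_minus_cancel)
      also have "... \<le> \<bar>\<beta>\<bar> + \<bar>\<theta>\<bar>" using cmod_le[of "Complex \<beta> \<theta>"] by simp
      finally show "norm (c - \<rho> k) \<le> 4" using \<beta> \<theta> by simp
      show "real k * \<gamma> / 2 * (real k * \<gamma>) \<le> norm (\<rho> k) * (real k * \<gamma>)" using rho_ge kg by (intro mult_right_mono) auto
    qed (use kg a in auto)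
    also have "... = 8 * exp (\<beta> * u) / \<gamma>^2 * (a / real k)" using k \<gamma> by (simp add: field_simps power2_eq_square)
    also have "... \<le> 8 * exp (\<beta> * u) / \<gamma>^2 * real K"
    proof (intro mult_left_mono)
      have "a / real k \<le> real K / 1" using a k by (intro frac_le) auto
      thus "a / real k \<le> real K" by simp
    qed auto
    finally have "\<bar>2 * Re (of_real (real k * a) * e / \<rho> k) - 2 * Re (of_real (real k * a) * e / c)\<bar> \<le> 2 * (8 * exp (\<beta> * u) / \<gamma>^2 * real K)"
      by simp
    thus ?thesis unfolding mk e_def[symmetric] a_def[symmetric] main by simp
  qed
  have eq: "(\<Sum>k=1..K. 2 * Re (of_nat (k * (K + 1 - k)) * exp (\<rho> k * of_real u) / \<rho> k)) -
     2 * (exp (\<beta> * u) / \<gamma>) * Im (cis (\<theta> * u) * fejD K (\<gamma> * u)) =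
     (\<Sum>k=1..K. 2 * Re (of_nat (k * (K + 1 - k)) * exp (\<rho> k * of_real u) / \<rho> k) -
     2 * (exp (\<beta> * u) / \<gamma>) * Im (cis (\<theta> * u) * (of_real (real K + 1 - real k) * cis (real k * (\<gamma> * u)))))"
    unfolding fejD_def sum_distrib_left Im_sum sum_subtractf by simp
  show ?thesis unfolding eq
  proof (rule order_trans[OF sum_abs])
    have "(\<Sum>k=1..K. \<bar>2 * Re (of_nat (k * (K + 1 - k)) * exp (\<rho> k * of_real u) / \<rho> k) -
     2 * (exp (\<beta> * u) / \<gamma>) * Im (cis (\<theta> * u) * (of_real (real K + 1 - real k) * cis (real k * (\<gamma> * u))))\<bar>)
      \<le> (\<Sum>k=1..K. 16 * exp (\<beta> * u) / \<gamma>^2 * real K)" by (rule sum_mono[OF term_eq])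
    also have "... = 16 * (exp (\<beta> * u) / \<gamma>) * (real K ^ 2 / \<gamma>)" by (simp add: power2_eq_square)
    finally show "(\<Sum>k=1..K. \<bar>2 * Re (of_nat (k * (K + 1 - k)) * exp (\<rho> k * of_real u) / \<rho> k) -
     2 * (exp (\<beta> * u) / \<gamma>) * Im (cis (\<theta> * u) * (of_real (real K + 1 - real k) * cis (real k * (\<gamma> * u))))\<bar>)
      \<le> 16 * (exp (\<beta> * u) / \<gamma>) * (real K ^ 2 / \<gamma>)" .
  qed
qed

section \<open>Size and phase of the blocks for u near Y^16\<close>

lemma pow8_shift_le:
  assumes "Y \<ge> (1::real)"
  shows "(Y + 1) ^ 8 \<le> Y ^ 8 + 255 * Y ^ 7"
proof -
  have m: "Y ^ i \<le> Y ^ 7" if "i \<le> 7" for i using that assms by (rule power_increasing)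
  have "(Y + 1) ^ 8 = Y^8 + 8 * Y^7 + 28 * Y^6 + 56 * Y^5 + 70 * Y^4 + 56 * Y^3 + 28 * Y^2 + 8 * Y^1 + Y^0"
    by (simp add: eval_nat_numeral algebra_simps)
  thus ?thesis using m[of 6] m[of 5] m[of 4] m[of 3] m[of 2] m[of 1] m[of 0] by linarith
qed

lemma pow8_diff_ge:
  assumes "r > (0::real)"
  shows "(r ^ 8 - 1)^2 \<ge> (r - 1)^2"
proof -
  define S where "S = (\<Sum>i<8. r ^ i)"
  have e: "r ^ 8 - 1 = (r - 1) * S" unfolding S_def by (rule power_diff_1_eq)
  have S1: "S \<ge> 1"
  proof -
    have "(\<Sum>i\<in>{0}. r ^ i) \<le> (\<Sum>i<8. r ^ i)" using assms by (intro sum_mono2) auto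
    thus ?thesis by (simp add: S_def)
  qed
  have "\<bar>r - 1\<bar> * 1 \<le> \<bar>r - 1\<bar> * S" using S1 by (intro mult_left_mono) auto
  hence "\<bar>r - 1\<bar> \<le> \<bar>r ^ 8 - 1\<bar>" unfolding e abs_mult using S1 by simp
  thus ?thesis by (simp add: abs_le_square_iff)
qed

lemma power_cancel_aux:
  fixes p q a :: real
  assumes "p \<noteq> 0"
  shows "a * p * (1 / (q * p)) = a / q" "a * p * (1 / (p / 256)) = 256 * a" "1 / p * (a * p) = a"
  using assms by auto

text \<open>Up to lower order the logarithm of V j at u = Y^16 is \<sigma> u minus Y^16 / j^8 + j^8.
  With r = j / Y the latter is Y^8 (2 + (r^8 - 1)^2 / r^8), so leaving the window |j - Y| \<le> 500
  sqrt Y costs a multiple of Y^7. Far from the window crude factors 1/2 and 2 in j / Y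
  suffice.\<close>

lemma exponent_irrelevant:
  fixes Y z :: real and j :: nat
  assumes Y: "Y = z^2" and z: "z \<ge> 1000" and j: "j \<ge> 2" and irr: "\<bar>real j - Y\<bar> > 500 * z"
  shows "Y ^ 16 * (1 / real j ^ 8 - 1 / real j ^ 9) + real j ^ 8 \<ge> 2 * Y ^ 8 + 260 * Y ^ 7 + real j"
proof -
  have Y1: "Y \<ge> 1000000" using z power_mono[of 1000 z 2] by (simp add: Y)
  have Y78: "Y ^ 8 = Y * Y ^ 7" by (simp add: power_Suc[symmetric])
  have Y87: "Y ^ 8 \<ge> 1000000 * Y ^ 7" unfolding Y78 using Y1 by (intro mult_right_mono) auto
  have Y7p: "Y ^ 7 \<ge> 0" using Y1 by simp
  have Y8p: "Y ^ 8 \<ge> 0" using Y1 by simp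
  have j2: "real j \<ge> 2" using j by simp
  have j0: "real j > 0" using j by simp
  have dj: "1 / real j ^ 8 - 1 / real j ^ 9 \<ge> 1 / real j ^ 8 / 2"
  proof -
    have "real j ^ 9 = real j ^ 8 * real j" by (simp add: power_Suc2[symmetric])
    hence "1 / real j ^ 9 = 1 / real j ^ 8 / real j" by simp
    also have "... \<le> 1 / real j ^ 8 / 2" using j2 by (intro divide_left_mono) auto
    finally show ?thesis by simp
  qed
  have jj8: "real j \<le> real j ^ 8 / 2"
  proof -
    have "2 * real j \<le> real j * real j" using j2 by simp
    also have "real j * real j = real j ^ 2" by (simp add: power2_eq_square)
    also have "... \<le> real j ^ 8" using j2 by (intro power_increasing) auto
    finally show ?thesis by simp
  qed
  consider "real j < Y / 2" | "real j > 2 * Y" | "Y / 2 \<le> real j" "real j \<le> 2 * Y" by linarith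
  thus ?thesis
  proof cases
    case 1
    have "real j ^ 8 \<le> (Y / 2) ^ 8" using 1 by (intro power_mono) auto
    also have "... = Y ^ 8 / 256" by (simp add: power_divide)
    finally have "Y ^ 16 * (1 / real j ^ 8) \<ge> Y ^ 16 * (1 / (Y ^ 8 / 256))"
      using j0 Y1 by (intro mult_left_mono divide_left_mono mult_pos_pos) auto
    also have "Y ^ 16 * (1 / (Y ^ 8 / 256)) = 256 * Y ^ 8"
    proof -
      have "Y ^ 16 = Y ^ 8 * Y ^ 8" by (simp add: power_add[symmetric])
      thus ?thesis by (simp only:) (rule power_cancel_aux(2), use Y1 in simp)
    qed
    finally have a: "Y ^ 16 * (1 / real j ^ 8) \<ge> 256 * Y ^ 8" .
    have "Y ^ 16 * (1 / real j ^ 8 - 1 / real j ^ 9) \<ge> Y ^ 16 * (1 / real j ^ 8 / 2)"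
      using dj Y1 by (intro mult_left_mono) auto
    hence "Y ^ 16 * (1 / real j ^ 8 - 1 / real j ^ 9) \<ge> 128 * Y ^ 8" using a by simp
    moreover have "real j ^ 8 \<ge> 0" by simp
    ultimately show ?thesis using Y87 Y7p jj8 by linarith
  next
    case 2
    have "(2 * Y) ^ 8 \<le> real j ^ 8" using 2 Y1 by (intro power_mono) auto
    hence "256 * Y ^ 8 \<le> real j ^ 8" by (simp add: power_mult_distrib)
    moreover have "0 \<le> 1 / real j ^ 8 / 2" by simp
    hence "0 \<le> 1 / real j ^ 8 - 1 / real j ^ 9" using dj by (rule order_trans)
    hence "Y ^ 16 * (1 / real j ^ 8 - 1 / real j ^ 9) \<ge> 0" using Y1 by (intro mult_nonneg_nonneg) auto
    ultimately show ?thesis using jj8 Y87 Y7p by linarith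
  next
    case 3
    define r where "r = real j / Y"
    have r: "1/2 \<le> r" "r \<le> 2" "r > 0" using 3 Y1 by (auto simp: r_def field_simps)
    have jr: "real j = r * Y" using Y1 by (simp add: r_def)
    have e1: "Y ^ 16 * (1 / real j ^ 8) = Y ^ 8 / r ^ 8"
    proof -
      have "Y ^ 16 = Y ^ 8 * Y ^ 8" by (simp add: power_add[symmetric])
      thus ?thesis unfolding jr power_mult_distrib by (simp only:) (rule power_cancel_aux(1), use Y1 in simp)
    qed
    have e2: "Y ^ 16 * (1 / real j ^ 9) \<le> 512 * Y ^ 7"
    proof -
      have "Y ^ 16 = Y ^ 7 * Y ^ 9" by (simp add: power_add[symmetric])
      hence "Y ^ 16 * (1 / real j ^ 9) = Y ^ 7 / r ^ 9" unfolding jr power_mult_distrib by (simp only:) (rule power_cancel_aux(1), use Y1 in simp)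
      also have "... \<le> Y ^ 7 / (1/2) ^ 9" using r Y7p by (intro divide_left_mono power_mono mult_pos_pos) auto
      finally show ?thesis by (simp add: power_divide)
    qed
    have "(r - 1)^2 \<ge> 250000 / Y"
    proof -
      have "real j - Y = (r - 1) * Y" by (simp add: jr algebra_simps)
      hence "\<bar>r - 1\<bar> * Y > 500 * z" using irr Y1 by (simp add: abs_mult)
      hence "(500 * z)^2 \<le> (\<bar>r - 1\<bar> * Y)^2" using z by (intro power_mono) auto
      hence "250000 * Y \<le> (r - 1)^2 * (Y * Y)" by (simp add: power_mult_distrib Y[symmetric] power2_eq_square[of Y])
      hence "250000 \<le> (r - 1)^2 * Y" using Y1 by (simp add: mult.assoc[symmetric])
      thus ?thesis using Y1 by (simp add: divide_le_eq)
    qed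
    hence q: "(r ^ 8 - 1)^2 \<ge> 250000 / Y" using pow8_diff_ge[OF r(3)] by linarith
    have r8: "r ^ 8 \<le> 256" "r ^ 8 > 0" using power_mono[OF r(2), of 8] r by auto
    have E: "1 / r ^ 8 + r ^ 8 = 2 + (r ^ 8 - 1)^2 / r ^ 8" using r8 by (simp add: field_simps power2_eq_square)
    have "(r ^ 8 - 1)^2 / r ^ 8 \<ge> (250000 / Y) / 256" using q r8 Y1 by (intro frac_le) auto
    \<comment> \<open>The budget is 976 = 512 + 260 + 204: 512 Y^7 pays for the tolerance 1 / j^9,
      260 Y^7 is the claimed gain, and 204 Y^7 covers the summand j.\<close>
    moreover have "976 / Y \<le> (250000 / Y) / 256" using Y1 by (simp add: field_simps)
    ultimately have "1 / r ^ 8 + r ^ 8 \<ge> 2 + 976 / Y" unfolding E by linarith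
    hence "Y ^ 8 * (1 / r ^ 8 + r ^ 8) \<ge> Y ^ 8 * (2 + 976 / Y)" using Y8p by (intro mult_left_mono) auto
    also have "Y ^ 8 * (2 + 976 / Y) = 2 * Y ^ 8 + 976 * Y ^ 7" unfolding Y78 using Y1 by (simp add: field_simps)
    finally have "Y ^ 8 * (1 / r ^ 8 + r ^ 8) \<ge> 2 * Y ^ 8 + 976 * Y ^ 7" .
    moreover have "Y ^ 8 * (1 / r ^ 8 + r ^ 8) = Y ^ 16 * (1 / real j ^ 8) + real j ^ 8"
      unfolding e1 by (simp add: jr power_mult_distrib algebra_simps)
    moreover have "real j \<le> 204 * Y ^ 7"
    proof -
      have "Y ^ 1 \<le> Y ^ 7" using Y1 by (intro power_increasing) auto
      thus ?thesis using 3 Y1 by simp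
    qed
    ultimately show ?thesis using e2 unfolding right_diff_distrib by linarith
  qed
qed

text \<open>Both parts of the theorem at once. The sign \<open>s\<close> is chosen so that s (pi(x)
  - li(x)) is negative for almost all x in either case.\<close>

locale race =
  fixes \<sigma> \<xi> s :: real and \<gamma> d \<theta> :: "nat \<Rightarrow> real" and J :: nat
  assumes J: "J \<ge> 2" and \<sigma>: "1/2 < \<sigma>" "\<sigma> < 1"
    and xs: "(\<xi> = 0 \<and> s = 1) \<or> (\<xi> = pi \<and> s = -1)"
    and \<gamma>: "\<And>j. j \<ge> J \<Longrightarrow> exp (real j ^ 8) \<le> \<gamma> j \<and> \<gamma> j \<le> 2 * exp (real j ^ 8)"
    and d: "\<And>j. j \<ge> J \<Longrightarrow> \<bar>d j - 1 / real j ^ 8\<bar> \<le> 1 / real j ^ 9"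
    and \<theta>: "\<And>j. j \<ge> J \<Longrightarrow> \<bar>\<theta> j - (\<xi> - pi / 2) / real j ^ 16\<bar> \<le> 1 / real j ^ 17"
    and d\<sigma>: "\<And>j. j \<ge> J \<Longrightarrow> d j < \<sigma> - 1/2"
begin

definition V :: "nat \<Rightarrow> real \<Rightarrow> real" where "V j u = exp ((\<sigma> - d j) * u) / \<gamma> j"
text \<open>What is left of the phase \<theta> j * u after removal of \<xi> - pi / 2. It is small
  when u is close to j^16.\<close>

definition \<phi> :: "nat \<Rightarrow> real \<Rightarrow> real" where "\<phi> j u = \<theta> j * u - (\<xi> - pi / 2)"
definition Rj :: "nat \<Rightarrow> real \<Rightarrow> real" where "Rj j u = 2 * Re (cis (\<phi> j u) * fejD (j ^ 3) (\<gamma> j * u))"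

lemma xi_bound: "\<bar>\<xi> - pi / 2\<bar> \<le> 2"
proof -
  have "\<xi> = 0 \<or> \<xi> = pi" using xs by auto
  thus ?thesis using pi_less_4 pi_gt_zero by (elim disjE) linarith+
qed

lemma j_ge: "j \<ge> J \<Longrightarrow> real j \<ge> 2" using J by simp

lemma gamma_ge: "j \<ge> J \<Longrightarrow> \<gamma> j \<ge> 100" "j \<ge> J \<Longrightarrow> \<gamma> j > 0"
proof -
  show 1: "\<gamma> j \<ge> 100" if "j \<ge> J"
  proof -
    have "(2::real) ^ 8 \<le> real j ^ 8" using j_ge[OF that] by (intro power_mono) auto
    hence "100 \<le> real j ^ 8" by simp
    also have "... \<le> exp (real j ^ 8)" using exp_ge_add_one_self[of "real j ^ 8"] by linarith
    finally show ?thesis using \<gamma>[OF that] by linarith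
  qed
  show "\<gamma> j > 0" if "j \<ge> J" using 1[OF that] by linarith
qed

lemma d_lower: "j \<ge> J \<Longrightarrow> d j \<ge> 1 / real j ^ 8 - 1 / real j ^ 9" using d[of j] by (auto simp: abs_le_iff)

lemma d_nonneg: "j \<ge> J \<Longrightarrow> d j \<ge> 0"
proof -
  assume j: "j \<ge> J"
  have "real j ^ 8 \<le> real j ^ 9" using j_ge[OF j] by (intro power_increasing) auto
  hence "1 / real j ^ 9 \<le> 1 / real j ^ 8" using j_ge[OF j] by (intro divide_left_mono mult_pos_pos) auto
  thus ?thesis using d_lower[OF j] by linarith
qed

lemma beta_bounds: "j \<ge> J \<Longrightarrow> \<sigma> - d j > 1/2" "j \<ge> J \<Longrightarrow> \<sigma> - d j < 1"
  using d\<sigma>[of j] d_nonneg[of j] \<sigma> by auto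

lemma theta_bound: "j \<ge> J \<Longrightarrow> \<bar>\<theta> j\<bar> \<le> 3"
proof -
  assume j: "j \<ge> J"
  have "1 \<le> real j ^ 16" "1 \<le> real j ^ 17" using j_ge[OF j] by (auto intro: one_le_power)
  note p = this
  have "\<bar>\<xi> - pi / 2\<bar> / \<bar>real j ^ 16\<bar> \<le> 2 / 1" using xi_bound p by (intro frac_le) auto
  hence 1: "\<bar>(\<xi> - pi / 2) / real j ^ 16\<bar> \<le> 2" by (simp only: abs_divide div_by_1)
  have 2: "1 / real j ^ 17 \<le> 1 / 1" using p by (intro frac_le) auto
  show ?thesis using \<theta>[OF j] 1 2 by linarith
qed

lemma V_pos: "j \<ge> J \<Longrightarrow> V j u > 0" using gamma_ge by (simp add: V_def)

lemma Rj_trivial: "\<bar>Rj j u\<bar> \<le> 2 * real (j ^ 3) ^ 2"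
proof -
  have "\<bar>Re (cis (\<phi> j u) * fejD (j ^ 3) (\<gamma> j * u))\<bar> \<le> norm (cis (\<phi> j u) * fejD (j ^ 3) (\<gamma> j * u))" by (rule abs_Re_le_cmod)
  also have "... \<le> real (j ^ 3) ^ 2" using fejD_trivial[of "j ^ 3" "\<gamma> j * u"] by (simp add: norm_mult)
  finally show ?thesis by (simp add: Rj_def)
qed

text \<open>Since cis (\<xi> - pi / 2) = - s * i, the imaginary part in
  \<open>zero_block_approx\<close> becomes - s times a real part. This is where \<xi> decides the
  sign.\<close>

lemma block_approx:
  assumes j: "j \<ge> J"
  shows "\<bar>(\<Sum>k=1..j^3. 2 * Re (of_nat (k * (j^3 + 1 - k)) * exp (Complex (\<sigma> - d j) (real k * \<gamma> j + \<theta> j) * of_real u) / Complex (\<sigma> - d j) (real k * \<gamma> j + \<theta> j)))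
     + s * (V j u * Rj j u)\<bar> \<le> 16 * (V j u * (real (j^3) ^ 2 / \<gamma> j))"
proof -
  define D where "D = fejD (j^3) (\<gamma> j * u)"
  have "2 * Im (cis (\<theta> j * u) * D) = - (s * Rj j u)"
  proof -
    have "cis (\<theta> j * u) = cis (\<phi> j u) * cis (\<xi> - pi / 2)" by (simp add: cis_mult \<phi>_def)
    moreover have "cis (\<xi> - pi / 2) = - of_real s * \<i>"
      using xs by (auto simp: complex_eq_iff cos_diff sin_diff)
    ultimately have "cis (\<theta> j * u) * D = - of_real s * \<i> * (cis (\<phi> j u) * D)" by simp
    hence "Im (cis (\<theta> j * u) * D) = - s * Re (cis (\<phi> j u) * D)" by simp
    thus ?thesis by (simp add: Rj_def D_def)
  qed
  note I2 = this
  have "2 * (exp ((\<sigma> - d j) * u) / \<gamma> j) * Im (cis (\<theta> j * u) * D) = V j u * (2 * Im (cis (\<theta> j * u) * D))"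
    unfolding V_def by (simp only: mult_ac)
  also have "... = - (s * (V j u * Rj j u))" unfolding I2 by simp
  finally have e: "2 * (exp ((\<sigma> - d j) * u) / \<gamma> j) * Im (cis (\<theta> j * u) * D) = - (s * (V j u * Rj j u))" .
  show ?thesis
    using zero_block_approx[of "\<gamma> j" "\<theta> j" "\<sigma> - d j" "j^3" u] gamma_ge[OF j] theta_bound[OF j] beta_bounds[OF j]
    unfolding D_def[symmetric] e unfolding V_def[symmetric] by (simp add: mult.assoc)
qed

text \<open>The loss 259 Y^7 consists of 255 Y^7 for rounding Y up to j, of Y^7 for the tolerance of
  d j, and of 3 Y^7 for the constants. In \<open>V_irrelevant\<close> it is 260 Y^7, so irrelevant
  blocks are smaller by the factor exp (- Y^7).\<close>

lemma V_lower:
  assumes Y: "Y \<ge> 1" and j: "j = nat \<lceil>Y\<rceil>" "j \<ge> J" and u: "Y ^ 16 \<le> u" "u \<le> Y ^ 16 + 1"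
  shows "V j u \<ge> exp (\<sigma> * u - 2 * Y ^ 8 - 259 * Y ^ 7)"
proof -
  have jY: "Y \<le> real j" "real j \<le> Y + 1" using j Y by linarith+
  have "d j \<le> 1 / real j ^ 8 + 1 / real j ^ 9" using d[OF j(2)] by (auto simp: abs_le_iff)
  also have "... \<le> 1 / Y ^ 8 + 1 / Y ^ 9" using jY Y by (intro add_mono divide_left_mono power_mono mult_pos_pos) auto
  finally have dY: "d j \<le> 1 / Y ^ 8 + 1 / Y ^ 9" .
  have "0 \<le> Y ^ 16" using Y by simp
  hence u0: "0 \<le> u" using u(1) by linarith
  have "d j * u \<le> (1 / Y ^ 8 + 1 / Y ^ 9) * (Y ^ 16 + 1)"
    using dY u u0 Y d_nonneg[OF j(2)] by (intro mult_mono) auto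
  also have "... = Y ^ 8 + Y ^ 7 + 1 / Y ^ 8 + 1 / Y ^ 9"
  proof -
    have "Y ^ 16 = Y ^ 8 * Y ^ 8" "Y ^ 16 = Y ^ 7 * Y ^ 9" by (simp_all add: power_add[symmetric])
    note p = this
    have 1: "1 / Y ^ 8 * Y ^ 16 = Y ^ 8" unfolding p(1) by (rule power_cancel_aux(3)) (use Y in simp)
    have 2: "1 / Y ^ 9 * Y ^ 16 = Y ^ 7" unfolding p(2) by (rule power_cancel_aux(3)) (use Y in simp)
    show ?thesis unfolding distrib_right distrib_left 1 2 by simp
  qed
  also have "... \<le> Y ^ 8 + Y ^ 7 + 2"
  proof -
    have "1 \<le> Y ^ 8" "1 \<le> Y ^ 9" using Y by (auto intro: one_le_power)
    hence "1 / Y ^ 8 \<le> 1 / 1" "1 / Y ^ 9 \<le> 1 / 1" by (intro frac_le; simp)+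
    thus ?thesis by linarith
  qed
  finally have du: "d j * u \<le> Y ^ 8 + Y ^ 7 + 2" .
  have "ln (\<gamma> j) \<le> ln (2 * exp (real j ^ 8))" using \<gamma>[OF j(2)] gamma_ge(2)[OF j(2)] by (subst ln_le_cancel_iff) auto
  also have "... = ln 2 + real j ^ 8" by (simp add: ln_mult)
  also have "real j ^ 8 \<le> (Y + 1) ^ 8" using jY Y by (intro power_mono) auto
  finally have lg: "ln (\<gamma> j) \<le> 1 + (Y ^ 8 + 255 * Y ^ 7)" using pow8_shift_le[OF Y] ln_2_less_1 by linarith
  have Y7: "1 \<le> Y ^ 7" using Y by (rule one_le_power)
  have "V j u = exp ((\<sigma> - d j) * u - ln (\<gamma> j))" using gamma_ge(2)[OF j(2)] by (simp add: V_def exp_diff)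
  moreover have "(\<sigma> - d j) * u - ln (\<gamma> j) \<ge> \<sigma> * u - 2 * Y ^ 8 - 259 * Y ^ 7" using du lg Y7 by (simp add: left_diff_distrib)
  ultimately show ?thesis by simp
qed

text \<open>The extra - j in the exponent leaves a convergent series when all irrelevant blocks are
  added up.\<close>

lemma V_irrelevant:
  assumes Y: "Y = z^2" and z: "z \<ge> 1000" and j: "j \<ge> J" and irr: "\<bar>real j - Y\<bar> > 500 * z" and u: "Y ^ 16 \<le> u"
  shows "V j u \<le> exp (\<sigma> * u - 2 * Y ^ 8 - 260 * Y ^ 7 - real j)"
proof -
  have "V j u = exp ((\<sigma> - d j) * u - ln (\<gamma> j))" using gamma_ge(2)[OF j] by (simp add: V_def exp_diff)
  moreover have "ln (\<gamma> j) \<ge> real j ^ 8"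
    using \<gamma>[OF j] gamma_ge(2)[OF j] by (metis exp_gt_zero ln_exp ln_le_cancel_iff)
  moreover have "d j * u \<ge> Y ^ 16 * (1 / real j ^ 8 - 1 / real j ^ 9)"
  proof -
    have "d j * u \<ge> d j * Y ^ 16" using u d_nonneg[OF j] by (intro mult_left_mono) auto
    moreover have "d j * Y ^ 16 \<ge> (1 / real j ^ 8 - 1 / real j ^ 9) * Y ^ 16" using d_lower[OF j] by (intro mult_right_mono) (auto simp: Y)
    ultimately show ?thesis by (simp add: mult.commute)
  qed
  moreover have "Y ^ 16 * (1 / real j ^ 8 - 1 / real j ^ 9) + real j ^ 8 \<ge> 2 * Y ^ 8 + 260 * Y ^ 7 + real j"
    using J j by (intro exponent_irrelevant[OF Y z _ irr]) auto
  ultimately show ?thesis by (simp add: left_diff_distrib)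
qed

text \<open>\<open>\<phi> j u\<close> splits into (\<xi> - pi / 2) (u / j^16 - 1), of order |j - Y|
  / Y = O(1 / z), and the tolerance of \<theta> j multiplied by u, of order 1 / Y. The constant 2 ^
  40 is generous.\<close>

lemma phi_bound:
  assumes Y: "Y = z^2" and z: "z \<ge> 1000" and j: "j \<ge> J" and rel: "\<bar>real j - Y\<bar> \<le> 500 * z" and u: "Y ^ 16 \<le> u" "u \<le> Y ^ 16 + 1"
  shows "\<bar>\<phi> j u\<bar> \<le> 2 ^ 40 / z"
proof -
  have Y1: "Y \<ge> 1000000" using z power_mono[of 1000 z 2] by (simp add: Y)
  have "500 * z \<le> Y / 2"
  proof -
    have "1000 * z \<le> z * z" using z by (intro mult_right_mono) auto
    thus ?thesis by (simp add: Y power2_eq_square)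
  qed
  hence jY: "Y / 2 \<le> real j" "real j \<le> 2 * Y" using rel by (auto simp: abs_le_iff)
  have j0: "real j > 0" using jY Y1 by linarith
  define a where "a = Y / real j"
  have a: "0 < a" "a \<le> 2" using jY j0 Y1 by (auto simp: a_def field_simps)
  have a1: "\<bar>a - 1\<bar> \<le> 1000 / z"
  proof -
    have "\<bar>a - 1\<bar> = \<bar>real j - Y\<bar> / real j" using j0 by (simp add: a_def field_simps abs_minus_commute)
    also have "... \<le> (500 * z) / (Y / 2)" using rel jY Y1 by (intro frac_le) auto
    also have "... = 1000 / z" using z by (simp add: Y power2_eq_square)
    finally show ?thesis .
  qed
  have "\<bar>a ^ 16 - 1\<bar> \<le> 1000 / z * 2 ^ 20"
  proof -
    have e: "a ^ 16 - 1 = (a - 1) * (\<Sum>i<16. a ^ i)" by (rule power_diff_1_eq)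
    have S: "\<bar>\<Sum>i<16. a ^ i\<bar> \<le> 2 ^ 20"
    proof -
      have "(\<Sum>i<16. a ^ i) \<le> (\<Sum>i<(16::nat). 2 ^ 16)"
      proof (intro sum_mono)
        fix i :: nat assume i: "i \<in> {..<16}"
        have "a ^ i \<le> 2 ^ i" using a by (intro power_mono) auto
        also have "... \<le> 2 ^ 16" using i by (intro power_increasing) auto
        finally show "a ^ i \<le> 2 ^ 16" .
      qed
      moreover have "(\<Sum>i<16. a ^ i) \<ge> 0" using a by (intro sum_nonneg) auto
      ultimately show ?thesis by simp
    qed
    show ?thesis unfolding e abs_mult using z by (intro mult_mono a1 S) auto
  qed
  moreover have "Y ^ 16 / real j ^ 16 = a ^ 16" by (simp add: a_def power_divide)
  moreover have "\<bar>u / real j ^ 16 - Y ^ 16 / real j ^ 16\<bar> \<le> 1 / z"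
  proof -
    have "\<bar>u / real j ^ 16 - Y ^ 16 / real j ^ 16\<bar> = (u - Y ^ 16) / real j ^ 16" using u j0 by (simp add: diff_divide_distrib[symmetric])
    also have "... \<le> 1 / real j"
    proof (intro frac_le)
      have "real j ^ 1 \<le> real j ^ 16" using jY Y1 by (intro power_increasing) auto
      thus "real j \<le> real j ^ 16" by simp
    qed (use u j0 in auto)
    also have "... \<le> 1 / z"
    proof (intro divide_left_mono)
      have "z \<le> Y / 2" using z \<open>500 * z \<le> Y / 2\<close> by linarith
      thus "z \<le> real j" using jY by linarith
    qed (use j0 z in auto)
    finally show ?thesis .
  qed
  ultimately have u16: "\<bar>u / real j ^ 16 - 1\<bar> \<le> (1000 * 2 ^ 20 + 1) / z" by (simp add: add_divide_distrib)
  have u17: "u / real j ^ 17 \<le> 2 ^ 19 / z"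
  proof -
    have "u / real j ^ 17 \<le> (2 * Y ^ 16) / (Y / 2) ^ 17"
    proof (intro frac_le)
      have "1 \<le> Y ^ 16" using Y1 by (intro one_le_power) auto
      thus "u \<le> 2 * Y ^ 16" using u by linarith
      show "(Y / 2) ^ 17 \<le> real j ^ 17" using jY Y1 by (intro power_mono) auto
    qed (use Y1 in auto)
    also have "... = 2 ^ 18 / Y"
    proof -
      have "Y ^ 17 = Y ^ 16 * Y" by (simp add: power_Suc2[symmetric])
      hence "(2 * Y ^ 16) / (Y / 2) ^ 17 = 2 * Y ^ 16 / (Y ^ 16 * Y / 2 ^ 17)" by (simp only: power_divide)
      moreover have "2 * p / (p * Y / 2 ^ 17) = 2 ^ 18 / Y" if "p \<noteq> 0" for p :: real using that Y1 by (simp add: field_simps)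
      moreover have "Y ^ 16 \<noteq> 0" using Y1 by simp
      ultimately show ?thesis by (simp only:)
    qed
    also have "... \<le> 2 ^ 18 / z" using z \<open>500 * z \<le> Y / 2\<close> Y1 by (intro divide_left_mono) auto
    also have "... \<le> 2 ^ 19 / z" using z by (intro divide_right_mono) auto
    finally show ?thesis .
  qed
  have "0 \<le> Y ^ 16" using Y1 by simp
  hence u0: "u \<ge> 0" using u(1) by linarith
  have "\<phi> j u = (\<theta> j - (\<xi> - pi / 2) / real j ^ 16) * u + (\<xi> - pi / 2) * (u / real j ^ 16 - 1)"
    by (simp add: \<phi>_def algebra_simps)
  also have "\<bar>...\<bar> \<le> \<bar>\<theta> j - (\<xi> - pi / 2) / real j ^ 16\<bar> * u + \<bar>\<xi> - pi / 2\<bar> * \<bar>u / real j ^ 16 - 1\<bar>"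
    using u0 by (simp add: abs_mult order_trans[OF abs_triangle_ineq])
  also have "... \<le> 1 / real j ^ 17 * u + 2 * ((1000 * 2 ^ 20 + 1) / z)"
    using \<theta>[OF j] xi_bound u16 u0 z by (intro add_mono mult_mono) auto
  also have "... \<le> 2 ^ 19 / z + 2 * ((1000 * 2 ^ 20 + 1) / z)" using u17 by simp
  also have "... = (2 ^ 19 + 2 * (1000 * 2 ^ 20 + 1)) / z" by (simp add: add_divide_distrib)
  also have "... \<le> 2 ^ 40 / z" using z by (intro divide_right_mono) auto
  finally show ?thesis .
qed

end

lemma eventually_const_mult_le:
  fixes f :: "real \<Rightarrow> real"
  assumes "(f \<longlongrightarrow> 0) F" "e > 0"
  shows "eventually (\<lambda>y. C * f y \<le> e) F"
proof -
  have "((\<lambda>y. C * f y) \<longlongrightarrow> C * 0) F" by (intro tendsto_intros assms)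
  hence "eventually (\<lambda>y. C * f y < e) F" using assms(2) by (intro order_tendstoD(2)) auto
  thus ?thesis by (rule eventually_mono) simp
qed

lemma summable_power_exp: "summable (\<lambda>j. real j ^ n * exp (- real j))"
proof (rule summable_comparison_test_ev)
  have "eventually (\<lambda>j. real j ^ n * exp (- real j) \<le> 1 / real j ^ 2) sequentially" by real_asymp
  thus "eventually (\<lambda>j. norm (real j ^ n * exp (- real j)) \<le> 1 / real j ^ 2) sequentially" by (rule eventually_mono) simp
  show "summable (\<lambda>j. 1 / real j ^ 2)" using inverse_power_summable[of 2, where ?'a = real] by (simp add: field_simps)
qed

section \<open>The sign of the sum over the blocks outside a small set\<close>

context race
begin

text \<open>An upper bound for the contribution of block i + J to the race. Besides the main term it
  contains the error 16 of \<open>block_approx\<close> and 96 u = 12 u * 8, where 12 u multiplies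
  \<open>Qz\<close> in \<open>prime_pi_approx\<close> and 8 is from
  \<open>Qz_block_le\<close>.\<close>

definition GH :: "real \<Rightarrow> nat \<Rightarrow> real" where
  "GH u i = V (i + J) u * Rj (i + J) u + (16 + 96 * u) * (V (i + J) u * (real ((i + J) ^ 3) ^ 2 / \<gamma> (i + J)))"

text \<open>All terms are compared with W, the sum of V j u * j^3 over the relevant blocks. The bias
  gives - 1/4 of W. The phases at the coarse threshold, the block approximation, the exceptional
  blocks, the irrelevant blocks and the remainder cost at most 1/64 of W each. The parametrization
  by y keeps every threshold an integral power.\<close>

lemma race_pointwise:
  fixes y C c' u :: real
  defines "z \<equiv> y ^ 8" and "Y \<equiv> y ^ 16"
  defines "Rel \<equiv> {j::nat. \<bar>real j - Y\<bar> \<le> 500 * z}"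
  defines "S \<equiv> \<lambda>t j x. norm (cis (\<gamma> j * ln x) - 1) < t"
  defines "E0 \<equiv> (\<Sum>j. real j ^ 6 * exp (- real j))"
  assumes y1: "y \<ge> 1" and e1: "z \<ge> 1000" and e2: "real J \<le> Y / 2" and e3: "2 ^ 40 / z \<le> 1"
    and e4: "8 * y ^ 24 \<le> (Y / 2) ^ 3" and e5: "4 * (2 ^ 40 / z) * y ^ 6 \<le> 1/64"
    and e6: "8 * (2 ^ 40 / z) * y ^ 12 * (1 / y ^ 5) \<le> 1/64"
    and e7: "(16 + 96 * (Y ^ 16 + 1)) * (8 * Y ^ 3 * exp (- ((Y / 2) ^ 8))) \<le> 1/64"
    and e8: "(18 + 96 * (Y ^ 16 + 1)) * E0 * exp (- (Y ^ 7)) \<le> 1/64"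
    and e9: "C * (2 + Y ^ 16) ^ 2 * exp (2 * Y ^ 8 + 259 * Y ^ 7 - (\<sigma> - c') * Y ^ 16) \<le> 1/64"
    and C: "C \<ge> 0" "c' < \<sigma>"
    and u: "Y ^ 16 \<le> u" "u \<le> Y ^ 16 + ln 2"
    and bad1: "\<And>j. j \<in> Rel \<Longrightarrow> \<not> S (1 / y ^ 12) j (exp u)"
    and bad2: "(\<Sum>j\<in>Rel. V j (Y ^ 16) * real (j ^ 3) * (if S (1 / y ^ 6) j (exp u) then 1 else 0)) \<le> (1 / y ^ 5) * (\<Sum>j\<in>Rel. V j (Y ^ 16) * real (j ^ 3))"
  shows "summable (GH u)" "(\<Sum>i. GH u i) + C * (1 + u) ^ 2 * exp (c' * u) < 0"
proof -
  have Yz: "Y = z^2" by (simp add: Y_def z_def power_mult[symmetric])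
  have Y1: "Y \<ge> 1000000" using e1 power_mono[of 1000 z 2] by (simp add: Yz)
  have u1: "u \<le> Y ^ 16 + 1" using u ln_2_less_1 by linarith
  have "0 \<le> Y ^ 16" using Y1 by simp
  hence u0: "u \<ge> 0" using u(1) by linarith
  have "500 * z \<le> Y / 2"
  proof -
    have "1000 * z \<le> z * z" using e1 by (intro mult_right_mono) auto
    thus ?thesis by (simp add: Yz power2_eq_square)
  qed
  hence Rel_bd: "Y / 2 \<le> real j \<and> real j \<le> 2 * Y" if "j \<in> Rel" for j using that by (auto simp: Rel_def abs_le_iff)
  have RelJ: "j \<ge> J" if "j \<in> Rel" for j using Rel_bd[OF that] e2 by linarith
  have finRel: "finite Rel"
  proof (rule finite_subset)
    show "Rel \<subseteq> {..nat \<lfloor>2 * Y\<rfloor>}" using Rel_bd by (auto simp: le_nat_floor)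
  qed auto
  define b where "b = (16 + 96 * u)"
  have b0: "b \<ge> 0" "b \<le> 16 + 96 * (Y ^ 16 + 1)" using u0 u1 by (auto simp: b_def)
  define \<Phi> where "\<Phi> = 2 ^ 40 / z"
  have \<Phi>0: "\<Phi> \<ge> 0" using e1 by (simp add: \<Phi>_def)
  define ind where "ind = (\<lambda>j. if S (1 / y ^ 6) j (exp u) then 1 else (0::real))"
  \<comment> \<open>The fine threshold gives 8 / q^2 \<le> 8 y^24, far below K of order y^48, so the
    bias survives in every relevant block. The two thresholds differ only in the phase term, which
    carries y^12 in exceptional blocks and y^6 in the others.\<close>
  have rel_term: "V j u * Rj j u + b * (V j u * (real (j ^ 3) ^ 2 / \<gamma> j)) \<le> V j u * real (j ^ 3) * (- 1/4 + 1/64 + 1/64 + 4 * \<Phi> * y ^ 12 * ind j)"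
    if j: "j \<in> Rel" for j
  proof -
    define q where "q = norm (cis (\<gamma> j * u) - 1)"
    define K where "K = real (j ^ 3)"
    have jJ: "j \<ge> J" by (rule RelJ[OF j])
    have K0: "K \<ge> 0" by (simp add: K_def)
    have qt: "q \<ge> 1 / y ^ 12" using bad1[OF j] by (simp add: S_def q_def not_less)
    have y12: "y ^ 12 > 0" using y1 by simp
    have q0: "q > 0" using qt y12 by (smt (verit) divide_pos_pos)
    have iq: "1 / q \<le> y ^ 12" using qt q0 y12 by (simp add: field_simps)
    have ph: "\<bar>\<phi> j u\<bar> \<le> \<Phi>" unfolding \<Phi>_def using j by (intro phi_bound[OF Yz e1 jJ _ u(1) u1]) (simp add: Rel_def)
    have ph1: "\<bar>\<phi> j u\<bar> \<le> 1" using ph e3 by (simp add: \<Phi>_def)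
    have Kbig: "8 / q^2 \<le> K"
    proof -
      have "8 / q^2 = 8 * (1 / q)^2" by (simp add: power_divide)
      also have "... \<le> 8 * (y ^ 12)^2" using iq q0 by (intro mult_left_mono power_mono) auto
      also have "... = 8 * y ^ 24" by (simp add: power_mult[symmetric])
      also have "... \<le> (Y / 2) ^ 3" by (rule e4)
      also have "... \<le> real j ^ 3" using Rel_bd[OF j] Y1 by (intro power_mono) auto
      finally show ?thesis by (simp add: K_def)
    qed
    have "Rj j u \<le> - K / 4 + 4 * \<bar>\<phi> j u\<bar> * K / q"
      unfolding Rj_def q_def K_def by (rule fejer_phase_bound[OF ph1]) (use q0 Kbig in \<open>auto simp: q_def K_def\<close>)
    also have "4 * \<bar>\<phi> j u\<bar> * K / q = 4 * K * \<bar>\<phi> j u\<bar> * (1 / q)" by simp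
    also have "... \<le> 4 * K * \<Phi> * (if ind j = 1 then y ^ 12 else y ^ 6)"
    proof (intro mult_mono mult_left_mono ph)
      show "1 / q \<le> (if ind j = 1 then y ^ 12 else y ^ 6)"
      proof (cases "S (1 / y ^ 6) j (exp u)")
        case True thus ?thesis using iq by (simp add: ind_def)
      next
        case False
        hence "1 / y ^ 6 \<le> q" by (simp add: S_def q_def not_less)
        moreover have "y ^ 6 > 0" using y1 by simp
        ultimately show ?thesis using False q0 by (simp add: ind_def field_simps)
      qed
    qed (use K0 \<Phi>0 q0 in auto)
    also have "... \<le> 4 * K * \<Phi> * (y ^ 6 + y ^ 12 * ind j)"
      using K0 \<Phi>0 y1 by (intro mult_left_mono) (auto simp: ind_def)
    also have "... = K * (4 * \<Phi> * y ^ 6) + K * (4 * \<Phi> * y ^ 12 * ind j)" by (simp add: algebra_simps)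
    also have "K * (4 * \<Phi> * y ^ 6) \<le> K * (1/64)" using e5 K0 unfolding \<Phi>_def by (intro mult_left_mono)
    finally have R: "Rj j u \<le> K * (- 1/4 + 1/64 + 4 * \<Phi> * y ^ 12 * ind j)" by (simp add: algebra_simps)
    have "b * (K ^ 2 / \<gamma> j) \<le> K * (1/64)"
    proof -
      have "1 / \<gamma> j \<le> exp (- ((Y / 2) ^ 8))"
      proof -
        have "(Y / 2) ^ 8 \<le> real j ^ 8" using Rel_bd[OF j] Y1 by (intro power_mono) auto
        hence "exp ((Y / 2) ^ 8) \<le> \<gamma> j" using \<gamma>[OF jJ] by (meson exp_le_cancel_iff order_trans)
        hence "1 / \<gamma> j \<le> 1 / exp ((Y / 2) ^ 8)" using gamma_ge(2)[OF jJ] by (intro divide_left_mono mult_pos_pos) auto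
        thus ?thesis by (simp only: exp_minus inverse_eq_divide)
      qed
      moreover have "K \<le> 8 * Y ^ 3"
      proof -
        have "real j ^ 3 \<le> (2 * Y) ^ 3" using Rel_bd[OF j] by (intro power_mono) auto
        thus ?thesis by (simp add: K_def power_mult_distrib)
      qed
      ultimately have "K * (1 / \<gamma> j) \<le> 8 * Y ^ 3 * exp (- ((Y / 2) ^ 8))" using K0 gamma_ge(2)[OF jJ] Y1 by (intro mult_mono) auto
      from mult_mono[OF b0(2) this] have "b * (K * (1 / \<gamma> j)) \<le> (16 + 96 * (Y ^ 16 + 1)) * (8 * Y ^ 3 * exp (- ((Y / 2) ^ 8)))"
        using K0 gamma_ge(2)[OF jJ] \<open>0 \<le> Y ^ 16\<close> by simp
      hence "b * (K * (1 / \<gamma> j)) \<le> 1/64" using e7 by linarith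
      hence "K * (b * (K * (1 / \<gamma> j))) \<le> K * (1/64)" using K0 by (rule mult_left_mono)
      thus ?thesis by (simp add: power2_eq_square mult_ac)
    qed
    moreover have "K * (- 1/4 + 1/64 + 1/64 + w) = K * (- 1/4 + 1/64 + w) + K * (1/64)" for w by (simp add: algebra_simps)
    ultimately have "Rj j u + b * (K ^ 2 / \<gamma> j) \<le> K * (- 1/4 + 1/64 + 1/64 + 4 * \<Phi> * y ^ 12 * ind j)" using R by (metis add_mono)
    hence "V j u * (Rj j u + b * (K ^ 2 / \<gamma> j)) \<le> V j u * (K * (- 1/4 + 1/64 + 1/64 + 4 * \<Phi> * y ^ 12 * ind j))"
      using V_pos[OF jJ, of u] by (intro mult_left_mono) auto
    thus ?thesis unfolding K_def by (simp only: distrib_left mult_ac)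
  qed
  define Q where "Q = exp (\<sigma> * u - 2 * Y ^ 8 - 260 * Y ^ 7)"
  have irr_V: "V j u * real (j ^ 3) ^ 2 \<le> Q * (real j ^ 6 * exp (- real j))" if j: "j \<ge> J" "j \<notin> Rel" for j
  proof -
    have "V j u \<le> exp (\<sigma> * u - 2 * Y ^ 8 - 260 * Y ^ 7 - real j)"
      using j by (intro V_irrelevant[OF Yz e1 j(1) _ u(1)]) (auto simp: Rel_def)
    also have "... = Q * exp (- real j)" by (simp add: Q_def exp_diff exp_minus divide_inverse)
    finally have "V j u * real (j ^ 3) ^ 2 \<le> Q * exp (- real j) * real (j ^ 3) ^ 2" by (intro mult_right_mono) auto
    also have "real (j ^ 3) ^ 2 = real j ^ 6" by (simp add: power_mult[symmetric])
    finally show ?thesis by (simp add: mult_ac power_mult[symmetric])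
  qed
  have ginv: "1 / \<gamma> j \<le> 1" if "j \<ge> J" for j using gamma_ge[OF that] by (simp add: divide_le_eq)
  have irr_term: "\<bar>V j u * Rj j u + b * (V j u * (real (j ^ 3) ^ 2 / \<gamma> j))\<bar> \<le> (2 + b) * (Q * (real j ^ 6 * exp (- real j)))"
    if j: "j \<ge> J" "j \<notin> Rel" for j
  proof -
    have "\<bar>V j u * Rj j u\<bar> \<le> V j u * (2 * real (j ^ 3) ^ 2)"
      unfolding abs_mult using Rj_trivial[of j u] V_pos[OF j(1), of u] by (intro mult_mono) auto
    moreover have "\<bar>b * (V j u * (real (j ^ 3) ^ 2 / \<gamma> j))\<bar> \<le> b * (V j u * real (j ^ 3) ^ 2)"
    proof -
      have "real (j ^ 3) ^ 2 / \<gamma> j = real (j ^ 3) ^ 2 * (1 / \<gamma> j)" by simp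
      also have "... \<le> real (j ^ 3) ^ 2 * 1" using ginv[OF j(1)] by (intro mult_left_mono) auto
      finally have "V j u * (real (j ^ 3) ^ 2 / \<gamma> j) \<le> V j u * real (j ^ 3) ^ 2" using V_pos[OF j(1), of u] by (intro mult_left_mono) auto
      moreover have "0 \<le> V j u * (real (j ^ 3) ^ 2 / \<gamma> j)"
        using V_pos[OF j(1), of u] gamma_ge(2)[OF j(1)] by (intro mult_nonneg_nonneg divide_nonneg_nonneg) auto
      ultimately show ?thesis using b0(1) by (metis abs_of_nonneg mult_left_mono mult_nonneg_nonneg)
    qed
    ultimately have "\<bar>V j u * Rj j u + b * (V j u * (real (j ^ 3) ^ 2 / \<gamma> j))\<bar> \<le> (2 + b) * (V j u * real (j ^ 3) ^ 2)"
      unfolding distrib_right by linarith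
    also have "... \<le> (2 + b) * (Q * (real j ^ 6 * exp (- real j)))" using b0 irr_V[OF j] by (intro mult_left_mono) auto
    finally show ?thesis .
  qed
  define g where "g = (\<lambda>i. (2 + b) * (Q * (real (i + J) ^ 6 * exp (- real (i + J)))))"
  have sg0: "summable (\<lambda>i. real (i + J) ^ 6 * exp (- real (i + J)))"
    by (rule summable_ignore_initial_segment[OF summable_power_exp])
  have gs: "summable g" unfolding g_def by (intro summable_mult sg0)
  have g_sum: "suminf g \<le> (2 + b) * (Q * E0)"
  proof -
    have "suminf g = (2 + b) * (Q * (\<Sum>i. real (i + J) ^ 6 * exp (- real (i + J))))"
      unfolding g_def by (simp only: suminf_mult[OF sg0] suminf_mult[OF summable_mult[OF sg0]])
    also have "(\<Sum>i. real (i + J) ^ 6 * exp (- real (i + J))) \<le> E0"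
    proof -
      have "E0 = (\<Sum>i. real (i + J) ^ 6 * exp (- real (i + J))) + (\<Sum>j<J. real j ^ 6 * exp (- real j))"
        unfolding E0_def by (rule suminf_split_initial_segment[OF summable_power_exp])
      moreover have "(\<Sum>j<J. real j ^ 6 * exp (- real j)) \<ge> 0" by (intro sum_nonneg) auto
      ultimately show ?thesis by linarith
    qed
    hence "(2 + b) * (Q * (\<Sum>i. real (i + J) ^ 6 * exp (- real (i + J)))) \<le> (2 + b) * (Q * E0)"
      using b0 by (intro mult_left_mono) (auto simp: Q_def)
    finally show ?thesis .
  qed
  define f where "f = (\<lambda>j. V j u * real (j ^ 3) * (- 1/4 + 1/64 + 1/64 + 4 * \<Phi> * y ^ 12 * ind j))"
  define h where "h = (\<lambda>i. (if i + J \<in> Rel then f (i + J) else 0) + g i)"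
  have relsum: "(\<lambda>i. if i + J \<in> Rel then F (i + J) else (0::real)) sums (\<Sum>j\<in>Rel. F j)" for F
  proof -
    have inj: "inj_on (\<lambda>i. i + J) {i. i + J \<in> Rel}" by (auto simp: inj_on_def)
    have img: "(\<lambda>i. i + J) ` {i. i + J \<in> Rel} = Rel"
      using RelJ by (auto simp: image_iff) (metis le_add_diff_inverse2)
    have fin: "finite {i. i + J \<in> Rel}" using finRel inj img finite_imageD by metis
    have "(\<lambda>i. if i + J \<in> Rel then F (i + J) else (0::real)) sums (\<Sum>i\<in>{i. i + J \<in> Rel}. F (i + J))"
      using sums_If_finite_set[OF fin, of "\<lambda>i. F (i + J)"] by simp
    also have "(\<Sum>i\<in>{i. i + J \<in> Rel}. F (i + J)) = (\<Sum>j\<in>Rel. F j)"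
      using sum.reindex[OF inj, of F] img by simp
    finally show ?thesis .
  qed
  have hs: "h sums ((\<Sum>j\<in>Rel. f j) + suminf g)" unfolding h_def by (intro sums_add relsum summable_sums gs)
  have g0: "g i \<ge> 0" for i unfolding g_def using b0 by (intro mult_nonneg_nonneg) (auto simp: Q_def)
  have GHh: "GH u i \<le> h i" for i
  proof (cases "i + J \<in> Rel")
    case True
    have "GH u i \<le> f (i + J)" using rel_term[OF True] unfolding GH_def f_def b_def by simp
    thus ?thesis using True g0[of i] by (simp add: h_def)
  next
    case False
    have "\<bar>GH u i\<bar> \<le> g i" using irr_term[of "i + J"] False unfolding GH_def g_def b_def by simp
    thus ?thesis using False by (simp add: h_def)
  qed
  show GHs: "summable (GH u)"
  proof (rule summable_comparison_test)
    define k where "k = (\<lambda>i. (if i + J \<in> Rel then \<bar>GH u (i + J - J)\<bar> else 0) + g i)"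
    have "norm (GH u i) \<le> k i" for i
    proof (cases "i + J \<in> Rel")
      case True thus ?thesis using g0[of i] by (simp add: k_def)
    next
      case False
      have "\<bar>GH u i\<bar> \<le> g i" using irr_term[of "i + J"] False unfolding GH_def g_def b_def by simp
      thus ?thesis using False by (simp add: k_def)
    qed
    thus "\<exists>N. \<forall>n\<ge>N. norm (GH u n) \<le> k n" by blast
    show "summable k" unfolding k_def
      by (intro summable_add gs sums_summable[OF relsum[of "\<lambda>j. \<bar>GH u (j - J)\<bar>"]])
  qed
  define W where "W = (\<Sum>j\<in>Rel. V j u * real (j ^ 3))"
  \<comment> \<open>On a dyadic interval ln x varies by at most ln 2 and the exponent of V is below
    1, so V changes at most by the factor 2. This allows the exceptional set to be defined with
    weights frozen at Y^16 = ln X.\<close>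
  have VJ: "V j (Y ^ 16) \<le> V j u" "V j u \<le> 2 * V j (Y ^ 16)" if j: "j \<in> Rel" for j
  proof -
    have jJ: "j \<ge> J" by (rule RelJ[OF j])
    note be = beta_bounds[OF jJ]
    have "exp ((\<sigma> - d j) * Y ^ 16) \<le> exp ((\<sigma> - d j) * u)" using u be by simp
    thus "V j (Y ^ 16) \<le> V j u" unfolding V_def using gamma_ge(2)[OF jJ] by (intro divide_right_mono) auto
    have "(\<sigma> - d j) * (u - Y ^ 16) \<le> 1 * ln 2" using u be by (intro mult_mono) auto
    hence "exp ((\<sigma> - d j) * u) \<le> exp ((\<sigma> - d j) * Y ^ 16 + ln 2)" by (simp add: algebra_simps)
    also have "... = 2 * exp ((\<sigma> - d j) * Y ^ 16)" by (simp add: exp_add)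
    finally show "V j u \<le> 2 * V j (Y ^ 16)" unfolding V_def using gamma_ge(2)[OF jJ] by (simp add: divide_right_mono)
  qed
  have Wlow: "W \<ge> exp (\<sigma> * u - 2 * Y ^ 8 - 259 * Y ^ 7)"
  proof -
    define j where "j = nat \<lceil>Y\<rceil>"
    have "\<bar>real j - Y\<bar> \<le> 1" using Y1 unfolding j_def by linarith
    hence jR: "j \<in> Rel" using e1 by (simp add: Rel_def)
    have j1: "real (j ^ 3) \<ge> 1" using Rel_bd[OF jR] Y1 by (simp add: one_le_power)
    have "exp (\<sigma> * u - 2 * Y ^ 8 - 259 * Y ^ 7) \<le> V j u"
      using Y1 by (intro V_lower[OF _ j_def RelJ[OF jR] u(1) u1]) auto
    also have "... \<le> V j u * real (j ^ 3)" using j1 V_pos[OF RelJ[OF jR], of u] mult_left_mono[of 1 "real (j ^ 3)" "V j u"] by simp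
    also have "... \<le> W" unfolding W_def
      by (intro member_le_sum[OF jR _ finRel] mult_nonneg_nonneg less_imp_le[OF V_pos[OF RelJ]]) auto
    finally show ?thesis .
  qed
  have Wpos: "W > 0" using Wlow exp_gt_zero less_le_trans by blast
  have fsum: "(\<Sum>j\<in>Rel. f j) \<le> - (3/16) * W"
  proof -
    have "(\<Sum>j\<in>Rel. f j) = (- 1/4 + 1/64 + 1/64) * W + 4 * \<Phi> * y ^ 12 * (\<Sum>j\<in>Rel. V j u * real (j ^ 3) * ind j)"
      unfolding f_def W_def sum_distrib_left sum.distrib[symmetric] by (intro sum.cong) (auto simp: algebra_simps)
    also have "(\<Sum>j\<in>Rel. V j u * real (j ^ 3) * ind j) \<le> 2 * ((1 / y ^ 5) * W)"
    proof -
      have "(\<Sum>j\<in>Rel. V j u * real (j ^ 3) * ind j) \<le> (\<Sum>j\<in>Rel. 2 * (V j (Y ^ 16) * real (j ^ 3) * ind j))"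
      proof (rule sum_mono)
        fix j assume j: "j \<in> Rel"
        have "V j u * (real (j ^ 3) * ind j) \<le> 2 * V j (Y ^ 16) * (real (j ^ 3) * ind j)"
          using VJ(2)[OF j] by (intro mult_right_mono) (auto simp: ind_def)
        thus "V j u * real (j ^ 3) * ind j \<le> 2 * (V j (Y ^ 16) * real (j ^ 3) * ind j)" by (simp add: mult_ac)
      qed
      also have "... = 2 * (\<Sum>j\<in>Rel. V j (Y ^ 16) * real (j ^ 3) * ind j)" by (simp only: sum_distrib_left)
      also have "... \<le> 2 * ((1 / y ^ 5) * (\<Sum>j\<in>Rel. V j (Y ^ 16) * real (j ^ 3)))" using bad2 unfolding ind_def by simp
      also have "(\<Sum>j\<in>Rel. V j (Y ^ 16) * real (j ^ 3)) \<le> W" unfolding W_def using VJ(1) by (intro sum_mono mult_right_mono) auto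
      hence "2 * ((1 / y ^ 5) * (\<Sum>j\<in>Rel. V j (Y ^ 16) * real (j ^ 3))) \<le> 2 * ((1 / y ^ 5) * W)"
        using y1 by (intro mult_left_mono) auto
      finally show ?thesis .
    qed
    \<comment> \<open>The exceptional blocks pay y^12 but carry at most the share 2 y^-5 of the
      weight; with \<Phi> = O(y^-8) the product is O(1 / y).\<close>
    hence "4 * \<Phi> * y ^ 12 * (\<Sum>j\<in>Rel. V j u * real (j ^ 3) * ind j) \<le> 4 * \<Phi> * y ^ 12 * (2 * ((1 / y ^ 5) * W))"
      using \<Phi>0 y1 by (intro mult_left_mono) auto
    also have "... = (8 * \<Phi> * y ^ 12 * (1 / y ^ 5)) * W" by simp
    also have "... \<le> 1/64 * W" using e6 Wpos unfolding \<Phi>_def by (intro mult_right_mono) auto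
    finally show ?thesis using Wpos by simp
  qed
  have gsum: "suminf g \<le> 1/64 * W"
  proof -
    have "Q = exp (- (Y ^ 7)) * exp (\<sigma> * u - 2 * Y ^ 8 - 259 * Y ^ 7)" unfolding Q_def exp_add[symmetric] by simp
    hence QW: "Q \<le> exp (- (Y ^ 7)) * W" using Wlow by simp
    have E0: "E0 \<ge> 0" unfolding E0_def by (rule suminf_nonneg[OF summable_power_exp]) auto
    have "(2 + b) * (Q * E0) \<le> (18 + 96 * (Y ^ 16 + 1)) * (exp (- (Y ^ 7)) * W * E0)"
      using b0 E0 QW Wpos by (intro mult_mono) (auto simp: Q_def intro!: mult_nonneg_nonneg)
    also have "... = ((18 + 96 * (Y ^ 16 + 1)) * E0 * exp (- (Y ^ 7))) * W" by simp
    also have "... \<le> 1/64 * W" using e8 Wpos by (intro mult_right_mono) auto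
    finally show ?thesis using g_sum by linarith
  qed
  have csum: "C * (1 + u) ^ 2 * exp (c' * u) \<le> 1/64 * W"
  proof -
    have "exp (c' * u) \<le> exp (2 * Y ^ 8 + 259 * Y ^ 7 - (\<sigma> - c') * Y ^ 16) * W"
    proof -
      have "(\<sigma> - c') * Y ^ 16 \<le> (\<sigma> - c') * u" using C(2) u by (intro mult_left_mono) auto
      hence "exp (c' * u) \<le> exp ((2 * Y ^ 8 + 259 * Y ^ 7 - (\<sigma> - c') * Y ^ 16) + (\<sigma> * u - 2 * Y ^ 8 - 259 * Y ^ 7))"
        by (simp add: left_diff_distrib)
      also have "... = exp (2 * Y ^ 8 + 259 * Y ^ 7 - (\<sigma> - c') * Y ^ 16) * exp (\<sigma> * u - 2 * Y ^ 8 - 259 * Y ^ 7)" by (rule exp_add)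
      also have "... \<le> exp (2 * Y ^ 8 + 259 * Y ^ 7 - (\<sigma> - c') * Y ^ 16) * W" using Wlow by (intro mult_left_mono) auto
      finally show ?thesis .
    qed
    moreover have "(1 + u) ^ 2 \<le> (2 + Y ^ 16) ^ 2" using u0 u1 by (intro power_mono) auto
    ultimately have "C * (1 + u) ^ 2 * exp (c' * u) \<le> C * (2 + Y ^ 16) ^ 2 * (exp (2 * Y ^ 8 + 259 * Y ^ 7 - (\<sigma> - c') * Y ^ 16) * W)"
      using C by (intro mult_mono) auto
    also have "... = (C * (2 + Y ^ 16) ^ 2 * exp (2 * Y ^ 8 + 259 * Y ^ 7 - (\<sigma> - c') * Y ^ 16)) * W" by simp
    also have "... \<le> 1/64 * W" using e9 Wpos by (intro mult_right_mono) auto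
    finally show ?thesis .
  qed
  have "suminf (GH u) \<le> suminf h" using GHh by (intro suminf_le GHs sums_summable[OF hs]) auto
  also have "... = (\<Sum>j\<in>Rel. f j) + suminf g" using hs by (rule sums_unique[symmetric])
  finally have "suminf (GH u) \<le> - (3/16) * W + 1/64 * W" using fsum gsum by linarith
  thus "(\<Sum>i. GH u i) + C * (1 + u) ^ 2 * exp (c' * u) < 0" using csum Wpos by linarith
qed

text \<open>For the fine threshold a union bound over at most 1000 y^8 + 1 indices, each excluding
  measure 32 y^-12 X, is affordable. For the coarse one the sets have measure 32 y^-6 X, and
  Markov's inequality at the share y^-5 leaves 32 X / y.\<close>

lemma race_bad_set:
  fixes C c' \<eta> :: real
  assumes C: "C \<ge> 0" "c' < \<sigma>" and \<eta>: "\<eta> > 0"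
  shows "\<exists>X0. \<forall>X\<ge>X0. \<exists>B. B \<in> fmeasurable lborel \<and> measure lborel B \<le> \<eta> * X \<and>
     (\<forall>x\<in>{X..2 * X} - B. summable (GH (ln x)) \<and> (\<Sum>i. GH (ln x) i) + C * (1 + ln x) ^ 2 * exp (c' * ln x) < 0)"
proof -
  define E0 where "E0 = (\<Sum>j. real j ^ 6 * exp (- real j))"
  \<comment> \<open>The size conditions of \<open>race_pointwise\<close> and the final measure bound
    form one predicate of y, so that a single threshold X0 serves them all.\<close>
  define P where "P = (\<lambda>y::real. y \<ge> 1 \<and> y ^ 8 \<ge> 1000 \<and> real J \<le> y ^ 16 / 2 \<and> 2 ^ 40 / y ^ 8 \<le> 1 \<and>
     8 * y ^ 24 \<le> (y ^ 16 / 2) ^ 3 \<and> 4 * (2 ^ 40 / y ^ 8) * y ^ 6 \<le> 1/64 \<and> 8 * (2 ^ 40 / y ^ 8) * y ^ 12 * (1 / y ^ 5) \<le> 1/64 \<and>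
     (16 + 96 * ((y ^ 16) ^ 16 + 1)) * (8 * (y ^ 16) ^ 3 * exp (- ((y ^ 16 / 2) ^ 8))) \<le> 1/64 \<and>
     (18 + 96 * ((y ^ 16) ^ 16 + 1)) * E0 * exp (- ((y ^ 16) ^ 7)) \<le> 1/64 \<and>
     C * (2 + (y ^ 16) ^ 16) ^ 2 * exp (2 * (y ^ 16) ^ 8 + 259 * (y ^ 16) ^ 7 - (\<sigma> - c') * (y ^ 16) ^ 16) \<le> 1/64 \<and>
     (1000 * y ^ 8 + 1) * (32 / y ^ 12) + 32 / y \<le> \<eta>)"
  have ev: "eventually P at_top"
  proof -
    have 1: "eventually (\<lambda>y::real. y \<ge> 1) at_top" "eventually (\<lambda>y::real. y ^ 8 \<ge> 1000) at_top"
      "eventually (\<lambda>y::real. real J \<le> y ^ 16 / 2) at_top" "eventually (\<lambda>y::real. 2 ^ 40 / y ^ 8 \<le> 1) at_top"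
      "eventually (\<lambda>y::real. 8 * y ^ 24 \<le> (y ^ 16 / 2) ^ 3) at_top"
      "eventually (\<lambda>y::real. 4 * (2 ^ 40 / y ^ 8) * y ^ 6 \<le> 1/64) at_top"
      "eventually (\<lambda>y::real. 8 * (2 ^ 40 / y ^ 8) * y ^ 12 * (1 / y ^ 5) \<le> 1/64) at_top"
      "eventually (\<lambda>y::real. (16 + 96 * ((y ^ 16) ^ 16 + 1)) * (8 * (y ^ 16) ^ 3 * exp (- ((y ^ 16 / 2) ^ 8))) \<le> 1/64) at_top"
      by real_asymp+
    have "((\<lambda>y::real. (18 + 96 * ((y ^ 16) ^ 16 + 1)) * exp (- ((y ^ 16) ^ 7))) \<longlongrightarrow> 0) at_top" by real_asymp
    from eventually_const_mult_le[OF this, of "1/64" E0]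
    have 2: "eventually (\<lambda>y::real. (18 + 96 * ((y ^ 16) ^ 16 + 1)) * E0 * exp (- ((y ^ 16) ^ 7)) \<le> 1/64) at_top" by (simp add: mult_ac)
    define a where "a = \<sigma> - c'"
    have a: "a > 0" using C by (simp add: a_def)
    have "((\<lambda>y::real. (2 + (y ^ 16) ^ 16) ^ 2 * exp (2 * (y ^ 16) ^ 8 + 259 * (y ^ 16) ^ 7 - a * (y ^ 16) ^ 16)) \<longlongrightarrow> 0) at_top"
      using a by real_asymp
    from eventually_const_mult_le[OF this, of "1/64" C]
    have 3: "eventually (\<lambda>y::real. C * (2 + (y ^ 16) ^ 16) ^ 2 * exp (2 * (y ^ 16) ^ 8 + 259 * (y ^ 16) ^ 7 - (\<sigma> - c') * (y ^ 16) ^ 16) \<le> 1/64) at_top"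
      unfolding a_def by (simp only: mult.assoc)
    have "((\<lambda>y::real. (1000 * y ^ 8 + 1) * (32 / y ^ 12) + 32 / y) \<longlongrightarrow> 0) at_top" by real_asymp
    from eventually_const_mult_le[OF this \<eta>, of 1]
    have 4: "eventually (\<lambda>y::real. (1000 * y ^ 8 + 1) * (32 / y ^ 12) + 32 / y \<le> \<eta>) at_top" by simp
    show ?thesis unfolding P_def by (intro eventually_conj 1 2 3 4)
  qed
  have lim: "filterlim (\<lambda>X. root 256 (ln X)) at_top at_top"
    by (rule filterlim_compose[OF _ ln_at_top]) real_asymp
  have "eventually (\<lambda>X. P (root 256 (ln X)) \<and> X > 1) at_top"
    by (intro eventually_conj eventually_gt_at_top eventually_compose_filterlim[OF ev lim])
  then obtain X0 where X0: "\<And>X. X \<ge> X0 \<Longrightarrow> P (root 256 (ln X)) \<and> X > 1" by (auto simp: eventually_at_top_linorder)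
  have "\<exists>B. B \<in> fmeasurable lborel \<and> measure lborel B \<le> \<eta> * X \<and>
     (\<forall>x\<in>{X..2 * X} - B. summable (GH (ln x)) \<and> (\<Sum>i. GH (ln x) i) + C * (1 + ln x) ^ 2 * exp (c' * ln x) < 0)"
    if XX: "X \<ge> X0" for X
  proof -
    define y where "y = root 256 (ln X)"
    have Py: "P y" and X1: "X > 1" using X0[OF XX] by (auto simp: y_def)
    have y256: "y ^ 256 = ln X" unfolding y_def using X1 by (intro real_root_pow_pos2) auto
    have Y16: "(y ^ 16) ^ 16 = ln X" using y256 by (simp add: power_mult[symmetric])
    have y1: "y \<ge> 1" using Py by (simp add: P_def)
    define Rel where "Rel = {j::nat. \<bar>real j - y ^ 16\<bar> \<le> 500 * y ^ 8}"
    have y8: "y ^ 8 \<ge> 1000" using Py by (simp add: P_def)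
    have yY: "y ^ 16 = y ^ 8 * y ^ 8" by (simp add: power_add[symmetric])
    have "500 * y ^ 8 \<le> y ^ 16 / 2" unfolding yY using mult_right_mono[OF y8, of "y ^ 8"] y1 by simp
    moreover have J2: "real J \<le> y ^ 16 / 2" using Py by (simp add: P_def)
    ultimately have RelJ: "j \<ge> J" if "j \<in> Rel" for j using that by (auto simp: Rel_def abs_le_iff)
    have finRel: "finite Rel" and cardRel: "real (card Rel) \<le> 1000 * y ^ 8 + 1"
    proof -
      define lo where "lo = \<lceil>y ^ 16 - 500 * y ^ 8\<rceil>"
      define hi where "hi = \<lfloor>y ^ 16 + 500 * y ^ 8\<rfloor>"
      have sub: "int ` Rel \<subseteq> {lo..hi}"
        by (auto simp: Rel_def lo_def hi_def abs_le_iff ceiling_le_iff le_floor_iff)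
      have "finite (int ` Rel)" using sub by (rule finite_subset) simp
      thus "finite Rel" by (rule finite_imageD) (simp add: inj_on_def)
      have "card Rel = card (int ` Rel)" by (simp add: card_image inj_on_def)
      also have "... \<le> card {lo..hi}" using sub by (intro card_mono) auto
      finally have "real (card Rel) \<le> real (nat (hi - lo + 1))" by simp
      also have "... \<le> 1000 * y ^ 8 + 1"
        using y8 unfolding lo_def hi_def by linarith
      finally show "real (card Rel) \<le> 1000 * y ^ 8 + 1" .
    qed
    define S where "S = (\<lambda>t j. {x \<in> {X..2 * X}. norm (cis (\<gamma> j * ln x) - 1) < t})"
    have Sm: "S t j \<in> fmeasurable lborel" "measure lborel (S t j) \<le> 32 * t * X" if "j \<in> Rel" "t > 0" for t j
    proof -
      have g1: "\<gamma> j \<ge> 1" using gamma_ge(1)[OF RelJ[OF that(1)]] by simp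
      show "measure lborel (S t j) \<le> 32 * t * X" unfolding S_def using X1 g1 that by (intro measure_near_multiples(2)) auto
      have Ss: "S t j \<in> sets lborel" unfolding S_def using X1 g1 that by (intro measure_near_multiples(1)) auto
      have "S t j \<subseteq> {X..2 * X}" by (auto simp: S_def)
      thus "S t j \<in> fmeasurable lborel" by (rule fmeasurableI2[OF Icc_fmeasurable _ Ss])
    qed
    define a where "a = (\<lambda>j. V j (ln X) * real (j ^ 3))"
    have a0: "a j \<ge> 0" if "j \<in> Rel" for j unfolding a_def by (intro mult_nonneg_nonneg less_imp_le[OF V_pos[OF RelJ[OF that]]]) simp
    define A where "A = (\<Sum>j\<in>Rel. a j)"
    have A: "A > 0"
    proof -
      define j where "j = nat \<lceil>y ^ 16\<rceil>"
      have "\<bar>real j - y ^ 16\<bar> \<le> 1" using y1 unfolding j_def by (simp, linarith)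
      hence jR: "j \<in> Rel" using y8 by (simp add: Rel_def)
      have "real j > 0" using J RelJ[OF jR] by simp
      hence "real (j ^ 3) > 0" by simp
      hence "a j > 0" unfolding a_def by (intro mult_pos_pos V_pos[OF RelJ[OF jR]])
      thus ?thesis unfolding A_def by (intro sum_pos2[OF finRel jR]) (auto intro: a0)
    qed
    define B1 where "B1 = (\<Union>j\<in>Rel. S (1 / y ^ 12) j)"
    define B2 where "B2 = {x. (1 / y ^ 5) * A \<le> (\<Sum>j\<in>Rel. a j * indicator (S (1 / y ^ 6) j) x)}"
    have lam: "(1 / y ^ 5) * A > 0" using A y1 by simp
    have B1m: "B1 \<in> fmeasurable lborel" unfolding B1_def using Sm y1 finRel by (intro fmeasurable.finite_UN) auto
    have "measure lborel B1 \<le> (\<Sum>j\<in>Rel. measure lborel (S (1 / y ^ 12) j))"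
      unfolding B1_def using Sm y1 finRel by (intro measure_UNION_le) (auto simp: fmeasurable_def)
    also have "... \<le> (\<Sum>j\<in>Rel. 32 * (1 / y ^ 12) * X)" by (intro sum_mono Sm(2)) (use y1 in auto)
    also have "... = real (card Rel) * (32 / y ^ 12) * X" by simp
    also have "... \<le> (1000 * y ^ 8 + 1) * (32 / y ^ 12) * X" using cardRel X1 y1 by (intro mult_right_mono) auto
    finally have B1b: "measure lborel B1 \<le> (1000 * y ^ 8 + 1) * (32 / y ^ 12) * X" .
    have t6: "1 / y ^ 6 > 0" using y1 by simp
    have B2m: "B2 \<in> fmeasurable lborel" "measure lborel B2 \<le> (32 * (1 / y ^ 6) * X) * A / ((1 / y ^ 5) * A)"
      unfolding B2_def A_def
      by (rule markov_weighted_indicators(1)[OF finRel a0 Sm(1)[OF _ t6] Sm(2)[OF _ t6] lam[unfolded A_def]], assumption+)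
        (rule markov_weighted_indicators(2)[OF finRel a0 Sm(1)[OF _ t6] Sm(2)[OF _ t6] lam[unfolded A_def]], assumption+)
    have "(32 * (1 / y ^ 6) * X) * A / ((1 / y ^ 5) * A) = 32 / y * X"
    proof -
      have "y ^ 6 = y * y ^ 5" by (simp add: power_Suc[symmetric])
      thus ?thesis using A y1 by (simp add: field_simps)
    qed
    with B2m have B2b: "measure lborel B2 \<le> 32 / y * X" by simp
    have "measure lborel (B1 \<union> B2) \<le> measure lborel B1 + measure lborel B2"
      using B1m B2m by (intro measure_Un_le) (auto simp: fmeasurable_def)
    also have "... \<le> ((1000 * y ^ 8 + 1) * (32 / y ^ 12) + 32 / y) * X" using B1b B2b unfolding distrib_right by linarith
    also have "... \<le> \<eta> * X" using Py X1 by (intro mult_right_mono) (auto simp: P_def)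
    finally have meas: "measure lborel (B1 \<union> B2) \<le> \<eta> * X" .
    have "summable (GH (ln x)) \<and> (\<Sum>i. GH (ln x) i) + C * (1 + ln x) ^ 2 * exp (c' * ln x) < 0" if x: "x \<in> {X..2 * X} - (B1 \<union> B2)" for x
    proof -
      have x0: "x > 0" using x X1 by auto
      have ex: "exp (ln x) = x" using x0 by simp
      have u: "(y ^ 16) ^ 16 \<le> ln x" "ln x \<le> (y ^ 16) ^ 16 + ln 2"
      proof -
        show "(y ^ 16) ^ 16 \<le> ln x" unfolding Y16 using x X1 by (subst ln_le_cancel_iff) auto
        have "ln x \<le> ln (2 * X)" using x x0 X1 by (subst ln_le_cancel_iff) auto
        thus "ln x \<le> (y ^ 16) ^ 16 + ln 2" unfolding Y16 using X1 by (simp add: ln_mult)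
      qed
      have bad1: "\<not> norm (cis (\<gamma> j * ln (exp (ln x))) - 1) < 1 / y ^ 12" if "j \<in> Rel" for j
        using x that unfolding ex by (auto simp: B1_def S_def)
      have bad2: "(\<Sum>j\<in>Rel. V j ((y ^ 16) ^ 16) * real (j ^ 3) * (if norm (cis (\<gamma> j * ln (exp (ln x))) - 1) < 1 / y ^ 6 then 1 else 0))
         \<le> (1 / y ^ 5) * (\<Sum>j\<in>Rel. V j ((y ^ 16) ^ 16) * real (j ^ 3))"
      proof -
        have "(\<Sum>j\<in>Rel. a j * indicator (S (1 / y ^ 6) j) x) = (\<Sum>j\<in>Rel. V j ((y ^ 16) ^ 16) * real (j ^ 3) * (if norm (cis (\<gamma> j * ln (exp (ln x))) - 1) < 1 / y ^ 6 then 1 else 0))"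
          unfolding Y16 ex a_def by (intro sum.cong) (use x in \<open>auto simp: S_def indicator_def\<close>)
        moreover have "(\<Sum>j\<in>Rel. a j * indicator (S (1 / y ^ 6) j) x) \<le> (1 / y ^ 5) * A" using x by (auto simp: B2_def)
        ultimately show ?thesis unfolding A_def a_def Y16 by simp
      qed
      note Py' = Py[unfolded P_def]
      show ?thesis
        using race_pointwise[of y C c' "ln x"] Py' C u bad1 bad2 unfolding Rel_def E0_def by blast
    qed
    thus ?thesis using meas B1m B2m by (intro exI[of _ "B1 \<union> B2"]) (auto intro: fmeasurable.Un)
  qed
  thus ?thesis by blast
qed

end

section \<open>The zeros of the configuration\<close>

lemma (in race) has_sum_imp_block_sums:
  fixes f :: "nat \<times> nat \<Rightarrow> real"
  assumes "(f has_sum a) (Sigma {J..} (\<lambda>j. {1..j ^ 3}))"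
  shows "(\<lambda>i. \<Sum>k=1..(i + J) ^ 3. f (i + J, k)) sums a"
proof -
  have "((\<lambda>j. \<Sum>k\<in>{1..j ^ 3}. f (j, k)) has_sum a) {J..}"
    by (rule has_sum_Sigma[OF isUCont_plus assms]) (auto intro: has_sum_finite)
  moreover have "bij_betw (\<lambda>i. i + J) UNIV {J..}" by (rule bij_betwI[where g = "\<lambda>j. j - J"]) auto
  ultimately have "((\<lambda>i. \<Sum>k\<in>{1..(i + J) ^ 3}. f (i + J, k)) has_sum a) UNIV"
    using has_sum_reindex_bij_betw[of "\<lambda>i. i + J" UNIV "{J..}" "\<lambda>j. \<Sum>k\<in>{1..j ^ 3}. f (j, k)"] by blast
  thus ?thesis by (rule has_sum_imp_sums)
qed

locale race_zeros = race +
  fixes c \<eta> :: real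
  assumes c\<eta>: "c - \<eta> > 1/2" "0 < \<eta>" "\<eta> \<le> 1"
    and above: "\<And>j. j \<ge> J \<Longrightarrow> c + \<eta> \<le> \<sigma> - d j"
    and zeros: "zeta_zeros (c - \<eta>) = case_prod (rho \<sigma> \<gamma> d \<theta>) ` (SIGMA j:{J..}. {1..j ^ 3}) \<union>
      cnj ` case_prod (rho \<sigma> \<gamma> d \<theta>) ` (SIGMA j:{J..}. {1..j ^ 3})"
    and multiplicity: "\<And>j k. j \<ge> J \<Longrightarrow> k \<in> {1..j ^ 3} \<Longrightarrow> zeta_zero_mult (rho \<sigma> \<gamma> d \<theta> j k) = k * (j ^ 3 + 1 - k)"
begin

abbreviation I where "I \<equiv> SIGMA j:{J..}. {1..j ^ 3}"
abbreviation r where "r \<equiv> rho \<sigma> \<gamma> d \<theta>"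
abbreviation Z where "Z \<equiv> zeta_zeros (c - \<eta>)"
abbreviation P where "P \<equiv> case_prod r ` I"

lemma Im_r: "Im (r j k) = real k * \<gamma> j + \<theta> j" "Re (r j k) = \<sigma> - d j" by (simp_all add: rho_def)

lemma height_lower:
  assumes "j \<ge> J" "k \<ge> 1"
  shows "Im (r j k) \<ge> real k * (\<gamma> j / 2)" "Im (r j k) \<ge> 97" "norm (r j k) \<ge> real k * (\<gamma> j / 2)"
proof -
  have g: "\<gamma> j \<ge> 100" by (rule gamma_ge(1)[OF assms(1)])
  have "1 * (\<gamma> j / 2) \<le> real k * (\<gamma> j / 2)" using assms g by (intro mult_right_mono) auto
  moreover have "real k * \<gamma> j = 2 * (real k * (\<gamma> j / 2))" by simp
  ultimately show 1: "Im (r j k) \<ge> real k * (\<gamma> j / 2)" "Im (r j k) \<ge> 97"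
    using theta_bound[OF assms(1)] g unfolding Im_r by linarith+
  show "norm (r j k) \<ge> real k * (\<gamma> j / 2)" using 1(1) abs_Im_le_cmod[of "r j k"] by linarith
qed

text \<open>Block j ends below about 2 j^3 exp (j^8), while every later block starts above about exp
  (j^8) exp (j^7). The 16 spare units of exp (j^8) \<ge> 1 absorb the two shifts of size at most 3
  and leave 10.\<close>

lemma heights_separated_aux:
  assumes j: "j \<ge> J" "k \<in> {1..j ^ 3}" "j < j'" "k' \<ge> 1"
  shows "Im (r j' k') - Im (r j k) \<ge> 10"
proof -
  have j2: "real j \<ge> 2" by (rule j_ge[OF j(1)])
  define e where "e = exp (real j ^ 8)"
  have e1: "e \<ge> 1" by (simp add: e_def)
  have j'J: "j' \<ge> J" using j by simp
  have "real j ^ 8 + real j ^ 7 = (real j + 1) * real j ^ 7" by (simp add: power_Suc[symmetric] distrib_right)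
  also have "... \<le> (real j + 1) * (real j + 1) ^ 7" using j2 by (intro mult_left_mono power_mono) auto
  also have "... = (real j + 1) ^ 8" by (simp add: power_Suc[symmetric])
  also have "... \<le> real j' ^ 8" using j by (intro power_mono) auto
  finally have "exp (real j ^ 8 + real j ^ 7) \<le> exp (real j' ^ 8)" by simp
  hence "e * exp (real j ^ 7) \<le> \<gamma> j'" using \<gamma>[OF j'J] by (simp add: e_def exp_add)
  moreover have "e * (2 * real j ^ 3 + 16) \<le> e * exp (real j ^ 7)"
  proof (intro mult_left_mono)
    have "8 \<le> real j ^ 3" "16 \<le> real j ^ 4" using power_mono[OF j2, of 3] power_mono[OF j2, of 4] by auto
    note p = this
    hence "real j ^ 3 * 16 \<le> real j ^ 3 * real j ^ 4" by (intro mult_left_mono) auto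
    also have "... = real j ^ 7" by (simp add: power_add[symmetric])
    finally show "2 * real j ^ 3 + 16 \<le> exp (real j ^ 7)" using p exp_ge_add_one_self[of "real j ^ 7"] by linarith
  qed (use e1 in auto)
  moreover have "real k * \<gamma> j \<le> real j ^ 3 * (2 * e)"
    using j(2) \<gamma>[OF j(1)] gamma_ge(2)[OF j(1)] by (intro mult_mono) (auto simp: e_def simp flip: of_nat_power)
  moreover have "1 * \<gamma> j' \<le> real k' * \<gamma> j'" using j gamma_ge(2)[OF j'J] by (intro mult_right_mono) auto
  moreover have "e * (2 * real j ^ 3 + 16) = real j ^ 3 * (2 * e) + 16 * e" by (simp add: algebra_simps)
  ultimately show ?thesis using e1 theta_bound[OF j(1)] theta_bound[OF j'J] unfolding Im_r by linarith
qed

lemma heights_separated: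
  assumes "p \<in> I" "q \<in> I" "p \<noteq> q"
  shows "\<bar>Im (case_prod r p) - Im (case_prod r q)\<bar> \<ge> 10"
proof -
  obtain j k j' k' where pq: "p = (j, k)" "q = (j', k')" by fastforce
  have jk: "j \<ge> J" "k \<in> {1..j ^ 3}" "j' \<ge> J" "k' \<in> {1..j' ^ 3}" using assms pq by auto
  consider "j < j'" | "j' < j" | "j = j'" "k \<noteq> k'" using assms pq by fastforce
  thus ?thesis
  proof cases
    case 1
    thus ?thesis using heights_separated_aux[of j k j' k'] jk pq by auto
  next
    case 2
    thus ?thesis using heights_separated_aux[of j' k' j k] jk pq by auto
  next
    case 3
    have "\<bar>real k - real k'\<bar> \<ge> 1" using 3 by linarith
    hence "1 * \<gamma> j \<le> \<bar>real k - real k'\<bar> * \<gamma> j" using gamma_ge(2)[OF jk(1)] by (intro mult_right_mono) auto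
    also have "... = \<bar>(real k - real k') * \<gamma> j\<bar>" using gamma_ge(2)[OF jk(1)] by (simp add: abs_mult)
    also have "(real k - real k') * \<gamma> j = Im (r j k) - Im (r j' k')" using 3 by (simp add: Im_r left_diff_distrib)
    finally show ?thesis using gamma_ge(1)[OF jk(1)] pq by simp
  qed
qed

lemma inj_r: "inj_on (case_prod r) I"
  using heights_separated by (intro inj_onI) fastforce

lemma P_Im: "w \<in> P \<Longrightarrow> Im w \<ge> 97" using height_lower(2) by fastforce

lemma P_disjoint: "P \<inter> cnj ` P = {}"
  unfolding disjoint_iff
proof (intro allI impI notI)
  fix w assume w: "w \<in> P" "w \<in> cnj ` P"
  from w(2) obtain v where "v \<in> P" "w = cnj v" by (rule imageE)
  thus False using P_Im[OF w(1)] P_Im[of v] by simp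
qed

lemma zeros_separated:
  assumes "w \<in> Z" "w' \<in> Z" "w \<noteq> w'"
  shows "dist w w' \<ge> 10"
proof -
  have A: "\<bar>Im v - Im v'\<bar> \<ge> 10" if "v \<in> P" "v' \<in> P" "v \<noteq> v'" for v v'
  proof -
    from that(1) obtain p where p: "v = case_prod r p" "p \<in> I" by (rule imageE)
    from that(2) obtain q where q: "v' = case_prod r q" "q \<in> I" by (rule imageE)
    show ?thesis unfolding p(1) q(1) using p q that(3) by (intro heights_separated) auto
  qed
  have B: "Im v + Im v' \<ge> 10" if "v \<in> P" "v' \<in> P" for v v' using P_Im[OF that(1)] P_Im[OF that(2)] by linarith
  have E: "(w \<in> P \<longrightarrow> Q) \<Longrightarrow> (\<And>v. v \<in> P \<Longrightarrow> w = cnj v \<Longrightarrow> Q) \<Longrightarrow> Q" if "w \<in> Z" for w Q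
    using that unfolding zeros by (elim UnE imageE[of _ cnj]) simp_all
  have "\<bar>Im w - Im w'\<bar> \<ge> 10"
  proof (rule E[OF assms(1)]; (intro impI)?; rule E[OF assms(2)]; (intro impI)?)
    assume "w \<in> P" "w' \<in> P" thus ?thesis using A assms(3) by simp
  next
    fix v assume "w \<in> P" "v \<in> P" "w' = cnj v" thus ?thesis using B[of w v] by simp
  next
    fix v assume "v \<in> P" "w = cnj v" "w' \<in> P" thus ?thesis using B[of v w'] by simp
  next
    fix v v' assume "v \<in> P" "w = cnj v" "v' \<in> P" "w' = cnj v'" thus ?thesis using A[of v v'] assms(3) by auto
  qed
  thus ?thesis using abs_Im_le_cmod[of "w - w'"] by (simp add: dist_norm)
qed

lemma multiplicity_le: "j \<ge> J \<Longrightarrow> k \<in> {1..j ^ 3} \<Longrightarrow> real (zeta_zero_mult (r j k)) \<le> real k * real (j ^ 3)"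
  unfolding multiplicity of_nat_mult by (intro mult_left_mono) auto

lemma multiplicity_le6: "j \<ge> J \<Longrightarrow> k \<in> {1..j ^ 3} \<Longrightarrow> real (zeta_zero_mult (r j k)) \<le> real j ^ 6"
proof -
  assume jk: "j \<ge> J" "k \<in> {1..j ^ 3}"
  have "real k * real (j ^ 3) \<le> real (j ^ 3) * real (j ^ 3)" using jk by (intro mult_right_mono) auto
  also have "... = real j ^ 6" by (simp add: power_add[symmetric])
  finally show ?thesis using multiplicity_le[OF jk] by linarith
qed

text \<open>Multiplicities in block j are at most j^6, whereas ln |\<rho>| is at least about
  j^8.\<close>

lemma multiplicity_le_ln:
  assumes "w \<in> Z"
  shows "real (zeta_zero_mult w) \<le> 1 * ln (norm w)"
proof -
  have *: "real (zeta_zero_mult (r j k)) \<le> ln (norm (r j k))" if jk: "j \<ge> J" "k \<in> {1..j ^ 3}" for j k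
  proof -
    have j2: "real j \<ge> 2" by (rule j_ge[OF jk(1)])
    have "1 * (\<gamma> j / 2) \<le> real k * (\<gamma> j / 2)" using jk gamma_ge(2)[OF jk(1)] by (intro mult_right_mono) auto
    hence "exp (real j ^ 8) / 2 \<le> norm (r j k)" using height_lower(3)[OF jk(1), of k] jk \<gamma>[OF jk(1)] by auto
    hence "ln (exp (real j ^ 8) / 2) \<le> ln (norm (r j k))" by (subst ln_le_cancel_iff) (auto intro: less_le_trans[OF _ \<open>_ \<le> norm _\<close>])
    hence "real j ^ 8 - ln 2 \<le> ln (norm (r j k))" by (simp add: ln_div)
    moreover have "4 * real j ^ 6 \<le> real j ^ 2 * real j ^ 6" using power_mono[OF j2, of 2] by (intro mult_right_mono) auto
    moreover have "real j ^ 2 * real j ^ 6 = real j ^ 8" by (simp add: power_add[symmetric])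
    moreover have "1 \<le> real j ^ 6" using j2 by (intro one_le_power) auto
    ultimately show ?thesis using multiplicity_le6[OF jk] ln_2_less_1 by linarith
  qed
  show ?thesis using assms * unfolding zeros by (auto simp: zeta_zero_mult_cnj)
qed

text \<open>Already the crude bound exp j \<le> \<gamma> j suffices: block j has j^3 terms, each at
  most 2 j^6 exp (- j).\<close>

lemma summable_zeros: "(\<lambda>w. real (zeta_zero_mult w) / norm w) summable_on Z"
proof -
  define f where "f = (\<lambda>w. real (zeta_zero_mult w) / norm w)"
  have fb: "f (r j k) \<le> real j ^ 6 * (2 * exp (- real j))" if jk: "j \<ge> J" "k \<in> {1..j ^ 3}" for j k
  proof -
    have "1 * (\<gamma> j / 2) \<le> real k * (\<gamma> j / 2)" using jk gamma_ge(2)[OF jk(1)] by (intro mult_right_mono) auto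
    moreover have "exp (real j) \<le> \<gamma> j"
    proof -
      have "real j ^ 1 \<le> real j ^ 8" using j_ge[OF jk(1)] by (intro power_increasing) auto
      thus ?thesis using \<gamma>[OF jk(1)] by (smt (verit) exp_le_cancel_iff power_one_right)
    qed
    ultimately have n: "exp (real j) / 2 \<le> norm (r j k)" using height_lower(3)[OF jk(1), of k] jk by auto
    have "f (r j k) \<le> real j ^ 6 / (exp (real j) / 2)"
      unfolding f_def using multiplicity_le6[OF jk] n by (intro frac_le) auto
    thus ?thesis by (simp add: exp_minus field_simps)
  qed
  have "(\<lambda>p. norm (f (case_prod r p))) summable_on I"
    unfolding Infinite_Sum.abs_summable_on_Sigma_iff
  proof (intro conjI ballI)
    have "summable (\<lambda>j. 2 * (real j ^ 9 * exp (- real j)))"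
      by (intro summable_mult summable_power_exp)
    hence "(\<lambda>j. 2 * (real j ^ 9 * exp (- real j))) summable_on {J..}"
      by (intro summable_on_subset_banach[OF summable_nonneg_imp_summable_on, of _ "{J..}"]) auto
    thus "(\<lambda>j. norm (\<Sum>\<^sub>\<infinity>k\<in>{1..j ^ 3}. norm (f (case_prod r (j, k))))) summable_on {J..}"
    proof (rule summable_on_comparison_test)
      fix j assume j: "j \<in> {J..}"
      have "(\<Sum>k\<in>{1..j ^ 3}. \<bar>f (r j k)\<bar>) \<le> (\<Sum>k\<in>{1..j ^ 3}. real j ^ 6 * (2 * exp (- real j)))"
      proof (intro sum_mono)
        fix k assume "k \<in> {1..j ^ 3}"
        thus "\<bar>f (r j k)\<bar> \<le> real j ^ 6 * (2 * exp (- real j))" using fb[of j k] j by (simp add: f_def)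
      qed
      also have "... = 2 * (real j ^ 9 * exp (- real j))" by (simp add: power_add[symmetric])
      finally show "norm (\<Sum>\<^sub>\<infinity>k\<in>{1..j ^ 3}. norm (f (case_prod r (j, k)))) \<le> 2 * (real j ^ 9 * exp (- real j))"
        by (simp add: sum_nonneg)
    qed auto
  qed auto
  hence "(f \<circ> case_prod r) summable_on I" unfolding o_def by (rule abs_summable_summable)
  hence sP: "f summable_on P" unfolding summable_on_reindex[OF inj_r] .
  moreover have "f summable_on cnj ` P"
    by (subst summable_on_reindex) (use sP in \<open>auto intro: inj_onI simp: o_def f_def zeta_zero_mult_cnj\<close>)
  ultimately show ?thesis unfolding zeros f_def by (intro summable_on_Un_disjoint P_disjoint)
qed

section \<open>Sums over the zeros arranged by blocks\<close>

definition zz where "zz = from_nat_into Z"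

lemma bij_zz: "bij_betw zz UNIV Z"
  unfolding zz_def
proof (rule bij_betw_from_nat_into)
  show "countable Z" unfolding zeros by auto
  have "(\<lambda>j. (j, 1)) ` {J..} \<subseteq> I" using J by auto
  moreover have "infinite ((\<lambda>j::nat. (j, 1::nat)) ` {J..})" using infinite_Ici[of J] by (subst finite_image_iff) (auto intro: inj_onI)
  ultimately have "infinite I" using finite_subset by blast
  hence "infinite P" using finite_image_iff[OF inj_r] by blast
  thus "infinite Z" unfolding zeros by simp
qed

sublocale zc: zeta_zero_config c \<eta> 1 zz
proof
  show "c < 1" using above[of J] beta_bounds(2)[of J] c\<eta> by auto
  show "c + \<eta> \<le> Re w \<and> Re w < 1" if "w \<in> Z" for w
    using that above beta_bounds(2) unfolding zeros by (auto simp: Im_r)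
  show "inj zz" "range zz = Z" using bij_zz by (auto simp: bij_betw_def)
  have "(\<lambda>n. real (zeta_zero_mult (zz n)) / norm (zz n)) summable_on UNIV"
    using summable_zeros unfolding summable_on_reindex_bij_betw[OF bij_zz, of "\<lambda>w. real (zeta_zero_mult w) / norm w"] .
  thus "summable (\<lambda>n. real (zeta_zero_mult (zz n)) / norm (zz n))" by (rule summable_on_imp_summable)
qed (use c\<eta> zeros_separated multiplicity_le_ln in auto)

text \<open>The conjugate zeros contribute the conjugate sum, which accounts for twice the real
  part. Unordered summability permits the grouping by j.\<close>

lemma Sc_block_sums: "(\<lambda>i. \<Sum>k=1..(i + J) ^ 3. 2 * Re (of_nat (zeta_zero_mult (r (i + J) k)) * exp (r (i + J) k * of_real v) / r (i + J) k)) sums Re (zc.Sc v)"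
proof -
  define F where "F = (\<lambda>w. of_nat (zeta_zero_mult w) * exp (w * of_real v) / w)"
  have F: "(F has_sum zc.Sc v) (P \<union> cnj ` P)" using zc.Sc_has_sum[of v] unfolding zeros F_def .
  hence "F summable_on P" using summable_on_subset_banach[OF has_sum_imp_summable Un_upper1] by metis
  then obtain a where a: "(F has_sum a) P" by (auto simp: summable_on_def)
  hence "((\<lambda>w. cnj (F w)) has_sum cnj a) P" by simp
  also have "(\<lambda>w. cnj (F w)) = F \<circ> cnj" by (auto simp: F_def zeta_zero_mult_cnj exp_cnj)
  finally have "(F has_sum cnj a) (cnj ` P)" by (subst has_sum_reindex) (simp_all add: inj_on_def o_def)
  from has_sum_Un_disjoint[OF a this P_disjoint] have "zc.Sc v = a + cnj a" using F has_sum_unique by blast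
  hence "Re (zc.Sc v) = 2 * Re a" by simp
  moreover have "((F \<circ> case_prod r) has_sum a) I" using a unfolding has_sum_reindex[OF inj_r] .
  hence "((\<lambda>p. Re (F (case_prod r p))) has_sum Re a) I" using has_sum_Re by (auto simp: o_def)
  hence "((\<lambda>p. 2 * Re (F (case_prod r p))) has_sum 2 * Re a) I" by (rule has_sum_cmult_right)
  ultimately show ?thesis using has_sum_imp_block_sums[of "\<lambda>p. 2 * Re (F (case_prod r p))"] by (simp add: F_def)
qed

lemma Qz_block_sums: "(\<lambda>i. \<Sum>k=1..(i + J) ^ 3. 2 * (real (zeta_zero_mult (r (i + J) k)) / norm (r (i + J) k) / norm (r (i + J) k) * exp (Re (r (i + J) k) * v))) sums zc.Qz v"
proof -
  define F where "F = (\<lambda>w. real (zeta_zero_mult w) / norm w / norm w * exp (Re w * v))"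
  have "((\<lambda>n. F (zz n)) has_sum zc.Qz v) UNIV"
    unfolding F_def zc.Qz_def by (intro sums_nonneg_imp_has_sum summable_sums zc.Qz_summable) auto
  hence F: "(F has_sum zc.Qz v) (P \<union> cnj ` P)" unfolding has_sum_reindex_bij_betw[OF bij_zz] zeros .
  hence "F summable_on P" using summable_on_subset_banach[OF has_sum_imp_summable Un_upper1] by metis
  then obtain a where a: "(F has_sum a) P" by (auto simp: summable_on_def)
  hence "((F \<circ> cnj) has_sum a) P" by (simp add: F_def o_def zeta_zero_mult_cnj)
  hence "(F has_sum a) (cnj ` P)" by (subst has_sum_reindex) (simp_all add: inj_on_def o_def)
  from has_sum_Un_disjoint[OF a this P_disjoint] have "zc.Qz v = 2 * a" using F has_sum_unique by fastforce
  moreover have "((F \<circ> case_prod r) has_sum a) I" using a unfolding has_sum_reindex[OF inj_r] .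
  hence "((\<lambda>p. 2 * F (case_prod r p)) has_sum 2 * a) I" unfolding o_def by (rule has_sum_cmult_right)
  ultimately show ?thesis using has_sum_imp_block_sums[of "\<lambda>p. 2 * F (case_prod r p)"] by (simp add: F_def)
qed

lemma Qz_block_le:
  assumes j: "j \<ge> J"
  shows "(\<Sum>k=1..j ^ 3. 2 * (real (zeta_zero_mult (r j k)) / norm (r j k) / norm (r j k) * exp (Re (r j k) * v))) \<le> 8 * (V j v * (real (j ^ 3) ^ 2 / \<gamma> j))"
proof -
  define e where "e = exp ((\<sigma> - d j) * v)"
  have g: "\<gamma> j > 0" by (rule gamma_ge(2)[OF j])
  have "(\<Sum>k=1..j ^ 3. 2 * (real (zeta_zero_mult (r j k)) / norm (r j k) / norm (r j k) * exp (Re (r j k) * v))) \<le> (\<Sum>k=1..j ^ 3. 8 * real (j ^ 3) / (\<gamma> j * \<gamma> j) * e)"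
  proof (rule sum_mono)
    fix k assume k: "k \<in> {1..j ^ 3}"
    have k1: "real k \<ge> 1" using k by simp
    have h: "norm (r j k) \<ge> real k * (\<gamma> j / 2)" using height_lower(3)[OF j] k by simp
    have kg: "real k * (\<gamma> j / 2) > 0" using k1 g by simp
    have "real (zeta_zero_mult (r j k)) / norm (r j k) / norm (r j k) \<le> real k * real (j ^ 3) / (real k * (\<gamma> j / 2)) / (real k * (\<gamma> j / 2))"
      using multiplicity_le[OF j k] h kg g by (intro frac_le) auto
    also have "... = 4 * real (j ^ 3) / (\<gamma> j * \<gamma> j) / real k" using k1 g by (simp add: field_simps)
    also have "... \<le> 4 * real (j ^ 3) / (\<gamma> j * \<gamma> j) / 1" using k1 g by (intro divide_left_mono) auto
    finally have "real (zeta_zero_mult (r j k)) / norm (r j k) / norm (r j k) * e \<le> 4 * real (j ^ 3) / (\<gamma> j * \<gamma> j) * e"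
      by (intro mult_right_mono) (auto simp: e_def)
    thus "2 * (real (zeta_zero_mult (r j k)) / norm (r j k) / norm (r j k) * exp (Re (r j k) * v)) \<le> 8 * real (j ^ 3) / (\<gamma> j * \<gamma> j) * e"
      by (simp add: Im_r e_def)
  qed
  also have "... = 8 * (V j v * (real (j ^ 3) ^ 2 / \<gamma> j))" by (simp add: V_def e_def power2_eq_square)
  finally show ?thesis .
qed

text \<open>Multiplying by \<open>s\<close> puts both races on the same side: an upper bound for s
  (pi - li) is wanted, so the main blocks keep their sign and all errors enter by absolute
  value.\<close>

lemma race_inequality:
  "\<exists>C\<ge>0. \<forall>u\<ge>ln 2. summable (GH u) \<longrightarrow>
     s * (u * (real (prime_pi (exp u)) - li (exp u))) \<le> (\<Sum>i. GH u i) + \<bar>zc.ez u\<bar> + u * (C * (1 + u) * exp (c * u))"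
proof -
  obtain C where C: "C \<ge> 0" "\<And>u. u \<ge> ln 2 \<Longrightarrow> \<bar>u * (real (prime_pi (exp u)) - li (exp u)) + Re (zc.Sc u)\<bar> \<le> \<bar>zc.ez u\<bar> + u * (C * (1 + u) * exp (c * u) + 12 * zc.Qz u)"
    using zc.prime_pi_approx by blast
  have s1: "s = 1 \<or> s = -1" using xs by auto
  have "s * (u * (real (prime_pi (exp u)) - li (exp u))) \<le> (\<Sum>i. GH u i) + \<bar>zc.ez u\<bar> + u * (C * (1 + u) * exp (c * u))"
    if u: "u \<ge> ln 2" and GHs: "summable (GH u)" for u
  proof -
    have u0: "u > 0" using u ln_gt_zero[of "2::real"] by linarith
    define S where "S = (\<lambda>i. \<Sum>k=1..(i + J) ^ 3. 2 * Re (of_nat (zeta_zero_mult (r (i + J) k)) * exp (r (i + J) k * of_real u) / r (i + J) k))"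
    define Q where "Q = (\<lambda>i. \<Sum>k=1..(i + J) ^ 3. 2 * (real (zeta_zero_mult (r (i + J) k)) / norm (r (i + J) k) / norm (r (i + J) k) * exp (Re (r (i + J) k) * u)))"
    have S: "S sums Re (zc.Sc u)" unfolding S_def by (rule Sc_block_sums)
    have Q: "Q sums zc.Qz u" unfolding Q_def by (rule Qz_block_sums)
    have "- s * S i + 12 * u * Q i \<le> GH u i" for i
    proof -
      define T where "T = V (i + J) u * (real ((i + J) ^ 3) ^ 2 / \<gamma> (i + J))"
      have J': "i + J \<ge> J" by simp
      have "S i = (\<Sum>k=1..(i + J)^3. 2 * Re (of_nat (k * ((i + J)^3 + 1 - k)) * exp (Complex (\<sigma> - d (i + J)) (real k * \<gamma> (i + J) + \<theta> (i + J)) * of_real u) / Complex (\<sigma> - d (i + J)) (real k * \<gamma> (i + J) + \<theta> (i + J))))"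
        unfolding S_def by (intro sum.cong) (auto simp: multiplicity[OF J'] simp flip: rho_def)
      hence "\<bar>S i + s * (V (i + J) u * Rj (i + J) u)\<bar> \<le> 16 * T" using block_approx[OF J', of u] unfolding T_def by simp
      hence "- s * S i \<le> V (i + J) u * Rj (i + J) u + 16 * T" using s1 by auto
      moreover have "Q i \<le> 8 * T" unfolding Q_def T_def by (rule Qz_block_le[OF J'])
      hence "12 * u * Q i \<le> 12 * u * (8 * T)" using u0 by (intro mult_left_mono) auto
      moreover have "GH u i = V (i + J) u * Rj (i + J) u + 16 * T + 12 * u * (8 * T)"
        unfolding GH_def T_def[symmetric] by (simp add: algebra_simps)
      ultimately show ?thesis by linarith
    qed
    hence "- s * Re (zc.Sc u) + 12 * u * zc.Qz u \<le> (\<Sum>i. GH u i)"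
      by (intro sums_le[OF _ sums_add[OF sums_mult[OF S] sums_mult[OF Q]] summable_sums[OF GHs]])
    moreover have "s * (u * (real (prime_pi (exp u)) - li (exp u))) \<le> - s * Re (zc.Sc u) + \<bar>u * (real (prime_pi (exp u)) - li (exp u)) + Re (zc.Sc u)\<bar>"
      using s1 by auto
    ultimately show ?thesis using C(2)[OF u] by (simp add: distrib_left)
  qed
  thus ?thesis using C(1) by blast
qed

end

text \<open>Chebyshev's inequality in v = ln x. Where |ez v| exceeds exp (c' v), the integrand of
  \<open>ez_L2\<close> is at least exp (2 (c' - c) v), and the density exp v of the substitution is
  at most 2 X on the dyadic interval.\<close>

lemma (in zeta_zero_config) ez_bad_set:
  assumes c': "c' > c" and e: "e > 0"
  shows "\<exists>X0. \<forall>X\<ge>X0. \<exists>B. B \<in> fmeasurable lborel \<and> measure lborel B \<le> e * X \<and>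
     (\<forall>x\<in>{X..2 * X} - B. \<bar>ez (ln x)\<bar> \<le> exp (c' * ln x))"
proof -
  obtain M where M: "(\<integral>\<^sup>+ v. ennreal ((ez v)^2 * exp (- 2 * c * v)) \<partial>lborel) \<le> ennreal M" using ez_L2 by blast
  define M' where "M' = max M 0"
  have M': "(\<integral>\<^sup>+ v. ennreal ((ez v)^2 * exp (- 2 * c * v)) \<partial>lborel) \<le> ennreal M'" "M' \<ge> 0"
    using M order_trans[OF M ennreal_leI[of M M']] by (auto simp: M'_def)
  define a where "a = c' - c"
  have a: "a > 0" using c' by (simp add: a_def)
  have "((\<lambda>X. exp (- 2 * a * ln X)) \<longlongrightarrow> 0) at_top" using a by real_asymp
  from eventually_const_mult_le[OF this e, of "2 * M'"]
  have "eventually (\<lambda>X. 2 * M' * exp (- 2 * a * ln X) \<le> e \<and> X > 1) at_top"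
    by (intro eventually_conj eventually_gt_at_top)
  then obtain X0 where X0: "\<And>X. X \<ge> X0 \<Longrightarrow> 2 * M' * exp (- 2 * a * ln X) \<le> e \<and> X > 1" by (auto simp: eventually_at_top_linorder)
  define E where "E = {x. \<bar>ez (ln x)\<bar> > exp (c' * ln x)}"
  note ez_measurable[measurable]
  have Em[measurable]: "E \<in> sets borel" unfolding E_def by measurable
  have "\<exists>B. B \<in> fmeasurable lborel \<and> measure lborel B \<le> e * X \<and> (\<forall>x\<in>{X..2 * X} - B. \<bar>ez (ln x)\<bar> \<le> exp (c' * ln x))"
    if XX: "X \<ge> X0" for X
  proof -
    have X1: "X > 1" and Xe: "2 * M' * exp (- 2 * a * ln X) \<le> e" using X0[OF XX] by auto
    define B where "B = E \<inter> {X..2 * X}"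
    have "emeasure lborel B = (\<integral>\<^sup>+ x. indicator E x * indicator {exp (ln X)..exp (ln (2 * X))} x \<partial>lborel)"
      using X1 by (simp add: B_def indicator_inter_arith[symmetric])
    also have "... = (\<integral>\<^sup>+ v. indicator E (exp v) * ennreal (exp v) * indicator {ln X..ln (2 * X)} v \<partial>lborel)"
      using X1 by (intro nn_integral_substitution_aux) (auto intro!: derivative_eq_intros continuous_intros)
    also have "... \<le> (\<integral>\<^sup>+ v. ennreal (2 * X * exp (- 2 * a * ln X)) * ennreal ((ez v)^2 * exp (- 2 * c * v)) \<partial>lborel)"
    proof (intro nn_integral_mono)
      fix v
      show "indicator E (exp v) * ennreal (exp v) * indicator {ln X..ln (2 * X)} v
         \<le> ennreal (2 * X * exp (- 2 * a * ln X)) * ennreal ((ez v)^2 * exp (- 2 * c * v))"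
      proof (cases "exp v \<in> E \<and> v \<in> {ln X..ln (2 * X)}")
        case True
        hence v: "exp (c' * v) < \<bar>ez v\<bar>" "ln X \<le> v" "v \<le> ln (2 * X)" by (auto simp: E_def)
        have "exp v \<le> 2 * X" using v(3) X1 by (metis exp_le_cancel_iff exp_ln mult_pos_pos zero_less_numeral less_trans zero_less_one)
        moreover have "1 \<le> exp (- 2 * a * ln X) * ((ez v)^2 * exp (- 2 * c * v))"
        proof -
          have "(exp (c' * v))^2 \<le> (ez v)^2" using v(1) by (simp add: abs_le_square_iff[symmetric])
          hence "exp (- 2 * a * ln X) * ((exp (c' * v))^2 * exp (- 2 * c * v)) \<le> exp (- 2 * a * ln X) * ((ez v)^2 * exp (- 2 * c * v))"
            by (intro mult_left_mono mult_right_mono) auto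
          moreover have "exp (- 2 * a * ln X) * ((exp (c' * v))^2 * exp (- 2 * c * v)) = exp (2 * (a * (v - ln X)))"
            by (simp add: a_def power2_eq_square exp_add[symmetric] algebra_simps)
          moreover have "exp (2 * (a * (v - ln X))) \<ge> 1" using a v(2) by simp
          ultimately show ?thesis by linarith
        qed
        ultimately have "exp v * 1 \<le> 2 * X * (exp (- 2 * a * ln X) * ((ez v)^2 * exp (- 2 * c * v)))"
          using X1 by (intro mult_mono) auto
        thus ?thesis using True X1 by (simp add: ennreal_mult[symmetric] mult.assoc ennreal_leI)
      qed auto
    qed
    also have "... = ennreal (2 * X * exp (- 2 * a * ln X)) * (\<integral>\<^sup>+ v. ennreal ((ez v)^2 * exp (- 2 * c * v)) \<partial>lborel)"
      by (rule nn_integral_cmult) measurable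
    also have "... \<le> ennreal (2 * X * exp (- 2 * a * ln X)) * ennreal M'" by (intro mult_left_mono M') auto
    also have "... = ennreal (2 * M' * exp (- 2 * a * ln X) * X)" using X1 M'(2) by (simp add: ennreal_mult[symmetric] mult_ac)
    also have "... \<le> ennreal (e * X)" using Xe X1 by (intro ennreal_leI mult_right_mono) auto
    finally have em: "emeasure lborel B \<le> ennreal (e * X)" .
    have "B \<in> fmeasurable lborel" using em by (intro fmeasurableI) (auto simp: B_def intro: le_less_trans)
    moreover have "measure lborel B \<le> e * X" unfolding measure_def using em e X1 by (intro enn2real_leI) auto
    ultimately show ?thesis by (intro exI[of _ B]) (auto simp: B_def E_def not_less)
  qed
  thus ?thesis by blast
qed

section \<open>Measurability and density of the race set\<close>

lemma borel_prime_pi: "(\<lambda>x. real (prime_pi x)) \<in> borel_measurable borel"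
proof (rule borel_measurable_mono)
  show "mono (\<lambda>x. real (prime_pi x))"
  proof (rule monoI)
    fix x y :: real assume "x \<le> y"
    moreover have "finite {p::nat. prime p \<and> real p \<le> y}" by (rule finite_subset[of _ "{..nat \<lfloor>y\<rfloor>}"]) (auto simp: le_nat_floor)
    ultimately show "real (prime_pi x) \<le> real (prime_pi y)" unfolding prime_pi_def by (intro of_nat_mono card_mono) auto
  qed
qed

text \<open>\<open>li\<close> is under control from 2 on; truncating its argument there yields a
  function continuous on the whole line.\<close>

lemma borel_li_max: "(\<lambda>x. li (max 2 x)) \<in> borel_measurable borel"
proof (rule borel_measurable_continuous_onI)
  have "isCont (\<lambda>x. li (max 2 x)) x" for x
  proof -
    have "continuous_on {2..\<bar>x\<bar> + 3} li"
      using li_has_derivative[of _ "\<bar>x\<bar> + 3"] by (auto simp: continuous_on_eq_continuous_within intro!: DERIV_continuous)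
    hence "continuous_on {..<\<bar>x\<bar> + 3} (\<lambda>x. li (max 2 x))"
      by (rule continuous_on_compose2) (auto intro!: continuous_intros)
    thus ?thesis by (rule continuous_on_interior) (auto simp: interior_open)
  qed
  thus "continuous_on UNIV (\<lambda>x. li (max 2 x))" by (simp add: continuous_at_imp_continuous_on)
qed

lemma borel_race_set: "{x. x \<ge> 2 \<and> s * (real (prime_pi x) - li x) \<ge> 0} \<in> sets borel"
proof -
  note borel_prime_pi[measurable] borel_li_max[measurable]
  have "{x. x \<ge> 2 \<and> s * (real (prime_pi x) - li x) \<ge> 0} = {x. x \<ge> 2 \<and> s * (real (prime_pi x) - li (max 2 x)) \<ge> 0}"
    by (auto simp: max_def)
  also have "... \<in> sets borel" by measurable
  finally show ?thesis .
qed

text \<open>The exceptional set is defined with \<ge>, so ties count as exceptional. This lets it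
  serve both the strict inequality in \<open>P1\<close> and its complement.\<close>

lemma (in race_zeros) race_density:
  "((\<lambda>X. measure lebesgue ({x. x \<ge> 2 \<and> s * (real (prime_pi x) - li x) \<ge> 0} \<inter> {2..X}) / X) \<longlongrightarrow> 0) at_top"
proof (rule density_zero_from_dyadic)
  define Bad where "Bad = {x. x \<ge> 2 \<and> s * (real (prime_pi x) - li x) \<ge> 0}"
  have Badb: "Bad \<in> sets borel" unfolding Bad_def by (rule borel_race_set)
  thus "{x. x \<ge> 2 \<and> s * (real (prime_pi x) - li x) \<ge> 0} \<in> sets lebesgue" unfolding Bad_def by (intro sets_completionI_sets) simp
  fix e :: real assume e: "e > 0"
  \<comment> \<open>An exponent with room on both sides: c < c' absorbs the mean square remainder
    and powers of u, while c' < \<sigma> lets the blocks dominate exp (c' u).\<close>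
  define c' where "c' = c + \<eta> / 2"
  have "d J \<ge> 0" by (rule d_nonneg) simp
  hence c': "c < c'" "c' < \<sigma>" using above[of J] c\<eta> by (auto simp: c'_def)
  obtain C where C: "C \<ge> 0" "\<And>u. u \<ge> ln 2 \<Longrightarrow> summable (GH u) \<Longrightarrow>
     s * (u * (real (prime_pi (exp u)) - li (exp u))) \<le> (\<Sum>i. GH u i) + \<bar>zc.ez u\<bar> + u * (C * (1 + u) * exp (c * u))"
    using race_inequality by blast
  obtain X1 where X1: "\<And>X. X \<ge> X1 \<Longrightarrow> \<exists>B. B \<in> fmeasurable lborel \<and> measure lborel B \<le> e / 2 * X \<and>
     (\<forall>x\<in>{X..2 * X} - B. summable (GH (ln x)) \<and> (\<Sum>i. GH (ln x) i) + (C + 1) * (1 + ln x) ^ 2 * exp (c' * ln x) < 0)"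
    using race_bad_set[of "C + 1" c' "e / 2"] C(1) c' e by auto
  obtain X2 where X2: "\<And>X. X \<ge> X2 \<Longrightarrow> \<exists>B. B \<in> fmeasurable lborel \<and> measure lborel B \<le> e / 2 * X \<and>
     (\<forall>x\<in>{X..2 * X} - B. \<bar>zc.ez (ln x)\<bar> \<le> exp (c' * ln x))"
    using zc.ez_bad_set[of c' "e / 2"] c' e by auto
  have "measure lebesgue (Bad \<inter> {X..2 * X}) \<le> e * X" if X: "X \<ge> max 2 (max X1 X2)" for X
  proof -
    obtain B1 where B1: "B1 \<in> fmeasurable lborel" "measure lborel B1 \<le> e / 2 * X"
      "\<And>x. x \<in> {X..2 * X} - B1 \<Longrightarrow> summable (GH (ln x)) \<and> (\<Sum>i. GH (ln x) i) + (C + 1) * (1 + ln x) ^ 2 * exp (c' * ln x) < 0"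
      using X1[of X] X by auto
    obtain B2 where B2: "B2 \<in> fmeasurable lborel" "measure lborel B2 \<le> e / 2 * X"
      "\<And>x. x \<in> {X..2 * X} - B2 \<Longrightarrow> \<bar>zc.ez (ln x)\<bar> \<le> exp (c' * ln x)"
      using X2[of X] X by auto
    have "x \<in> B1 \<union> B2" if x: "x \<in> Bad" "x \<in> {X..2 * X}" for x
    proof (rule ccontr)
      assume "x \<notin> B1 \<union> B2"
      hence xB: "x \<in> {X..2 * X} - B1" "x \<in> {X..2 * X} - B2" using x by auto
      define u where "u = ln x"
      have x2: "x \<ge> 2" using x X by auto
      hence u: "u \<ge> ln 2" unfolding u_def by (subst ln_le_cancel_iff) auto
      have u0: "u > 0" using u ln_gt_zero[of "2::real"] by linarith
      have ex: "exp u = x" using x2 by (simp add: u_def)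
      have g: "summable (GH u)" "(\<Sum>i. GH u i) + (C + 1) * (1 + u) ^ 2 * exp (c' * u) < 0" using B1(3)[OF xB(1)] by (auto simp: u_def)
      have "u * (C * (1 + u) * exp (c * u)) \<le> (1 + u) * (C * (1 + u) * exp (c' * u))"
        using u0 C(1) c' by (intro mult_mono) (auto intro!: mult_nonneg_nonneg)
      moreover have "1 * exp (c' * u) \<le> (1 + u) ^ 2 * exp (c' * u)" using u0 by (intro mult_right_mono one_le_power) auto
      moreover have "\<bar>zc.ez u\<bar> \<le> exp (c' * u)" using B2(3)[OF xB(2)] by (simp add: u_def)
      moreover have "(C + 1) * (1 + u) ^ 2 * exp (c' * u) = (1 + u) * (C * (1 + u) * exp (c' * u)) + (1 + u) ^ 2 * exp (c' * u)"
        by (simp add: power2_eq_square algebra_simps)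
      ultimately have "s * (u * (real (prime_pi x) - li x)) < 0" using C(2)[OF u g(1)] g(2) unfolding ex by linarith
      hence "u * (s * (real (prime_pi x) - li x)) < 0" by (simp add: mult_ac)
      moreover have "s * (real (prime_pi x) - li x) \<ge> 0" using x(1) by (simp add: Bad_def)
      ultimately show False using u0 mult_nonneg_nonneg[of u "s * (real (prime_pi x) - li x)"] by linarith
    qed
    hence sub: "Bad \<inter> {X..2 * X} \<subseteq> B1 \<union> B2" by blast
    have b: "Bad \<inter> {X..2 * X} \<in> sets borel" using Badb by auto
    hence "measure lebesgue (Bad \<inter> {X..2 * X}) = measure lborel (Bad \<inter> {X..2 * X})" by (simp add: measure_completion)
    also have "... \<le> measure lborel (B1 \<union> B2)"
      using b B1 B2 by (intro measure_mono_fmeasurable[OF sub]) auto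
    also have "... \<le> measure lborel B1 + measure lborel B2" using B1 B2 by (intro measure_Un_le) (auto simp: fmeasurable_def)
    also have "... \<le> e * X" using B1(2) B2(2) by simp
    finally show ?thesis .
  qed
  thus "\<exists>X0. \<forall>X\<ge>X0. measure lebesgue ({x. x \<ge> 2 \<and> s * (real (prime_pi x) - li x) \<ge> 0} \<inter> {X..2 * X}) \<le> e * X"
    unfolding Bad_def by blast
qed

text \<open>For s = 1 the set \<open>P1\<close> is contained in the exceptional set; for s = - 1 it
  is the complement of that set within [2, X].\<close>

lemma (in race_zeros) P1_density:
  "((\<lambda>X. measure lebesgue (P1 \<inter> {2..X}) / X) \<longlongrightarrow> (if s = 1 then 0 else 1)) at_top"
proof -
  define Bad where "Bad = {x. x \<ge> 2 \<and> s * (real (prime_pi x) - li x) \<ge> 0}"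
  have Badb: "Bad \<in> sets borel" unfolding Bad_def by (rule borel_race_set)
  have Bl: "Bad \<inter> {2..X} \<in> fmeasurable lebesgue" for X
    by (rule fmeasurableI2[OF lmeasurable_interval(1)[of 2 X]]) (use Badb in \<open>auto intro: sets_completionI_sets\<close>)
  have lim: "((\<lambda>X. measure lebesgue (Bad \<inter> {2..X}) / X) \<longlongrightarrow> 0) at_top" unfolding Bad_def by (rule race_density)
  have c: "{x. x \<ge> 2 \<and> - 1 * (real (prime_pi x) - li x) \<ge> 0} \<in> sets borel" by (rule borel_race_set)
  have P1c: "P1 = {2..} - {x. x \<ge> 2 \<and> - 1 * (real (prime_pi x) - li x) \<ge> 0}" by (auto simp: P1_def)
  have P1b: "P1 \<in> sets borel" unfolding P1c using c by (intro sets.Diff) auto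
  show ?thesis
  proof (cases "s = 1")
    case True
    have "((\<lambda>X. measure lebesgue (P1 \<inter> {2..X}) / X) \<longlongrightarrow> 0) at_top"
    proof (rule tendsto_sandwich[OF _ _ tendsto_const lim])
      show "eventually (\<lambda>X. 0 \<le> measure lebesgue (P1 \<inter> {2..X}) / X) at_top"
        using eventually_gt_at_top[of 0] by eventually_elim simp
      show "eventually (\<lambda>X. measure lebesgue (P1 \<inter> {2..X}) / X \<le> measure lebesgue (Bad \<inter> {2..X}) / X) at_top"
        using eventually_gt_at_top[of 0]
      proof eventually_elim
        case (elim X)
        have "measure lebesgue (P1 \<inter> {2..X}) \<le> measure lebesgue (Bad \<inter> {2..X})"
          using P1b True by (intro measure_mono_fmeasurable[OF _ _ Bl]) (auto simp: P1_def Bad_def intro: sets_completionI_sets)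
        thus ?case using elim by (intro divide_right_mono) auto
      qed
    qed
    thus ?thesis using True by simp
  next
    case False
    hence s: "s = - 1" using xs by auto
    have "eventually (\<lambda>X. (X - 2) / X - measure lebesgue (Bad \<inter> {2..X}) / X = measure lebesgue (P1 \<inter> {2..X}) / X) at_top"
      using eventually_gt_at_top[of 2]
    proof eventually_elim
      case (elim X)
      have "P1 \<inter> {2..X} = {2..X} - Bad \<inter> {2..X}" unfolding P1c Bad_def s by auto
      also have "measure lebesgue ... = measure lebesgue {2..X} - measure lebesgue (Bad \<inter> {2..X})"
        using Bl[of X] by (intro measurable_measure_Diff) (auto simp: lmeasurable_interval(1)[of 2 X, unfolded box_real])
      finally show ?case using elim by (simp add: diff_divide_distrib)
    qed
    moreover have "((\<lambda>X::real. (X - 2) / X) \<longlongrightarrow> 1) at_top" by real_asymp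
    hence "((\<lambda>X. (X - 2) / X - measure lebesgue (Bad \<inter> {2..X}) / X) \<longlongrightarrow> 1 - 0) at_top" by (intro tendsto_diff lim)
    ultimately show ?thesis using False by (simp add: tendsto_cong)
  qed
qed

section \<open>Choice of the line Re s = c\<close>

lemma zeta_zero_mult_pos_iff: "zeta_zero_mult w > 0 \<longleftrightarrow> w \<noteq> 1 \<and> zeta w = 0"
proof -
  have "zorder zeta w > 0" if w: "w \<noteq> 1" "zeta w = 0"
  proof -
    note connected_minus_one
    moreover have "open (UNIV - {1::complex})" by (intro open_Diff) auto
    moreover have "\<exists>x\<in>UNIV - {1}. zeta x \<noteq> 0" using zeta_3_lower[of 3] by (intro bexI[of _ 3]) auto
    ultimately show ?thesis using zorder_exist_zero[OF zeta_holomorphic, of w] w by auto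
  qed
  thus ?thesis by (auto simp: zeta_zero_mult_def)
qed

text \<open>For j \<ge> 2 the real parts \<sigma> - d j increase strictly, so a zero-free strip fits
  between two consecutive blocks i and J = i + 1 far out. All earlier blocks then lie to its left
  and belong to the remainder. Block 1 is special: its tolerance allows any d 1 in [0, 2], and only
  d 1 > 0 makes sure that it is passed eventually.\<close>

lemma race_zeros_exist:
  fixes \<sigma> \<delta> \<xi> s :: real
  assumes \<sigma>: "1 / 2 < \<sigma>" "\<sigma> < 1" and \<delta>: "0 < \<delta>" "\<delta> < \<sigma> - 1 / 2"
    and xs: "(\<xi> = 0 \<and> s = 1) \<or> (\<xi> = pi \<and> s = -1)"
    and adm: "admissible_params \<xi> \<gamma> d \<theta>" and j0: "j0 \<ge> 1" and dle: "\<And>j. j \<ge> j0 \<Longrightarrow> d j \<le> \<delta>"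
    and B1: "\<And>w. B_mult \<sigma> \<gamma> d \<theta> j0 w \<le> zeta_zero_mult w"
    and B2: "\<And>w. Re w \<ge> \<sigma> - \<delta> \<Longrightarrow> Im w \<ge> 0 \<Longrightarrow> zeta_zero_mult w \<le> B_mult \<sigma> \<gamma> d \<theta> j0 w"
    and d1: "j0 = 1 \<Longrightarrow> d 1 > 0"
  shows "\<exists>J c \<eta>. race_zeros \<sigma> \<xi> s \<gamma> d \<theta> J c \<eta>"
proof -
  have dj: "\<bar>d j - 1 / real j ^ 8\<bar> \<le> 1 / real j ^ 9" if "j \<ge> 1" for j using adm that by (simp add: admissible_params_def)
  have split9: "1 / real j ^ 9 = 1 / real j ^ 8 * (1 / real j)" for j by (simp add: power_Suc2[symmetric])
  have lower: "d j \<ge> 1 / real j ^ 8 * (1 - 1 / real j)" if "j \<ge> 1" for j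
    using dj[OF that] unfolding split9 right_diff_distrib by linarith
  have upper: "d j \<le> 1 / real j ^ 8 * (1 + 1 / real j)" if "j \<ge> 1" for j
    using dj[OF that] unfolding split9 distrib_left by linarith
  \<comment> \<open>From j to j + 1 the value 1 / j^8 drops by a relative amount of about 8 / j,
    more than the two tolerances of relative size 1 / j can make up for.\<close>
  have dec1: "d (Suc j) < d j" if j: "j \<ge> 2" for j
  proof -
    define x where "x = 1 / real j"
    have x: "0 < x" "x \<le> 1/2" using j by (auto simp: x_def field_simps)
    have "1 + 1 / real (Suc j) \<le> 1 + x" unfolding x_def using j by (intro add_left_mono divide_left_mono) auto
    also have "... < (1 - x) * (1 + 8 * x)"
    proof -
      have "0 < 2 * x * (3 - 4 * x)" using x by (intro mult_pos_pos) auto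
      thus ?thesis by (simp add: algebra_simps)
    qed
    also have "... \<le> (1 - x) * (1 + x) ^ 8"
      using x Bernoulli_inequality[of x 8] by (intro mult_left_mono) auto
    finally have *: "1 + 1 / real (Suc j) < (1 - x) * (1 + x) ^ 8" .
    have cancel: "1 / (p * q) * (y * p) = 1 / q * y" if "p \<noteq> 0" for p q y :: real using that by simp
    have "(1 + x) * real j = real (Suc j)" using j by (simp add: x_def field_simps)
    hence pw: "real (Suc j) ^ 8 = (1 + x) ^ 8 * real j ^ 8" by (simp add: power_mult_distrib[symmetric])
    have "d (Suc j) \<le> 1 / real (Suc j) ^ 8 * (1 + 1 / real (Suc j))" by (rule upper) simp
    also have "... < 1 / real (Suc j) ^ 8 * ((1 - x) * (1 + x) ^ 8)" using * by (intro mult_strict_left_mono) auto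
    also have "... = 1 / real j ^ 8 * (1 - x)" unfolding pw by (rule cancel) (use x in auto)
    also have "... \<le> d j" unfolding x_def using j by (intro lower) auto
    finally show ?thesis .
  qed
  have dec: "d j < d i" if "2 \<le> i" "i < j" for i j
    using that(2,1) by (induction rule: less_Suc_induct) (auto intro: dec1 less_trans)
  have dpos: "d j > 0" if "j \<ge> 2" for j
  proof -
    have "0 < 1 / real j ^ 8 * (1 - 1 / real j)" using that by (intro mult_pos_pos) auto
    also have "... \<le> d j" using that by (intro lower) simp
    finally show ?thesis .
  qed
  \<comment> \<open>A target for d i: at most \<delta>, so that the strip lies in the region where
    all zeros are prescribed, and at most d 1 if block 1 is present, so that this block is to the
    left of the strip.\<close>
  define e where "e = (if j0 = 1 then min \<delta> (d 1) else \<delta>)"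
  have e: "e > 0" "e \<le> \<delta>" "j0 = 1 \<Longrightarrow> e \<le> d 1" using \<delta> d1 by (auto simp: e_def)
  obtain N :: nat where N: "real N > 2 / e" using reals_Archimedean2 by blast
  define i where "i = max N (max 2 j0)"
  define J where "J = Suc i"
  have i: "i \<ge> 2" "i \<ge> j0" "real i > 2 / e" using N by (auto simp: i_def)
  have die: "d i \<le> e"
  proof -
    have i1: "real i \<ge> 1" using i by simp
    have "1 / real i ^ 8 * (1 + 1 / real i) \<le> 1 / real i ^ 1 * (1 + 1 / 1)"
      using i1 by (intro mult_mono divide_left_mono add_left_mono power_increasing) auto
    moreover have "2 / real i < e" using i(3) i1 e(1) by (simp add: field_simps)
    ultimately show ?thesis using upper[of i] i by simp
  qed
  have dlt: "d j < d i \<longleftrightarrow> j \<ge> J" if "j \<ge> j0" for j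
  proof
    assume a: "d j < d i"
    show "j \<ge> J"
    proof (rule ccontr)
      assume "\<not> j \<ge> J"
      hence ji: "j \<le> i" by (simp add: J_def)
      have "j \<ge> 1" using that j0 by simp
      then consider "j = 1" | "j \<ge> 2" by linarith
      thus False
      proof cases
        case 1 thus False using that j0 e(3) die a by simp
      next
        case 2 thus False using dec[of j i] ji a by (cases "j = i") auto
      qed
    qed
  qed (use dec[of i j] i in \<open>simp add: J_def\<close>)
  \<comment> \<open>[c - \<eta>, c + \<eta>] is the middle half of the gap between \<sigma> - d i
    and \<sigma> - d J.\<close>
  define c where "c = \<sigma> - (d i + d J) / 2"
  define \<eta> where "\<eta> = (d i - d J) / 4"
  have dJi: "d J < d i" unfolding J_def by (rule dec1[OF i(1)])
  have dJ0: "d J > 0" using i by (intro dpos) (simp add: J_def)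
  have JJ: "J \<ge> 2" "J \<ge> j0" using i by (auto simp: J_def)
  have c\<eta>: "\<sigma> - d i < c - \<eta>" "\<sigma> - \<delta> \<le> c - \<eta>" "1/2 < c - \<eta>" "0 < \<eta>" "\<eta> \<le> 1"
    unfolding c_def \<eta>_def using dJi dJ0 die e(2) \<delta> \<sigma> by (simp_all add: field_simps)
  have above: "c + \<eta> \<le> \<sigma> - d j" if "j \<ge> J" for j
  proof -
    have "d j \<le> d J" using dec[of J j] JJ that by (cases "j = J") auto
    thus ?thesis unfolding c_def \<eta>_def using dJi by (simp add: field_simps)
  qed
  define r where "r = rho \<sigma> \<gamma> d \<theta>"
  define fib where "fib = (\<lambda>w. {(j, k). j \<ge> j0 \<and> 1 \<le> k \<and> k \<le> j ^ 3 \<and> r j k = w})"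
  have Bm: "B_mult \<sigma> \<gamma> d \<theta> j0 w = (\<Sum>(j, k)\<in>fib w. k * (j ^ 3 + 1 - k))" for w by (simp add: B_mult_def fib_def r_def)
  have dh: "d j < \<sigma> - 1 / 2" if "j \<ge> J" for j using dle[of j] that JJ \<delta> by simp
  interpret race \<sigma> \<xi> s \<gamma> d \<theta> J
    by unfold_locales (use JJ \<sigma> xs adm j0 dh in \<open>auto simp: admissible_params_def\<close>)
  have ImP: "Im (r j k) > 0" if "j \<ge> J" "k \<ge> 1" for j k
  proof -
    have "1 * \<gamma> j \<le> real k * \<gamma> j" using that gamma_ge(2)[of j] by (intro mult_right_mono) auto
    hence "0 < real k * \<gamma> j + \<theta> j" using theta_bound[OF that(1)] gamma_ge(1)[OF that(1)] by linarith
    thus ?thesis by (simp add: r_def rho_def)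
  qed
  \<comment> \<open>No coincidences occur to the right of the strip: equal real parts force equal j
    by monotonicity of d, and then the heights determine k. Hence the sum in \<open>B_mult\<close>
    has a single term there.\<close>
  have fibr: "fib (r j k) = {(j, k)}" if j: "j \<ge> J" "k \<in> {1..j ^ 3}" for j k
  proof -
    have "j' = j \<and> k' = k" if f: "(j', k') \<in> fib (r j k)" for j' k'
    proof -
      have f': "j' \<ge> j0" "d j' = d j" "real k' * \<gamma> j' + \<theta> j' = real k * \<gamma> j + \<theta> j" using f by (auto simp: fib_def r_def rho_def)
      have "d j < d i" using dlt[of j] j JJ by simp
      hence "j' \<ge> J" using f' dlt[of j'] by simp
      hence "j' = j" using f'(2) dec[of j j'] dec[of j' j] j JJ by (cases rule: linorder_cases[of j j']) auto
      thus ?thesis using f'(3) gamma_ge(2)[OF j(1)] by simp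
    qed
    thus ?thesis using j JJ by (auto simp: fib_def)
  qed
  have up: "w \<in> case_prod r ` (SIGMA j:{J..}. {1..j ^ 3})" if w: "w \<in> zeta_zeros (c - \<eta>)" "Im w \<ge> 0" for w
  proof -
    have "zeta_zero_mult w > 0" "Re w > c - \<eta>" using w(1) by (auto simp: zeta_zero_mult_pos_iff zeta_zeros_def)
    hence "B_mult \<sigma> \<gamma> d \<theta> j0 w > 0" using B2[of w] w(2) c\<eta>(2) by linarith
    hence "fib w \<noteq> {}" unfolding Bm by (metis less_irrefl sum.empty)
    then obtain j k where jk: "j \<ge> j0" "1 \<le> k" "k \<le> j ^ 3" "w = r j k" by (auto simp: fib_def)
    hence "d j < d i" using \<open>Re w > c - \<eta>\<close> c\<eta>(1) by (simp add: r_def rho_def)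
    hence "j \<ge> J" using dlt[OF jk(1)] by simp
    thus ?thesis using jk by (auto intro!: image_eqI[of _ _ "(j, k)"])
  qed
  have low: "r j k \<in> zeta_zeros (c - \<eta>)" "zeta_zero_mult (r j k) = k * (j ^ 3 + 1 - k)" if jk: "j \<ge> J" "k \<in> {1..j ^ 3}" for j k
  proof -
    have b: "B_mult \<sigma> \<gamma> d \<theta> j0 (r j k) = k * (j ^ 3 + 1 - k)" unfolding Bm fibr[OF jk] by simp
    have R: "Re (r j k) > c - \<eta>" using above[OF jk(1)] c\<eta>(4) by (simp add: r_def rho_def)
    have "zeta_zero_mult (r j k) \<le> B_mult \<sigma> \<gamma> d \<theta> j0 (r j k)" using R c\<eta>(2) ImP[of j k] jk by (intro B2) auto
    thus m: "zeta_zero_mult (r j k) = k * (j ^ 3 + 1 - k)" using B1[of "r j k"] b by linarith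
    have "zeta_zero_mult (r j k) > 0" unfolding m using jk(2) by auto
    thus "r j k \<in> zeta_zeros (c - \<eta>)" using R by (auto simp: zeta_zero_mult_pos_iff zeta_zeros_def)
  qed
  have cn: "cnj w \<in> zeta_zeros a" if "w \<in> zeta_zeros a" for w a
    using that by (auto simp: zeta_zeros_def zeta_cnj cnj_eq_one_iff)
  have "zeta_zeros (c - \<eta>) = case_prod r ` (SIGMA j:{J..}. {1..j ^ 3}) \<union> cnj ` case_prod r ` (SIGMA j:{J..}. {1..j ^ 3})" (is "?Z = ?P \<union> cnj ` ?P")
  proof (intro equalityI subsetI)
    fix w assume w: "w \<in> ?Z"
    show "w \<in> ?P \<union> cnj ` ?P"
    proof (cases "Im w \<ge> 0")
      case True thus ?thesis using up[OF w] by (intro UnI1)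
    next
      case False
      hence "cnj w \<in> ?P" by (intro up cn w) simp
      hence "cnj (cnj w) \<in> cnj ` ?P" by (rule imageI)
      thus ?thesis by simp
    qed
  next
    fix w assume "w \<in> ?P \<union> cnj ` ?P"
    thus "w \<in> ?Z" using low(1) cn by auto
  qed
  hence "race_zeros \<sigma> \<xi> s \<gamma> d \<theta> J c \<eta>"
    by unfold_locales (use c\<eta> above low(2) in \<open>auto simp: r_def\<close>)
  thus ?thesis by blast
qed

section \<open>Zeros of small height\<close>

text \<open>The Euler-Maclaurin value of the tail of the series from n on, with Bernoulli terms
  through B2. \<open>em_err\<close> is the defect of a single step from n to n + 1.\<close>

definition em_main :: "nat \<Rightarrow> complex \<Rightarrow> complex" where
  "em_main n s = of_nat n powr (1 - s) / (s - 1) + of_nat n powr (- s) / 2 + s * of_nat n powr (- s - 1) / 12"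

definition em_err :: "nat \<Rightarrow> complex \<Rightarrow> complex" where
  "em_err n s = of_nat n powr (- s) + em_main (Suc n) s - em_main n s"

text \<open>The third Bernoulli polynomial has maximal modulus sqrt 3 / 36 on [0, 1], just below
  1/20. In w = y - 1/2 it is w^3 - w / 4, and 29/100 approximates the extremal point sqrt 3 / 6 in
  the square that certifies the bound.\<close>

lemma bernoulli3_bound:
  fixes y :: real
  assumes "0 \<le> y" "y \<le> 1"
  shows "\<bar>y ^ 3 - 3 / 2 * y^2 + y / 2\<bar> \<le> 1 / 20"
proof -
  have *: "w / 4 - w ^ 3 \<le> 1 / 20" if "w \<ge> 0" for w :: real
  proof -
    have "w ^ 3 - w / 4 + 1 / 20 = (w - 29/100)^2 * (w + 58/100) + 23/10000 * w + 611/500000"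
      by (simp add: power2_eq_square power3_eq_cube field_simps)
    moreover have "0 \<le> (w - 29/100)^2 * (w + 58/100)" using that by (intro mult_nonneg_nonneg) auto
    ultimately show ?thesis using that by linarith
  qed
  define w where "w = y - 1 / 2"
  have e: "y ^ 3 - 3 / 2 * y^2 + y / 2 = w ^ 3 - w / 4" by (simp add: w_def power2_eq_square power3_eq_cube field_simps)
  have w: "\<bar>w\<bar> \<le> 1 / 2" using assms unfolding w_def by linarith
  hence "w^2 \<le> (1 / 2)^2" by (metis abs_ge_zero power2_abs power_mono)
  hence "0 \<le> \<bar>w\<bar> * (1 / 4 - w^2)" by (intro mult_nonneg_nonneg) (auto simp: power_divide)
  hence "\<bar>w\<bar> ^ 3 \<le> \<bar>w\<bar> / 4" by (simp add: power2_eq_square power3_eq_cube algebra_simps)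
  moreover have "\<bar>w ^ 3 - w / 4\<bar> = \<bar>\<bar>w\<bar> ^ 3 - \<bar>w\<bar> / 4\<bar>" by (cases "w \<ge> 0") (auto simp: power3_eq_cube)
  ultimately show ?thesis unfolding e using *[of "\<bar>w\<bar>"] by linarith
qed

text \<open>K collects the boundary terms of repeated integration by parts with the Bernoulli
  polynomials B1, B2, B3 in x - n; in its derivative everything cancels except a term with B3. As B3
  vanishes at 0 and 1, the increment of K is \<open>em_err\<close>. The constant is 120 = 20 *
  6.\<close>

lemma em_err_bound:
  assumes n: "n \<ge> 1" and s: "Re s > 0" "s \<noteq> 1"
  shows "norm (em_err n s) \<le> norm (s * (s + 1) * (s + 2)) / (120 * (Re s + 2)) * (real n powr (- Re s - 2) - real (Suc n) powr (- Re s - 2))"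
proof -
  define N where "N = (of_nat n :: complex)"
  define K where "K = (\<lambda>w::complex. (w - N - 1/2) * w powr (- s) + ((w - N)^2 - (w - N) + 1/6) / 2 * (s * w powr (- s - 1))
     + ((w - N)^3 - 3/2 * (w - N)^2 + (w - N) / 2) / 6 * (s * (s + 1) * w powr (- s - 2)) - w powr (1 - s) / (1 - s))"
  define K' where "K' = (\<lambda>w::complex. - (((w - N)^3 - 3/2 * (w - N)^2 + (w - N) / 2) / 6 * (s * (s + 1) * (s + 2) * w powr (- s - 3))))"
  define c where "c = norm (s * (s + 1) * (s + 2)) / 120"
  have Kd: "((\<lambda>x. K (of_real x)) has_vector_derivative K' (of_real x)) (at x)" if x: "x > 0" for x :: real
  proof -
    define w where "w = (of_real x :: complex)"
    have w0: "w \<notin> \<real>\<^sub>\<le>\<^sub>0" using x by (auto simp: w_def complex_nonpos_Reals_iff)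
    have P: "((\<lambda>w. w powr a) has_field_derivative a * w powr (a - 1)) (at w)" for a
      using has_field_derivative_powr[OF w0, of a] by simp
    have P1: "((\<lambda>w. w powr (- s - 1)) has_field_derivative (- s - 1) * w powr (- s - 2)) (at w)" using P[of "- s - 1"] by (simp add: algebra_simps)
    have P2: "((\<lambda>w. w powr (- s - 2)) has_field_derivative (- s - 2) * w powr (- s - 3)) (at w)" using P[of "- s - 2"] by (simp add: algebra_simps)
    have P3: "((\<lambda>w. w powr (1 - s) / (1 - s)) has_field_derivative w powr (- s)) (at w)"
      using DERIV_cdivide[OF P[of "1 - s"], of "1 - s"] s by simp
    have 1: "((\<lambda>w. (w - N - 1/2) * w powr (- s)) has_field_derivative 1 * w powr (- s) + - s * w powr (- s - 1) * (w - N - 1/2)) (at w)"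
      by (rule DERIV_mult[OF _ P]) (auto intro!: derivative_eq_intros)
    have 2: "((\<lambda>w. ((w - N)^2 - (w - N) + 1/6) / 2 * (s * w powr (- s - 1))) has_field_derivative
        (2 * (w - N) - 1) / 2 * (s * w powr (- s - 1)) + s * ((- s - 1) * w powr (- s - 2)) * (((w - N)^2 - (w - N) + 1/6) / 2)) (at w)"
      by (rule DERIV_mult[OF _ DERIV_cmult[OF P1]]) (auto intro!: derivative_eq_intros)
    have 3: "((\<lambda>w. ((w - N)^3 - 3/2 * (w - N)^2 + (w - N) / 2) / 6 * (s * (s + 1) * w powr (- s - 2))) has_field_derivative
        (3 * (w - N)^2 - 3 * (w - N) + 1/2) / 6 * (s * (s + 1) * w powr (- s - 2)) + s * (s + 1) * ((- s - 2) * w powr (- s - 3)) * (((w - N)^3 - 3/2 * (w - N)^2 + (w - N) / 2) / 6)) (at w)"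
      by (rule DERIV_mult[OF _ DERIV_cmult[OF P2]]) (auto intro!: derivative_eq_intros, simp add: field_simps)
    have alg: "1 * p0 + - s * p1 * (y - 1/2) + ((2 * y - 1) / 2 * (s * p1) + s * ((- s - 1) * p2) * ((y^2 - y + 1/6) / 2))
        + ((3 * y^2 - 3 * y + 1/2) / 6 * (s * (s + 1) * p2) + s * (s + 1) * ((- s - 2) * p3) * ((y^3 - 3/2 * y^2 + y / 2) / 6)) - p0
        = - ((y^3 - 3/2 * y^2 + y / 2) / 6 * (s * (s + 1) * (s + 2) * p3))" for p0 p1 p2 p3 y
      by (simp add: field_simps power2_eq_square power3_eq_cube)
    have "(K has_field_derivative K' w) (at w)"
      using DERIV_diff[OF DERIV_add[OF DERIV_add[OF 1 2] 3] P3] unfolding K_def K'_def alg .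
    thus ?thesis unfolding w_def by (rule has_vector_derivative_real_field)
  qed
  have \<phi>d: "((\<lambda>x. - (c / (Re s + 2)) * x powr (- Re s - 2)) has_real_derivative c * x powr (- Re s - 3)) (at x)" if "x > 0" for x
  proof -
    have "- (c / (Re s + 2)) * ((- Re s - 2) * x powr (- Re s - 2 - 1)) = c / (Re s + 2) * (Re s + 2) * x powr (- Re s - 3)" by (simp add: algebra_simps add_divide_distrib)
    also have "... = c * x powr (- Re s - 3)" using s by simp
    finally show ?thesis using DERIV_cmult[OF has_real_derivative_powr[OF that, of "- Re s - 2"], of "- (c / (Re s + 2))"] by simp
  qed
  have "norm (K (of_real (real (Suc n))) - K (of_real (real n))) \<le> - (c / (Re s + 2)) * real (Suc n) powr (- Re s - 2) - - (c / (Re s + 2)) * real n powr (- Re s - 2)"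
  proof (rule differentiable_bound_general[where f' = "\<lambda>x. K' (of_real x)" and \<phi>' = "\<lambda>x. c * x powr (- Re s - 3)"])
    show "continuous_on {real n..real (Suc n)} (\<lambda>x. K (of_real x))"
      using n by (intro continuous_at_imp_continuous_on ballI has_vector_derivative_continuous[OF Kd]) auto
    show "continuous_on {real n..real (Suc n)} (\<lambda>x. - (c / (Re s + 2)) * x powr (- Re s - 2))"
      using n by (intro continuous_intros) auto
    fix x assume x: "real n < x" "x < real (Suc n)"
    have x0: "x > 0" using x n by linarith
    show "((\<lambda>x. K (of_real x)) has_vector_derivative K' (of_real x)) (at x)" by (rule Kd[OF x0])
    show "((\<lambda>x. - (c / (Re s + 2)) * x powr (- Re s - 2)) has_vector_derivative c * x powr (- Re s - 3)) (at x)"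
      using \<phi>d[OF x0] by (simp add: has_real_derivative_iff_has_vector_derivative)
    define y where "y = x - real n"
    have y: "0 \<le> y" "y \<le> 1" using x by (auto simp: y_def)
    have "K' (of_real x) = - (of_real (y ^ 3 - 3 / 2 * y^2 + y / 2) / 6 * (s * (s + 1) * (s + 2) * of_real x powr (- s - 3)))"
      by (simp add: K'_def N_def y_def)
    also have "norm ... = \<bar>y ^ 3 - 3 / 2 * y^2 + y / 2\<bar> / 6 * (norm (s * (s + 1) * (s + 2)) * x powr (- Re s - 3))"
      using x0 norm_powr_real_powr[of "of_real x" "- s - 3"] by (simp only: norm_minus_cancel norm_mult norm_divide norm_of_real) simp
    also have "... \<le> (1 / 20) / 6 * (norm (s * (s + 1) * (s + 2)) * x powr (- Re s - 3))"
      by (intro mult_right_mono divide_right_mono bernoulli3_bound[OF y]) auto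
    finally show "norm (K' (of_real x)) \<le> c * x powr (- Re s - 3)" by (simp add: c_def)
  qed simp
  also have "K (of_real (real (Suc n))) - K (of_real (real n)) = em_err n s"
    using s by (simp add: K_def N_def em_err_def em_main_def divide_simps) (simp add: algebra_simps)
  also have "c / (Re s + 2) = norm (s * (s + 1) * (s + 2)) / (120 * (Re s + 2))" by (simp add: c_def)
  finally show ?thesis unfolding right_diff_distrib by linarith
qed

lemma em_err_summable:
  assumes N: "N \<ge> 1" and s: "Re s > 0" "s \<noteq> 1"
  shows "summable (\<lambda>i. em_err (i + N) s)"
    "norm (\<Sum>i. em_err (i + N) s) \<le> norm (s * (s + 1) * (s + 2)) / (120 * (Re s + 2)) * real N powr (- Re s - 2)"
proof -
  define f where "f = (\<lambda>i. real (i + N) powr (- Re s - 2))"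
  define c where "c = norm (s * (s + 1) * (s + 2)) / (120 * (Re s + 2))"
  have "f \<longlonglongrightarrow> 0" unfolding f_def using s
    by (intro tendsto_neg_powr filterlim_compose[OF filterlim_real_sequentially] filterlim_add_const_nat_at_top) auto
  hence "(\<lambda>i. f i - f (Suc i)) sums (f 0 - 0)" by (rule telescope_sums')
  hence g: "(\<lambda>i. c * (f i - f (Suc i))) sums (c * f 0)" using sums_mult by fastforce
  have b: "norm (em_err (i + N) s) \<le> c * (f i - f (Suc i))" for i
    using em_err_bound[of "i + N" s] N s by (simp add: f_def c_def add_ac)
  show "summable (\<lambda>i. em_err (i + N) s)" using b by (intro summable_comparison_test'[OF sums_summable[OF g]]) auto
  have "norm (\<Sum>i. em_err (i + N) s) \<le> (\<Sum>i. c * (f i - f (Suc i)))" by (rule norm_suminf_le[OF b sums_summable[OF g]])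
  also have "... = c * f 0" using g by (simp add: sums_iff)
  finally show "norm (\<Sum>i. em_err (i + N) s) \<le> norm (s * (s + 1) * (s + 2)) / (120 * (Re s + 2)) * real N powr (- Re s - 2)"
    by (simp add: c_def f_def)
qed

text \<open>The identity for Re s > 1 telescopes. It extends by holomorphy on the open
  quarter-plane, which is convex and avoids the pole; the second formula splits off the first
  step.\<close>

lemma zeta_euler_maclaurin:
  assumes "Re s > 0" "Im s > 0"
  shows "zeta s = em_main 1 s + (\<Sum>i. em_err (i + 1) s)" "zeta s = 1 + em_main 2 s + (\<Sum>i. em_err (i + 2) s)"
proof -
  define S where "S = {s. Re s > 0} \<inter> {s. Im s > 0}"
  have S: "open S" "convex S" unfolding S_def
    by (auto intro!: open_Int open_halfspace_Re_gt open_halfspace_Im_gt convex_Int convex_halfspace_Re_gt convex_halfspace_Im_gt)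
  have S1: "s \<noteq> 1" if "s \<in> S" for s using that by (auto simp: S_def)
  have mh: "em_main n holomorphic_on S" if "n \<ge> 1" for n
    unfolding em_main_def using that S1 by (intro holomorphic_intros) auto
  have eh: "em_err (n + 1) holomorphic_on S" for n
    unfolding em_err_def by (intro holomorphic_intros mh) auto
  have "(\<lambda>s. \<Sum>i. em_err (i + 1) s) holomorphic_on S"
  proof (rule holomorphic_on_suminf[OF S(1) eh])
    fix x assume "x \<in> S"
    then obtain d where d: "d > 0" "ball x d \<subseteq> S" using S(1) open_contains_ball by blast
    define C where "C = (norm x + d + 2) ^ 3 / 240"
    have C0: "C \<ge> 0" using d by (simp add: C_def)
    have "norm (em_err (n + 1) y) \<le> C * real (n + 1) powr (- 2)" if y: "y \<in> ball x d" for n y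
    proof -
      have yS: "Re y > 0" "y \<noteq> 1" using y d S1 by (auto simp: S_def)
      have "norm y \<le> norm x + d" using y norm_triangle_ineq2[of y x] by (auto simp: dist_norm norm_minus_commute)
      hence "norm (y * (y + 1) * (y + 2)) \<le> (norm x + d + 2) * (norm x + d + 2) * (norm x + d + 2)"
        unfolding norm_mult using d norm_triangle_ineq[of y 1] norm_triangle_ineq[of y 2] by (intro mult_mono) auto
      hence "norm (y * (y + 1) * (y + 2)) / (120 * (Re y + 2)) \<le> ((norm x + d + 2) * (norm x + d + 2) * (norm x + d + 2)) / 240"
        using yS d by (intro frac_le) auto
      hence a: "norm (y * (y + 1) * (y + 2)) / (120 * (Re y + 2)) \<le> C" by (simp add: C_def power3_eq_cube)
      have "real (n + 1) powr (- Re y - 2) \<le> real (n + 1) powr (- 2)" using yS by (intro powr_mono) auto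
      moreover have "real (Suc (n + 1)) powr (- Re y - 2) \<ge> 0" by simp
      ultimately have b: "real (n + 1) powr (- Re y - 2) - real (Suc (n + 1)) powr (- Re y - 2) \<le> real (n + 1) powr (- 2)" by linarith
      have c: "real (Suc (n + 1)) powr (- Re y - 2) \<le> real (n + 1) powr (- Re y - 2)" using yS by (intro powr_mono2') auto
      show ?thesis
        using em_err_bound[of "n + 1" y] yS mult_mono[OF a b C0] c by simp
    qed
    moreover have "summable (\<lambda>n. C * real (n + 1) powr (- 2))" by (intro summable_mult summable_shift_powr) auto
    ultimately show "\<exists>d>0. \<exists>M. summable M \<and> (\<forall>n. \<forall>y\<in>ball x d. norm (em_err (n + 1) y) \<le> M n)" using d(1) by blast
  qed
  hence h: "(\<lambda>s. em_main 1 s + (\<Sum>i. em_err (i + 1) s)) holomorphic_on S" by (intro holomorphic_intros mh) auto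
  have eq: "zeta s = em_main 1 s + (\<Sum>i. em_err (i + 1) s)" if s: "Re s > 1" "Im s > 0" for s
  proof -
    have s1: "s \<noteq> 1" using s by auto
    have "(\<lambda>n. of_nat (n + 1) powr (- (s - 1)) / (s - 1) + of_nat (n + 1) powr (- s) / 2 + s * of_nat (n + 1) powr (- (s + 1)) / 12) \<longlonglongrightarrow> 0 / (s - 1) + 0 / 2 + s * 0 / 12"
      using s s1 by (intro tendsto_intros tendsto_powr_complex_0) auto
    hence "(\<lambda>n. em_main (n + 1) s) \<longlonglongrightarrow> 0" by (simp add: em_main_def)
    hence "(\<lambda>n. em_main (n + 1) s - em_main (Suc n + 1) s) sums (em_main (0 + 1) s - 0)" by (rule telescope_sums')
    hence "(\<lambda>n. em_main (n + 1) s - em_main (Suc n + 1) s + em_err (n + 1) s) sums (em_main (0 + 1) s - 0 + (\<Sum>i. em_err (i + 1) s))"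
      using s s1 by (intro sums_add summable_sums em_err_summable(1)) auto
    hence "(\<lambda>n. 1 / of_nat (Suc n) powr s) sums (em_main 1 s + (\<Sum>i. em_err (i + 1) s))"
      by (simp add: em_err_def powr_minus_divide)
    thus ?thesis using zeta_sums[OF s(1)] sums_unique2 by blast
  qed
  show 1: "zeta s = em_main 1 s + (\<Sum>i. em_err (i + 1) s)"
  proof (rule analytic_continuation_open[where s = "{s. Re s > 1} \<inter> {s. Im s > 0}" and s' = S and f = zeta])
    show "open ({s. Re s > 1} \<inter> {s. Im s > 0})" by (intro open_Int open_halfspace_Re_gt open_halfspace_Im_gt)
    have "Complex 2 1 \<in> {s. Re s > 1} \<inter> {s. Im s > 0}" by simp
    thus "{s. Re s > 1} \<inter> {s. Im s > 0} \<noteq> {}" by blast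
    show "zeta holomorphic_on S" using S1 by (intro holomorphic_on_subset[OF zeta_holomorphic]) auto
  qed (use S h eq assms convex_connected in \<open>auto simp: S_def\<close>)
  have "s \<noteq> 1" using assms by auto
  hence "(\<Sum>i. em_err (i + 1) s) = (\<Sum>i. em_err (Suc i + 1) s) + em_err (0 + 1) s"
    using suminf_split_head[OF em_err_summable(1)[of 1 s]] assms by simp
  thus "zeta s = 1 + em_main 2 s + (\<Sum>i. em_err (i + 2) s)" unfolding 1 by (simp add: em_err_def numeral_2_eq_2)
qed

section \<open>Numerical exclusion of the low zeros\<close>

lemma cmod_shift_le:
  assumes "0 \<le> Re s" "Re s \<le> 1" "\<bar>Im s\<bar> \<le> T" "0 \<le> a" "(1 + a)^2 + T^2 \<le> b^2" "0 \<le> b"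
  shows "norm (s + of_real a) \<le> b"
proof -
  have "(norm (s + of_real a))^2 = (Re s + a)^2 + (Im s)^2" by (simp add: cmod_power2)
  also have "(Im s)^2 \<le> T^2" using assms by (simp add: abs_le_square_iff[symmetric])
  also have "(Re s + a)^2 \<le> (1 + a)^2" using assms by (intro power_mono) auto
  finally have "(norm (s + of_real a))^2 \<le> b^2" using assms by linarith
  thus ?thesis by (rule power2_le_imp_le) (use assms in auto)
qed

lemma cubic_le:
  assumes s: "0 \<le> Re s" "Re s \<le> 1" "\<bar>Im s\<bar> \<le> T"
    and b: "1 + T^2 \<le> b0^2" "4 + T^2 \<le> b1^2" "9 + T^2 \<le> b2^2" "0 \<le> b0" "0 \<le> b1" "0 \<le> b2"
  shows "norm (s * (s + 1) * (s + 2)) \<le> b0 * b1 * b2"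
  unfolding norm_mult
  using cmod_shift_le[OF s, of 0 b0] cmod_shift_le[OF s, of 1 b1] cmod_shift_le[OF s, of 2 b2] b by (intro mult_mono) auto

text \<open>At a zero the Euler-Maclaurin main term is no larger than the error, which is governed
  by W. Up to height 2 the expansion from n = 1 is refuted by its imaginary part - t / |s - 1|^2 + t
  / 12. Above 2 the expansion from n = 2 has main term 1 + 2^(-s) p, and |p| is too small to cancel
  the 1.\<close>

lemma zeta_nonzero_low:
  assumes s: "1 / 2 < Re s" "Re s < 1" "14 / 100 \<le> Im s" "Im s \<le> 802 / 100"
  shows "zeta s \<noteq> 0"
proof
  assume z: "zeta s = 0"
  define x t where "x = Re s" and "t = Im s"
  have xt: "1 / 2 < x" "x < 1" "14 / 100 \<le> t" "t \<le> 802 / 100" using s by (auto simp: x_def t_def)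
  have s0: "Re s > 0" "Im s > 0" "s \<noteq> 1" using s by auto
  define q where "q = (1 - x)^2 + t^2"
  have xq: "(1 - x)^2 \<le> 1 / 4" using xt power_mono[of "1 - x" "1/2" 2] by (simp add: power_divide)
  have q0: "q > 0" unfolding q_def using xt by (simp add: add_nonneg_pos)
  have inv: "Re (1 / (s - 1)) = - (1 - x) / q" "Im (1 / (s - 1)) = - t / q"
    by (simp_all add: Re_divide Im_divide q_def x_def t_def power2_eq_square algebra_simps)
  have C: "norm (s * (s + 1) * (s + 2)) \<le> b0 * b1 * b2"
    if "t \<le> T" "1 + T^2 \<le> b0^2" "4 + T^2 \<le> b1^2" "9 + T^2 \<le> b2^2" "0 \<le> b0" "0 \<le> b1" "0 \<le> b2" for T b0 b1 b2
    using that xt by (intro cubic_le[of s T]) (auto simp: x_def t_def)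
  define W where "W = norm (s * (s + 1) * (s + 2))"
  have R: "norm (\<Sum>i. em_err (i + N) s) \<le> W / 300 * real N powr (- Re s - 2)" if "N \<ge> 1" for N
  proof -
    have "W / (120 * (Re s + 2)) \<le> W / 300" unfolding W_def using s by (intro divide_left_mono) auto
    hence "W / (120 * (Re s + 2)) * real N powr (- Re s - 2) \<le> W / 300 * real N powr (- Re s - 2)" by (intro mult_right_mono) auto
    thus ?thesis using em_err_summable(2)[OF that s0(1,3)] unfolding W_def by linarith
  qed
  have small: "t * (1 / q - 1 / 12) \<le> W / 300"
  proof -
    have "(\<Sum>i. em_err (i + 1) s) = - (1 / (s - 1) + 1 / 2 + s / 12)" using zeta_euler_maclaurin(1)[OF s0(1,2)] z by (simp add: em_main_def add_eq_0_iff)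
    hence "norm (\<Sum>i. em_err (i + 1) s) = norm (1 / (s - 1) + 1 / 2 + s / 12)" by (simp only: norm_minus_cancel)
    hence "\<bar>Im (1 / (s - 1) + 1 / 2 + s / 12)\<bar> \<le> W / 300"
      using R[of 1] abs_Im_le_cmod[of "1 / (s - 1) + 1 / 2 + s / 12"] by simp
    hence "\<bar>- (t / q) + t / 12\<bar> \<le> W / 300" using inv(2) by (simp add: t_def)
    moreover have "t * (1 / q - 1 / 12) = t / q - t / 12" by (simp add: right_diff_distrib)
    ultimately show ?thesis by linarith
  qed
  have q_le: "q \<le> 1 / 4 + T^2" if "t \<le> T" for T
    unfolding q_def using xq xt power_mono[OF that, of 2] by linarith
  have q_ge: "t^2 \<le> q" by (simp add: q_def)
  consider "t \<le> 1" | "1 \<le> t" "t \<le> 2" | "2 \<le> t" by linarith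
  thus False
  proof cases
    case 1
    have "1 / (5/4) \<le> 1 / q" using q_le[OF 1] q0 by (intro divide_left_mono) auto
    hence "14/100 * (7/10) \<le> t * (1 / q - 1 / 12)" using xt by (intro mult_mono) auto
    \<comment> \<open>The factors are sqrt (1 + T^2), sqrt (4 + T^2), sqrt (9 + T^2) rounded up,
      here for T = 1 and later for T = 2, 4 and 8.02.\<close>
    moreover have "W \<le> 1415/1000 * (2237/1000) * (3163/1000)" unfolding W_def by (rule C[OF 1]) (auto simp: power2_eq_square)
    ultimately show False using small by simp
  next
    case 2
    have "1 / (17/4) \<le> 1 / q" using q_le[OF 2(2)] q0 by (intro divide_left_mono) auto
    hence "1 * (15/100) \<le> t * (1 / q - 1 / 12)" using 2 by (intro mult_mono) auto
    moreover have "W \<le> 2237/1000 * (2829/1000) * (3606/1000)" unfolding W_def by (rule C[OF 2(2)]) (auto simp: power2_eq_square)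
    ultimately show False using small by simp
  next
    case 3
    define v where "v = 1 / (s - 1)"
    define p where "p = 2 * v + 1 / 2 + s / 24"
    define k where "k = (2::real) powr (- Re s)"
    \<comment> \<open>7072/10000 is 1 / sqrt 2 rounded up, the value of 2 powr (- x) at the critical
      abscissa x = 1/2.\<close>
    have k: "0 < k" "k \<le> 7072/10000"
    proof -
      have "k \<le> 2 powr (- (1/2))" unfolding k_def using s by (intro powr_mono) auto
      also have "... = 1 / sqrt 2" by (simp add: powr_minus_divide powr_half_sqrt)
      also have "... \<le> 7072/10000"
      proof -
        have "1415/1000 \<ge> 10000/(7072::real)" by simp
        have "10000/7072 \<le> sqrt 2" by (rule real_le_rsqrt) (simp add: power2_eq_square)
        thus ?thesis by (simp add: field_simps)
      qed
      finally show "k \<le> 7072/10000" .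
    qed (simp add: k_def)
    have pw: "em_main 2 s = 2 powr (- s) * p"
    proof -
      have "2 powr (1 - s) = 2 * 2 powr (- s)" "2 powr (- s - 1) = 2 powr (- s) / (2::complex)"
        by (simp_all add: powr_diff powr_minus divide_simps)
      thus ?thesis by (simp add: em_main_def p_def v_def algebra_simps)
    qed
    have "(\<Sum>i. em_err (i + 2) s) = - (1 + 2 powr (- s) * p)" using zeta_euler_maclaurin(2)[OF s0(1,2)] z pw by (simp add: add_eq_0_iff)
    hence "norm (\<Sum>i. em_err (i + 2) s) = norm (1 + 2 powr (- s) * p)" by (simp only: norm_minus_cancel)
    hence "norm (1 + 2 powr (- s) * p) \<le> W / 300 * 2 powr (- Re s - 2)" using R[of 2] by simp
    moreover have "(2::real) powr (- Re s - 2) = k / 4" by (simp add: k_def powr_diff)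
    moreover have "norm (1 + 2 powr (- s) * p) \<ge> 1 - k * norm p"
    proof -
      have "norm (2 powr (- s) * p) = k * norm p" using norm_powr_real_powr[of 2 "- s"] by (simp add: norm_mult k_def)
      thus ?thesis using norm_triangle_ineq2[of 1 "- (2 powr (- s) * p)"] by simp
    qed
    ultimately have "1 \<le> k * (norm p + W / 1200)" by (simp add: algebra_simps)
    also have "... \<le> 7072/10000 * (norm p + W / 1200)" using k by (intro mult_right_mono) (auto simp: W_def)
    finally have main: "norm p + W / 1200 \<ge> 10000/7072" by simp
    have q4: "q \<ge> 4" using q_ge 3 power_mono[OF 3, of 2] by simp
    \<comment> \<open>542/1000 is 1/2 + 1/24 rounded up; the remaining part 2 * Re v of Re p lies
      between - 1/4 and 0.\<close>
    have Rp: "\<bar>Re p\<bar> \<le> 542/1000"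
    proof -
      have "Re v = - ((1 - x) / q)" using inv(1)[folded v_def] by (simp only: minus_divide_left)
      moreover have "Re p = 1 / 2 + x / 24 + 2 * Re v" by (simp add: p_def x_def)
      moreover have "0 \<le> (1 - x) / q" "(1 - x) / q \<le> (1/2) / 4" using xt q4 by (auto intro!: divide_nonneg_pos frac_le)
      ultimately show ?thesis using xt by linarith
    qed
    have Ip: "Im p = t / 24 - 2 * (t / q)" using inv(2)[folded v_def] by (simp add: p_def t_def)
    have tq: "0 \<le> t / q" "t / q \<le> 1 / t"
    proof -
      have "t / q \<le> t / t^2" using q_ge q0 3 by (intro divide_left_mono mult_pos_pos) auto
      thus "t / q \<le> 1 / t" using 3 by (simp add: power2_eq_square)
    qed (use 3 q0 in auto)
    have np: "norm p \<le> b" if "\<bar>Im p\<bar> \<le> a" "(542/1000)^2 + a^2 \<le> b^2" "0 \<le> b" for a b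
    proof -
      have "(norm p)^2 = (Re p)^2 + (Im p)^2" by (simp add: cmod_power2)
      also have "... \<le> (542/1000)^2 + a^2" using Rp that(1) by (intro add_mono) (auto simp: abs_le_square_iff[symmetric])
      finally have "(norm p)^2 \<le> b^2" using that(2) by linarith
      thus ?thesis by (rule power2_le_imp_le[OF _ that(3)])
    qed
    show False
    proof (cases "t \<le> 4")
      case True
      have "1 / t \<le> 1 / 2" using 3 by (intro divide_left_mono) auto
      hence "\<bar>Im p\<bar> \<le> 1" unfolding Ip using tq 3 True by linarith
      hence "norm p \<le> 114/100" by (rule np) (auto simp: power2_eq_square)
      moreover have "W \<le> 4124/1000 * (4473/1000) * 5" unfolding W_def by (rule C[OF True]) (auto simp: power2_eq_square)
      ultimately show False using main by simp
    next
      case False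
      have "1 / t \<le> 1 / 4" using False by (intro divide_left_mono) auto
      hence "\<bar>Im p\<bar> \<le> 1/2" unfolding Ip using tq xt False by linarith
      hence "norm p \<le> 74/100" by (rule np) (auto simp: power2_eq_square)
      moreover have "W \<le> 8083/1000 * (8266/1000) * (8563/1000)" unfolding W_def by (rule C[OF xt(4)]) (auto simp: power2_eq_square)
      ultimately show False using main by simp
    qed
  qed
qed

lemma first_zero_off_line:
  assumes \<sigma>: "1 / 2 < \<sigma>" "\<sigma> < 1" and \<xi>: "\<xi> = 0 \<or> \<xi> = pi" and adm: "admissible_params \<xi> \<gamma> d \<theta>"
    and B1: "\<And>w. B_mult \<sigma> \<gamma> d \<theta> 1 w \<le> zeta_zero_mult w"
  shows "d 1 > 0"
proof (rule ccontr)
  assume "\<not> d 1 > 0"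
  have a: "exp 1 \<le> \<gamma> 1" "\<gamma> 1 \<le> 2 * exp 1" "\<bar>d 1 - 1\<bar> \<le> 1" "\<bar>\<theta> 1 - (\<xi> - pi / 2)\<bar> \<le> 1"
    using adm by (auto simp: admissible_params_def)
  have d0: "d 1 = 0" using a(3) \<open>\<not> d 1 > 0\<close> by linarith
  define w where "w = rho \<sigma> \<gamma> d \<theta> 1 1"
  have w: "Re w = \<sigma>" "Im w = \<gamma> 1 + \<theta> 1" using d0 by (simp_all add: w_def rho_def)
  have "(1, 1) \<in> {(j, k). 1 \<le> j \<and> 1 \<le> k \<and> k \<le> j ^ 3 \<and> rho \<sigma> \<gamma> d \<theta> j k = w}" by (simp add: w_def)
  hence "(case (1, 1) of (j, k) \<Rightarrow> k * (j ^ 3 + 1 - k)) \<le> B_mult \<sigma> \<gamma> d \<theta> 1 w"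
    unfolding B_mult_def by (intro member_le_sum finite_rho_fibre[OF adm]) auto
  hence "zeta_zero_mult w > 0" using B1[of w] by simp
  hence "zeta w = 0" by (simp add: zeta_zero_mult_pos_iff)
  \<comment> \<open>The extreme heights \<gamma> 1 + \<theta> 1 are e - pi / 2 - 1 \<approx> 0.147,
    for \<xi> = 0, and 2 e + pi / 2 + 1 \<approx> 8.007, for \<xi> = pi. They fix the range of
    \<open>zeta_nonzero_low\<close>.\<close>
  moreover have "14 / 100 \<le> Im w \<and> Im w \<le> 802 / 100"
  proof -
    have "inverse (2 ^ 32) \<le> (1 / 1000 :: real)" by simp
    hence e: "2717 / 1000 \<le> exp (1::real)" "exp (1::real) \<le> 272 / 100" using e_approx_32 by linarith+
    have p: "3141 / 1000 \<le> pi" "pi \<le> 3142 / 1000" using pi_approx by simp_all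
    from \<xi> show ?thesis by (rule disjE) (use a e p w in linarith)+
  qed
  ultimately show False using zeta_nonzero_low[of w] \<sigma> w by simp
qed

theorem theorem1p2:
  fixes \<sigma> \<delta> A :: real
  assumes "1 / 2 < \<sigma>" and "\<sigma> < 1"
    and "0 < \<delta>" and "\<delta> < \<sigma> - 1 / 2"
    and "A > 0"
  shows "(\<forall>B. is_B 0 \<sigma> \<delta> A B \<and>
              (\<forall>\<rho>. B \<rho> \<le> zeta_zero_mult \<rho>) \<and>
              (\<forall>s. Re s \<ge> \<sigma> - \<delta> \<and> Im s \<ge> 0 \<longrightarrow> zeta_zero_mult s \<le> B s)
            \<longrightarrow> ((\<lambda>X. measure lebesgue (P1 \<inter> {2..X}) / X) \<longlongrightarrow> 0) at_top)
       \<and> (\<forall>B. is_B pi \<sigma> \<delta> A B \<and>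
              (\<forall>\<rho>. B \<rho> \<le> zeta_zero_mult \<rho>) \<and>
              (\<forall>s. Re s \<ge> \<sigma> - \<delta> \<and> Im s \<ge> 0 \<longrightarrow> zeta_zero_mult s \<le> B s)
            \<longrightarrow> ((\<lambda>X. measure lebesgue (P1 \<inter> {2..X}) / X) \<longlongrightarrow> 1) at_top)"
proof -
  have "((\<lambda>X. measure lebesgue (P1 \<inter> {2..X}) / X) \<longlongrightarrow> (if s = 1 then 0 else 1)) at_top"
    if xs: "(\<xi> = 0 \<and> s = 1) \<or> (\<xi> = pi \<and> s = -1)" and B: "is_B \<xi> \<sigma> \<delta> A B" "\<forall>\<rho>. B \<rho> \<le> zeta_zero_mult \<rho>"
      "\<forall>s. Re s \<ge> \<sigma> - \<delta> \<and> Im s \<ge> 0 \<longrightarrow> zeta_zero_mult s \<le> B s" for \<xi> s :: real and B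
  proof -
    obtain \<gamma> d \<theta> j0 where p: "admissible_params \<xi> \<gamma> d \<theta>" "j0 \<ge> 1" "\<forall>j\<ge>j0. \<gamma> j > A \<and> d j \<le> \<delta>" "B = B_mult \<sigma> \<gamma> d \<theta> j0"
      using B(1) unfolding is_B_def by blast
    have "d 1 > 0" if "j0 = 1"
      using assms xs p B that by (intro first_zero_off_line[of \<sigma> \<xi> \<gamma> d \<theta>]) auto
    hence "\<exists>J c \<eta>. race_zeros \<sigma> \<xi> s \<gamma> d \<theta> J c \<eta>"
      using assms xs p B by (intro race_zeros_exist[of \<sigma> \<delta> \<xi> s \<gamma> d \<theta> j0]) auto
    thus ?thesis using race_zeros.P1_density by blast
  qed
  from this[of 0 1] this[of pi "- 1"] show ?thesis by auto
qed

end
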